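(* Let $R$ be a local ring and $M$ a finitely generated $R$-module. The inequality $\mathrm{inj\,ld}_RM\ge\dim M$ then holds. Hence, if $M$ is injectively Koszul, then $\dim M=0$.
   Context: Local rings $(R,\mathfrak m,k)$ are commutative noetherian. A complex $I$ of injective $R$-modules is minimal if $\mathrm{Ker}(\partial^n)\subseteq I^n$ is an injective envelope for each $n$. For such $I$, let $\mathcal G^jI\subseteq I$ be the subcomplex with $(\mathcal G^jI)^n=(0:_{I^n}\mathfrak m^{j-n})$; these form an increasing filtration of $I$, and the associated graded complex is $\mathrm{inj\,lin}_RI=\bigoplus_j\mathcal G^{j+1}I/\mathcal G^jI$. For an $R$-module $M$ with minimal injective resolution $I$, the injective linearity defect is $\mathrm{inj\,ld}_RM=\sup\{i\in\mathbb Z:H^i(\mathrm{inj\,lin}_RI)\ne0\}$. $M$ is injectively Koszul if $\mathrm{inj\,ld}_RM=0$. *)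

theory Defs
  imports "HOL-Algebra.Algebra" "HOL-Library.Extended_Real"
begin

section \<open>Noetherian local rings and their modules\<close>

locale noetherian_local_ring = cring R + noetherian_ring R for R (structure) +
  fixes \<mm> :: "'a set"
  assumes maximalideal_m: "maximalideal \<mm> R"
    and unique_maximalideal: "maximalideal J R \<Longrightarrow> J = \<mm>"

definition mod_hom ::
  "('a, 'r) ring_scheme \<Rightarrow> ('a, 'b, 'm) module_scheme \<Rightarrow> ('a, 'c, 'n) module_scheme \<Rightarrow> ('b \<Rightarrow> 'c) set"
  where "mod_hom R M N =
    {f \<in> carrier M \<rightarrow> carrier N.
      (\<forall>x\<in>carrier M. \<forall>y\<in>carrier M. f (x \<oplus>\<^bsub>M\<^esub> y) = f x \<oplus>\<^bsub>N\<^esub> f y) \<and>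
      (\<forall>r\<in>carrier R. \<forall>x\<in>carrier M. f (r \<odot>\<^bsub>M\<^esub> x) = r \<odot>\<^bsub>N\<^esub> f x)}"

definition finitely_generated_module ::
  "('a, 'r) ring_scheme \<Rightarrow> ('a, 'b, 'm) module_scheme \<Rightarrow> bool"
  where "finitely_generated_module R M \<longleftrightarrow>
    (\<exists>S. finite S \<and> S \<subseteq> carrier M \<and>
      carrier M = {(\<Oplus>\<^bsub>M\<^esub>s\<in>S. a s \<odot>\<^bsub>M\<^esub> s) | a. a \<in> S \<rightarrow> carrier R})"

definition annihilator :: "('a, 'r) ring_scheme \<Rightarrow> ('a, 'b, 'm) module_scheme \<Rightarrow> 'a set"
  where "annihilator R M = {a \<in> carrier R. \<forall>x\<in>carrier M. a \<odot>\<^bsub>M\<^esub> x = \<zero>\<^bsub>M\<^esub>}"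

definition annihilated_by :: "('a, 'b, 'm) module_scheme \<Rightarrow> 'a set \<Rightarrow> 'b set"
  where "annihilated_by M J = {x \<in> carrier M. \<forall>a\<in>J. a \<odot>\<^bsub>M\<^esub> x = \<zero>\<^bsub>M\<^esub>}"

text \<open>
  Dimensions take values in the extended reals; the zero ring and the zero module
  have dimension \<open>Sup {} = -\<infinity>\<close>.
\<close>

definition krull_dim :: "('a, 'r) ring_scheme \<Rightarrow> ereal"
  where "krull_dim R =
    Sup {ereal (real n) | n. \<exists>p. (\<forall>i\<le>n. primeideal (p i) R) \<and> (\<forall>i<n. p i \<subset> p (Suc i))}"

definition module_dim :: "('a, 'r) ring_scheme \<Rightarrow> ('a, 'b, 'm) module_scheme \<Rightarrow> ereal"
  where "module_dim R M = krull_dim (R Quot annihilator R M)"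

text \<open>
  The fields \<open>mult\<close> and \<open>one\<close> of a \<^typ>\<open>('a, 'b) module\<close> play no role in \<^locale>\<open>module\<close>.
\<close>

definition quotient_module :: "('a, 'b, 'm) module_scheme \<Rightarrow> 'b set \<Rightarrow> ('a, 'b set) module"
  where "quotient_module M N =
    \<lparr>carrier = a_rcosets\<^bsub>M\<^esub> N, monoid.mult = undefined, one = undefined,
      ring.zero = N, ring.add = set_add M,
      smult = (\<lambda>r U. \<Union>x\<in>U. N +>\<^bsub>M\<^esub> (r \<odot>\<^bsub>M\<^esub> x))\<rparr>"

definition direct_sum_module :: "('j \<Rightarrow> ('a, 'b, 'm) module_scheme) \<Rightarrow> ('a, 'j \<Rightarrow> 'b) module"
  where "direct_sum_module M =
    \<lparr>carrier = {x. (\<forall>j. x j \<in> carrier (M j)) \<and> finite {j. x j \<noteq> \<zero>\<^bsub>M j\<^esub>}},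
      monoid.mult = undefined, one = undefined,
      ring.zero = (\<lambda>j. \<zero>\<^bsub>M j\<^esub>), ring.add = (\<lambda>x y j. x j \<oplus>\<^bsub>M j\<^esub> y j),
      smult = (\<lambda>r x j. r \<odot>\<^bsub>M j\<^esub> x j)\<rparr>"

section \<open>Injective modules and injective envelopes\<close>

text \<open>
  A definition cannot quantify over the types of the test modules \<open>A\<close> and \<open>B\<close>, so their carriers
  are taken in the type of ring elements. Nothing is lost: by Baer's argument the extension
  property then holds for test modules over arbitrary types, see
  \<open>injective_module_extend\<close> below.
\<close>

definition injective_module :: "('a, 'r) ring_scheme \<Rightarrow> ('a, 'e, 'm) module_scheme \<Rightarrow> bool"
  where "injective_module R E \<longleftrightarrow> module R E \<and>
    (\<forall>(A :: ('a, 'a) module) (B :: ('a, 'a) module) f g.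
      module R A \<longrightarrow> module R B \<longrightarrow> f \<in> mod_hom R A B \<longrightarrow> inj_on f (carrier A) \<longrightarrow>
      g \<in> mod_hom R A E \<longrightarrow> (\<exists>h\<in>mod_hom R B E. \<forall>x\<in>carrier A. h (f x) = g x))"

lemma mod_homD:
  assumes "f \<in> mod_hom R M N"
  shows "x \<in> carrier M \<Longrightarrow> f x \<in> carrier N"
    and "x \<in> carrier M \<Longrightarrow> y \<in> carrier M \<Longrightarrow> f (x \<oplus>\<^bsub>M\<^esub> y) = f x \<oplus>\<^bsub>N\<^esub> f y"
    and "r \<in> carrier R \<Longrightarrow> x \<in> carrier M \<Longrightarrow> f (r \<odot>\<^bsub>M\<^esub> x) = r \<odot>\<^bsub>N\<^esub> f x"
  using assms by (auto simp: mod_hom_def)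

definition regular_module :: "('a, 'r) ring_scheme \<Rightarrow> ('a, 'a) module"
  where "regular_module R =
    \<lparr>carrier = carrier R, monoid.mult = monoid.mult R, one = one R,
      ring.zero = ring.zero R, ring.add = ring.add R, smult = monoid.mult R\<rparr>"

lemma regular_module_simps [simp]:
  "carrier (regular_module R) = carrier R" "ring.zero (regular_module R) = ring.zero R"
  "ring.add (regular_module R) = ring.add R" "smult (regular_module R) = monoid.mult R"
  by (simp_all add: regular_module_def)

lemma module_regular:
  assumes "cring R"
  shows "module R (regular_module R)"
proof -
  interpret cring R by fact
  show ?thesis
    by (intro moduleI abelian_groupI)
      (auto simp: assms a_ac m_assoc l_distr r_distr intro: add.l_inv_ex)
qed

definition partial_hom_graph ::
  "('a, 'r) ring_scheme \<Rightarrow> ('a, 'b, 'm) module_scheme \<Rightarrow> ('a, 'c, 'n) module_scheme \<Rightarrow> ('b \<times> 'c) set \<Rightarrow> bool"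
  where "partial_hom_graph R B E G \<longleftrightarrow> G \<subseteq> carrier B \<times> carrier E \<and> single_valued G \<and>
    (\<forall>x y x' y'. (x, y) \<in> G \<longrightarrow> (x', y') \<in> G \<longrightarrow> (x \<oplus>\<^bsub>B\<^esub> x', y \<oplus>\<^bsub>E\<^esub> y') \<in> G) \<and>
    (\<forall>r\<in>carrier R. \<forall>x y. (x, y) \<in> G \<longrightarrow> (r \<odot>\<^bsub>B\<^esub> x, r \<odot>\<^bsub>E\<^esub> y) \<in> G)"

lemma partial_hom_graph_extend:
  fixes R :: "('a, 'r) ring_scheme"
    and E :: "('a, 'e, 'm) module_scheme" and B :: "('a, 'b, 'n) module_scheme"
  assumes E: "injective_module R E" and B: "module R B"
    and G: "partial_hom_graph R B E G" and ne: "G \<noteq> {}"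
    and b: "b \<in> carrier B"
  shows "\<exists>G'. partial_hom_graph R B E G' \<and> G \<subseteq> G' \<and> b \<in> Domain G'"
proof -
  have modE: "module R E" using E by (simp add: injective_module_def)
  interpret B: module R B by (rule B)
  interpret E: module R E by (rule modE)
  have Gc: "x \<in> carrier B" "y \<in> carrier E" if "(x, y) \<in> G" for x y
    using that G by (auto simp: partial_hom_graph_def)
  have Gsv: "y = y'" if "(x, y) \<in> G" "(x, y') \<in> G" for x y y'
    using that G by (auto simp: partial_hom_graph_def single_valued_def)
  have Gadd: "(x \<oplus>\<^bsub>B\<^esub> x', y \<oplus>\<^bsub>E\<^esub> y') \<in> G" if "(x, y) \<in> G" "(x', y') \<in> G" for x y x' y'
    using that G by (auto simp: partial_hom_graph_def)
  have Gsm: "(r \<odot>\<^bsub>B\<^esub> x, r \<odot>\<^bsub>E\<^esub> y) \<in> G" if "r \<in> carrier R" "(x, y) \<in> G" for r x y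
    using that G by (auto simp: partial_hom_graph_def)
  have G0: "(\<zero>\<^bsub>B\<^esub>, \<zero>\<^bsub>E\<^esub>) \<in> G"
  proof -
    obtain x y where xy: "(x, y) \<in> G" using ne by auto
    show ?thesis using Gsm[OF B.R.zero_closed xy] Gc[OF xy] by simp
  qed
  have Gneg: "(\<ominus>\<^bsub>B\<^esub> x, \<ominus>\<^bsub>E\<^esub> y) \<in> G" if xy: "(x, y) \<in> G" for x y
    using Gsm[OF B.R.a_inv_closed[OF B.R.one_closed] xy] Gc[OF xy]
    by (simp add: B.smult_l_minus E.smult_l_minus)

  define J where "J = {r \<in> carrier R. r \<odot>\<^bsub>B\<^esub> b \<in> Domain G}"
  define \<phi> where "\<phi> r = (THE y. (r \<odot>\<^bsub>B\<^esub> b, y) \<in> G)" for r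
  have phi: "(r \<odot>\<^bsub>B\<^esub> b, \<phi> r) \<in> G" if r: "r \<in> J" for r
  proof -
    obtain y where y: "(r \<odot>\<^bsub>B\<^esub> b, y) \<in> G" using r unfolding J_def by blast
    show ?thesis unfolding \<phi>_def by (rule theI[where a = y]) (use y Gsv in blast)+
  qed
  have phi_eq: "\<phi> r = y" if "r \<in> carrier R" "(r \<odot>\<^bsub>B\<^esub> b, y) \<in> G" for r y
    using Gsv[OF phi that(2)] that by (auto simp: J_def)

  let ?N = "regular_module R"
  have modN: "module R ?N" by (rule module_regular) unfold_locales
  interpret N: module R ?N by (rule modN)
  have J_add: "r \<oplus>\<^bsub>R\<^esub> s \<in> J \<and> \<phi> (r \<oplus>\<^bsub>R\<^esub> s) = \<phi> r \<oplus>\<^bsub>E\<^esub> \<phi> s" if "r \<in> J" "s \<in> J" for r s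
  proof -
    have rs: "r \<in> carrier R" "s \<in> carrier R" using that by (auto simp only: J_def mem_Collect_eq)
    have "((r \<oplus>\<^bsub>R\<^esub> s) \<odot>\<^bsub>B\<^esub> b, \<phi> r \<oplus>\<^bsub>E\<^esub> \<phi> s) \<in> G"
      using Gadd[OF phi[OF that(1)] phi[OF that(2)]] rs b by (simp add: B.smult_l_distr)
    thus ?thesis using phi_eq rs by (auto simp: J_def)
  qed
  have J_smult: "r \<otimes>\<^bsub>R\<^esub> s \<in> J \<and> \<phi> (r \<otimes>\<^bsub>R\<^esub> s) = r \<odot>\<^bsub>E\<^esub> \<phi> s" if "r \<in> carrier R" "s \<in> J" for r s
  proof -
    have s: "s \<in> carrier R" using that by (auto simp only: J_def mem_Collect_eq)
    have "((r \<otimes>\<^bsub>R\<^esub> s) \<odot>\<^bsub>B\<^esub> b, r \<odot>\<^bsub>E\<^esub> \<phi> s) \<in> G"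
      using Gsm[OF that(1) phi[OF that(2)]] that s b by (simp add: B.smult_assoc1)
    thus ?thesis using phi_eq that s by (auto simp: J_def)
  qed
  have J_zero: "\<zero>\<^bsub>R\<^esub> \<in> J" using G0 b by (auto simp: J_def)
  have J_neg: "\<ominus>\<^bsub>?N\<^esub> r \<in> J" if r: "r \<in> J" for r
  proof -
    have rc: "r \<in> carrier R" using r by (simp add: J_def)
    have "\<ominus>\<^bsub>?N\<^esub> r = \<ominus>\<^bsub>R\<^esub> r"
      by (simp add: a_inv_def m_inv_def)
    also have "\<dots> = (\<ominus>\<^bsub>R\<^esub> \<one>\<^bsub>R\<^esub>) \<otimes>\<^bsub>R\<^esub> r" using rc by (simp add: B.R.l_minus)
    finally show ?thesis using J_smult[of "\<ominus>\<^bsub>R\<^esub> \<one>\<^bsub>R\<^esub>" r] r by simp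
  qed
  have subJ: "submodule J R ?N"
    by (rule N.submoduleI) (use J_add J_smult J_zero J_neg in \<open>auto simp: J_def\<close>)
  let ?A = "?N\<lparr>carrier := J\<rparr>"
  have modA: "module R ?A" by (rule submodule.submodule_is_module[OF subJ modN])
  have incl: "(\<lambda>x. x) \<in> mod_hom R ?A ?N" by (auto simp: mod_hom_def J_def)
  have phi_hom: "\<phi> \<in> mod_hom R ?A E"
    using J_add J_smult Gc(2)[OF phi] by (auto simp: mod_hom_def)
  obtain \<psi> where psi: "\<psi> \<in> mod_hom R ?N E" and psi_eq: "\<And>x. x \<in> J \<Longrightarrow> \<psi> x = \<phi> x"
  proof -
    have "\<exists>h\<in>mod_hom R ?N E. \<forall>x\<in>carrier ?A. h ((\<lambda>x. x) x) = \<phi> x"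
      using E[unfolded injective_module_def, THEN conjunct2, rule_format, OF modA modN incl _ phi_hom]
      by simp
    thus thesis using that by auto
  qed
  define e where "e = \<psi> \<one>\<^bsub>R\<^esub>"
  have e: "e \<in> carrier E" using mod_homD(1)[OF psi] by (simp add: e_def)
  have psi_e: "\<psi> r = r \<odot>\<^bsub>E\<^esub> e" if "r \<in> carrier R" for r
    using mod_homD(3)[OF psi that, of "\<one>\<^bsub>R\<^esub>"] that by (simp add: e_def)

  define G' where "G' = {(x \<oplus>\<^bsub>B\<^esub> r \<odot>\<^bsub>B\<^esub> b, y \<oplus>\<^bsub>E\<^esub> r \<odot>\<^bsub>E\<^esub> e) | x y r. (x, y) \<in> G \<and> r \<in> carrier R}"
  have G'I: "(x \<oplus>\<^bsub>B\<^esub> r \<odot>\<^bsub>B\<^esub> b, y \<oplus>\<^bsub>E\<^esub> r \<odot>\<^bsub>E\<^esub> e) \<in> G'" if "(x, y) \<in> G" "r \<in> carrier R" for x y r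
    using that by (auto simp: G'_def)
  have sub: "G \<subseteq> G'"
  proof (rule subrelI)
    fix x y assume xy: "(x, y) \<in> G"
    show "(x, y) \<in> G'"
      using G'I[OF xy B.R.zero_closed] Gc[OF xy] b e by simp
  qed
  have bG: "(b, e) \<in> G'"
    using G'I[OF G0 B.R.one_closed] b e by simp
  have sv: "y \<oplus>\<^bsub>E\<^esub> r \<odot>\<^bsub>E\<^esub> e = y' \<oplus>\<^bsub>E\<^esub> r' \<odot>\<^bsub>E\<^esub> e"
    if xy: "(x, y) \<in> G" and xy': "(x', y') \<in> G" and r: "r \<in> carrier R" and r': "r' \<in> carrier R"
      and eq: "x \<oplus>\<^bsub>B\<^esub> r \<odot>\<^bsub>B\<^esub> b = x' \<oplus>\<^bsub>B\<^esub> r' \<odot>\<^bsub>B\<^esub> b" for x y x' y' r r'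
  proof -
    let ?s = "r \<oplus>\<^bsub>R\<^esub> \<ominus>\<^bsub>R\<^esub> r'"
    note c = Gc[OF xy] Gc[OF xy'] r r' b e
    have "x \<oplus>\<^bsub>B\<^esub> r \<odot>\<^bsub>B\<^esub> b \<oplus>\<^bsub>B\<^esub> \<ominus>\<^bsub>B\<^esub> (r' \<odot>\<^bsub>B\<^esub> b) = x'"
      unfolding eq using c by (simp add: B.M.a_assoc B.M.r_neg)
    hence "x \<oplus>\<^bsub>B\<^esub> (r \<odot>\<^bsub>B\<^esub> b \<oplus>\<^bsub>B\<^esub> \<ominus>\<^bsub>B\<^esub> (r' \<odot>\<^bsub>B\<^esub> b)) = x'"
      using c by (simp add: B.M.a_assoc)
    hence "?s \<odot>\<^bsub>B\<^esub> b = \<ominus>\<^bsub>B\<^esub> x \<oplus>\<^bsub>B\<^esub> x'"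
      using c by (auto simp: B.smult_l_distr B.smult_l_minus B.M.r_neg1)
    hence "(?s \<odot>\<^bsub>B\<^esub> b, \<ominus>\<^bsub>E\<^esub> y \<oplus>\<^bsub>E\<^esub> y') \<in> G"
      using Gadd[OF Gneg[OF xy] xy'] by simp
    moreover from this have "?s \<in> J" using c by (auto simp: J_def)
    ultimately have "?s \<odot>\<^bsub>E\<^esub> e = \<ominus>\<^bsub>E\<^esub> y \<oplus>\<^bsub>E\<^esub> y'"
      using phi_eq[of ?s] psi_eq[of ?s] psi_e[of ?s] c by simp
    hence "r \<odot>\<^bsub>E\<^esub> e \<oplus>\<^bsub>E\<^esub> \<ominus>\<^bsub>E\<^esub> (r' \<odot>\<^bsub>E\<^esub> e) = \<ominus>\<^bsub>E\<^esub> y \<oplus>\<^bsub>E\<^esub> y'"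
      using c by (simp add: E.smult_l_distr E.smult_l_minus)
    hence "y \<oplus>\<^bsub>E\<^esub> (r \<odot>\<^bsub>E\<^esub> e \<oplus>\<^bsub>E\<^esub> \<ominus>\<^bsub>E\<^esub> (r' \<odot>\<^bsub>E\<^esub> e)) \<oplus>\<^bsub>E\<^esub> r' \<odot>\<^bsub>E\<^esub> e
        = y \<oplus>\<^bsub>E\<^esub> (\<ominus>\<^bsub>E\<^esub> y \<oplus>\<^bsub>E\<^esub> y') \<oplus>\<^bsub>E\<^esub> r' \<odot>\<^bsub>E\<^esub> e" by simp
    thus ?thesis using c by (simp add: E.M.a_assoc E.M.r_neg2 E.M.l_neg)
  qed
  have add': "(u \<oplus>\<^bsub>B\<^esub> u', v \<oplus>\<^bsub>E\<^esub> v') \<in> G'" if uv: "(u, v) \<in> G'" and uv': "(u', v') \<in> G'" for u v u' v'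
  proof -
    obtain x y r where 1: "(x, y) \<in> G" "r \<in> carrier R"
      "u = x \<oplus>\<^bsub>B\<^esub> r \<odot>\<^bsub>B\<^esub> b" "v = y \<oplus>\<^bsub>E\<^esub> r \<odot>\<^bsub>E\<^esub> e" using uv by (auto simp: G'_def)
    obtain x' y' r' where 2: "(x', y') \<in> G" "r' \<in> carrier R"
      "u' = x' \<oplus>\<^bsub>B\<^esub> r' \<odot>\<^bsub>B\<^esub> b" "v' = y' \<oplus>\<^bsub>E\<^esub> r' \<odot>\<^bsub>E\<^esub> e" using uv' by (auto simp: G'_def)
    note c = Gc[OF 1(1)] Gc[OF 2(1)] 1(2) 2(2) b e
    have "u \<oplus>\<^bsub>B\<^esub> u' = (x \<oplus>\<^bsub>B\<^esub> x') \<oplus>\<^bsub>B\<^esub> (r \<oplus>\<^bsub>R\<^esub> r') \<odot>\<^bsub>B\<^esub> b"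
      unfolding 1 2 using c by (simp add: B.smult_l_distr B.M.a_ac)
    moreover have "v \<oplus>\<^bsub>E\<^esub> v' = (y \<oplus>\<^bsub>E\<^esub> y') \<oplus>\<^bsub>E\<^esub> (r \<oplus>\<^bsub>R\<^esub> r') \<odot>\<^bsub>E\<^esub> e"
      unfolding 1 2 using c by (simp add: E.smult_l_distr E.M.a_ac)
    ultimately show ?thesis
      using G'I[OF Gadd[OF 1(1) 2(1)] B.R.a_closed[OF 1(2) 2(2)]] by simp
  qed
  have sm': "(s \<odot>\<^bsub>B\<^esub> u, s \<odot>\<^bsub>E\<^esub> v) \<in> G'" if s: "s \<in> carrier R" and uv: "(u, v) \<in> G'" for s u v
  proof -
    obtain x y r where 1: "(x, y) \<in> G" "r \<in> carrier R"
      "u = x \<oplus>\<^bsub>B\<^esub> r \<odot>\<^bsub>B\<^esub> b" "v = y \<oplus>\<^bsub>E\<^esub> r \<odot>\<^bsub>E\<^esub> e" using uv by (auto simp: G'_def)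
    note c = Gc[OF 1(1)] 1(2) b e s
    have "s \<odot>\<^bsub>B\<^esub> u = s \<odot>\<^bsub>B\<^esub> x \<oplus>\<^bsub>B\<^esub> (s \<otimes>\<^bsub>R\<^esub> r) \<odot>\<^bsub>B\<^esub> b"
      unfolding 1 using c by (simp add: B.smult_r_distr B.smult_assoc1)
    moreover have "s \<odot>\<^bsub>E\<^esub> v = s \<odot>\<^bsub>E\<^esub> y \<oplus>\<^bsub>E\<^esub> (s \<otimes>\<^bsub>R\<^esub> r) \<odot>\<^bsub>E\<^esub> e"
      unfolding 1 using c by (simp add: E.smult_r_distr E.smult_assoc1)
    ultimately show ?thesis
      using G'I[OF Gsm[OF s 1(1)] B.R.m_closed[OF s 1(2)]] by simp
  qed
  have "G' \<subseteq> carrier B \<times> carrier E" using Gc b e by (auto simp: G'_def)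
  moreover have "single_valued G'"
    unfolding single_valued_def by (auto simp: G'_def intro: sv)
  ultimately have "partial_hom_graph R B E G'"
    unfolding partial_hom_graph_def using add' sm' by blast
  thus ?thesis using sub bG by blast
qed

lemma injective_module_extend:
  fixes R :: "('a, 'r) ring_scheme" and E :: "('a, 'e, 'm) module_scheme"
    and A :: "('a, 'b, 'n) module_scheme" and B :: "('a, 'c, 'k) module_scheme"
  assumes E: "injective_module R E" and A: "module R A" and B: "module R B"
    and f: "f \<in> mod_hom R A B" and inj: "inj_on f (carrier A)" and g: "g \<in> mod_hom R A E"
  shows "\<exists>h\<in>mod_hom R B E. \<forall>x\<in>carrier A. h (f x) = g x"
proof -
  interpret A: module R A by (rule A)
  interpret B: module R B by (rule B)
  define G0 where "G0 = (\<lambda>x. (f x, g x)) ` carrier A"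
  have G0: "partial_hom_graph R B E G0"
    unfolding partial_hom_graph_def
  proof (intro conjI allI impI ballI)
    show "G0 \<subseteq> carrier B \<times> carrier E"
      using mod_homD(1)[OF f] mod_homD(1)[OF g] by (auto simp: G0_def)
    show "single_valued G0"
      using inj by (auto simp: G0_def single_valued_def inj_on_def)
  next
    fix x y x' y' assume "(x, y) \<in> G0" "(x', y') \<in> G0"
    then obtain a a' where a: "a \<in> carrier A" "a' \<in> carrier A"
      "x = f a" "y = g a" "x' = f a'" "y' = g a'" by (auto simp: G0_def)
    show "(x \<oplus>\<^bsub>B\<^esub> x', y \<oplus>\<^bsub>E\<^esub> y') \<in> G0"
      unfolding G0_def
      by (rule image_eqI[of _ _ "a \<oplus>\<^bsub>A\<^esub> a'"]) (use a mod_homD[OF f] mod_homD[OF g] in auto)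
  next
    fix r x y assume r: "r \<in> carrier R" and "(x, y) \<in> G0"
    then obtain a where a: "a \<in> carrier A" "x = f a" "y = g a" by (auto simp: G0_def)
    show "(r \<odot>\<^bsub>B\<^esub> x, r \<odot>\<^bsub>E\<^esub> y) \<in> G0"
      unfolding G0_def
      by (rule image_eqI[of _ _ "r \<odot>\<^bsub>A\<^esub> a"]) (use a r mod_homD[OF f] mod_homD[OF g] in auto)
  qed
  have G0ne: "G0 \<noteq> {}" using A.M.zero_closed by (auto simp: G0_def)
  define S where "S = {G. partial_hom_graph R B E G \<and> G0 \<subseteq> G}"
  have "\<exists>G\<in>S. \<forall>H\<in>S. G \<subseteq> H \<longrightarrow> H = G"
  proof (rule subset_Zorn_nonempty)
    show "S \<noteq> {}" using G0 by (auto simp: S_def)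
  next
    fix C assume Cne: "C \<noteq> {}" and C: "subset.chain S C"
    have CS: "C \<subseteq> S" using C by (simp add: subset_chain_def)
    have ch: "\<exists>G\<in>C. z \<in> G \<and> z' \<in> G" if "z \<in> \<Union>C" "z' \<in> \<Union>C" for z z'
    proof -
      obtain G H where "G \<in> C" "z \<in> G" "H \<in> C" "z' \<in> H" using \<open>z \<in> \<Union>C\<close> \<open>z' \<in> \<Union>C\<close> by blast
      moreover have "G \<subseteq> H \<or> H \<subseteq> G" using C \<open>G \<in> C\<close> \<open>H \<in> C\<close> by (auto simp: subset_chain_def)
      ultimately show ?thesis by blast
    qed
    have gr: "partial_hom_graph R B E G" if "G \<in> C" for G using that CS by (auto simp: S_def)
    have "partial_hom_graph R B E (\<Union>C)"
      unfolding partial_hom_graph_def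
    proof (intro conjI allI impI ballI)
      show "\<Union>C \<subseteq> carrier B \<times> carrier E" using gr unfolding partial_hom_graph_def by blast
      show "single_valued (\<Union>C)"
      proof (rule single_valuedI)
        fix x y y' assume "(x, y) \<in> \<Union>C" "(x, y') \<in> \<Union>C"
        from ch[OF this] obtain G where "G \<in> C" "(x, y) \<in> G" "(x, y') \<in> G" by blast
        thus "y = y'" using gr[of G] by (auto simp: partial_hom_graph_def single_valued_def)
      qed
    next
      fix x y x' y' assume "(x, y) \<in> \<Union>C" "(x', y') \<in> \<Union>C"
      from ch[OF this] obtain G where G: "G \<in> C" "(x, y) \<in> G" "(x', y') \<in> G" by blast
      hence "(x \<oplus>\<^bsub>B\<^esub> x', y \<oplus>\<^bsub>E\<^esub> y') \<in> G" using gr[of G] by (auto simp: partial_hom_graph_def)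
      thus "(x \<oplus>\<^bsub>B\<^esub> x', y \<oplus>\<^bsub>E\<^esub> y') \<in> \<Union>C" using G by blast
    next
      fix r x y assume r: "r \<in> carrier R" and "(x, y) \<in> \<Union>C"
      then obtain G where G: "G \<in> C" "(x, y) \<in> G" by blast
      hence "(r \<odot>\<^bsub>B\<^esub> x, r \<odot>\<^bsub>E\<^esub> y) \<in> G" using gr[of G] r by (auto simp: partial_hom_graph_def)
      thus "(r \<odot>\<^bsub>B\<^esub> x, r \<odot>\<^bsub>E\<^esub> y) \<in> \<Union>C" using G by blast
    qed
    moreover have "G0 \<subseteq> \<Union>C" using Cne CS by (auto simp: S_def)
    ultimately show "\<Union>C \<in> S" by (simp add: S_def)
  qed
  then obtain G where GS: "G \<in> S" and Gmax: "\<And>H. H \<in> S \<Longrightarrow> G \<subseteq> H \<Longrightarrow> H = G" by blast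
  have G: "partial_hom_graph R B E G" and G0G: "G0 \<subseteq> G" using GS by (auto simp: S_def)
  have dom: "b \<in> Domain G" if b: "b \<in> carrier B" for b
  proof -
    have "G \<noteq> {}" using G0G G0ne by blast
    from partial_hom_graph_extend[OF E B G this b]
    obtain G' where G': "partial_hom_graph R B E G'" "G \<subseteq> G'" "b \<in> Domain G'" by blast
    hence "G' \<in> S" using G0G by (auto simp: S_def)
    thus ?thesis using Gmax[of G'] G' by blast
  qed
  define h where "h x = (THE y. (x, y) \<in> G)" for x
  have h_eq: "h x = y" if "(x, y) \<in> G" for x y
    unfolding h_def using that G
    by (intro the_equality) (auto simp: partial_hom_graph_def single_valued_def)
  have hG: "(x, h x) \<in> G" if x: "x \<in> carrier B" for x
  proof -
    obtain y where "(x, y) \<in> G" using dom[OF x] by blast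
    thus ?thesis using h_eq[of x y] by simp
  qed
  have "h \<in> mod_hom R B E"
    unfolding mod_hom_def
  proof (intro CollectI conjI ballI)
    show "h \<in> carrier B \<rightarrow> carrier E"
    proof
      fix x assume "x \<in> carrier B"
      from hG[OF this] G show "h x \<in> carrier E" by (auto simp: partial_hom_graph_def)
    qed
  next
    fix x y assume "x \<in> carrier B" "y \<in> carrier B"
    hence "(x \<oplus>\<^bsub>B\<^esub> y, h x \<oplus>\<^bsub>E\<^esub> h y) \<in> G" using hG G by (auto simp: partial_hom_graph_def)
    thus "h (x \<oplus>\<^bsub>B\<^esub> y) = h x \<oplus>\<^bsub>E\<^esub> h y" by (rule h_eq)
  next
    fix r x assume "r \<in> carrier R" "x \<in> carrier B"
    hence "(r \<odot>\<^bsub>B\<^esub> x, r \<odot>\<^bsub>E\<^esub> h x) \<in> G" using hG G by (auto simp: partial_hom_graph_def)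
    thus "h (r \<odot>\<^bsub>B\<^esub> x) = r \<odot>\<^bsub>E\<^esub> h x" by (rule h_eq)
  qed
  moreover have "h (f x) = g x" if "x \<in> carrier A" for x
    by (rule h_eq) (use G0G that in \<open>auto simp: G0_def\<close>)
  ultimately show ?thesis by blast
qed

text \<open>The inclusion \<open>N \<subseteq> E\<close> is an injective envelope: \<open>E\<close> is injective and essential over \<open>N\<close>.\<close>

definition injective_envelope ::
  "('a, 'r) ring_scheme \<Rightarrow> 'b set \<Rightarrow> ('a, 'b, 'm) module_scheme \<Rightarrow> bool"
  where "injective_envelope R N E \<longleftrightarrow> injective_module R E \<and> submodule N R E \<and>
    (\<forall>L. submodule L R E \<longrightarrow> L \<noteq> {\<zero>\<^bsub>E\<^esub>} \<longrightarrow> L \<inter> N \<noteq> {\<zero>\<^bsub>E\<^esub>})"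

section \<open>Complexes and minimal injective resolutions\<close>

definition cochain_complex ::
  "('a, 'r) ring_scheme \<Rightarrow> (int \<Rightarrow> ('a, 'b) module) \<Rightarrow> (int \<Rightarrow> 'b \<Rightarrow> 'b) \<Rightarrow> bool"
  where "cochain_complex R C d \<longleftrightarrow>
    (\<forall>n. module R (C n) \<and> d n \<in> mod_hom R (C n) (C (n + 1)) \<and>
      (\<forall>x\<in>carrier (C n). d (n + 1) (d n x) = \<zero>\<^bsub>C (n + 1 + 1)\<^esub>))"

definition cocycles :: "(int \<Rightarrow> ('a, 'b) module) \<Rightarrow> (int \<Rightarrow> 'b \<Rightarrow> 'b) \<Rightarrow> int \<Rightarrow> 'b set"
  where "cocycles C d n = a_kernel (C n) (C (n + 1)) (d n)"

definition coboundaries :: "(int \<Rightarrow> ('a, 'b) module) \<Rightarrow> (int \<Rightarrow> 'b \<Rightarrow> 'b) \<Rightarrow> int \<Rightarrow> 'b set"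
  where "coboundaries C d n = d (n - 1) ` carrier (C (n - 1))"

definition cohomology ::
  "(int \<Rightarrow> ('a, 'b) module) \<Rightarrow> (int \<Rightarrow> 'b \<Rightarrow> 'b) \<Rightarrow> int \<Rightarrow> ('a, 'b set) module"
  where "cohomology C d n =
    quotient_module ((C n)\<lparr>carrier := cocycles C d n\<rparr>) (coboundaries C d n)"

definition minimal_injective_complex ::
  "('a, 'r) ring_scheme \<Rightarrow> (int \<Rightarrow> ('a, 'b) module) \<Rightarrow> (int \<Rightarrow> 'b \<Rightarrow> 'b) \<Rightarrow> bool"
  where "minimal_injective_complex R I d \<longleftrightarrow>
    cochain_complex R I d \<and> (\<forall>n. injective_module R (I n)) \<and>
    (\<forall>n. injective_envelope R (cocycles I d n) (I n))"

text \<open>\<open>0 \<rightarrow> M \<rightarrow> I\<^sup>0 \<rightarrow> I\<^sup>1 \<rightarrow> \<dots>\<close> is exact, with augmentation \<open>\<epsilon>\<close>, and \<open>I\<^sup>n = 0\<close> for \<open>n < 0\<close>.\<close>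

definition injective_resolution ::
  "('a, 'r) ring_scheme \<Rightarrow> ('a, 'm, 'k) module_scheme \<Rightarrow> (int \<Rightarrow> ('a, 'b) module) \<Rightarrow>
    (int \<Rightarrow> 'b \<Rightarrow> 'b) \<Rightarrow> ('m \<Rightarrow> 'b) \<Rightarrow> bool"
  where "injective_resolution R M I d \<epsilon> \<longleftrightarrow>
    cochain_complex R I d \<and> (\<forall>n. injective_module R (I n)) \<and>
    (\<forall>n<0. carrier (I n) = {\<zero>\<^bsub>I n\<^esub>}) \<and>
    \<epsilon> \<in> mod_hom R M (I 0) \<and> inj_on \<epsilon> (carrier M) \<and> \<epsilon> ` carrier M = cocycles I d 0 \<and>
    (\<forall>n>0. cocycles I d n = coboundaries I d n)"

definition minimal_injective_resolution ::
  "('a, 'r) ring_scheme \<Rightarrow> ('a, 'm, 'k) module_scheme \<Rightarrow> (int \<Rightarrow> ('a, 'b) module) \<Rightarrow>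
    (int \<Rightarrow> 'b \<Rightarrow> 'b) \<Rightarrow> ('m \<Rightarrow> 'b) \<Rightarrow> bool"
  where "minimal_injective_resolution R M I d \<epsilon> \<longleftrightarrow>
    injective_resolution R M I d \<epsilon> \<and> minimal_injective_complex R I d"

section \<open>The injective linear part and the injective linearity defect\<close>

text \<open>
  \<open>(\<G>\<^sup>j I)\<^sup>n = (0 : \<mm>\<^sup>j\<^sup>-\<^sup>n)\<close> in \<open>I\<^sup>n\<close>. For \<open>j \<le> n\<close> the power \<open>\<mm>\<^sup>j\<^sup>-\<^sup>n\<close> is the whole ring, so that
  \<open>(\<G>\<^sup>j I)\<^sup>n = 0\<close>; here \<open>nat (j - n) = 0\<close> and the unit of \<^const>\<open>ideals_set\<close> is the whole ring.
\<close>

definition inj_filtration ::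
  "('a, 'r) ring_scheme \<Rightarrow> 'a set \<Rightarrow> (int \<Rightarrow> ('a, 'b) module) \<Rightarrow> int \<Rightarrow> int \<Rightarrow> 'b set"
  where "inj_filtration R \<mm> I j n =
    annihilated_by (I n) (\<mm> [^]\<^bsub>ideals_set R\<^esub> nat (j - n))"

definition inj_lin ::
  "('a, 'r) ring_scheme \<Rightarrow> 'a set \<Rightarrow> (int \<Rightarrow> ('a, 'b) module) \<Rightarrow> int \<Rightarrow> ('a, int \<Rightarrow> 'b set) module"
  where "inj_lin R \<mm> I n = direct_sum_module (\<lambda>j.
    quotient_module ((I n)\<lparr>carrier := inj_filtration R \<mm> I (j + 1) n\<rparr>) (inj_filtration R \<mm> I j n))"

text \<open>
  The differential induced by \<open>d\<close>: in each summand the coset of \<open>u\<close> goes to the coset of \<open>d u\<close>.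
\<close>

definition inj_lin_diff ::
  "('a, 'r) ring_scheme \<Rightarrow> 'a set \<Rightarrow> (int \<Rightarrow> ('a, 'b) module) \<Rightarrow> (int \<Rightarrow> 'b \<Rightarrow> 'b) \<Rightarrow>
    int \<Rightarrow> (int \<Rightarrow> 'b set) \<Rightarrow> int \<Rightarrow> 'b set"
  where "inj_lin_diff R \<mm> I d n x =
    (\<lambda>j. \<Union>u\<in>x j. inj_filtration R \<mm> I j (n + 1) +>\<^bsub>I (n + 1)\<^esub> d n u)"

text \<open>
  For a module \<open>M\<close> the invariant is computed from its minimal injective resolution \<open>(I, d)\<close>,
  which is unique up to isomorphism. The supremum is taken in the extended reals, so it is
  \<open>-\<infinity>\<close> if all cohomology vanishes.
\<close>

definition inj_ld ::
  "('a, 'r) ring_scheme \<Rightarrow> 'a set \<Rightarrow> (int \<Rightarrow> ('a, 'b) module) \<Rightarrow> (int \<Rightarrow> 'b \<Rightarrow> 'b) \<Rightarrow> ereal"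
  where "inj_ld R \<mm> I d =
    Sup {ereal (real_of_int i) | i.
      carrier (cohomology (inj_lin R \<mm> I) (inj_lin_diff R \<mm> I d) i)
        \<noteq> {\<zero>\<^bsub>cohomology (inj_lin R \<mm> I) (inj_lin_diff R \<mm> I d) i\<^esub>}}"

definition injectively_koszul ::
  "('a, 'r) ring_scheme \<Rightarrow> 'a set \<Rightarrow> (int \<Rightarrow> ('a, 'b) module) \<Rightarrow> (int \<Rightarrow> 'b \<Rightarrow> 'b) \<Rightarrow> bool"
  where "injectively_koszul R \<mm> I d \<longleftrightarrow> inj_ld R \<mm> I d = 0"

end

theory Submission
  imports Defs
begin

text \<open>
  Let \<open>\<mm>\<close> be the maximal ideal and let \<open>I\<close> be the minimal injective resolution of \<open>M\<close>. The subcomplexes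
  of the filtration exhaust the \<open>\<mm>\<close>-torsion subcomplex of \<open>I\<close>, whose cohomology is the local
  cohomology of \<open>M\<close>, and in degree \<open>n\<close> they vanish up to index \<open>n\<close>. Hence, if the linear part has no
  cohomology in degree \<open>n\<close>, then neither has the torsion subcomplex: boundaries can be subtracted
  from a torsion cocycle of degree \<open>n\<close> until nothing is left
  (\<open>torsion_cocycle_bounds\<close>). So it suffices that local cohomology does not vanish in some
  degree at least \<open>dim M\<close>. That is the non-vanishing theorem of Grothendieck; it is proved here for every
  chain of primes in the support of \<open>M\<close> (\<open>torsion_cohomology_nonvanishing\<close>). The second assertion follows, as
  \<open>dim M \<ge> 0\<close> unless \<open>M = 0\<close>, and for \<open>M = 0\<close> the defect is \<open>-\<infinity>\<close>.

  The non-vanishing theorem is proved by induction on the length \<open>n\<close> of the chain. For the module \<open>M/rM\<close> the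
  induction uses the mapping cone of \<open>r\<close> on a complex of modules, which is again a complex whose
  modules are \<open>soft\<close>, a property of injective modules that makes torsion compute local
  cohomology. If local cohomology vanishes in all degrees \<open>\<ge> n\<close>, then its top candidate
  \<open>H\<close>, in degree \<open>n - 1 \<ge> 1\<close>, is artinian and satisfies \<open>H = \<mm>H\<close>. Then \<open>H = rH\<close> for some \<open>r \<in> \<mm>\<close> by prime
  avoidance for the attached primes of \<open>H\<close> (\<open>artinian_divisible\<close>), and the cone of \<open>r\<close> loses one more degree of local
  cohomology. On the other hand the support of \<open>M/rM\<close> contains a chain of length \<open>n - 1\<close>, by Krull's
  principal ideal theorem (\<open>prime_chain_containing\<close>). For \<open>n \<le> 1\<close> the top degree is at most \<open>0\<close>, and
  Nakayama's lemma shows that \<open>M\<close> is torsion, respectively zero, locally at the first prime.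

  Two devices avoid quotient modules and changes of type. Cohomology is a pair of
  submodules \<open>B \<subseteq> Z\<close>, with chain conditions on the submodules in between. All complexes consist of submodules of
  one module that is isomorphic to its own square, so that cones remain inside it.
\<close>

section \<open>Chain conditions on intervals of submodules\<close>

text \<open>With \<open>\<subseteq>\<close> or \<open>\<supseteq>\<close> for \<open>rel\<close> this is the maximum or the minimum condition, so that the noetherian
  and the artinian condition can be treated together.\<close>

definition extremal_condition :: "('s set \<Rightarrow> 's set \<Rightarrow> bool) \<Rightarrow> 's set set \<Rightarrow> bool"
  where "extremal_condition rel L \<longleftrightarrow>
    (\<forall>F. F \<subseteq> L \<longrightarrow> F \<noteq> {} \<longrightarrow> (\<exists>U\<in>F. \<forall>V\<in>F. rel U V \<longrightarrow> V = U))"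

lemma extremal_conditionD:
  assumes "extremal_condition rel L" "F \<subseteq> L" "U \<in> F"
  shows "\<exists>V\<in>F. \<forall>W\<in>F. rel V W \<longrightarrow> W = V"
  using assms unfolding extremal_condition_def by blast

lemma extremal_condition_mono:
  "extremal_condition rel L \<Longrightarrow> L' \<subseteq> L \<Longrightarrow> extremal_condition rel L'"
  unfolding extremal_condition_def by (meson subset_trans)

text \<open>In all uses \<open>f\<close> describes the submodules of one module by those of another one, and so replaces
  the passage to submodules and quotient modules.\<close>

lemma extremal_condition_transfer:
  assumes L: "extremal_condition rel L"
    and rel: "(rel = (\<subseteq>) \<and> rel' = (\<subseteq>)) \<or> (rel = (\<supseteq>) \<and> rel' = (\<supseteq>))"
    and f: "\<And>U. U \<in> K \<Longrightarrow> f U \<in> L"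
    and mono: "\<And>U V. U \<in> K \<Longrightarrow> V \<in> K \<Longrightarrow> U \<subseteq> V \<Longrightarrow> f U \<subseteq> f V"
    and inj: "inj_on f K"
  shows "extremal_condition rel' K"
  unfolding extremal_condition_def
proof (intro allI impI)
  fix F assume F: "F \<subseteq> K" "F \<noteq> {}"
  then obtain U0 where "U0 \<in> F" by blast
  hence "f U0 \<in> f ` F" by blast
  moreover have "f ` F \<subseteq> L" using f F by blast
  ultimately have "\<exists>V\<in>f ` F. \<forall>W\<in>f ` F. rel V W \<longrightarrow> W = V"
    by (intro extremal_conditionD[OF L])
  then obtain V where V: "V \<in> f ` F" "\<And>W. W \<in> f ` F \<Longrightarrow> rel V W \<Longrightarrow> W = V"
    by blast
  then obtain U where U: "U \<in> F" "V = f U" by blast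
  have "W = U" if W: "W \<in> F" "rel' U W" for W
  proof -
    have "rel (f U) (f W)" using mono[of U W] mono[of W U] U W F rel by auto
    hence "f W = f U" using V(2)[of "f W"] U W by blast
    thus ?thesis using inj F U W unfolding inj_on_def by blast
  qed
  thus "\<exists>U\<in>F. \<forall>V\<in>F. rel' U V \<longrightarrow> V = U" using U by blast
qed

lemmas noetherian_transfer = extremal_condition_transfer[where rel = "(\<subseteq>)" and rel' = "(\<subseteq>)", simplified]
lemmas artinian_transfer = extremal_condition_transfer[where rel = "(\<supseteq>)" and rel' = "(\<supseteq>)", simplified]

lemma descending_sequence_stabilizes:
  assumes L: "extremal_condition (\<supseteq>) L" and f: "\<And>i::nat. f i \<in> L" and dec: "\<And>i. f (Suc i) \<subseteq> f i"
  obtains n where "\<And>i. n \<le> i \<Longrightarrow> f i = f n"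
proof -
  have "range f \<subseteq> L" "f 0 \<in> range f" using f by auto
  hence "\<exists>V\<in>range f. \<forall>W\<in>range f. W \<subseteq> V \<longrightarrow> W = V"
    by (rule extremal_conditionD[OF L])
  then obtain V where V: "V \<in> range f" "\<forall>W\<in>range f. W \<subseteq> V \<longrightarrow> W = V"
    by (rule bexE)
  then obtain n where n: "V = f n" by blast
  have "f i \<subseteq> f n" if "n \<le> i" for i
    using that by (induct i rule: dec_induct) (use dec in blast)+
  hence "f i = f n" if "n \<le> i" for i using that V(2) n by simp
  thus thesis by (rule that)
qed

lemma extremal_condition_descendingI:
  assumes "\<And>f :: nat \<Rightarrow> 's set. (\<And>i. f i \<in> L) \<Longrightarrow> (\<And>i. f (Suc i) \<subset> f i) \<Longrightarrow> False"
  shows "extremal_condition (\<supseteq>) L"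
  unfolding extremal_condition_def
proof (intro allI impI, rule ccontr)
  fix F assume F: "F \<subseteq> L" "F \<noteq> {}" and no: "\<not> (\<exists>U\<in>F. \<forall>V\<in>F. U \<supseteq> V \<longrightarrow> V = U)"
  have step: "\<exists>V. V \<in> F \<and> V \<subset> U" if "U \<in> F" for U using no that by blast
  have "\<exists>f. \<forall>n. f n \<in> F \<and> f (Suc n) \<subset> f n"
    by (rule dependent_nat_choice) (use F step in auto)
  then obtain f where "\<And>i::nat. f i \<in> F" "\<And>i. f (Suc i) \<subset> f i" by blast
  thus False using assms[of f] F by blast
qed

context module
begin

lemma M_minus_zero: "\<ominus>\<^bsub>M\<^esub> \<zero>\<^bsub>M\<^esub> = \<zero>\<^bsub>M\<^esub>"
  using M.l_neg[of "\<zero>\<^bsub>M\<^esub>"] by simp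

lemma smult_lcomm:
  "a \<in> carrier R \<Longrightarrow> b \<in> carrier R \<Longrightarrow> x \<in> carrier M \<Longrightarrow> a \<odot>\<^bsub>M\<^esub> (b \<odot>\<^bsub>M\<^esub> x) = b \<odot>\<^bsub>M\<^esub> (a \<odot>\<^bsub>M\<^esub> x)"
  by (metis R.m_comm smult_assoc1)

text \<open>With these rules the normalisation method for rings decides linear identities in the module.\<close>

lemmas module_normalization [algebra add: module "ring.zero M" "ring.add M" "a_inv M" "a_minus M"] =
  M.a_closed M.zero_closed M.a_inv_closed M.minus_closed M.a_assoc M.l_zero M.l_neg M.a_comm
  M.minus_eq M.r_zero M.r_neg M.r_neg2 M.r_neg1 M.minus_add M.minus_minus M_minus_zero M.a_lcomm
  smult_closed smult_r_distr smult_l_distr smult_r_minus smult_l_minus smult_assoc1 smult_lcomm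
  smult_one smult_l_null smult_r_null
  R.a_closed R.zero_closed R.a_inv_closed R.minus_closed R.m_closed R.one_closed R.minus_eq

lemma submodule_closed:
  assumes "submodule V R M"
  shows "V \<subseteq> carrier M" "x \<in> V \<Longrightarrow> x \<in> carrier M" "\<zero>\<^bsub>M\<^esub> \<in> V"
    "x \<in> V \<Longrightarrow> y \<in> V \<Longrightarrow> x \<oplus>\<^bsub>M\<^esub> y \<in> V" "x \<in> V \<Longrightarrow> y \<in> V \<Longrightarrow> x \<ominus>\<^bsub>M\<^esub> y \<in> V"
    "x \<in> V \<Longrightarrow> \<ominus>\<^bsub>M\<^esub> x \<in> V" "a \<in> carrier R \<Longrightarrow> x \<in> V \<Longrightarrow> a \<odot>\<^bsub>M\<^esub> x \<in> V"
proof -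
  note E = submoduleE[OF assms]
  show 1: "V \<subseteq> carrier M" "x \<in> V \<Longrightarrow> x \<in> carrier M" using E(1) by auto
  show "\<zero>\<^bsub>M\<^esub> \<in> V" using E(2,3,5) E(1) M.r_neg by (metis ex_in_conv subsetD)
  show "x \<in> V \<Longrightarrow> y \<in> V \<Longrightarrow> x \<oplus>\<^bsub>M\<^esub> y \<in> V" "x \<in> V \<Longrightarrow> y \<in> V \<Longrightarrow> x \<ominus>\<^bsub>M\<^esub> y \<in> V"
    "x \<in> V \<Longrightarrow> \<ominus>\<^bsub>M\<^esub> x \<in> V" "a \<in> carrier R \<Longrightarrow> x \<in> V \<Longrightarrow> a \<odot>\<^bsub>M\<^esub> x \<in> V"
    using E by (auto simp: M.minus_eq)
qed

lemma submoduleI':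
  assumes "V \<subseteq> carrier M" "\<zero>\<^bsub>M\<^esub> \<in> V" "\<And>x y. x \<in> V \<Longrightarrow> y \<in> V \<Longrightarrow> x \<oplus>\<^bsub>M\<^esub> y \<in> V"
    and sm: "\<And>a x. a \<in> carrier R \<Longrightarrow> x \<in> V \<Longrightarrow> a \<odot>\<^bsub>M\<^esub> x \<in> V"
  shows "submodule V R M"
proof (rule submoduleI)
  fix x assume x: "x \<in> V"
  hence "\<ominus>\<^bsub>M\<^esub> x = (\<ominus> \<one>) \<odot>\<^bsub>M\<^esub> x" using assms(1) by (auto simp: smult_l_minus)
  thus "\<ominus>\<^bsub>M\<^esub> x \<in> V" using sm[OF _ x, of "\<ominus> \<one>"] by simp
qed (use assms in auto)

lemma submodule_add_cancel:
  assumes V: "submodule V R M" and x: "x \<in> V" and y: "y \<in> carrier M" and xy: "x \<oplus>\<^bsub>M\<^esub> y \<in> V"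
  shows "y \<in> V"
proof -
  have "y = (x \<oplus>\<^bsub>M\<^esub> y) \<ominus>\<^bsub>M\<^esub> x" using x y submodule_closed[OF V] by algebra
  thus ?thesis using submodule_closed(5)[OF V xy x] by simp
qed

lemma submodule_Int:
  "submodule U R M \<Longrightarrow> submodule V R M \<Longrightarrow> submodule (U \<inter> V) R M"
  by (rule submoduleI') (auto dest: submodule_closed)

lemma mem_set_add: "x \<in> U <+>\<^bsub>M\<^esub> V \<longleftrightarrow> (\<exists>u\<in>U. \<exists>v\<in>V. x = u \<oplus>\<^bsub>M\<^esub> v)"
  unfolding set_add_def' by blast

lemma set_addI: "u \<in> U \<Longrightarrow> v \<in> V \<Longrightarrow> u \<oplus>\<^bsub>M\<^esub> v \<in> U <+>\<^bsub>M\<^esub> V"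
  unfolding mem_set_add by blast

lemma set_addE:
  assumes "x \<in> U <+>\<^bsub>M\<^esub> V"
  obtains u v where "u \<in> U" "v \<in> V" "x = u \<oplus>\<^bsub>M\<^esub> v"
  using assms unfolding mem_set_add by blast

lemma submodule_set_add:
  assumes U: "submodule U R M" and V: "submodule V R M"
  shows "submodule (U <+>\<^bsub>M\<^esub> V) R M"
proof (rule submoduleI')
  note u = submodule_closed[OF U] and v = submodule_closed[OF V]
  show "U <+>\<^bsub>M\<^esub> V \<subseteq> carrier M" using u v by (auto elim!: set_addE)
  have "\<zero>\<^bsub>M\<^esub> \<oplus>\<^bsub>M\<^esub> \<zero>\<^bsub>M\<^esub> \<in> U <+>\<^bsub>M\<^esub> V" by (rule set_addI[OF u(3) v(3)])
  thus "\<zero>\<^bsub>M\<^esub> \<in> U <+>\<^bsub>M\<^esub> V" by simp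
next
  note u = submodule_closed[OF U] and v = submodule_closed[OF V]
  fix x y assume "x \<in> U <+>\<^bsub>M\<^esub> V" "y \<in> U <+>\<^bsub>M\<^esub> V"
  then obtain a b a' b' where *: "a \<in> U" "b \<in> V" "a' \<in> U" "b' \<in> V" "x = a \<oplus>\<^bsub>M\<^esub> b" "y = a' \<oplus>\<^bsub>M\<^esub> b'"
    by (elim set_addE)
  have "a \<in> carrier M" "b \<in> carrier M" "a' \<in> carrier M" "b' \<in> carrier M" using * u v by auto
  hence "x \<oplus>\<^bsub>M\<^esub> y = (a \<oplus>\<^bsub>M\<^esub> a') \<oplus>\<^bsub>M\<^esub> (b \<oplus>\<^bsub>M\<^esub> b')" unfolding * by algebra
  thus "x \<oplus>\<^bsub>M\<^esub> y \<in> U <+>\<^bsub>M\<^esub> V" using set_addI[OF u(4)[OF *(1,3)] v(4)[OF *(2,4)]] by simp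
next
  note u = submodule_closed[OF U] and v = submodule_closed[OF V]
  fix r x assume r: "r \<in> carrier R" "x \<in> U <+>\<^bsub>M\<^esub> V"
  then obtain a b where *: "a \<in> U" "b \<in> V" "x = a \<oplus>\<^bsub>M\<^esub> b"
    by (elim set_addE)
  hence "r \<odot>\<^bsub>M\<^esub> x = (r \<odot>\<^bsub>M\<^esub> a) \<oplus>\<^bsub>M\<^esub> (r \<odot>\<^bsub>M\<^esub> b)" using u v r by (auto simp: smult_r_distr)
  thus "r \<odot>\<^bsub>M\<^esub> x \<in> U <+>\<^bsub>M\<^esub> V" using set_addI[OF u(7)[OF r(1) *(1)] v(7)[OF r(1) *(2)]] by simp
qed

lemma set_add_upper:
  assumes U: "submodule U R M" and V: "submodule V R M"
  shows "U \<subseteq> U <+>\<^bsub>M\<^esub> V" "V \<subseteq> U <+>\<^bsub>M\<^esub> V"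
proof -
  note u = submodule_closed[OF U] and v = submodule_closed[OF V]
  show "U \<subseteq> U <+>\<^bsub>M\<^esub> V"
  proof
    fix x assume "x \<in> U"
    thus "x \<in> U <+>\<^bsub>M\<^esub> V" using set_addI[OF _ v(3), of x U] u by simp
  qed
  show "V \<subseteq> U <+>\<^bsub>M\<^esub> V"
  proof
    fix x assume "x \<in> V"
    thus "x \<in> U <+>\<^bsub>M\<^esub> V" using set_addI[OF u(3), of x V] v by simp
  qed
qed

lemma set_add_least:
  "submodule W R M \<Longrightarrow> U \<subseteq> W \<Longrightarrow> V \<subseteq> W \<Longrightarrow> U <+>\<^bsub>M\<^esub> V \<subseteq> W"
  by (auto elim!: set_addE dest: submodule_closed)

lemma set_add_mono: "U \<subseteq> U' \<Longrightarrow> V \<subseteq> V' \<Longrightarrow> U <+>\<^bsub>M\<^esub> V \<subseteq> U' <+>\<^bsub>M\<^esub> V'"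
  by (auto elim!: set_addE intro: set_addI)

lemma submodule_smult_image:
  assumes V: "submodule V R M" and r: "r \<in> carrier R"
  shows "submodule ((\<lambda>x. r \<odot>\<^bsub>M\<^esub> x) ` V) R M"
proof (rule submoduleI')
  note c = submodule_closed[OF V]
  show "(\<lambda>x. r \<odot>\<^bsub>M\<^esub> x) ` V \<subseteq> carrier M" using c r by auto
  show "\<zero>\<^bsub>M\<^esub> \<in> (\<lambda>x. r \<odot>\<^bsub>M\<^esub> x) ` V" using c r by (intro image_eqI[of _ _ "\<zero>\<^bsub>M\<^esub>"]) auto
  fix x y assume "x \<in> (\<lambda>x. r \<odot>\<^bsub>M\<^esub> x) ` V" "y \<in> (\<lambda>x. r \<odot>\<^bsub>M\<^esub> x) ` V"
  then obtain u v where "u \<in> V" "v \<in> V" "x = r \<odot>\<^bsub>M\<^esub> u" "y = r \<odot>\<^bsub>M\<^esub> v" by blast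
  thus "x \<oplus>\<^bsub>M\<^esub> y \<in> (\<lambda>x. r \<odot>\<^bsub>M\<^esub> x) ` V" using c r
    by (intro image_eqI[of _ _ "u \<oplus>\<^bsub>M\<^esub> v"]) (auto simp: smult_r_distr)
next
  note c = submodule_closed[OF V]
  fix a x assume a: "a \<in> carrier R" and "x \<in> (\<lambda>x. r \<odot>\<^bsub>M\<^esub> x) ` V"
  then obtain u where "u \<in> V" "x = r \<odot>\<^bsub>M\<^esub> u" by blast
  thus "a \<odot>\<^bsub>M\<^esub> x \<in> (\<lambda>x. r \<odot>\<^bsub>M\<^esub> x) ` V" using c r a
    by (intro image_eqI[of _ _ "a \<odot>\<^bsub>M\<^esub> u"]) (auto simp: smult_lcomm)
qed

lemma submodule_cyclic:
  assumes z: "z \<in> carrier M"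
  shows "submodule ((\<lambda>a. a \<odot>\<^bsub>M\<^esub> z) ` carrier R) R M"
proof (rule submoduleI')
  show "(\<lambda>a. a \<odot>\<^bsub>M\<^esub> z) ` carrier R \<subseteq> carrier M" using z by auto
  show "\<zero>\<^bsub>M\<^esub> \<in> (\<lambda>a. a \<odot>\<^bsub>M\<^esub> z) ` carrier R" using z by (intro image_eqI[of _ _ \<zero>]) auto
  fix x y assume "x \<in> (\<lambda>a. a \<odot>\<^bsub>M\<^esub> z) ` carrier R" "y \<in> (\<lambda>a. a \<odot>\<^bsub>M\<^esub> z) ` carrier R"
  then obtain a b where "a \<in> carrier R" "b \<in> carrier R" "x = a \<odot>\<^bsub>M\<^esub> z" "y = b \<odot>\<^bsub>M\<^esub> z" by blast
  thus "x \<oplus>\<^bsub>M\<^esub> y \<in> (\<lambda>a. a \<odot>\<^bsub>M\<^esub> z) ` carrier R" using z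
    by (intro image_eqI[of _ _ "a \<oplus> b"]) (auto simp: smult_l_distr)
next
  fix a x assume a: "a \<in> carrier R" and "x \<in> (\<lambda>a. a \<odot>\<^bsub>M\<^esub> z) ` carrier R"
  then obtain b where "b \<in> carrier R" "x = b \<odot>\<^bsub>M\<^esub> z" by blast
  thus "a \<odot>\<^bsub>M\<^esub> x \<in> (\<lambda>a. a \<odot>\<^bsub>M\<^esub> z) ` carrier R" using z a
    by (intro image_eqI[of _ _ "a \<otimes> b"]) (auto simp: smult_assoc1)
qed

lemma mem_cyclic: "z \<in> carrier M \<Longrightarrow> z \<in> (\<lambda>a. a \<odot>\<^bsub>M\<^esub> z) ` carrier R"
  by (rule image_eqI[of _ _ \<one>]) auto

lemma submodule_preimage_smult:
  assumes V: "submodule V R M" and Z: "submodule Z R M" and r: "r \<in> carrier R"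
  shows "submodule {x \<in> Z. r \<odot>\<^bsub>M\<^esub> x \<in> V} R M"
proof (rule submoduleI')
  note c = submodule_closed[OF V] submodule_closed[OF Z]
  show "{x \<in> Z. r \<odot>\<^bsub>M\<^esub> x \<in> V} \<subseteq> carrier M" using c by auto
  show "\<zero>\<^bsub>M\<^esub> \<in> {x \<in> Z. r \<odot>\<^bsub>M\<^esub> x \<in> V}" using c r by auto
  fix x y assume "x \<in> {x \<in> Z. r \<odot>\<^bsub>M\<^esub> x \<in> V}" "y \<in> {x \<in> Z. r \<odot>\<^bsub>M\<^esub> x \<in> V}"
  thus "x \<oplus>\<^bsub>M\<^esub> y \<in> {x \<in> Z. r \<odot>\<^bsub>M\<^esub> x \<in> V}" using c r by (auto simp: smult_r_distr)
next
  note c = submodule_closed[OF V] submodule_closed[OF Z]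
  fix a x assume "a \<in> carrier R" "x \<in> {x \<in> Z. r \<odot>\<^bsub>M\<^esub> x \<in> V}"
  thus "a \<odot>\<^bsub>M\<^esub> x \<in> {x \<in> Z. r \<odot>\<^bsub>M\<^esub> x \<in> V}" using c r by (auto simp: smult_lcomm[of r])
qed

lemma conductor_ideal:
  assumes V: "submodule V R M" and z: "z \<in> carrier M"
  shows "ideal {a \<in> carrier R. a \<odot>\<^bsub>M\<^esub> z \<in> V} R"
proof (rule idealI)
  note c = submodule_closed[OF V]
  show "ring R" by (rule R.ring_axioms)
  show "subgroup {a \<in> carrier R. a \<odot>\<^bsub>M\<^esub> z \<in> V} (add_monoid R)"
    by (rule R.add.subgroupI)
      (use c z in \<open>auto simp: smult_l_distr smult_l_minus a_inv_def[symmetric] intro!: exI[of _ \<zero>]\<close>)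
  fix a x assume "a \<in> {a \<in> carrier R. a \<odot>\<^bsub>M\<^esub> z \<in> V}" "x \<in> carrier R"
  thus "x \<otimes> a \<in> {a \<in> carrier R. a \<odot>\<^bsub>M\<^esub> z \<in> V}" "a \<otimes> x \<in> {a \<in> carrier R. a \<odot>\<^bsub>M\<^esub> z \<in> V}"
    using c z by (auto simp: smult_assoc1 R.m_comm[of a x])
qed

text \<open>Intervals of submodules replace quotient modules: the submodules of \<open>Z/B\<close> are the elements of
  \<open>interval B Z\<close>.\<close>

definition interval :: "'c set \<Rightarrow> 'c set \<Rightarrow> 'c set set"
  where "interval B Z = {U. submodule U R M \<and> B \<subseteq> U \<and> U \<subseteq> Z}"

abbreviation noetherian_interval :: "'c set \<Rightarrow> 'c set \<Rightarrow> bool"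
  where "noetherian_interval B Z \<equiv> extremal_condition (\<subseteq>) (interval B Z)"

abbreviation artinian_interval :: "'c set \<Rightarrow> 'c set \<Rightarrow> bool"
  where "artinian_interval B Z \<equiv> extremal_condition (\<supseteq>) (interval B Z)"

lemma interval_condition_mono:
  "extremal_condition rel (interval B Z) \<Longrightarrow> B \<subseteq> B' \<Longrightarrow> Z' \<subseteq> Z \<Longrightarrow>
    extremal_condition rel (interval B' Z')"
  by (erule extremal_condition_mono) (auto simp: interval_def)

text \<open>The modular law, which makes both chain conditions pass to extensions.\<close>

lemma submodule_eq_by_modularity:
  assumes U: "submodule U R M" and V: "submodule V R M" and L: "submodule L R M"
    and sub: "U \<subseteq> V" and i: "V \<inter> L \<subseteq> U" and s: "V \<subseteq> U <+>\<^bsub>M\<^esub> L"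
  shows "V = U"
proof
  show "V \<subseteq> U"
  proof
    fix v assume v: "v \<in> V"
    then obtain u l where *: "u \<in> U" "l \<in> L" "v = u \<oplus>\<^bsub>M\<^esub> l" using s by (blast elim: set_addE)
    have "l \<in> V" using submodule_add_cancel[OF V, of u l] * v sub submodule_closed[OF L] by auto
    hence "l \<in> U" using i * by blast
    thus "v \<in> U" using * submodule_closed[OF U] by auto
  qed
qed (rule sub)

text \<open>An extremal element is found by first making \<open>U \<inter> L\<close> extremal, and then \<open>U + L\<close> among the
  submodules with this intersection.\<close>

lemma interval_condition_extend:
  assumes rel: "rel = (\<subseteq>) \<or> rel = (\<supseteq>)" and L: "submodule L R M" and BL: "B \<subseteq> L" and LZ: "L \<subseteq> Z"
    and Z: "submodule Z R M"
    and 1: "extremal_condition rel (interval B L)" and 2: "extremal_condition rel (interval L Z)"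
  shows "extremal_condition rel (interval B Z)"
  unfolding extremal_condition_def
proof (intro allI impI)
  fix F assume F: "F \<subseteq> interval B Z" "F \<noteq> {}"
  have FD: "submodule U R M" "B \<subseteq> U" "U \<subseteq> Z" if "U \<in> F" for U using F that by (auto simp: interval_def)
  have i1: "(\<lambda>U. U \<inter> L) ` F \<subseteq> interval B L"
    using FD BL L submodule_Int by (auto simp: interval_def)
  obtain U0 where "U0 \<in> F" using F by blast
  hence "U0 \<inter> L \<in> (\<lambda>U. U \<inter> L) ` F" by blast
  from extremal_conditionD[OF 1 i1 this]
  obtain Ui where Ui: "Ui \<in> (\<lambda>U. U \<inter> L) ` F" "\<And>W. W \<in> (\<lambda>U. U \<inter> L) ` F \<Longrightarrow> rel Ui W \<Longrightarrow> W = Ui"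
    by blast
  define G where "G = {U \<in> F. U \<inter> L = Ui}"
  have i2: "(\<lambda>U. U <+>\<^bsub>M\<^esub> L) ` G \<subseteq> interval L Z"
  proof (rule image_subsetI)
    fix U assume "U \<in> G"
    hence "U \<in> F" by (simp add: G_def)
    thus "U <+>\<^bsub>M\<^esub> L \<in> interval L Z"
      unfolding interval_def
      using submodule_set_add[OF FD(1) L] set_add_upper(2)[OF FD(1) L]
        set_add_least[OF Z FD(3) LZ] by simp
  qed
  obtain U1 where "U1 \<in> G" using Ui by (auto simp: G_def)
  hence "U1 <+>\<^bsub>M\<^esub> L \<in> (\<lambda>U. U <+>\<^bsub>M\<^esub> L) ` G" by blast
  from extremal_conditionD[OF 2 i2 this]
  obtain Us where Us: "Us \<in> (\<lambda>U. U <+>\<^bsub>M\<^esub> L) ` G"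
      "\<And>W. W \<in> (\<lambda>U. U <+>\<^bsub>M\<^esub> L) ` G \<Longrightarrow> rel Us W \<Longrightarrow> W = Us"
    by blast
  then obtain U where U: "U \<in> G" "Us = U <+>\<^bsub>M\<^esub> L" by blast
  have "V = U" if V: "V \<in> F" "rel U V" for V
  proof -
    have "rel (U \<inter> L) (V \<inter> L)" using V rel by auto
    hence VX: "V \<inter> L = Ui" using Ui(2)[of "V \<inter> L"] V U by (auto simp: G_def)
    have "rel (U <+>\<^bsub>M\<^esub> L) (V <+>\<^bsub>M\<^esub> L)"
      using V rel set_add_mono[of U V L L] set_add_mono[of V U L L] by auto
    hence VY: "V <+>\<^bsub>M\<^esub> L = U <+>\<^bsub>M\<^esub> L" using Us(2)[of "V <+>\<^bsub>M\<^esub> L"] V U VX by (auto simp: G_def)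
    have UV: "submodule U R M" "submodule V R M" using U V FD by (auto simp: G_def)
    have sU: "U \<subseteq> U <+>\<^bsub>M\<^esub> L" "V \<subseteq> V <+>\<^bsub>M\<^esub> L" using set_add_upper UV L by auto
    have i: "V \<inter> L \<subseteq> U" "U \<inter> L \<subseteq> V" using VX U by (auto simp: G_def)
    have a: "V \<subseteq> U <+>\<^bsub>M\<^esub> L" "U \<subseteq> V <+>\<^bsub>M\<^esub> L" using VY sU by auto
    from rel V(2) have "U \<subseteq> V \<or> V \<subseteq> U" by auto
    thus ?thesis
      using submodule_eq_by_modularity[OF UV L _ i(1) a(1)]
        submodule_eq_by_modularity[OF UV(2,1) L _ i(2) a(2)] by blast
  qed
  thus "\<exists>U\<in>F. \<forall>V\<in>F. rel U V \<longrightarrow> V = U" using U by (auto simp: G_def)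
qed

lemma interval_condition_trivial: "extremal_condition rel (interval B B)"
proof -
  have eq: "U = B" if "U \<in> interval B B" for U using that by (auto simp: interval_def)
  show ?thesis
    unfolding extremal_condition_def
  proof (intro allI impI)
    fix F assume F: "F \<subseteq> interval B B" "F \<noteq> {}"
    then obtain U where "U \<in> F" by blast
    thus "\<exists>U\<in>F. \<forall>V\<in>F. rel U V \<longrightarrow> V = U" using eq F(1) by (intro bexI[of _ U]) auto
  qed
qed

end

section \<open>Prime ideals and noetherian modules\<close>

lemma (in noetherian_ring) ideals_noetherian: "extremal_condition (\<subseteq>) {I. ideal I R}"
  unfolding extremal_condition_def
proof (intro allI impI)
  fix F assume F: "F \<subseteq> {I. ideal I R}" "F \<noteq> {}"
  have "\<exists>U\<in>F. \<forall>V\<in>F. U \<subseteq> V \<longrightarrow> V = U"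
  proof (rule subset_Zorn_nonempty[OF F(2)])
    fix C assume C: "C \<noteq> {}" "subset.chain F C"
    hence "C \<subseteq> F" "subset.chain {I. ideal I R} C" using F by (auto simp: subset_chain_def)
    thus "\<Union>C \<in> F" using ideal_chain_is_trivial[OF C(1)] by blast
  qed
  thus "\<exists>U\<in>F. \<forall>V\<in>F. U \<subseteq> V \<longrightarrow> V = U" .
qed

lemma (in cring) primeideal_pow_mem:
  assumes "primeideal P R" "a \<in> carrier R" "a [^] (n::nat) \<in> P"
  shows "a \<in> P"
  using assms(3)
proof (induct n)
  case 0
  interpret P: primeideal P R by fact
  show ?case using 0 P.one_imp_carrier P.I_notcarr by simp
next
  case (Suc n)
  interpret P: primeideal P R by fact
  show ?case using Suc P.I_prime[of "a [^] n" a] assms(2) by auto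
qed

lemma (in cring) primeideal_compl_mult:
  assumes "primeideal P R" "a \<in> carrier R - P" "b \<in> carrier R - P"
  shows "a \<otimes> b \<in> carrier R - P"
  using primeideal.I_prime[OF assms(1), of a b] assms by auto

lemma (in cring) primeideal_one_compl: "primeideal P R \<Longrightarrow> \<one> \<in> carrier R - P"
  using ideal.one_imp_carrier[OF primeideal.axioms(1), of P R] primeideal.I_notcarr[of P R] by auto

lemma (in cring) ideal_minus_closed:
  assumes "ideal I R" "x \<in> I" "y \<in> I"
  shows "x \<ominus> y \<in> I"
proof -
  interpret ideal I R by fact
  show ?thesis using assms(2,3) by (simp add: minus_eq)
qed

text \<open>The submodule \<open>\<aa>Z\<close>. Sums of products suffice, since scalars can be absorbed into the ideal.\<close>

inductive_set ideal_multiples ::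
    "('a, 'c, 'm) module_scheme \<Rightarrow> 'a set \<Rightarrow> 'c set \<Rightarrow> 'c set"
  for M (structure) and \<aa> :: "'a set" and Z :: "'c set" where
  prod: "a \<in> \<aa> \<Longrightarrow> z \<in> Z \<Longrightarrow> a \<odot>\<^bsub>M\<^esub> z \<in> ideal_multiples M \<aa> Z"
| sum: "x \<in> ideal_multiples M \<aa> Z \<Longrightarrow> y \<in> ideal_multiples M \<aa> Z \<Longrightarrow>
    x \<oplus>\<^bsub>M\<^esub> y \<in> ideal_multiples M \<aa> Z"

context module
begin

lemma ideal_multiples_least:
  assumes V: "submodule V R M" and m: "\<And>a z. a \<in> \<aa> \<Longrightarrow> z \<in> Z \<Longrightarrow> a \<odot>\<^bsub>M\<^esub> z \<in> V"
  shows "ideal_multiples M \<aa> Z \<subseteq> V"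
proof
  fix x assume "x \<in> ideal_multiples M \<aa> Z"
  thus "x \<in> V" by induct (use m submodule_closed[OF V] in auto)
qed

lemma submodule_ideal_multiples:
  assumes "ideal \<aa> R" and Z: "submodule Z R M"
  shows "submodule (ideal_multiples M \<aa> Z) R M"
proof (rule submoduleI')
  interpret \<aa>: ideal \<aa> R by fact
  note c = submodule_closed[OF Z]
  show 1: "ideal_multiples M \<aa> Z \<subseteq> carrier M"
    by (rule ideal_multiples_least[OF carrier_is_submodule]) (use c in auto)
  show "\<zero>\<^bsub>M\<^esub> \<in> ideal_multiples M \<aa> Z"
    using ideal_multiples.prod[of \<zero> \<aa> "\<zero>\<^bsub>M\<^esub>" Z M] c by simp
  fix r x assume r: "r \<in> carrier R" and "x \<in> ideal_multiples M \<aa> Z"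
  from this(2) show "r \<odot>\<^bsub>M\<^esub> x \<in> ideal_multiples M \<aa> Z"
  proof induct
    case (prod a z)
    have "r \<odot>\<^bsub>M\<^esub> (a \<odot>\<^bsub>M\<^esub> z) = (r \<otimes> a) \<odot>\<^bsub>M\<^esub> z" using prod r c by (auto simp: smult_assoc1)
    thus ?case using ideal_multiples.prod[of "r \<otimes> a" \<aa> z Z M] prod r \<aa>.I_l_closed by simp
  next
    case (sum x y)
    have "x \<in> carrier M" "y \<in> carrier M" using sum 1 by auto
    thus ?case using sum r by (simp add: smult_r_distr ideal_multiples.sum)
  qed
qed (rule ideal_multiples.sum)

lemma submodule_saturation:
  assumes P: "primeideal P R" and V: "submodule V R M"
  shows "submodule {x \<in> carrier M. \<exists>s\<in>carrier R - P. s \<odot>\<^bsub>M\<^esub> x \<in> V} R M"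
proof (rule submoduleI')
  note c = submodule_closed[OF V]
  show "\<zero>\<^bsub>M\<^esub> \<in> {x \<in> carrier M. \<exists>s\<in>carrier R - P. s \<odot>\<^bsub>M\<^esub> x \<in> V}"
    using R.primeideal_one_compl[OF P] c by (auto intro!: bexI[of _ \<one>])
next
  note c = submodule_closed[OF V]
  fix x y assume "x \<in> {x \<in> carrier M. \<exists>s\<in>carrier R - P. s \<odot>\<^bsub>M\<^esub> x \<in> V}"
    "y \<in> {x \<in> carrier M. \<exists>s\<in>carrier R - P. s \<odot>\<^bsub>M\<^esub> x \<in> V}"
  then obtain s t where *: "x \<in> carrier M" "y \<in> carrier M" "s \<in> carrier R - P" "t \<in> carrier R - P"
    "s \<odot>\<^bsub>M\<^esub> x \<in> V" "t \<odot>\<^bsub>M\<^esub> y \<in> V" by auto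
  hence st: "s \<in> carrier R" "t \<in> carrier R" by auto
  have "(s \<otimes> t) \<odot>\<^bsub>M\<^esub> (x \<oplus>\<^bsub>M\<^esub> y) = (t \<odot>\<^bsub>M\<^esub> (s \<odot>\<^bsub>M\<^esub> x)) \<oplus>\<^bsub>M\<^esub> (s \<odot>\<^bsub>M\<^esub> (t \<odot>\<^bsub>M\<^esub> y))"
    using *(1,2) st by algebra
  also have "\<dots> \<in> V" by (intro c(4) c(7) * st)
  finally show "x \<oplus>\<^bsub>M\<^esub> y \<in> {x \<in> carrier M. \<exists>s\<in>carrier R - P. s \<odot>\<^bsub>M\<^esub> x \<in> V}"
    using R.primeideal_compl_mult[OF P *(3,4)] * by auto
next
  note c = submodule_closed[OF V]
  fix a x assume a: "a \<in> carrier R" "x \<in> {x \<in> carrier M. \<exists>s\<in>carrier R - P. s \<odot>\<^bsub>M\<^esub> x \<in> V}"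
  then obtain s where *: "x \<in> carrier M" "s \<in> carrier R - P" "s \<odot>\<^bsub>M\<^esub> x \<in> V" by auto
  hence "s \<odot>\<^bsub>M\<^esub> (a \<odot>\<^bsub>M\<^esub> x) = a \<odot>\<^bsub>M\<^esub> (s \<odot>\<^bsub>M\<^esub> x)" using a by (intro smult_lcomm) auto
  thus "a \<odot>\<^bsub>M\<^esub> x \<in> {x \<in> carrier M. \<exists>s\<in>carrier R - P. s \<odot>\<^bsub>M\<^esub> x \<in> V}"
    using *(1,2) c(7)[OF a(1) *(3)] a(1) by (auto intro!: bexI[of _ s])
qed auto

end

locale noetherian_base_module = module R M + R?: noetherian_ring R
  for R (structure) and M (structure)
begin

text \<open>An annihilator that is maximal among the annihilators of nonzero multiples of \<open>z\<close> in \<open>M/V\<close> is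
  prime.\<close>

lemma prime_conductor:
  assumes V: "submodule V R M" and z: "z \<in> carrier M" "z \<notin> V"
  obtains c where "c \<in> carrier R" "c \<odot>\<^bsub>M\<^esub> z \<notin> V"
    "primeideal {a \<in> carrier R. a \<odot>\<^bsub>M\<^esub> (c \<odot>\<^bsub>M\<^esub> z) \<in> V} R"
proof -
  define A where "A c = {a \<in> carrier R. a \<odot>\<^bsub>M\<^esub> (c \<odot>\<^bsub>M\<^esub> z) \<in> V}" for c
  define F where "F = A ` {c \<in> carrier R. c \<odot>\<^bsub>M\<^esub> z \<notin> V}"
  have "F \<subseteq> {I. ideal I R}" using conductor_ideal[OF V] z by (auto simp: F_def A_def)
  moreover have "A \<one> \<in> F" using z by (auto simp: F_def)
  ultimately have "\<exists>I\<in>F. \<forall>K\<in>F. I \<subseteq> K \<longrightarrow> K = I" by (rule extremal_conditionD[OF ideals_noetherian])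
  then obtain I where I: "I \<in> F" "\<forall>K\<in>F. I \<subseteq> K \<longrightarrow> K = I" by (rule bexE)
  then obtain c where c: "c \<in> carrier R" "c \<odot>\<^bsub>M\<^esub> z \<notin> V" "I = A c" by (auto simp: F_def)
  have "primeideal (A c) R"
  proof (rule primeidealI)
    show "ideal (A c) R" using conductor_ideal[OF V] z c by (auto simp: A_def)
    show "cring R" by (rule R.is_cring)
    show "carrier R \<noteq> A c"
    proof
      assume "carrier R = A c"
      hence "\<one> \<in> A c" by auto
      thus False using c z by (auto simp: A_def)
    qed
    fix a b assume ab: "a \<in> carrier R" "b \<in> carrier R" "a \<otimes> b \<in> A c"
    show "a \<in> A c \<or> b \<in> A c"
    proof (rule disjCI)
      assume b: "b \<notin> A c"
      have bc: "(b \<otimes> c) \<odot>\<^bsub>M\<^esub> z = b \<odot>\<^bsub>M\<^esub> (c \<odot>\<^bsub>M\<^esub> z)" using ab c z by (simp add: smult_assoc1)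
      hence "A (b \<otimes> c) \<in> F" using b ab c unfolding F_def by (intro imageI) (auto simp: A_def)
      moreover have "A c \<subseteq> A (b \<otimes> c)"
        using bc ab c z submodule_closed(7)[OF V ab(2)] by (auto simp: A_def smult_lcomm[of _ b])
      ultimately have "A (b \<otimes> c) = A c" using I c by blast
      moreover have "a \<in> A (b \<otimes> c)" using ab bc c z by (auto simp: A_def smult_assoc1)
      ultimately show "a \<in> A c" by simp
    qed
  qed
  thus thesis using that c by (auto simp: A_def)
qed

text \<open>Nakayama's lemma after localisation at \<open>P\<close>, with explicit denominators. Let \<open>U\<close> be maximal among
  the submodules that do not become equal to \<open>Z\<close>, witnessed by \<open>a\<close>. Then \<open>U + Ra\<close> becomes equal to
  \<open>Z\<close>, hence \<open>a\<close> lies in \<open>U + Pa\<close> after localisation, and so in \<open>U\<close>.\<close>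

lemma local_nakayama:
  assumes P: "primeideal P R" and W: "submodule W R M" and Z: "submodule Z R M" and WZ: "W \<subseteq> Z"
    and noeth: "noetherian_interval W Z"
    and gen: "\<And>z. z \<in> Z \<Longrightarrow> \<exists>s\<in>carrier R - P. s \<odot>\<^bsub>M\<^esub> z \<in> W <+>\<^bsub>M\<^esub> ideal_multiples M P Z"
    and z: "z \<in> Z"
  shows "\<exists>s\<in>carrier R - P. s \<odot>\<^bsub>M\<^esub> z \<in> W"
proof (rule ccontr)
  assume no: "\<not> (\<exists>s\<in>carrier R - P. s \<odot>\<^bsub>M\<^esub> z \<in> W)"
  interpret P: primeideal P R by fact
  define F where "F = {U \<in> interval W Z. \<exists>a\<in>Z. \<forall>s\<in>carrier R - P. s \<odot>\<^bsub>M\<^esub> a \<notin> U}"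
  have "F \<subseteq> interval W Z" "W \<in> F" using no W WZ z by (auto simp: F_def interval_def)
  hence "\<exists>U\<in>F. \<forall>V\<in>F. U \<subseteq> V \<longrightarrow> V = U" by (rule extremal_conditionD[OF noeth])
  then obtain U where U: "U \<in> F" "\<forall>V\<in>F. U \<subseteq> V \<longrightarrow> V = U" by (rule bexE)
  then obtain a where a: "a \<in> Z" "\<And>s. s \<in> carrier R - P \<Longrightarrow> s \<odot>\<^bsub>M\<^esub> a \<notin> U" by (auto simp: F_def)
  have sU: "submodule U R M" and WU: "W \<subseteq> U" "U \<subseteq> Z" using U by (auto simp: F_def interval_def)
  note cU = submodule_closed[OF sU] and cZ = submodule_closed[OF Z]
  have ac: "a \<in> carrier M" using a cZ by auto
  let ?C = "(\<lambda>b. b \<odot>\<^bsub>M\<^esub> a) ` carrier R"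
  let ?V = "U <+>\<^bsub>M\<^esub> ?C"
  have C: "submodule ?C R M" by (rule submodule_cyclic[OF ac])
  have "?V \<in> interval W Z"
    using submodule_set_add[OF sU C] set_add_upper[OF sU C] WU set_add_least[OF Z WU(2), of ?C] cZ(7)[OF _ a(1)]
    unfolding interval_def by blast
  moreover have "?V \<noteq> U"
    using set_add_upper(2)[OF sU C] mem_cyclic[OF ac] a(2)[OF R.primeideal_one_compl[OF P]] ac by auto
  ultimately have "?V \<notin> F" using U(2) set_add_upper(1)[OF sU C] by blast
  hence V: "\<exists>s\<in>carrier R - P. s \<odot>\<^bsub>M\<^esub> z \<in> ?V" if "z \<in> Z" for z
    using that \<open>?V \<in> interval W Z\<close> by (auto simp: F_def)
  have key: "\<exists>s\<in>carrier R - P. \<exists>u\<in>U. \<exists>c\<in>P. s \<odot>\<^bsub>M\<^esub> y = u \<oplus>\<^bsub>M\<^esub> c \<odot>\<^bsub>M\<^esub> a"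
    if "y \<in> ideal_multiples M P Z" for y using that
  proof induct
    case (prod p z)
    obtain s u c where *: "s \<in> carrier R - P" "u \<in> U" "c \<in> carrier R" "s \<odot>\<^bsub>M\<^esub> z = u \<oplus>\<^bsub>M\<^esub> c \<odot>\<^bsub>M\<^esub> a"
      using V[OF prod(2)] by (auto elim!: set_addE)
    have pc: "p \<in> carrier R" "z \<in> carrier M" "s \<in> carrier R" "u \<in> carrier M"
      using prod * cZ cU by auto
    have "s \<odot>\<^bsub>M\<^esub> (p \<odot>\<^bsub>M\<^esub> z) = p \<odot>\<^bsub>M\<^esub> (s \<odot>\<^bsub>M\<^esub> z)" using pc by (intro smult_lcomm) auto
    also have "\<dots> = (p \<odot>\<^bsub>M\<^esub> u) \<oplus>\<^bsub>M\<^esub> (p \<otimes> c) \<odot>\<^bsub>M\<^esub> a" unfolding *(4) using pc *(3) ac by algebra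
    finally show ?case
      using *(1) cU(7)[OF pc(1) *(2)] P.I_r_closed[OF prod(1) *(3)] by blast
  next
    case (sum x y)
    obtain s u c where *: "s \<in> carrier R - P" "u \<in> U" "c \<in> P" "s \<odot>\<^bsub>M\<^esub> x = u \<oplus>\<^bsub>M\<^esub> c \<odot>\<^bsub>M\<^esub> a"
      using sum by blast
    obtain t v d where **: "t \<in> carrier R - P" "v \<in> U" "d \<in> P" "t \<odot>\<^bsub>M\<^esub> y = v \<oplus>\<^bsub>M\<^esub> d \<odot>\<^bsub>M\<^esub> a"
      using sum by blast
    have carr: "s \<in> carrier R" "t \<in> carrier R" "c \<in> carrier R" "d \<in> carrier R" "u \<in> carrier M"
      "v \<in> carrier M" "x \<in> carrier M" "y \<in> carrier M"
      using * ** cU submodule_closed(2)[OF submodule_ideal_multiples[OF P.ideal_axioms Z]] sum by auto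
    have "(s \<otimes> t) \<odot>\<^bsub>M\<^esub> (x \<oplus>\<^bsub>M\<^esub> y) = t \<odot>\<^bsub>M\<^esub> (s \<odot>\<^bsub>M\<^esub> x) \<oplus>\<^bsub>M\<^esub> s \<odot>\<^bsub>M\<^esub> (t \<odot>\<^bsub>M\<^esub> y)"
      using carr by algebra
    also have "\<dots> = (t \<odot>\<^bsub>M\<^esub> u \<oplus>\<^bsub>M\<^esub> s \<odot>\<^bsub>M\<^esub> v) \<oplus>\<^bsub>M\<^esub> (t \<otimes> c \<oplus> s \<otimes> d) \<odot>\<^bsub>M\<^esub> a"
      unfolding *(4) **(4) using carr ac by algebra
    finally show ?case
      using R.primeideal_compl_mult[OF P *(1) **(1)] cU(4)[OF cU(7)[OF carr(2) *(2)] cU(7)[OF carr(1) **(2)]]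
        P.a_closed[OF P.I_l_closed[OF *(3) carr(2)] P.I_l_closed[OF **(3) carr(1)]] by blast
  qed
  obtain s w y where *: "s \<in> carrier R - P" "w \<in> W" "y \<in> ideal_multiples M P Z" "s \<odot>\<^bsub>M\<^esub> a = w \<oplus>\<^bsub>M\<^esub> y"
    using gen[OF a(1)] by (auto elim!: set_addE)
  obtain t u c where **: "t \<in> carrier R - P" "u \<in> U" "c \<in> P" "t \<odot>\<^bsub>M\<^esub> y = u \<oplus>\<^bsub>M\<^esub> c \<odot>\<^bsub>M\<^esub> a"
    using key[OF *(3)] by blast
  have carr: "s \<in> carrier R" "t \<in> carrier R" "c \<in> carrier R" "u \<in> carrier M" "w \<in> carrier M" "y \<in> carrier M"
    using * ** cU WU submodule_closed(2)[OF submodule_ideal_multiples[OF P.ideal_axioms Z]] by auto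
  have "(t \<otimes> s \<ominus> c) \<odot>\<^bsub>M\<^esub> a = t \<odot>\<^bsub>M\<^esub> (s \<odot>\<^bsub>M\<^esub> a) \<ominus>\<^bsub>M\<^esub> c \<odot>\<^bsub>M\<^esub> a" using carr ac by algebra
  also have "\<dots> = t \<odot>\<^bsub>M\<^esub> w \<oplus>\<^bsub>M\<^esub> t \<odot>\<^bsub>M\<^esub> y \<ominus>\<^bsub>M\<^esub> c \<odot>\<^bsub>M\<^esub> a" unfolding *(4) using carr ac by algebra
  also have "\<dots> = t \<odot>\<^bsub>M\<^esub> w \<oplus>\<^bsub>M\<^esub> u" unfolding **(4) using carr ac by algebra
  also have "\<dots> \<in> U" using * ** cU WU carr by auto
  finally have "(t \<otimes> s \<ominus> c) \<odot>\<^bsub>M\<^esub> a \<in> U" .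
  moreover have "t \<otimes> s \<ominus> c \<notin> P"
  proof
    assume "t \<otimes> s \<ominus> c \<in> P"
    hence "(t \<otimes> s \<ominus> c) \<oplus> c \<in> P" using ** by (intro P.a_closed)
    moreover have "(t \<otimes> s \<ominus> c) \<oplus> c = t \<otimes> s" using carr by algebra
    ultimately show False using R.primeideal_compl_mult[OF P **(1) *(1)] by auto
  qed
  ultimately show False using a(2)[of "t \<otimes> s \<ominus> c"] carr by auto
qed

end

section \<open>Krull's principal ideal theorem for chains of primes\<close>

locale noetherian_cring = cring R + noetherian_ring R for R (structure)

lemma set_add_regular [simp]: "U <+>\<^bsub>regular_module R\<^esub> V = U <+>\<^bsub>R\<^esub> V"
  by (simp add: set_add_def')

context noetherian_cring
begin

lemma regular_noetherian_base_module: "noetherian_base_module R (regular_module R)"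
  by (intro noetherian_base_module.intro module_regular is_cring noetherian_ring_axioms)

lemma submodule_regular_iff: "submodule V R (regular_module R) \<longleftrightarrow> ideal V R"
proof
  interpret N: noetherian_base_module R "regular_module R" by (rule regular_noetherian_base_module)
  show "ideal V R" if V: "submodule V R (regular_module R)"
  proof -
    have "{a \<in> carrier R. a \<odot>\<^bsub>regular_module R\<^esub> \<one> \<in> V} = V"
      using N.submodule_closed(1)[OF V] by auto
    thus ?thesis using N.conductor_ideal[OF V, of \<one>] by simp
  qed
  show "submodule V R (regular_module R)" if "ideal V R"
  proof -
    interpret ideal V R by fact
    show ?thesis by (rule N.submoduleI') (auto intro: I_l_closed)
  qed
qed

lemma regular_noetherian_interval:
  "module.noetherian_interval R (regular_module R) B Z"
proof -
  interpret N: noetherian_base_module R "regular_module R" by (rule regular_noetherian_base_module)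
  show ?thesis
    by (rule extremal_condition_mono[OF ideals_noetherian])
      (auto simp: N.interval_def submodule_regular_iff)
qed

lemma submodule_add_ideals:
  assumes "ideal I R" "ideal J R"
  shows "I \<subseteq> I <+>\<^bsub>R\<^esub> J" "J \<subseteq> I <+>\<^bsub>R\<^esub> J" "ideal (I <+>\<^bsub>R\<^esub> J) R"
proof -
  interpret N: noetherian_base_module R "regular_module R" by (rule regular_noetherian_base_module)
  show "I \<subseteq> I <+>\<^bsub>R\<^esub> J" "J \<subseteq> I <+>\<^bsub>R\<^esub> J"
    using N.set_add_upper[of I J] assms by (simp_all add: submodule_regular_iff)
  show "ideal (I <+>\<^bsub>R\<^esub> J) R" by (rule add_ideals[OF assms])
qed

text \<open>After localisation at a minimal prime \<open>P\<close> over \<open>J\<close>, the ring \<open>R/J\<close> is artinian, hence descending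
  chains of ideals become stationary. The ideal \<open>U\<close> is maximal such that the chain \<open>L t \<inter> U\<close> is stationary modulo
  \<open>J\<close>. If \<open>U\<close> were proper after localisation, an element \<open>c\<close> with \<open>Pc \<subseteq> U\<close> could be adjoined: the
  step from \<open>U\<close> to \<open>U + Rc\<close> is one-dimensional over the residue field of \<open>P\<close>.\<close>

lemma descending_chain_modulo_minimal_prime:
  fixes L :: "nat \<Rightarrow> 'a set"
  assumes P: "primeideal P R" and J: "ideal J R"
    and min: "\<And>Q. primeideal Q R \<Longrightarrow> J \<subseteq> Q \<Longrightarrow> Q \<subseteq> P \<Longrightarrow> Q = P"
    and L: "\<And>t. ideal (L t) R" and dec: "\<And>t. L (Suc t) \<subseteq> L t"
  shows "\<exists>t. \<forall>a\<in>L t. \<exists>s\<in>carrier R - P. s \<otimes> a \<in> L (Suc t) <+>\<^bsub>R\<^esub> J"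
proof -
  let ?N = "regular_module R"
  interpret N: noetherian_base_module R ?N by (rule regular_noetherian_base_module)
  interpret P: primeideal P R by fact
  interpret J: ideal J R by fact
  have dec': "L u \<subseteq> L t" if "t \<le> u" for t u
    using that by (induct u rule: dec_induct) (use dec in blast)+
  define LJ where "LJ t = L t <+>\<^bsub>R\<^esub> J" for t
  have LJ: "ideal (LJ t) R" "L t \<subseteq> LJ t" "J \<subseteq> LJ t" for t
    using submodule_add_ideals[OF L[of t] J] by (auto simp: LJ_def)
  define E where "E U \<longleftrightarrow> (\<exists>t0. \<forall>t\<ge>t0. \<forall>a\<in>L t \<inter> U. \<exists>s\<in>carrier R - P. s \<otimes> a \<in> LJ (Suc t))" for U
  have one: "\<one> \<in> carrier R - P" by (rule primeideal_one_compl[OF P])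
  have EJ: "E J"
    unfolding E_def using LJ(3) J.Icarr one by (intro exI[of _ 0] allI impI ballI bexI[of _ \<one>]) auto
  define F where "F = {U. ideal U R \<and> J \<subseteq> U \<and> E U}"
  have "F \<subseteq> {I. ideal I R}" "J \<in> F" using EJ J by (auto simp: F_def)
  hence "\<exists>U\<in>F. \<forall>V\<in>F. U \<subseteq> V \<longrightarrow> V = U" by (rule extremal_conditionD[OF ideals_noetherian])
  then obtain U where U: "U \<in> F" "\<forall>V\<in>F. U \<subseteq> V \<longrightarrow> V = U" by (rule bexE)
  have iU: "ideal U R" and JU: "J \<subseteq> U" and EU: "E U" using U by (auto simp: F_def)
  interpret U: ideal U R by (rule iU)
  obtain t0 where t0: "\<And>t a. t0 \<le> t \<Longrightarrow> a \<in> L t \<Longrightarrow> a \<in> U \<Longrightarrow> \<exists>s\<in>carrier R - P. s \<otimes> a \<in> LJ (Suc t)"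
    using EU unfolding E_def by blast
  define S where "S = {x \<in> carrier R. \<exists>s\<in>carrier R - P. s \<otimes> x \<in> U}"
  have S: "ideal S R"
    using N.submodule_saturation[OF P, of U] iU by (simp add: submodule_regular_iff S_def)
  interpret S: ideal S R by (rule S)
  have US: "U \<subseteq> S" unfolding S_def using U.Icarr one by (auto intro!: bexI[of _ \<one>])
  have "\<one> \<in> S"
  proof (rule ccontr)
    assume "\<one> \<notin> S"
    then obtain c where c: "c \<in> carrier R" "c \<notin> S" "primeideal {a \<in> carrier R. a \<otimes> c \<in> S} R"
      using N.prime_conductor[of S \<one>] S by (auto simp: submodule_regular_iff)
    let ?Q = "{a \<in> carrier R. a \<otimes> c \<in> S}"
    have "J \<subseteq> ?Q"
    proof
      fix a assume "a \<in> J"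
      hence "a \<in> carrier R" "a \<in> S" using J.Icarr JU US by auto
      thus "a \<in> ?Q" using S.I_r_closed[of a c] c(1) by simp
    qed
    moreover have "?Q \<subseteq> P"
    proof
      fix a assume a: "a \<in> ?Q"
      show "a \<in> P"
      proof (rule ccontr)
        assume aP: "a \<notin> P"
        have ac: "a \<in> carrier R" "a \<otimes> c \<in> S" using a by simp_all
        then obtain s where s: "s \<in> carrier R - P" "s \<otimes> (a \<otimes> c) \<in> U" unfolding S_def by blast
        have "(s \<otimes> a) \<otimes> c \<in> U" using s ac(1) c(1) by (simp add: m_assoc)
        moreover have "s \<otimes> a \<in> carrier R - P" using primeideal_compl_mult[OF P s(1)] ac(1) aP by blast
        ultimately show False using c(1,2) unfolding S_def by blast
      qed
    qed
    ultimately have Q: "?Q = P" using min[OF c(3)] by blast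
    let ?C = "(\<lambda>b. b \<otimes> c) ` carrier R"
    have C: "ideal ?C R" using N.submodule_cyclic[of c] c by (simp add: submodule_regular_iff)
    let ?V = "U <+>\<^bsub>R\<^esub> ?C"
    note V = submodule_add_ideals[OF iU C]
    have "?V \<noteq> U" using V(2) N.mem_cyclic[of c] c US by auto
    hence "\<not> E ?V" using U(2) V(1,3) JU unfolding F_def by blast
    moreover have "E ?V"
    \<comment> \<open>If some \<open>L t \<inter> ?V\<close> lies in \<open>S\<close>, then the stationarity on \<open>U\<close> suffices. Otherwise each \<open>L (Suc t)\<close>
      contains \<open>b = u + ec\<close> with \<open>e\<close> outside \<open>P\<close>, and a multiple of \<open>b\<close> moves \<open>ea\<close> into \<open>U\<close>.\<close>
    proof (cases "\<exists>t1. \<forall>b\<in>L t1 \<inter> ?V. b \<in> S")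
      case True
      then obtain t1 where t1: "\<And>b. b \<in> L t1 \<Longrightarrow> b \<in> ?V \<Longrightarrow> b \<in> S" by blast
      show ?thesis
        unfolding E_def
      proof (intro exI[of _ "max t0 t1"] allI impI ballI)
        fix t a assume t: "max t0 t1 \<le> t" and a: "a \<in> L t \<inter> ?V"
        interpret Lt: ideal "L t" R by (rule L)
        have "a \<in> S" using t1 a dec'[of t1 t] t by auto
        then obtain s where s: "s \<in> carrier R - P" "s \<otimes> a \<in> U" unfolding S_def by blast
        moreover have "s \<otimes> a \<in> L t" using a s Lt.I_l_closed by auto
        ultimately obtain s' where s': "s' \<in> carrier R - P" "s' \<otimes> (s \<otimes> a) \<in> LJ (Suc t)"
          using t0[of t] t by auto
        have "(s' \<otimes> s) \<otimes> a \<in> LJ (Suc t)" using s s' a Lt.Icarr by (simp add: m_assoc)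
        thus "\<exists>s\<in>carrier R - P. s \<otimes> a \<in> LJ (Suc t)"
          using primeideal_compl_mult[OF P s'(1) s(1)] by blast
      qed
    next
      case False
      show ?thesis
        unfolding E_def
      proof (intro exI[of _ t0] allI impI ballI)
        fix t a assume t: "t0 \<le> t" and a: "a \<in> L t \<inter> ?V"
        interpret Lt: ideal "L t" R by (rule L)
        interpret LJt: ideal "LJ (Suc t)" R by (rule LJ)
        obtain b where b: "b \<in> L (Suc t)" "b \<in> ?V" "b \<notin> S" using False by blast
        have bc: "b \<in> L t" using b(1) dec by blast
        hence bc: "b \<in> L t" "b \<in> carrier R" using Lt.Icarr by simp_all
        obtain u e where ue: "u \<in> U" "e \<in> carrier R" "b = u \<oplus> e \<otimes> c"
          using b(2) by (auto simp: set_add_def')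
        obtain v f where vf: "v \<in> U" "f \<in> carrier R" "a = v \<oplus> f \<otimes> c"
          using a by (auto simp: set_add_def')
        have carr: "u \<in> carrier R" "v \<in> carrier R" using ue vf by auto
        have eP: "e \<in> carrier R - P"
        proof -
          have "e \<notin> ?Q" using b(3) ue US S.a_closed by auto
          thus ?thesis using Q ue by auto
        qed
        have "e \<otimes> a \<ominus> f \<otimes> b = e \<otimes> v \<ominus> f \<otimes> u"
          unfolding ue(3) vf(3) using carr ue(2) vf(2) c(1) by algebra
        hence 1: "e \<otimes> a \<ominus> f \<otimes> b \<in> U"
          using ideal_minus_closed[OF iU] U.I_l_closed ue vf by simp
        have "e \<otimes> a \<ominus> f \<otimes> b \<in> L t"
          using ideal_minus_closed[OF L] Lt.I_l_closed ue vf a bc by simp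
        then obtain s where s: "s \<in> carrier R - P" "s \<otimes> (e \<otimes> a \<ominus> f \<otimes> b) \<in> LJ (Suc t)"
          using t0[OF t _ 1] by blast
        have "s \<otimes> (f \<otimes> b) \<in> LJ (Suc t)"
        proof -
          have "b \<in> LJ (Suc t)" using LJ(2) b(1) by blast
          thus ?thesis using LJt.I_l_closed s vf(2) by simp
        qed
        hence "s \<otimes> (e \<otimes> a \<ominus> f \<otimes> b) \<oplus> s \<otimes> (f \<otimes> b) \<in> LJ (Suc t)" using s by (intro LJt.a_closed)
        moreover have "s \<otimes> (e \<otimes> a \<ominus> f \<otimes> b) \<oplus> s \<otimes> (f \<otimes> b) = (s \<otimes> e) \<otimes> a"
        proof -
          have "a \<in> carrier R" "s \<in> carrier R" using a s Lt.Icarr by auto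
          thus ?thesis using bc ue(2) vf(2) by algebra
        qed
        ultimately show "\<exists>s\<in>carrier R - P. s \<otimes> a \<in> LJ (Suc t)"
          using primeideal_compl_mult[OF P s(1) eP] by auto
      qed
    qed
    ultimately show False by blast
  qed
  then obtain s where s: "s \<in> carrier R - P" "s \<otimes> \<one> \<in> U" unfolding S_def by blast
  hence s: "s \<in> carrier R - P" "s \<in> U" by simp_all
  have "\<exists>s\<in>carrier R - P. s \<otimes> a \<in> LJ (Suc t0)" if a: "a \<in> L t0" for a
  proof -
    interpret Lt: ideal "L t0" R by (rule L)
    have "s \<otimes> a \<in> L t0" "s \<otimes> a \<in> U" using a s Lt.I_l_closed U.I_r_closed Lt.Icarr by auto
    then obtain s' where s': "s' \<in> carrier R - P" "s' \<otimes> (s \<otimes> a) \<in> LJ (Suc t0)"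
      using t0[of t0] by auto
    have "(s' \<otimes> s) \<otimes> a \<in> LJ (Suc t0)" using s s' a Lt.Icarr by (simp add: m_assoc)
    thus ?thesis using primeideal_compl_mult[OF P s'(1) s(1)] by blast
  qed
  thus ?thesis unfolding LJ_def by blast
qed

text \<open>Krull's principal ideal theorem. In a local domain \<open>A\<close> whose maximal ideal is minimal over \<open>(r)\<close>,
  let \<open>x \<noteq> 0\<close> lie in a nonmaximal prime \<open>q\<close>. The ideals \<open>L t = A \<inter> x\<^sup>t A[1/r]\<close> become stationary
  modulo \<open>r\<close>, and \<open>L t \<inter> (r) = r L t\<close>, so they become stationary by Nakayama's lemma. Thus \<open>x\<close> is a
  unit in \<open>A[1/r]\<close>, which is absurd as \<open>q\<close> does not contain \<open>r\<close>. The quotient by \<open>p\<close> and the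
  localisation at \<open>P\<close> are made explicit.\<close>

lemma intermediate_prime_containing:
  assumes p: "primeideal p R" and q: "primeideal q R" and P: "primeideal P R"
    and pq: "p \<subset> q" and qP: "q \<subset> P" and r: "r \<in> P"
  shows "\<exists>Q. primeideal Q R \<and> p \<subset> Q \<and> Q \<subset> P \<and> r \<in> Q"
proof (cases "r \<in> q")
  case True thus ?thesis using q pq qP by blast
next
  case rq: False
  show ?thesis
  proof (rule ccontr)
    assume no: "\<not> ?thesis"
    let ?N = "regular_module R"
    interpret N: noetherian_base_module R ?N by (rule regular_noetherian_base_module)
    interpret p: primeideal p R by fact
    interpret q: primeideal q R by fact
    interpret P: primeideal P R by fact
    have rc: "r \<in> carrier R" using r P.Icarr by blast
    have rp: "r \<notin> p" using rq pq by blast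
    let ?C = "(\<lambda>b. b \<otimes> r) ` carrier R"
    have C: "ideal ?C R" using N.submodule_cyclic[of r] rc by (simp add: submodule_regular_iff)
    define J where "J = p <+>\<^bsub>R\<^esub> ?C"
    have J: "ideal J R" "p \<subseteq> J" "?C \<subseteq> J"
      using submodule_add_ideals[OF p.ideal_axioms C] by (auto simp: J_def)
    have rJ: "r \<in> J" using J(3) N.mem_cyclic[of r] rc by auto
    have min: "Q = P" if "primeideal Q R" "J \<subseteq> Q" "Q \<subseteq> P" for Q
      using no that J rJ rp by blast
    obtain x where x: "x \<in> q" "x \<notin> p" using pq by blast
    have xc: "x \<in> carrier R" using x by simp
    define K where "K t = {a \<in> carrier R. \<exists>c\<in>carrier R. \<exists>b\<in>p. a = x [^] t \<otimes> c \<oplus> b}" for t :: nat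
    have xt: "x [^] (t::nat) \<in> carrier R" for t using xc by simp
    have K: "ideal (K t) R" for t
    proof -
      have "ideal ((\<lambda>b. b \<otimes> x [^] t) ` carrier R <+>\<^bsub>R\<^esub> p) R"
        using N.submodule_cyclic[of "x [^] t"] xc p.ideal_axioms by (intro add_ideals) (simp_all add: submodule_regular_iff)
      moreover have "(\<lambda>b. b \<otimes> x [^] t) ` carrier R <+>\<^bsub>R\<^esub> p = K t"
        unfolding set_add_def' K_def using xt p.Icarr by (auto simp: m_comm) 
      ultimately show ?thesis by simp
    qed
    have Kdec: "K (Suc t) \<subseteq> K t" for t
    proof
      fix a assume "a \<in> K (Suc t)"
      then obtain c b where *: "a \<in> carrier R" "c \<in> carrier R" "b \<in> p" "a = x [^] Suc t \<otimes> c \<oplus> b"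
        by (auto simp: K_def)
      hence "a = x [^] t \<otimes> (x \<otimes> c) \<oplus> b" using xt xc by (simp add: m_assoc)
      moreover have "x \<otimes> c \<in> carrier R" using * xc by simp
      ultimately show "a \<in> K t" unfolding K_def using *(1,3) by blast
    qed
    define L where "L t = {a \<in> carrier R. \<exists>k::nat. r [^] k \<otimes> a \<in> K t}" for t
    have rk: "r [^] (k::nat) \<in> carrier R" for k using rc by simp
    have L: "ideal (L t) R" for t
    proof -
      interpret K: ideal "K t" R by (rule K)
      have up: "r [^] (k + l) \<otimes> a \<in> K t" if "r [^] k \<otimes> a \<in> K t" "a \<in> carrier R" for k l :: nat and a
      proof -
        have "r [^] (k + l) \<otimes> a = r [^] l \<otimes> (r [^] k \<otimes> a)"
          using rc rk that by (simp add: nat_pow_mult[symmetric] m_ac)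
        thus ?thesis using that K.I_l_closed[OF that(1) rk] by simp
      qed
      have "submodule (L t) R ?N"
      proof (rule N.submoduleI')
        show "\<zero>\<^bsub>?N\<^esub> \<in> L t" using rk by (auto simp: L_def K.additive_subgroup_axioms intro!: exI[of _ 0])
        fix a b assume ab: "a \<in> L t" "b \<in> L t"
        then obtain k l :: nat where kl: "r [^] k \<otimes> a \<in> K t" "r [^] l \<otimes> b \<in> K t"
          and c: "a \<in> carrier R" "b \<in> carrier R" unfolding L_def by blast
        have "r [^] (k + l) \<otimes> (a \<oplus> b) = r [^] (k + l) \<otimes> a \<oplus> r [^] (l + k) \<otimes> b"
          using c rk by (simp add: r_distr add.commute)
        hence "r [^] (k + l) \<otimes> (a \<oplus> b) \<in> K t" using up kl c by simp
        thus "a \<oplus>\<^bsub>?N\<^esub> b \<in> L t" using c unfolding L_def regular_module_simps by blast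
      next
        fix a b assume "a \<in> carrier R" "b \<in> L t"
        then obtain k :: nat where "r [^] k \<otimes> b \<in> K t" "b \<in> carrier R" "a \<in> carrier R" unfolding L_def by blast
        hence "r [^] k \<otimes> (a \<otimes> b) \<in> K t" using K.I_l_closed[of "r [^] k \<otimes> b" a] rk by (simp add: m_lcomm)
        thus "a \<odot>\<^bsub>?N\<^esub> b \<in> L t" using \<open>a \<in> carrier R\<close> \<open>b \<in> carrier R\<close> unfolding L_def regular_module_simps by blast
      qed (auto simp: L_def)
      thus ?thesis by (simp add: submodule_regular_iff)
    qed
    have Ldec: "L (Suc t) \<subseteq> L t" for t using Kdec unfolding L_def by blast
    have pL: "p \<subseteq> L t" for t
    proof
      fix b assume b: "b \<in> p"
      have "b = x [^] t \<otimes> \<zero> \<oplus> b" using b xt by simp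
      hence "b \<in> K t" unfolding K_def using b p.Icarr[OF b] zero_closed by blast
      thus "b \<in> L t" unfolding L_def using b by (auto intro!: exI[of _ 0])
    qed
    obtain t where t: "\<And>a. a \<in> L t \<Longrightarrow> \<exists>s\<in>carrier R - P. s \<otimes> a \<in> L (Suc t) <+>\<^bsub>R\<^esub> J"
      using descending_chain_modulo_minimal_prime[of P J L, OF P J(1) min L Ldec] by blast
    interpret L: ideal "L t" R by (rule L)
    interpret L': ideal "L (Suc t)" R by (rule L)
    \<comment> \<open>An element \<open>cr\<close> of \<open>L t\<close> has \<open>c\<close> in \<open>L t\<close>, so \<open>J\<close> may be replaced by \<open>P L t\<close>.\<close>
    have gen: "\<exists>s\<in>carrier R - P. s \<otimes> a \<in> L (Suc t) <+>\<^bsub>R\<^esub> ideal_multiples ?N P (L t)"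
      if a: "a \<in> L t" for a
    proof -
      obtain s b b' c where *: "s \<in> carrier R - P" "b \<in> L (Suc t)" "b' \<in> p" "c \<in> carrier R"
        "s \<otimes> a = b \<oplus> (b' \<oplus> c \<otimes> r)"
        using t[OF a] unfolding J_def set_add_def' by blast
      have carr: "a \<in> carrier R" "b \<in> carrier R" "b' \<in> carrier R" using a * by auto
      have "c \<otimes> r = s \<otimes> a \<ominus> b \<ominus> b'" unfolding *(5) using carr rc *(4) by algebra
      moreover have "s \<otimes> a \<in> L t" using *(1) a L.I_l_closed by blast
      moreover have "b \<in> L t" "b' \<in> L t" using *(2,3) Ldec pL by blast+
      ultimately have "c \<otimes> r \<in> L t" using ideal_minus_closed[OF L] by simp
      then obtain k :: nat where "r [^] k \<otimes> (c \<otimes> r) \<in> K t" unfolding L_def by blast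
      hence "r [^] Suc k \<otimes> c \<in> K t" using rc *(4) by (simp add: m_ac)
      hence "c \<in> L t" unfolding L_def using *(4) by blast
      hence "r \<otimes> c \<in> ideal_multiples ?N P (L t)" using ideal_multiples.prod[OF r, of c "L t" ?N] by simp
      moreover have "b \<oplus> b' \<in> L (Suc t)" using *(2,3) pL by (intro L'.a_closed) blast+
      moreover have "s \<otimes> a = (b \<oplus> b') \<oplus> r \<otimes> c" unfolding *(5) using carr rc *(4) by algebra
      ultimately show ?thesis using *(1) unfolding set_add_def' by blast
    qed
    have "x [^] t \<in> L t"
    proof -
      have "x [^] t = x [^] t \<otimes> \<one> \<oplus> \<zero>" using xt by simp
      hence "x [^] t \<in> K t" unfolding K_def using xt p.zero_closed one_closed by blast
      thus ?thesis unfolding L_def using xt by (auto intro!: exI[of _ 0])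
    qed
    hence "\<exists>s\<in>carrier R - P. s \<otimes> x [^] t \<in> L (Suc t)"
      using N.local_nakayama[OF P, of "L (Suc t)" "L t" "x [^] t"] gen L Ldec[of t] regular_noetherian_interval
      by (simp add: submodule_regular_iff)
    then obtain s c b and k :: nat where *: "s \<in> carrier R - P" "c \<in> carrier R" "b \<in> p"
        "r [^] k \<otimes> (s \<otimes> x [^] t) = x [^] Suc t \<otimes> c \<oplus> b"
      unfolding L_def K_def by blast
    have carr: "s \<in> carrier R" "b \<in> carrier R" using * by auto
    have "x [^] t \<otimes> (r [^] k \<otimes> s \<ominus> x \<otimes> c) = r [^] k \<otimes> (s \<otimes> x [^] t) \<ominus> x [^] Suc t \<otimes> c"
      using carr *(2) xt[of t] rk[of k] xc unfolding nat_pow_Suc by algebra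
    also have "\<dots> = b" unfolding *(4) using carr *(2) xt[of "Suc t"] by algebra
    finally have "x [^] t \<otimes> (r [^] k \<otimes> s \<ominus> x \<otimes> c) \<in> p" using * by simp
    moreover have "x [^] t \<notin> p" using primeideal_pow_mem[OF p xc] x by blast
    moreover have "r [^] k \<otimes> s \<ominus> x \<otimes> c \<in> carrier R" using carr(1) *(2) xc rk by simp
    ultimately have "r [^] k \<otimes> s \<ominus> x \<otimes> c \<in> p" using p.I_prime[OF xt] by blast
    moreover have "x \<otimes> c \<in> q" by (rule q.I_r_closed[OF x(1) *(2)])
    ultimately have "(r [^] k \<otimes> s \<ominus> x \<otimes> c) \<oplus> x \<otimes> c \<in> q" using pq by (intro q.a_closed) blast+
    moreover have "(r [^] k \<otimes> s \<ominus> x \<otimes> c) \<oplus> x \<otimes> c = r [^] k \<otimes> s" using carr *(2) rk[of k] xc by algebra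
    ultimately have "r [^] k \<otimes> s \<in> q" by simp
    hence "r [^] k \<in> q \<or> s \<in> q" using q.I_prime rk carr by blast
    thus False using primeideal_pow_mem[OF q rc] rq *(1) qP by blast
  qed
qed


text \<open>The primes of the chain are moved onto \<open>r\<close> one at a time, from the top down. So a chain of primes
  over \<open>p 0\<close> loses at most one member when \<open>r\<close> is added to \<open>p 0\<close>.\<close>

lemma prime_chain_containing:
  assumes "\<And>i. i \<le> Suc n \<Longrightarrow> primeideal (p i) R" "\<And>i. i \<le> n \<Longrightarrow> p i \<subset> p (Suc i)"
    and "r \<in> p (Suc n)"
  shows "\<exists>q. (\<forall>i\<le>n. primeideal (q i) R) \<and> (\<forall>i<n. q i \<subset> q (Suc i)) \<and>
    p 0 \<subseteq> q 0 \<and> r \<in> q 0 \<and> q n = p (Suc n)"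
  using assms
proof (induct n arbitrary: p)
  case 0
  show ?case using 0(1)[of 1] 0(2)[of 0] 0(3) by (intro exI[of _ "\<lambda>_. p 1"]) auto
next
  case (Suc n)
  obtain Q where Q: "primeideal Q R" "p n \<subset> Q" "Q \<subset> p (Suc (Suc n))" "r \<in> Q"
    using intermediate_prime_containing[of "p n" "p (Suc n)" "p (Suc (Suc n))" r] Suc(2,4)
      Suc(3)[of n] Suc(3)[of "Suc n"] by auto
  let ?p = "\<lambda>i. if i = Suc n then Q else p i"
  have "\<exists>q. (\<forall>i\<le>n. primeideal (q i) R) \<and> (\<forall>i<n. q i \<subset> q (Suc i)) \<and>
    ?p 0 \<subseteq> q 0 \<and> r \<in> q 0 \<and> q n = ?p (Suc n)"
    by (rule Suc(1)) (use Q Suc(2,3) in \<open>auto simp: le_Suc_eq\<close>)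
  then obtain q where q: "\<forall>i\<le>n. primeideal (q i) R" "\<forall>i<n. q i \<subset> q (Suc i)" "p 0 \<subseteq> q 0" "r \<in> q 0" "q n = Q"
    by auto
  let ?q = "\<lambda>i. if i = Suc n then p (Suc (Suc n)) else q i"
  show ?case
  proof (intro exI[of _ ?q] conjI allI impI)
    fix i assume "i \<le> Suc n"
    thus "primeideal (?q i) R" using q Suc(2) by auto
  next
    fix i assume "i < Suc n"
    thus "?q i \<subset> ?q (Suc i)" using q Q by (cases "i = n") auto
  qed (use q in auto)
qed

end

section \<open>Artinian modules over a local ring\<close>

text \<open>The prime \<open>p\<close> is chosen minimal in the family, so that some \<open>e\<close> outside \<open>p\<close> lies in all others.\<close>

lemma (in cring) prime_avoidance:
  assumes "finite \<P>" and "\<And>p. p \<in> \<P> \<Longrightarrow> primeideal p R" and a: "ideal \<aa> R"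
    and "\<And>p. p \<in> \<P> \<Longrightarrow> \<not> \<aa> \<subseteq> p"
  shows "\<exists>r\<in>\<aa>. \<forall>p\<in>\<P>. r \<notin> p"
  using assms(1,2,4)
proof (induct rule: finite_psubset_induct)
  case (psubset \<P>)
  interpret \<aa>: ideal \<aa> R by (rule a)
  show ?case
  proof (cases "\<P> = {}")
    case True
    thus ?thesis using \<aa>.zero_closed by blast
  next
    case False
    obtain p where p: "p \<in> \<P>" "\<And>q. q \<in> \<P> \<Longrightarrow> q \<subseteq> p \<Longrightarrow> p = q"
      using finite_has_minimal[OF psubset(1) False] by blast
    interpret p: primeideal p R using psubset(3) p(1) by blast
    have "\<exists>r\<in>\<aa>. \<forall>q\<in>\<P> - {p}. r \<notin> q"
      by (rule psubset(2)) (use p psubset(3,4) in blast)+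
    then obtain r where r: "r \<in> \<aa>" "\<And>q. q \<in> \<P> - {p} \<Longrightarrow> r \<notin> q" by blast
    show ?thesis
    proof (cases "r \<in> p")
      case False thus ?thesis using r by blast
    next
      case True
      have "\<exists>e\<in>carrier R - p. \<forall>q\<in>\<Q>. e \<in> q" if "finite \<Q>" "\<Q> \<subseteq> \<P> - {p}" for \<Q>
        using that
      proof induct
        case empty
        show ?case using primeideal_one_compl[OF p.primeideal_axioms] by blast
      next
        case (insert q \<Q>)
        interpret q: primeideal q R using psubset(3) insert by blast
        obtain e where e: "e \<in> carrier R - p" "\<forall>q\<in>\<Q>. e \<in> q" using insert by blast
        have "\<not> q \<subseteq> p" using p(2) insert(4) by blast
        then obtain f where f: "f \<in> q" "f \<notin> p" by blast
        hence fc: "f \<in> carrier R - p" using q.Icarr by blast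
        have "e \<otimes> f \<in> q'" if "q' \<in> insert q \<Q>" for q'
        proof -
          interpret q': primeideal q' R using psubset(3) insert(4) that by blast
          show ?thesis using that e f fc q'.I_l_closed q'.I_r_closed by blast
        qed
        thus ?case using primeideal_compl_mult[OF p.primeideal_axioms e(1) fc] by blast
      qed
      from this[of "\<P> - {p}"] psubset(1) obtain e where e: "e \<in> carrier R - p" "\<forall>q\<in>\<P> - {p}. e \<in> q"
        by blast
      obtain s where s: "s \<in> \<aa>" "s \<notin> p" using psubset(4)[OF p(1)] by blast
      have carr: "s \<in> carrier R" "e \<in> carrier R" "r \<in> carrier R" using s e r \<aa>.Icarr by auto
      have cancel: "r = (r \<oplus> s \<otimes> e) \<ominus> s \<otimes> e" "s \<otimes> e = (r \<oplus> s \<otimes> e) \<ominus> r" using carr by algebra+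
      have "r \<oplus> s \<otimes> e \<notin> q" if "q \<in> \<P>" for q
      proof
        assume *: "r \<oplus> s \<otimes> e \<in> q"
        interpret q: primeideal q R using psubset(3) that by blast
        show False
        proof (cases "q = p")
          case True
          hence "(r \<oplus> s \<otimes> e) \<ominus> r \<in> p"
            using ideal_minus_closed[OF p.ideal_axioms] * \<open>r \<in> p\<close> by blast
          hence "s \<otimes> e \<in> p" using cancel(2) by simp
          thus False using p.I_prime[OF carr(1,2)] s e by blast
        next
          case False
          hence "s \<otimes> e \<in> q" using e that carr q.I_l_closed by blast
          hence "(r \<oplus> s \<otimes> e) \<ominus> s \<otimes> e \<in> q" using ideal_minus_closed[OF q.ideal_axioms] * by blast
          hence "r \<in> q" using cancel(1) by simp
          thus False using r False that by blast
        qed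
      qed
      moreover have "r \<oplus> s \<otimes> e \<in> \<aa>" using r s carr \<aa>.I_r_closed by (intro \<aa>.a_closed) auto
      ultimately show ?thesis by blast
    qed
  qed
qed

context module
begin

lemma smult_pow_add:
  "a \<in> carrier R \<Longrightarrow> x \<in> carrier M \<Longrightarrow> a [^] (k + l :: nat) \<odot>\<^bsub>M\<^esub> x = a [^] k \<odot>\<^bsub>M\<^esub> (a [^] l \<odot>\<^bsub>M\<^esub> x)"
  by (simp add: R.nat_pow_mult[symmetric] smult_assoc1)

lemma smult_pow_Suc:
  "a \<in> carrier R \<Longrightarrow> x \<in> carrier M \<Longrightarrow> a [^] Suc k \<odot>\<^bsub>M\<^esub> x = a [^] k \<odot>\<^bsub>M\<^esub> (a \<odot>\<^bsub>M\<^esub> x)"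
  by (simp add: smult_assoc1)

lemma smult_pow_Suc':
  "a \<in> carrier R \<Longrightarrow> x \<in> carrier M \<Longrightarrow> a [^] Suc k \<odot>\<^bsub>M\<^esub> x = a \<odot>\<^bsub>M\<^esub> (a [^] k \<odot>\<^bsub>M\<^esub> x)"
  by (simp add: smult_assoc1 smult_lcomm)

lemma smult_pow_le:
  assumes V: "submodule V R M" and "a \<in> carrier R" "x \<in> carrier M" "a [^] (k::nat) \<odot>\<^bsub>M\<^esub> x \<in> V" "k \<le> l"
  shows "a [^] l \<odot>\<^bsub>M\<^esub> x \<in> V"
proof -
  have "a [^] ((l - k) + k) \<odot>\<^bsub>M\<^esub> x = a [^] (l - k) \<odot>\<^bsub>M\<^esub> (a [^] k \<odot>\<^bsub>M\<^esub> x)"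
    using assms by (intro smult_pow_add)
  thus ?thesis using assms submodule_closed(7)[OF V, of "a [^] (l - k)"] by simp
qed

lemma add_pow_smult_mem:
  assumes V: "submodule V R M" and a: "a \<in> carrier R" and b: "b \<in> carrier R"
    and "x \<in> carrier M" "a [^] (k::nat) \<odot>\<^bsub>M\<^esub> x \<in> V" "b [^] (l::nat) \<odot>\<^bsub>M\<^esub> x \<in> V"
  shows "(a \<oplus> b) [^] (k + l) \<odot>\<^bsub>M\<^esub> x \<in> V"
  using assms(4-6)
proof (induct "k + l" arbitrary: k l x)
  case 0 thus ?case by simp
next
  case (Suc n)
  note c = submodule_closed[OF V]
  have ab: "a \<oplus> b \<in> carrier R" using a b by simp
  show ?case
  proof (cases "k = 0 \<or> l = 0")
    case True
    hence "x \<in> V" using Suc by auto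
    thus ?thesis using c(7) ab by simp
  next
    case False
    then obtain k' l' where kl: "k = Suc k'" "l = Suc l'" by (meson not0_implies_Suc)
    have 1: "(a \<oplus> b) [^] (k' + l) \<odot>\<^bsub>M\<^esub> (a \<odot>\<^bsub>M\<^esub> x) \<in> V"
    proof (rule Suc(1))
      show "a [^] k' \<odot>\<^bsub>M\<^esub> (a \<odot>\<^bsub>M\<^esub> x) \<in> V" using Suc(4) kl smult_pow_Suc[OF a Suc(3)] by simp
      show "b [^] l \<odot>\<^bsub>M\<^esub> (a \<odot>\<^bsub>M\<^esub> x) \<in> V"
        using c(7)[OF a Suc(5)] smult_lcomm[of a "b [^] l" x] a b Suc(3) by simp
    qed (use Suc kl a in auto)
    have 2: "(a \<oplus> b) [^] (k + l') \<odot>\<^bsub>M\<^esub> (b \<odot>\<^bsub>M\<^esub> x) \<in> V"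
    proof (rule Suc(1))
      show "b [^] l' \<odot>\<^bsub>M\<^esub> (b \<odot>\<^bsub>M\<^esub> x) \<in> V" using Suc(5) kl smult_pow_Suc[OF b Suc(3)] by simp
      show "a [^] k \<odot>\<^bsub>M\<^esub> (b \<odot>\<^bsub>M\<^esub> x) \<in> V"
        using c(7)[OF b Suc(4)] smult_lcomm[of b "a [^] k" x] a b Suc(3) by simp
    qed (use Suc kl b in auto)
    have n: "k' + l = n" "k + l' = n" "k + l = Suc n" using Suc kl by auto
    have "(a \<oplus> b) [^] (k + l) \<odot>\<^bsub>M\<^esub> x = (a \<oplus> b) [^] n \<odot>\<^bsub>M\<^esub> ((a \<oplus> b) \<odot>\<^bsub>M\<^esub> x)"
      using smult_pow_Suc[OF ab Suc(3), of n] n by simp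
    also have "\<dots> = (a \<oplus> b) [^] n \<odot>\<^bsub>M\<^esub> (a \<odot>\<^bsub>M\<^esub> x) \<oplus>\<^bsub>M\<^esub> (a \<oplus> b) [^] n \<odot>\<^bsub>M\<^esub> (b \<odot>\<^bsub>M\<^esub> x)"
      using a b ab Suc(3) by (simp add: smult_l_distr smult_r_distr)
    also have "\<dots> \<in> V" using 1 2 n c(4) by simp
    finally show ?thesis .
  qed
qed

text \<open>The elements that are multiplied into \<open>V\<close> by the \<open>n\<close>-th power of \<open>\<bb>\<close>, without forming this power.\<close>

primrec colon_power :: "'a set \<Rightarrow> 'c set \<Rightarrow> nat \<Rightarrow> 'c set"
  where "colon_power \<bb> V 0 = V"
  | "colon_power \<bb> V (Suc n) = {x \<in> carrier M. \<forall>a\<in>\<bb>. a \<odot>\<^bsub>M\<^esub> x \<in> colon_power \<bb> V n}"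

lemma submodule_colon_power:
  assumes V: "submodule V R M" and b: "\<bb> \<subseteq> carrier R"
  shows "submodule (colon_power \<bb> V n) R M"
proof (induct n)
  case 0 thus ?case using V by simp
next
  case (Suc n)
  note c = submodule_closed[OF Suc]
  show ?case
  proof (rule submoduleI')
    fix a x assume a: "a \<in> carrier R" and x: "x \<in> colon_power \<bb> V (Suc n)"
    have "b' \<odot>\<^bsub>M\<^esub> (a \<odot>\<^bsub>M\<^esub> x) \<in> colon_power \<bb> V n" if b': "b' \<in> \<bb>" for b'
      using c(7)[OF a, of "b' \<odot>\<^bsub>M\<^esub> x"] x a b b' smult_lcomm[of a b' x] by auto
    thus "a \<odot>\<^bsub>M\<^esub> x \<in> colon_power \<bb> V (Suc n)" using a x by simp
  qed (use c b in \<open>auto simp: smult_r_distr subset_iff\<close>)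
qed

lemma colon_power_Suc_mono:
  assumes V: "submodule V R M" and b: "\<bb> \<subseteq> carrier R"
  shows "colon_power \<bb> V n \<subseteq> colon_power \<bb> V (Suc n)"
proof (induct n)
  case 0
  show ?case using submodule_closed[OF V] b by auto
next
  case (Suc n)
  show ?case
  proof
    fix x assume "x \<in> colon_power \<bb> V (Suc n)"
    hence "x \<in> carrier M" "\<forall>a\<in>\<bb>. a \<odot>\<^bsub>M\<^esub> x \<in> colon_power \<bb> V n" by auto
    thus "x \<in> colon_power \<bb> V (Suc (Suc n))" using Suc unfolding colon_power.simps(2)[of _ _ "Suc n"] by blast
  qed
qed

lemma colon_power_mono:
  assumes V: "submodule V R M" and b: "\<bb> \<subseteq> carrier R" and n: "n \<le> n'"
  shows "colon_power \<bb> V n \<subseteq> colon_power \<bb> V n'"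
  using n by (induct n' rule: dec_induct) (use colon_power_Suc_mono[OF V b] in blast)+

lemma colon_power_mono_target: "V \<subseteq> V' \<Longrightarrow> colon_power \<bb> V n \<subseteq> colon_power \<bb> V' n"
  by (induct n) auto

text \<open>The binomial argument: a product of \<open>n + k\<close> elements of \<open>\<bb> + (x)\<close> is a sum of products with \<open>n\<close>
  factors in \<open>\<bb>\<close> or \<open>k\<close> factors \<open>x\<close>.\<close>

lemma colon_power_insert:
  assumes V: "submodule V R M" and b: "ideal \<bb> R" and x: "x \<in> carrier R"
    and "y \<in> carrier M" "y \<in> colon_power \<bb> V n" "x [^] (k::nat) \<odot>\<^bsub>M\<^esub> y \<in> V"
  shows "y \<in> colon_power (\<bb> <+>\<^bsub>R\<^esub> (\<lambda>c. c \<otimes> x) ` carrier R) V (n + k)"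
  using assms(4-6)
proof (induct "n + k" arbitrary: n k y)
  case 0 thus ?case by simp
next
  case (Suc m)
  interpret \<bb>: ideal \<bb> R by (rule b)
  let ?c = "\<bb> <+>\<^bsub>R\<^esub> (\<lambda>c. c \<otimes> x) ` carrier R"
  have cR: "?c \<subseteq> carrier R" using x \<bb>.Icarr by (auto simp: set_add_def')
  note sub = submodule_closed[OF submodule_colon_power[OF V cR]]
  show ?case
  proof (cases "n = 0 \<or> k = 0")
    case True
    hence "y \<in> V" using Suc by auto
    thus ?thesis using colon_power_mono[OF V cR, of 0 "n + k"] by auto
  next
    case False
    then obtain n' k' where nk: "n = Suc n'" "k = Suc k'" by (meson not0_implies_Suc)
    have "c \<odot>\<^bsub>M\<^esub> y \<in> colon_power ?c V m" if c: "c \<in> ?c" for c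
    proof -
      obtain b' d where *: "b' \<in> \<bb>" "d \<in> carrier R" "c = b' \<oplus> d \<otimes> x"
        using c unfolding set_add_def' by blast
      have b': "b' \<in> carrier R" using * by simp
      have xk: "x [^] k \<in> carrier R" using x by simp
      have "b' \<odot>\<^bsub>M\<^esub> y \<in> colon_power ?c V (n' + k)"
      proof (rule Suc(1))
        show "m = n' + k" "b' \<odot>\<^bsub>M\<^esub> y \<in> carrier M" using Suc nk b' by auto
        show "b' \<odot>\<^bsub>M\<^esub> y \<in> colon_power \<bb> V n'" using Suc(4) nk * by simp
        show "x [^] k \<odot>\<^bsub>M\<^esub> (b' \<odot>\<^bsub>M\<^esub> y) \<in> V"
          using submodule_closed(7)[OF V b' Suc(5)] smult_lcomm[OF b' xk Suc(3)] by simp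
      qed
      moreover have "x \<odot>\<^bsub>M\<^esub> y \<in> colon_power ?c V (n + k')"
      proof (rule Suc(1))
        show "m = n + k'" "x \<odot>\<^bsub>M\<^esub> y \<in> carrier M" using Suc nk x by auto
        show "x \<odot>\<^bsub>M\<^esub> y \<in> colon_power \<bb> V n"
          using submodule_closed(7)[OF submodule_colon_power[OF V] x Suc(4)] \<bb>.Icarr by blast
        show "x [^] k' \<odot>\<^bsub>M\<^esub> (x \<odot>\<^bsub>M\<^esub> y) \<in> V" using Suc(5) nk smult_pow_Suc[OF x Suc(3)] by simp
      qed
      moreover have "n' + k = m" "n + k' = m" using Suc nk by auto
      ultimately have "b' \<odot>\<^bsub>M\<^esub> y \<oplus>\<^bsub>M\<^esub> d \<odot>\<^bsub>M\<^esub> (x \<odot>\<^bsub>M\<^esub> y) \<in> colon_power ?c V m"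
        using sub(4) sub(7)[OF *(2)] by simp
      moreover have "c \<odot>\<^bsub>M\<^esub> y = b' \<odot>\<^bsub>M\<^esub> y \<oplus>\<^bsub>M\<^esub> d \<odot>\<^bsub>M\<^esub> (x \<odot>\<^bsub>M\<^esub> y)"
        using * b' x Suc(3) by (simp add: smult_l_distr smult_assoc1)
      ultimately show ?thesis by simp
    qed
    moreover have "n + k = Suc m" using Suc by simp
    ultimately show ?thesis using Suc(3) by simp
  qed
qed

end

context noetherian_base_module
begin

text \<open>The exponents become uniform because \<open>\<aa>\<close> is finitely generated. This is used in the form that an
  ideal \<open>\<bb>\<close> with uniform exponent that is maximal among those inside \<open>\<aa>\<close> must be \<open>\<aa>\<close>.\<close>

lemma nilpotent_uniform:
  assumes V: "submodule V R M" and a: "ideal \<aa> R" and L: "L \<subseteq> carrier M"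
    and nil: "\<And>a. a \<in> \<aa> \<Longrightarrow> \<exists>k::nat. \<forall>y\<in>L. a [^] k \<odot>\<^bsub>M\<^esub> y \<in> V"
  shows "\<exists>n. L \<subseteq> colon_power \<aa> V n"
proof -
  interpret \<aa>: ideal \<aa> R by (rule a)
  define F where "F = {\<bb>. ideal \<bb> R \<and> \<bb> \<subseteq> \<aa> \<and> (\<exists>n. L \<subseteq> colon_power \<bb> V n)}"
  have "L \<subseteq> colon_power {\<zero>} V 1" using L submodule_closed(3)[OF V] by auto
  hence "\<exists>n. L \<subseteq> colon_power {\<zero>} V n" by blast
  hence "{\<zero>} \<in> F" using \<aa>.zero_closed R.zeroideal unfolding F_def by blast
  moreover have "F \<subseteq> {I. ideal I R}" by (auto simp: F_def)
  ultimately have "\<exists>U\<in>F. \<forall>V\<in>F. U \<subseteq> V \<longrightarrow> V = U" by (intro extremal_conditionD[OF ideals_noetherian])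
  then obtain \<bb> where b: "\<bb> \<in> F" "\<forall>V\<in>F. \<bb> \<subseteq> V \<longrightarrow> V = \<bb>" by (rule bexE)
  then obtain n where n: "ideal \<bb> R" "\<bb> \<subseteq> \<aa>" "L \<subseteq> colon_power \<bb> V n" by (auto simp: F_def)
  have "\<bb> = \<aa>"
  proof (rule ccontr)
    assume "\<bb> \<noteq> \<aa>"
    then obtain x where x: "x \<in> \<aa>" "x \<notin> \<bb>" using n by blast
    have xc: "x \<in> carrier R" using x \<aa>.Icarr by blast
    obtain k :: nat where k: "\<forall>y\<in>L. x [^] k \<odot>\<^bsub>M\<^esub> y \<in> V" using nil[OF x(1)] by blast
    let ?C = "(\<lambda>c. c \<otimes> x) ` carrier R"
    let ?c = "\<bb> <+>\<^bsub>R\<^esub> ?C"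
    interpret nc: noetherian_cring R by unfold_locales
    interpret N: noetherian_base_module R "regular_module R" by (rule nc.regular_noetherian_base_module)
    have C: "ideal ?C R" using N.submodule_cyclic[of x] xc by (simp add: nc.submodule_regular_iff)
    have "L \<subseteq> colon_power ?c V (n + k)"
      using colon_power_insert[OF V n(1) xc, of _ n k] n(3) k L by blast
    moreover have "?c \<subseteq> \<aa>"
    proof
      fix c assume "c \<in> ?c"
      then obtain b' d where "b' \<in> \<bb>" "d \<in> carrier R" "c = b' \<oplus> d \<otimes> x" by (auto simp: set_add_def')
      thus "c \<in> \<aa>" using n(2) \<aa>.I_l_closed[OF x(1)] \<aa>.a_closed by blast
    qed
    ultimately have "?c \<in> F" using nc.submodule_add_ideals(3)[OF n(1) C] by (auto simp: F_def)
    hence "?c = \<bb>" using b(2) nc.submodule_add_ideals(1)[OF n(1) C] by blast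
    hence "x \<in> \<bb>" using nc.submodule_add_ideals(2)[OF n(1) C] N.mem_cyclic[of x] xc by auto
    thus False using x by blast
  qed
  thus ?thesis using n by blast
qed

end


context module
begin

text \<open>Fitting's decomposition: once the images \<open>r\<^sup>k L\<close> are stationary modulo \<open>B\<close>, the module \<open>L\<close> is the
  sum of such an image and of a part killed by \<open>r\<^sup>k\<close>.\<close>

lemma stable_power_image:
  assumes L: "submodule L R M" and B: "submodule B R M"
    and r: "r \<in> carrier R" and st: "B <+>\<^bsub>M\<^esub> (\<lambda>x. r [^] (2 * k :: nat) \<odot>\<^bsub>M\<^esub> x) ` L = B <+>\<^bsub>M\<^esub> (\<lambda>x. r [^] k \<odot>\<^bsub>M\<^esub> x) ` L"
    and x: "x \<in> L"
  shows "\<exists>y\<in>L. r [^] k \<odot>\<^bsub>M\<^esub> (x \<ominus>\<^bsub>M\<^esub> r [^] k \<odot>\<^bsub>M\<^esub> y) \<in> B"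
proof -
  note cL = submodule_closed[OF L] and cB = submodule_closed[OF B]
  have rk: "r [^] k \<in> carrier R" using r by simp
  have "\<zero>\<^bsub>M\<^esub> \<oplus>\<^bsub>M\<^esub> r [^] k \<odot>\<^bsub>M\<^esub> x \<in> B <+>\<^bsub>M\<^esub> (\<lambda>x. r [^] k \<odot>\<^bsub>M\<^esub> x) ` L"
    using cB x by (intro set_addI) auto
  then obtain b y where *: "b \<in> B" "y \<in> L" "r [^] k \<odot>\<^bsub>M\<^esub> x = b \<oplus>\<^bsub>M\<^esub> r [^] (2 * k) \<odot>\<^bsub>M\<^esub> y"
    using st[symmetric] rk x cL by (auto elim!: set_addE)
  have yc: "y \<in> carrier M" "b \<in> carrier M" "x \<in> carrier M" using * x cL cB by auto
  have "r [^] (2 * k) \<odot>\<^bsub>M\<^esub> y = r [^] k \<odot>\<^bsub>M\<^esub> (r [^] k \<odot>\<^bsub>M\<^esub> y)"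
    using smult_pow_add[OF r yc(1), of k k] by (simp add: mult_2)
  hence "r [^] k \<odot>\<^bsub>M\<^esub> x = b \<oplus>\<^bsub>M\<^esub> r [^] k \<odot>\<^bsub>M\<^esub> (r [^] k \<odot>\<^bsub>M\<^esub> y)" using * by simp
  moreover have "r [^] k \<odot>\<^bsub>M\<^esub> (x \<ominus>\<^bsub>M\<^esub> r [^] k \<odot>\<^bsub>M\<^esub> y) = r [^] k \<odot>\<^bsub>M\<^esub> x \<ominus>\<^bsub>M\<^esub> r [^] k \<odot>\<^bsub>M\<^esub> (r [^] k \<odot>\<^bsub>M\<^esub> y)"
    using rk yc by algebra
  moreover have "(b \<oplus>\<^bsub>M\<^esub> r [^] k \<odot>\<^bsub>M\<^esub> (r [^] k \<odot>\<^bsub>M\<^esub> y)) \<ominus>\<^bsub>M\<^esub> r [^] k \<odot>\<^bsub>M\<^esub> (r [^] k \<odot>\<^bsub>M\<^esub> y) = b"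
    using rk yc by algebra
  ultimately have "r [^] k \<odot>\<^bsub>M\<^esub> (x \<ominus>\<^bsub>M\<^esub> r [^] k \<odot>\<^bsub>M\<^esub> y) = b" by simp
  thus ?thesis using * by auto
qed

text \<open>Melkersson's criterion. Let \<open>L' \<subseteq> L\<close> be submodules of a module on which \<open>s\<close> acts locally
  nilpotently. If \<open>s\<^sup>t L \<inter> (0 : s)\<close> and \<open>s\<^sup>t L' \<inter> (0 : s)\<close> agree for all \<open>t\<close>, then \<open>L' = L\<close>. As these leading
  terms decrease both in \<open>t\<close> and in \<open>L\<close>, the diagonal of a descending sequence controls all of them.\<close>

lemma artinian_of_torsion_kernel:
  assumes B: "submodule B R M" and Z: "submodule Z R M" and BZ: "B \<subseteq> Z" and s: "s \<in> carrier R"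
    and tor: "\<And>z. z \<in> Z \<Longrightarrow> \<exists>k::nat. s [^] k \<odot>\<^bsub>M\<^esub> z \<in> B"
    and K: "artinian_interval B {z \<in> Z. s \<odot>\<^bsub>M\<^esub> z \<in> B}"
  shows "artinian_interval B Z"
proof (rule extremal_condition_descendingI)
  fix f :: "nat \<Rightarrow> 'c set" assume f: "\<And>i. f i \<in> interval B Z" and dec: "\<And>i. f (Suc i) \<subset> f i"
  note cB = submodule_closed[OF B] and cZ = submodule_closed[OF Z]
  have fi: "submodule (f i) R M" "B \<subseteq> f i" "f i \<subseteq> Z" for i using f[of i] by (auto simp: interval_def)
  have st: "s [^] (t::nat) \<in> carrier R" for t using s by simp
  \<comment> \<open>The leading terms \<open>s\<^sup>t L \<inter> (0 : s)\<close>, modulo \<open>B\<close>.\<close>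
  define V where "V t L = B <+>\<^bsub>M\<^esub> (\<lambda>x. s [^] t \<odot>\<^bsub>M\<^esub> x) ` {x \<in> L. s [^] Suc t \<odot>\<^bsub>M\<^esub> x \<in> B}"
    for t :: nat and L
  have V: "V t (f i) \<in> interval B {z \<in> Z. s \<odot>\<^bsub>M\<^esub> z \<in> B}" for t i
  proof -
    have 1: "submodule ((\<lambda>x. s [^] t \<odot>\<^bsub>M\<^esub> x) ` {x \<in> f i. s [^] Suc t \<odot>\<^bsub>M\<^esub> x \<in> B}) R M"
      by (intro submodule_smult_image submodule_preimage_smult B fi st)
    have K: "submodule {z \<in> Z. s \<odot>\<^bsub>M\<^esub> z \<in> B} R M" by (rule submodule_preimage_smult[OF B Z s])
    have "(\<lambda>x. s [^] t \<odot>\<^bsub>M\<^esub> x) ` {x \<in> f i. s [^] Suc t \<odot>\<^bsub>M\<^esub> x \<in> B} \<subseteq> {z \<in> Z. s \<odot>\<^bsub>M\<^esub> z \<in> B}"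
    proof (rule image_subsetI)
      fix x assume "x \<in> {x \<in> f i. s [^] Suc t \<odot>\<^bsub>M\<^esub> x \<in> B}"
      hence x: "x \<in> Z" "s [^] Suc t \<odot>\<^bsub>M\<^esub> x \<in> B" using fi by blast+
      moreover have "x \<in> carrier M" using x cZ by blast
      ultimately show "s [^] t \<odot>\<^bsub>M\<^esub> x \<in> {z \<in> Z. s \<odot>\<^bsub>M\<^esub> z \<in> B}"
        using cZ(7)[OF st x(1)] smult_pow_Suc'[OF s, of x t] by simp
    qed
    moreover have "B \<subseteq> {z \<in> Z. s \<odot>\<^bsub>M\<^esub> z \<in> B}" using BZ cB(7)[OF s] by blast
    ultimately show ?thesis
      unfolding interval_def V_def
      using submodule_set_add[OF B 1] set_add_upper(1)[OF B 1] set_add_least[OF K] by blast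
  qed
  have Vmono: "V t (f j) \<subseteq> V t (f i)" if "i \<le> j" for t i j
  proof -
    have "f j \<subseteq> f i" using that by (induct j rule: dec_induct) (use dec in blast)+
    thus ?thesis unfolding V_def by (intro set_add_mono image_mono) auto
  qed
  have VSuc: "V (Suc t) (f i) \<subseteq> V t (f i)" for t i
    unfolding V_def
  proof (intro set_add_mono subset_refl image_subsetI)
    fix x assume x: "x \<in> {x \<in> f i. s [^] Suc (Suc t) \<odot>\<^bsub>M\<^esub> x \<in> B}"
    hence xc: "x \<in> carrier M" using submodule_closed(2)[OF fi(1)] by blast
    have "s \<odot>\<^bsub>M\<^esub> x \<in> {x \<in> f i. s [^] Suc t \<odot>\<^bsub>M\<^esub> x \<in> B}"
      using x submodule_closed(7)[OF fi(1) s] smult_pow_Suc[OF s xc, of "Suc t"] by simp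
    moreover have "s [^] Suc t \<odot>\<^bsub>M\<^esub> x = s [^] t \<odot>\<^bsub>M\<^esub> (s \<odot>\<^bsub>M\<^esub> x)" by (rule smult_pow_Suc[OF s xc])
    ultimately show "s [^] Suc t \<odot>\<^bsub>M\<^esub> x \<in> (\<lambda>x. s [^] t \<odot>\<^bsub>M\<^esub> x) ` {x \<in> f i. s [^] Suc t \<odot>\<^bsub>M\<^esub> x \<in> B}"
      by blast
  qed
  have Vle: "V u (f j) \<subseteq> V t (f i)" if "t \<le> u" "i \<le> j" for t u i j
  proof -
    have "V u (f j) \<subseteq> V t (f j)" using that(1) by (induct u rule: dec_induct) (use VSuc in blast)+
    thus ?thesis using Vmono[OF that(2)] by blast
  qed
  have Vdec: "V (Suc i) (f (Suc i)) \<subseteq> V i (f i)" "V t (f (Suc i)) \<subseteq> V t (f i)" for t i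
    by (intro Vle; simp)+
  obtain n where n: "\<And>i. n \<le> i \<Longrightarrow> V i (f i) = V n (f n)"
    by (rule descending_sequence_stabilizes[OF K, of "\<lambda>i. V i (f i)"]) (use V Vdec(1) in blast)+
  have "\<exists>m. \<forall>i\<ge>m. V t (f i) = V t (f m)" for t
  proof -
    obtain m where "\<And>i. m \<le> i \<Longrightarrow> V t (f i) = V t (f m)"
      by (rule descending_sequence_stabilizes[OF K, of "\<lambda>i. V t (f i)"]) (use V Vdec(2) in blast)+
    thus ?thesis by blast
  qed
  then obtain m where m: "\<And>t i. m t \<le> i \<Longrightarrow> V t (f i) = V t (f (m t))" by metis
  \<comment> \<open>From \<open>n\<close> on the diagonal is constant, which settles all \<open>t \<ge> n\<close>. The finitely many others have
    their own bounds \<open>m t\<close>.\<close>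
  define N where "N = Max (insert n (m ` {..<n}))"
  have nN: "n \<le> N" and mN: "\<And>t. t < n \<Longrightarrow> m t \<le> N" unfolding N_def by (auto intro: Max_ge)
  have eq: "V t (f (Suc N)) = V t (f N)" for t
  proof (cases "t < n")
    case True
    thus ?thesis using m[of t N] m[of t "Suc N"] mN[of t] by simp
  next
    case False
    have *: "V t (f i) = V n (f n)" if "n \<le> i" for i
    proof
      show "V t (f i) \<subseteq> V n (f n)" using False that by (intro Vle) auto
      have "V (max t i) (f (max t i)) \<subseteq> V t (f i)" by (intro Vle) auto
      thus "V n (f n) \<subseteq> V t (f i)" using n[of "max t i"] that by auto
    qed
    thus ?thesis using nN by simp
  qed
  have "x \<in> f (Suc N)" if "x \<in> f N" "s [^] k \<odot>\<^bsub>M\<^esub> x \<in> B" for x and k :: nat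
    using that
  proof (induct k arbitrary: x)
    case 0
    thus ?case using fi(2) submodule_closed(2)[OF fi(1)] by (auto simp: )
  next
    case (Suc k)
    let ?g = "f (Suc N)"
    note cN = submodule_closed[OF fi(1)[of N]] and cS = submodule_closed[OF fi(1)[of "Suc N"]]
    have xc: "x \<in> carrier M" using Suc cN by blast
    have "\<zero>\<^bsub>M\<^esub> \<oplus>\<^bsub>M\<^esub> s [^] k \<odot>\<^bsub>M\<^esub> x \<in> V k (f N)" unfolding V_def using Suc cB by (intro set_addI) auto
    hence "s [^] k \<odot>\<^bsub>M\<^esub> x \<in> V k ?g" using eq xc st by simp
    then obtain b y where *: "b \<in> B" "y \<in> ?g" "s [^] k \<odot>\<^bsub>M\<^esub> x = b \<oplus>\<^bsub>M\<^esub> s [^] k \<odot>\<^bsub>M\<^esub> y"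
      unfolding V_def by (blast elim: set_addE)
    have carr: "b \<in> carrier M" "y \<in> carrier M" using * cB cS by auto
    have yN: "y \<in> f N" using * dec by blast
    have "s [^] k \<odot>\<^bsub>M\<^esub> (x \<ominus>\<^bsub>M\<^esub> y) = s [^] k \<odot>\<^bsub>M\<^esub> x \<ominus>\<^bsub>M\<^esub> s [^] k \<odot>\<^bsub>M\<^esub> y" using st[of k] xc carr by algebra
    also have "\<dots> = b" unfolding *(3) using st[of k] carr by algebra
    finally have "s [^] k \<odot>\<^bsub>M\<^esub> (x \<ominus>\<^bsub>M\<^esub> y) \<in> B" using * by simp
    hence "x \<ominus>\<^bsub>M\<^esub> y \<in> ?g" using Suc(1)[of "x \<ominus>\<^bsub>M\<^esub> y"] cN(5)[OF Suc(2) yN] by blast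
    hence "(x \<ominus>\<^bsub>M\<^esub> y) \<oplus>\<^bsub>M\<^esub> y \<in> ?g" using cS(4) * by blast
    moreover have "(x \<ominus>\<^bsub>M\<^esub> y) \<oplus>\<^bsub>M\<^esub> y = x" using xc carr by algebra
    ultimately show ?case by simp
  qed
  moreover obtain x where "x \<in> f N" "x \<notin> f (Suc N)" using dec by blast
  moreover from this obtain k :: nat where "s [^] k \<odot>\<^bsub>M\<^esub> x \<in> B" using tor fi(3) by blast
  ultimately show False by blast
qed

end

context noetherian_local_ring
begin

lemma proper_ideal_subset:
  assumes I: "ideal I R" "\<one> \<notin> I"
  shows "I \<subseteq> \<mm>"
proof -
  define F where "F = {K. ideal K R \<and> I \<subseteq> K \<and> \<one> \<notin> K}"
  have "F \<subseteq> {K. ideal K R}" "I \<in> F" using I by (auto simp: F_def)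
  hence "\<exists>U\<in>F. \<forall>V\<in>F. U \<subseteq> V \<longrightarrow> V = U" by (rule extremal_conditionD[OF ideals_noetherian])
  then obtain U where U: "U \<in> F" "\<forall>V\<in>F. U \<subseteq> V \<longrightarrow> V = U" by (rule bexE)
  have iU: "ideal U R" "I \<subseteq> U" "\<one> \<notin> U" using U by (auto simp: F_def)
  have "maximalideal U R"
  proof (rule maximalidealI)
    show "carrier R \<noteq> U" using iU by auto
    fix K assume K: "ideal K R" "U \<subseteq> K" "K \<subseteq> carrier R"
    show "K = U \<or> K = carrier R"
    proof (rule disjCI)
      assume "K \<noteq> carrier R"
      hence "\<one> \<notin> K" using ideal.one_imp_carrier[OF K(1)] by blast
      hence "K \<in> F" using K iU by (auto simp: F_def)
      thus "K = U" using U(2) K(2) by blast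
    qed
  qed (rule iU)
  thus ?thesis using unique_maximalideal iU by blast
qed

lemma primeideal_m: "primeideal \<mm> R"
  by (rule maximalideal_prime[OF maximalideal_m])

lemma ideal_m: "ideal \<mm> R"
  using maximalideal_m by (rule maximalideal.axioms(1))

lemma m_subset: "\<mm> \<subseteq> carrier R"
  using ideal.Icarr[OF ideal_m] by blast

lemma primeideal_subset: "primeideal p R \<Longrightarrow> p \<subseteq> \<mm>"
  using proper_ideal_subset primeideal_one_compl primeideal.axioms(1) by blast

lemma unit_outside_m:
  assumes s: "s \<in> carrier R" "s \<notin> \<mm>"
  obtains u where "u \<in> carrier R" "u \<otimes> s = \<one>"
proof -
  have "ideal (PIdl s) R" by (rule cgenideal_ideal[OF s(1)])
  moreover have "s \<in> PIdl s" by (rule cgenideal_self[OF s(1)])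
  ultimately have "\<one> \<in> PIdl s" using proper_ideal_subset s by blast
  thus thesis using that unfolding cgenideal_def by auto
qed

end

locale noetherian_local_module = noetherian_base_module R M + R?: noetherian_local_ring R \<mm>
  for R (structure) and M (structure) and \<mm>
begin

lemma smult_unit_mem:
  assumes V: "submodule V R M" and s: "s \<in> carrier R" "s \<notin> \<mm>" and x: "x \<in> carrier M" "s \<odot>\<^bsub>M\<^esub> x \<in> V"
  shows "x \<in> V"
proof -
  obtain u where u: "u \<in> carrier R" "u \<otimes> s = \<one>" using unit_outside_m[OF s] .
  have "u \<odot>\<^bsub>M\<^esub> (s \<odot>\<^bsub>M\<^esub> x) = (u \<otimes> s) \<odot>\<^bsub>M\<^esub> x"
    using smult_assoc1[OF u(1) s(1) x(1)] by simp
  hence "x = u \<odot>\<^bsub>M\<^esub> (s \<odot>\<^bsub>M\<^esub> x)" using u x by simp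
  thus ?thesis using submodule_closed(7)[OF V u(1) x(2)] by simp
qed

lemma nakayama:
  assumes W: "submodule W R M" and Z: "submodule Z R M" and WZ: "W \<subseteq> Z"
    and noeth: "noetherian_interval W Z"
    and gen: "Z \<subseteq> W <+>\<^bsub>M\<^esub> ideal_multiples M \<mm> Z"
  shows "Z = W"
proof
  show "Z \<subseteq> W"
  proof
    fix z assume z: "z \<in> Z"
    have one: "\<one> \<in> carrier R - \<mm>" by (rule R.primeideal_one_compl[OF primeideal_m])
    have "\<exists>s\<in>carrier R - \<mm>. s \<odot>\<^bsub>M\<^esub> z \<in> W"
    proof (rule local_nakayama[OF primeideal_m W Z WZ noeth _ z])
      fix z assume "z \<in> Z"
      hence "\<one> \<odot>\<^bsub>M\<^esub> z \<in> W <+>\<^bsub>M\<^esub> ideal_multiples M \<mm> Z" using gen submodule_closed[OF Z] by auto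
      thus "\<exists>s\<in>carrier R - \<mm>. s \<odot>\<^bsub>M\<^esub> z \<in> W <+>\<^bsub>M\<^esub> ideal_multiples M \<mm> Z" using one by blast
    qed
    thus "z \<in> W" using smult_unit_mem[OF W] z submodule_closed(2)[OF Z] by blast
  qed
qed (rule WZ)

text \<open>A maximal artinian submodule \<open>U\<close> is everything: otherwise there is \<open>y\<close> outside \<open>U\<close> with
  \<open>\<mm>y \<subseteq> U\<close>, and \<open>U + Ry\<close> is a simple extension of \<open>U\<close>.\<close>

lemma artinian_of_noetherian_torsion:
  assumes B: "submodule B R M" and Z: "submodule Z R M" and BZ: "B \<subseteq> Z"
    and noeth: "noetherian_interval B Z"
    and tor: "\<And>z a. z \<in> Z \<Longrightarrow> a \<in> \<mm> \<Longrightarrow> \<exists>k::nat. a [^] k \<odot>\<^bsub>M\<^esub> z \<in> B"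
  shows "artinian_interval B Z"
proof -
  define F where "F = {U \<in> interval B Z. artinian_interval B U}"
  have "B \<in> F" using B BZ interval_condition_trivial by (auto simp: F_def interval_def)
  hence "\<exists>U\<in>F. \<forall>V\<in>F. U \<subseteq> V \<longrightarrow> V = U" by (intro extremal_conditionD[OF noeth]) (auto simp: F_def)
  then obtain U where U: "U \<in> F" "\<forall>V\<in>F. U \<subseteq> V \<longrightarrow> V = U" by (rule bexE)
  have sU: "submodule U R M" "B \<subseteq> U" "U \<subseteq> Z" and aU: "artinian_interval B U"
    using U by (auto simp: F_def interval_def)
  note cU = submodule_closed[OF sU(1)] and cZ = submodule_closed[OF Z]
  have "U = Z"
  proof (rule ccontr)
    assume "U \<noteq> Z"
    then obtain z where z: "z \<in> Z" "z \<notin> U" using sU by blast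
    have zc: "z \<in> carrier M" using z cZ by blast
    obtain c where c: "c \<in> carrier R" "c \<odot>\<^bsub>M\<^esub> z \<notin> U"
      and pr: "primeideal {a \<in> carrier R. a \<odot>\<^bsub>M\<^esub> (c \<odot>\<^bsub>M\<^esub> z) \<in> U} R" (is "primeideal ?p R")
      using prime_conductor[OF sU(1) zc z(2)] .
    define y where "y = c \<odot>\<^bsub>M\<^esub> z"
    have y: "y \<in> Z" "y \<notin> U" "y \<in> carrier M" using c z cZ by (auto simp: y_def)
    have my: "a \<odot>\<^bsub>M\<^esub> y \<in> U" if a: "a \<in> \<mm>" for a
    proof -
      obtain k :: nat where "a [^] k \<odot>\<^bsub>M\<^esub> y \<in> B" using tor[OF y(1) a] by blast
      hence "a [^] k \<in> ?p" using sU a m_subset by (auto simp: y_def)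
      hence "a \<in> ?p" using R.primeideal_pow_mem[OF pr] a m_subset by blast
      thus ?thesis by (simp add: y_def)
    qed
    let ?C = "(\<lambda>b. b \<odot>\<^bsub>M\<^esub> y) ` carrier R"
    have C: "submodule ?C R M" by (rule submodule_cyclic[OF y(3)])
    let ?V = "U <+>\<^bsub>M\<^esub> ?C"
    note V = submodule_set_add[OF sU(1) C] set_add_upper[OF sU(1) C]
    have CZ: "?C \<subseteq> Z" using cZ(7)[OF _ y(1)] by blast
    have VZ: "?V \<subseteq> Z" by (rule set_add_least[OF Z sU(3) CZ])
    have two: "W = U \<or> W = ?V" if W: "W \<in> interval U ?V" for W
    proof (rule disjCI)
      assume "W \<noteq> ?V"
      have sW: "submodule W R M" "U \<subseteq> W" "W \<subseteq> ?V" using W by (auto simp: interval_def)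
      have yW: "y \<notin> W"
      proof
        assume "y \<in> W"
        hence "?C \<subseteq> W" using submodule_closed(7)[OF sW(1)] by blast
        hence "?V \<subseteq> W" using set_add_least[OF sW(1,2)] by blast
        thus False using sW \<open>W \<noteq> ?V\<close> by blast
      qed
      have "w \<in> U" if w: "w \<in> W" for w
      proof -
        obtain u b where *: "u \<in> U" "b \<in> carrier R" "w = u \<oplus>\<^bsub>M\<^esub> b \<odot>\<^bsub>M\<^esub> y"
          using sW(3) w by (blast elim: set_addE)
        have "b \<odot>\<^bsub>M\<^esub> y \<in> W" using submodule_add_cancel[OF sW(1), of u] * w sW(2) y(3) by blast
        hence "b \<in> \<mm>" using smult_unit_mem[OF sW(1) *(2) _ y(3)] yW by blast
        thus ?thesis using my * cU by blast
      qed
      thus "W = U" using sW by blast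
    qed
    have "artinian_interval U ?V"
      unfolding extremal_condition_def
    proof (intro allI impI)
      fix G assume G: "G \<subseteq> interval U ?V" "G \<noteq> {}"
      have UV: "U \<subseteq> ?V" by (rule V(2))
      show "\<exists>W\<in>G. \<forall>W'\<in>G. W \<supseteq> W' \<longrightarrow> W' = W"
      proof (cases "U \<in> G")
        case True
        have "W' = U" if "W' \<in> G" "W' \<subseteq> U" for W'
        proof -
          have "W' \<in> interval U ?V" using that G by blast
          thus ?thesis using that by (auto simp: interval_def)
        qed
        thus ?thesis using True by blast
      next
        case False
        hence "W = ?V" if "W \<in> G" for W using two[of W] that G by blast
        thus ?thesis using G by blast
      qed
    qed
    hence "artinian_interval B ?V"
      by (rule interval_condition_extend[OF _ sU(1,2) V(2,1) aU, rotated]) simp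
    hence "?V \<in> F" using V sU VZ by (auto simp: F_def interval_def)
    hence "?V = U" using U V by blast
    thus False using V(3) mem_cyclic[OF y(3)] y(2) by blast
  qed
  thus ?thesis using aU by simp
qed

text \<open>A weak form of secondary representation: \<open>\<P>\<close> contains the attached primes of \<open>L/B\<close> except \<open>\<mm>\<close>,
  whose share of \<open>L/B\<close> is killed by a power of \<open>\<mm>\<close>.\<close>

definition finitely_attached :: "'c set \<Rightarrow> 'c set \<Rightarrow> bool"
  where "finitely_attached B L \<longleftrightarrow> (\<exists>\<P> n. finite \<P> \<and> (\<forall>p\<in>\<P>. primeideal p R \<and> \<not> \<mm> \<subseteq> p) \<and>
    (\<forall>r\<in>carrier R. (\<forall>p\<in>\<P>. r \<notin> p) \<longrightarrow> L \<subseteq> colon_power \<mm> (B <+>\<^bsub>M\<^esub> (\<lambda>x. r \<odot>\<^bsub>M\<^esub> x) ` L) n))"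

lemma finitely_attachedE:
  assumes "finitely_attached B L"
  obtains \<P> n where "finite \<P>" "\<forall>p\<in>\<P>. primeideal p R \<and> \<not> \<mm> \<subseteq> p"
    "\<forall>r\<in>carrier R. (\<forall>p\<in>\<P>. r \<notin> p) \<longrightarrow>
      L \<subseteq> colon_power \<mm> (B <+>\<^bsub>M\<^esub> (\<lambda>x. r \<odot>\<^bsub>M\<^esub> x) ` L) n"
proof -
  from assms obtain \<P> n where *: "finite \<P> \<and> (\<forall>p\<in>\<P>. primeideal p R \<and> \<not> \<mm> \<subseteq> p) \<and>
    (\<forall>r\<in>carrier R. (\<forall>p\<in>\<P>. r \<notin> p) \<longrightarrow> L \<subseteq> colon_power \<mm> (B <+>\<^bsub>M\<^esub> (\<lambda>x. r \<odot>\<^bsub>M\<^esub> x) ` L) n)"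
    unfolding finitely_attached_def by (elim exE)
  show thesis by (rule that[of \<P> n]) (use * in simp_all)
qed

lemma finitely_attached_sum:
  assumes B: "submodule B R M" and L: "submodule L R M"
    and L1: "submodule L1 R M" "L1 \<subseteq> L" and L2: "submodule L2 R M" "L2 \<subseteq> L"
    and sum: "L \<subseteq> L1 <+>\<^bsub>M\<^esub> L2"
    and f1: "finitely_attached B L1" and f2: "finitely_attached B L2"
  shows "finitely_attached B L"
proof -
  obtain P1 n1 where 1: "finite P1" "\<forall>p\<in>P1. primeideal p R \<and> \<not> \<mm> \<subseteq> p"
    "\<forall>r\<in>carrier R. (\<forall>p\<in>P1. r \<notin> p) \<longrightarrow>
      L1 \<subseteq> colon_power \<mm> (B <+>\<^bsub>M\<^esub> (\<lambda>x. r \<odot>\<^bsub>M\<^esub> x) ` L1) n1"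
    using finitely_attachedE[OF f1] .
  obtain P2 n2 where 2: "finite P2" "\<forall>p\<in>P2. primeideal p R \<and> \<not> \<mm> \<subseteq> p"
    "\<forall>r\<in>carrier R. (\<forall>p\<in>P2. r \<notin> p) \<longrightarrow>
      L2 \<subseteq> colon_power \<mm> (B <+>\<^bsub>M\<^esub> (\<lambda>x. r \<odot>\<^bsub>M\<^esub> x) ` L2) n2"
    using finitely_attachedE[OF f2] .
  have "L \<subseteq> colon_power \<mm> (B <+>\<^bsub>M\<^esub> (\<lambda>x. r \<odot>\<^bsub>M\<^esub> x) ` L) (max n1 n2)"
    if r: "r \<in> carrier R" "\<forall>p\<in>P1 \<union> P2. r \<notin> p" for r
  proof -
    let ?V = "B <+>\<^bsub>M\<^esub> (\<lambda>x. r \<odot>\<^bsub>M\<^esub> x) ` L"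
    have V: "submodule ?V R M" by (intro submodule_set_add submodule_smult_image B L r)
    have s: "submodule (colon_power \<mm> ?V (max n1 n2)) R M" by (rule submodule_colon_power[OF V m_subset])
    have "L1 \<subseteq> colon_power \<mm> (B <+>\<^bsub>M\<^esub> (\<lambda>x. r \<odot>\<^bsub>M\<^esub> x) ` L1) n1" by (rule 1(3)[rule_format]) (use r in blast)+
    also have "\<dots> \<subseteq> colon_power \<mm> ?V n1"
      by (intro colon_power_mono_target set_add_mono image_mono L1) simp
    also have "\<dots> \<subseteq> colon_power \<mm> ?V (max n1 n2)" by (rule colon_power_mono[OF V m_subset]) simp
    finally have i1: "L1 \<subseteq> colon_power \<mm> ?V (max n1 n2)" .
    have "L2 \<subseteq> colon_power \<mm> (B <+>\<^bsub>M\<^esub> (\<lambda>x. r \<odot>\<^bsub>M\<^esub> x) ` L2) n2" by (rule 2(3)[rule_format]) (use r in blast)+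
    also have "\<dots> \<subseteq> colon_power \<mm> ?V n2"
      by (intro colon_power_mono_target set_add_mono image_mono L2) simp
    also have "\<dots> \<subseteq> colon_power \<mm> ?V (max n1 n2)" by (rule colon_power_mono[OF V m_subset]) simp
    finally have i2: "L2 \<subseteq> colon_power \<mm> ?V (max n1 n2)" .
    show ?thesis using sum set_add_least[OF s i1 i2] by blast
  qed
  moreover have "finite (P1 \<union> P2)" "\<forall>p\<in>P1 \<union> P2. primeideal p R \<and> \<not> \<mm> \<subseteq> p" using 1(1,2) 2(1,2) by blast+
  ultimately show ?thesis unfolding finitely_attached_def
    by (intro exI[of _ "P1 \<union> P2"] exI[of _ "max n1 n2"] conjI ballI impI) simp_all
qed

text \<open>The elements that act nilpotently on \<open>L/B\<close> form its only attached prime, unless \<open>L = B\<close>. If this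
  prime is \<open>\<mm>\<close>, then a power of \<open>\<mm>\<close> kills \<open>L/B\<close>.\<close>

lemma finitely_attached_irreducible:
  assumes B: "submodule B R M" and L: "submodule L R M" and BL: "B \<subseteq> L"
    and dich: "\<And>r. r \<in> carrier R \<Longrightarrow>
      L \<subseteq> B <+>\<^bsub>M\<^esub> (\<lambda>x. r \<odot>\<^bsub>M\<^esub> x) ` L \<or> (\<exists>k::nat. \<forall>x\<in>L. r [^] k \<odot>\<^bsub>M\<^esub> x \<in> B)"
  shows "finitely_attached B L"
proof -
  note cB = submodule_closed[OF B] and cL = submodule_closed[OF L]
  have V: "submodule (B <+>\<^bsub>M\<^esub> (\<lambda>x. r \<odot>\<^bsub>M\<^esub> x) ` L) R M" if "r \<in> carrier R" for r
    by (intro submodule_set_add submodule_smult_image B L that)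
  have BV: "B \<subseteq> B <+>\<^bsub>M\<^esub> (\<lambda>x. r \<odot>\<^bsub>M\<^esub> x) ` L" if "r \<in> carrier R" for r
    by (intro set_add_upper B submodule_smult_image L that)
  define p where "p = {r \<in> carrier R. \<exists>k::nat. \<forall>x\<in>L. r [^] k \<odot>\<^bsub>M\<^esub> x \<in> B}"
  show ?thesis
  proof (cases "\<mm> \<subseteq> p \<or> \<one> \<in> p")
    case True
    have "\<exists>n. L \<subseteq> colon_power \<mm> B n"
    proof (cases "\<one> \<in> p")
      case True
      hence "L \<subseteq> B" using cL unfolding p_def by auto
      thus ?thesis by (intro exI[of _ 0]) simp
    next
      case False
      show ?thesis
        by (rule nilpotent_uniform[OF B ideal_m cL(1)]) (use True False in \<open>auto simp: p_def\<close>)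
    qed
    then obtain n where n: "L \<subseteq> colon_power \<mm> B n" by blast
    have "L \<subseteq> colon_power \<mm> (B <+>\<^bsub>M\<^esub> (\<lambda>x. r \<odot>\<^bsub>M\<^esub> x) ` L) n" if "r \<in> carrier R" for r
      using n colon_power_mono_target[OF BV[OF that]] by blast
    thus ?thesis unfolding finitely_attached_def by (intro exI[of _ "{}"] exI[of _ n]) blast
  next
    case False
    have pD: "r \<in> carrier R" "\<exists>k::nat. \<forall>x\<in>L. r [^] k \<odot>\<^bsub>M\<^esub> x \<in> B" if "r \<in> p" for r
      using that by (auto simp: p_def)
    have ip: "ideal p R"
    proof -
      interpret nc: noetherian_cring R by unfold_locales
      interpret N: noetherian_base_module R "regular_module R" by (rule nc.regular_noetherian_base_module)
      have "submodule p R (regular_module R)"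
      proof (rule N.submoduleI')
        show "p \<subseteq> carrier (regular_module R)" by (auto simp: p_def)
        have "\<zero> [^] (1::nat) \<odot>\<^bsub>M\<^esub> x \<in> B" if "x \<in> L" for x using that cL cB by simp
        thus "\<zero>\<^bsub>regular_module R\<^esub> \<in> p"
          unfolding p_def regular_module_simps by blast
        fix r s assume "r \<in> p" "s \<in> p"
        then obtain k l :: nat where *: "r \<in> carrier R" "s \<in> carrier R" "\<And>x. x \<in> L \<Longrightarrow> r [^] k \<odot>\<^bsub>M\<^esub> x \<in> B"
          "\<And>x. x \<in> L \<Longrightarrow> s [^] l \<odot>\<^bsub>M\<^esub> x \<in> B" unfolding p_def by blast
        have "(r \<oplus> s) [^] (k + l) \<odot>\<^bsub>M\<^esub> x \<in> B" if "x \<in> L" for x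
          by (rule add_pow_smult_mem[OF B]) (use * that cL in auto)
        thus "r \<oplus>\<^bsub>regular_module R\<^esub> s \<in> p"
          unfolding p_def regular_module_simps using *(1,2) R.a_closed by blast
      next
        fix c r assume c: "c \<in> carrier R" and "r \<in> p"
        then obtain k :: nat where *: "r \<in> carrier R" "\<And>x. x \<in> L \<Longrightarrow> r [^] k \<odot>\<^bsub>M\<^esub> x \<in> B"
          unfolding p_def by blast
        have "(c \<otimes> r) [^] k \<odot>\<^bsub>M\<^esub> x \<in> B" if x: "x \<in> L" for x
        proof -
          have "(c \<otimes> r) [^] k \<odot>\<^bsub>M\<^esub> x = c [^] k \<odot>\<^bsub>M\<^esub> (r [^] k \<odot>\<^bsub>M\<^esub> x)"
            using * c x cL by (simp add: R.nat_pow_distrib smult_assoc1)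
          thus ?thesis using cB(7)[OF _ *(2)[OF x]] c by simp
        qed
        thus "c \<odot>\<^bsub>regular_module R\<^esub> r \<in> p"
          unfolding p_def regular_module_simps using *(1) c R.m_closed by blast
      qed
      thus ?thesis by (simp add: nc.submodule_regular_iff)
    qed
    have prime: "b \<in> p" if ab: "a \<in> carrier R" "b \<in> carrier R" "a \<otimes> b \<in> p" "a \<notin> p" for a b
    proof -
      obtain k :: nat where k: "\<And>x. x \<in> L \<Longrightarrow> (a \<otimes> b) [^] k \<odot>\<^bsub>M\<^esub> x \<in> B" using pD(2)[OF ab(3)] by blast
      have ak: "a [^] k \<in> carrier R" "b [^] k \<in> carrier R" using ab by auto
      have no: "\<not> (\<exists>j::nat. \<forall>x\<in>L. (a [^] k) [^] j \<odot>\<^bsub>M\<^esub> x \<in> B)"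
      proof
        assume "\<exists>j::nat. \<forall>x\<in>L. (a [^] k) [^] j \<odot>\<^bsub>M\<^esub> x \<in> B"
        then obtain j :: nat where "\<forall>x\<in>L. a [^] (k * j) \<odot>\<^bsub>M\<^esub> x \<in> B"
          using ab(1) by (auto simp: R.nat_pow_pow)
        thus False using ab unfolding p_def by blast
      qed
      have "b [^] k \<odot>\<^bsub>M\<^esub> y \<in> B" if y: "y \<in> L" for y
      proof -
        obtain b0 y' where *: "b0 \<in> B" "y' \<in> L" "y = b0 \<oplus>\<^bsub>M\<^esub> a [^] k \<odot>\<^bsub>M\<^esub> y'"
          using dich[OF ak(1)] no y by (blast elim: set_addE)
        have carr: "b0 \<in> carrier M" "y' \<in> carrier M" using * cB cL by auto
        have "b [^] k \<odot>\<^bsub>M\<^esub> y = b [^] k \<odot>\<^bsub>M\<^esub> b0 \<oplus>\<^bsub>M\<^esub> (a [^] k \<otimes> b [^] k) \<odot>\<^bsub>M\<^esub> y'"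
          unfolding *(3) using ak carr by algebra
        also have "a [^] k \<otimes> b [^] k = (a \<otimes> b) [^] k" using ab by (simp add: R.nat_pow_distrib)
        finally show ?thesis using cB(4)[OF cB(7)[OF ak(2) *(1)] k[OF *(2)]] by simp
      qed
      thus ?thesis unfolding p_def using ab by blast
    qed
    have pr: "primeideal p R"
    proof (rule primeidealI[OF ip R.is_cring])
      show "carrier R \<noteq> p" using False by blast
    qed (use prime in blast)
    have "L \<subseteq> colon_power \<mm> (B <+>\<^bsub>M\<^esub> (\<lambda>x. r \<odot>\<^bsub>M\<^esub> x) ` L) 0" if "r \<in> carrier R" "r \<notin> p" for r
      using dich[OF that(1)] that by (auto simp: p_def)
    thus ?thesis
      unfolding finitely_attached_def using pr False by (intro exI[of _ "{p}"] exI[of _ 0]) blast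
  qed
qed

text \<open>A minimal counterexample is not a sum of two smaller submodules, so by Fitting's decomposition each
  ring element acts on it surjectively or nilpotently.\<close>

lemma artinian_finitely_attached:
  assumes B: "submodule B R M" and Z: "submodule Z R M" and BZ: "B \<subseteq> Z"
    and art: "artinian_interval B Z"
  shows "finitely_attached B Z"
proof (rule ccontr)
  assume "\<not> finitely_attached B Z"
  define F where "F = {L \<in> interval B Z. \<not> finitely_attached B L}"
  have "F \<subseteq> interval B Z" "Z \<in> F" using \<open>\<not> finitely_attached B Z\<close> Z BZ by (auto simp: F_def interval_def)
  hence "\<exists>U\<in>F. \<forall>V\<in>F. U \<supseteq> V \<longrightarrow> V = U" by (rule extremal_conditionD[OF art])
  then obtain L where L: "L \<in> F" "\<forall>V\<in>F. L \<supseteq> V \<longrightarrow> V = L" by (rule bexE)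
  have sL: "submodule L R M" "B \<subseteq> L" "L \<subseteq> Z" and bad: "\<not> finitely_attached B L"
    using L by (auto simp: F_def interval_def)
  note cB = submodule_closed[OF B] and cL = submodule_closed[OF sL(1)]
  have good: "finitely_attached B V" if "submodule V R M" "B \<subseteq> V" "V \<subseteq> L" "V \<noteq> L" for V
    using L(2) that sL unfolding F_def interval_def by blast
  have "L \<subseteq> B <+>\<^bsub>M\<^esub> (\<lambda>x. r \<odot>\<^bsub>M\<^esub> x) ` L \<or> (\<exists>k::nat. \<forall>x\<in>L. r [^] k \<odot>\<^bsub>M\<^esub> x \<in> B)"
    if r: "r \<in> carrier R" for r
  proof -
    have rk: "r [^] (k::nat) \<in> carrier R" for k using r by simp
    define A where "A k = B <+>\<^bsub>M\<^esub> (\<lambda>x. r [^] k \<odot>\<^bsub>M\<^esub> x) ` L" for k :: nat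
    have im: "submodule ((\<lambda>x. r [^] k \<odot>\<^bsub>M\<^esub> x) ` L) R M" for k :: nat
      by (rule submodule_smult_image[OF sL(1) rk])
    have imL: "(\<lambda>x. r [^] k \<odot>\<^bsub>M\<^esub> x) ` L \<subseteq> L" for k :: nat using cL(7)[OF rk] by blast
    have A: "submodule (A k) R M" "B \<subseteq> A k" "A k \<subseteq> L" for k
      unfolding A_def using submodule_set_add[OF B im] set_add_upper(1)[OF B im]
        set_add_least[OF sL(1,2) imL] by blast+
    have AI: "A k \<in> interval B Z" for k using A[of k] sL by (auto simp: interval_def)
    have AS: "A (Suc k) \<subseteq> A k" for k
      unfolding A_def
    proof (intro set_add_mono subset_refl image_subsetI)
      fix x assume x: "x \<in> L"
      hence "r [^] Suc k \<odot>\<^bsub>M\<^esub> x = r [^] k \<odot>\<^bsub>M\<^esub> (r \<odot>\<^bsub>M\<^esub> x)" using smult_pow_Suc[OF r] cL by blast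
      thus "r [^] Suc k \<odot>\<^bsub>M\<^esub> x \<in> (\<lambda>x. r [^] k \<odot>\<^bsub>M\<^esub> x) ` L" using cL(7)[OF r x] by blast
    qed
    obtain n where n: "\<And>i. n \<le> i \<Longrightarrow> A i = A n"
      by (rule descending_sequence_stabilizes[OF art, of A]) (use AI AS in blast)+
    define k where "k = Suc n"
    have k: "A (2 * k) = A k" using n[of k] n[of "2 * k"] by (simp add: k_def)
    define K where "K = {x \<in> L. r [^] k \<odot>\<^bsub>M\<^esub> x \<in> B}"
    have K: "submodule K R M" "B \<subseteq> K" "K \<subseteq> L"
      unfolding K_def using submodule_preimage_smult[OF B sL(1) rk] sL(2) cB(7)[OF rk] by blast+
    have sum: "L \<subseteq> A k <+>\<^bsub>M\<^esub> K"
    proof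
      fix x assume x: "x \<in> L"
      obtain y where y: "y \<in> L" "r [^] k \<odot>\<^bsub>M\<^esub> (x \<ominus>\<^bsub>M\<^esub> r [^] k \<odot>\<^bsub>M\<^esub> y) \<in> B"
        using stable_power_image[OF sL(1) B r k[unfolded A_def] x] by blast
      have carr: "x \<in> carrier M" "y \<in> carrier M" using x y cL by auto
      have "x \<ominus>\<^bsub>M\<^esub> r [^] k \<odot>\<^bsub>M\<^esub> y \<in> K"
        unfolding K_def using y cL(5)[OF x cL(7)[OF rk y(1)]] by blast
      moreover have "r [^] k \<odot>\<^bsub>M\<^esub> y \<in> A k" unfolding A_def using set_add_upper(2)[OF B im] y(1) by blast
      ultimately have "r [^] k \<odot>\<^bsub>M\<^esub> y \<oplus>\<^bsub>M\<^esub> (x \<ominus>\<^bsub>M\<^esub> r [^] k \<odot>\<^bsub>M\<^esub> y) \<in> A k <+>\<^bsub>M\<^esub> K" by (intro set_addI)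
      moreover have "r [^] k \<odot>\<^bsub>M\<^esub> y \<oplus>\<^bsub>M\<^esub> (x \<ominus>\<^bsub>M\<^esub> r [^] k \<odot>\<^bsub>M\<^esub> y) = x"
        using carr rk[of k] by algebra
      ultimately show "x \<in> A k <+>\<^bsub>M\<^esub> K" by simp
    qed
    have "A k = L \<or> K = L"
    proof (rule ccontr)
      assume "\<not> (A k = L \<or> K = L)"
      hence "finitely_attached B L"
        using finitely_attached_sum[OF B sL(1) A(1,3)[of k] K(1,3) sum] good A[of k] K by blast
      thus False using bad by blast
    qed
    moreover have "A k \<subseteq> A 1" unfolding k_def
      by (induct n) (use AS in auto)
    ultimately show ?thesis using r unfolding A_def K_def by auto
  qed
  from finitely_attached_irreducible[OF B sL(1,2) this] show False using bad by blast
qed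

text \<open>Prime avoidance gives an \<open>r\<close> outside all attached primes except \<open>\<mm>\<close>. The part that is only killed
  by a power of \<open>\<mm>\<close> does no harm, since \<open>Z/B\<close> is equal to \<open>\<mm>\<close> times itself.\<close>

lemma artinian_divisible:
  assumes B: "submodule B R M" and Z: "submodule Z R M" and BZ: "B \<subseteq> Z"
    and art: "artinian_interval B Z" and div: "Z \<subseteq> B <+>\<^bsub>M\<^esub> ideal_multiples M \<mm> Z"
  shows "\<exists>r\<in>\<mm>. Z \<subseteq> B <+>\<^bsub>M\<^esub> (\<lambda>x. r \<odot>\<^bsub>M\<^esub> x) ` Z"
proof -
  obtain \<P> n where P: "finite \<P>" "\<forall>p\<in>\<P>. primeideal p R \<and> \<not> \<mm> \<subseteq> p"
    "\<forall>r\<in>carrier R. (\<forall>p\<in>\<P>. r \<notin> p) \<longrightarrow>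
      Z \<subseteq> colon_power \<mm> (B <+>\<^bsub>M\<^esub> (\<lambda>x. r \<odot>\<^bsub>M\<^esub> x) ` Z) n"
    using finitely_attachedE[OF artinian_finitely_attached[OF B Z BZ art]] .
  obtain r where r: "r \<in> \<mm>" "\<forall>p\<in>\<P>. r \<notin> p" using R.prime_avoidance[OF P(1) _ ideal_m] P(2) by blast
  have rc: "r \<in> carrier R" using r m_subset by blast
  let ?V = "B <+>\<^bsub>M\<^esub> (\<lambda>x. r \<odot>\<^bsub>M\<^esub> x) ` Z"
  have im: "submodule ((\<lambda>x. r \<odot>\<^bsub>M\<^esub> x) ` Z) R M" by (rule submodule_smult_image[OF Z rc])
  have V: "submodule ?V R M" by (rule submodule_set_add[OF B im])
  have "Z \<subseteq> colon_power \<mm> ?V n" by (rule P(3)[rule_format, OF rc]) (use r(2) in blast)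
  hence "Z \<subseteq> ?V"
  proof (induct n)
    case 0 thus ?case by simp
  next
    case (Suc n)
    have s: "submodule (colon_power \<mm> ?V n) R M" by (rule submodule_colon_power[OF V m_subset])
    have "ideal_multiples M \<mm> Z \<subseteq> colon_power \<mm> ?V n"
      by (rule ideal_multiples_least[OF s]) (use Suc(2) in auto)
    moreover have "B \<subseteq> colon_power \<mm> ?V n"
      using set_add_upper(1)[OF B im] colon_power_mono[OF V m_subset, of 0 n] by auto
    ultimately have "Z \<subseteq> colon_power \<mm> ?V n" using div set_add_least[OF s] by blast
    thus ?case by (rule Suc(1))
  qed
  thus ?thesis using r by blast
qed

end

section \<open>Complexes inside one module and mapping cones\<close>

lemma (in module) mod_hom_props:
  assumes f: "f \<in> mod_hom R M M"
  shows "x \<in> carrier M \<Longrightarrow> f x \<in> carrier M"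
    and "x \<in> carrier M \<Longrightarrow> y \<in> carrier M \<Longrightarrow> f (x \<oplus>\<^bsub>M\<^esub> y) = f x \<oplus>\<^bsub>M\<^esub> f y"
    and "r \<in> carrier R \<Longrightarrow> x \<in> carrier M \<Longrightarrow> f (r \<odot>\<^bsub>M\<^esub> x) = r \<odot>\<^bsub>M\<^esub> f x"
    and "f \<zero>\<^bsub>M\<^esub> = \<zero>\<^bsub>M\<^esub>"
    and "x \<in> carrier M \<Longrightarrow> f (\<ominus>\<^bsub>M\<^esub> x) = \<ominus>\<^bsub>M\<^esub> f x"
    and "x \<in> carrier M \<Longrightarrow> y \<in> carrier M \<Longrightarrow> f (x \<ominus>\<^bsub>M\<^esub> y) = f x \<ominus>\<^bsub>M\<^esub> f y"
proof -
  note D = mod_homD[OF f]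
  show 1: "x \<in> carrier M \<Longrightarrow> f x \<in> carrier M" for x by (rule D(1))
  show 2: "x \<in> carrier M \<Longrightarrow> y \<in> carrier M \<Longrightarrow> f (x \<oplus>\<^bsub>M\<^esub> y) = f x \<oplus>\<^bsub>M\<^esub> f y" for x y by (rule D(2))
  show 3: "r \<in> carrier R \<Longrightarrow> x \<in> carrier M \<Longrightarrow> f (r \<odot>\<^bsub>M\<^esub> x) = r \<odot>\<^bsub>M\<^esub> f x" for r x by (rule D(3))
  show "f \<zero>\<^bsub>M\<^esub> = \<zero>\<^bsub>M\<^esub>" using 3[OF R.zero_closed M.zero_closed] 1[OF M.zero_closed] by simp
  show 5: "x \<in> carrier M \<Longrightarrow> f (\<ominus>\<^bsub>M\<^esub> x) = \<ominus>\<^bsub>M\<^esub> f x" for x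
    using 3[of "\<ominus> \<one>" x] 1[of x] by (simp add: smult_l_minus)
  show "x \<in> carrier M \<Longrightarrow> y \<in> carrier M \<Longrightarrow> f (x \<ominus>\<^bsub>M\<^esub> y) = f x \<ominus>\<^bsub>M\<^esub> f y"
    using 2[of x "\<ominus>\<^bsub>M\<^esub> y"] 5[of y] by (simp add: M.minus_eq)
qed

text \<open>All complexes live inside one module \<open>M\<close> that is isomorphic to its own square by \<open>pair\<close>. So
  mapping cones, also iterated ones, are families of submodules of the same module, and the
  inductions over them stay within one type.\<close>

locale paired_local_module = noetherian_local_module R M \<mm> for R (structure) and M (structure) and \<mm> +
  fixes pair :: "'c \<Rightarrow> 'c \<Rightarrow> 'c" and p1 p2 :: "'c \<Rightarrow> 'c"
  assumes p1_hom: "p1 \<in> mod_hom R M M" and p2_hom: "p2 \<in> mod_hom R M M"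
    and pair_closed [simp]: "x \<in> carrier M \<Longrightarrow> y \<in> carrier M \<Longrightarrow> pair x y \<in> carrier M"
    and p1_pair [simp]: "x \<in> carrier M \<Longrightarrow> y \<in> carrier M \<Longrightarrow> p1 (pair x y) = x"
    and p2_pair [simp]: "x \<in> carrier M \<Longrightarrow> y \<in> carrier M \<Longrightarrow> p2 (pair x y) = y"
    and pair_p1_p2: "u \<in> carrier M \<Longrightarrow> pair (p1 u) (p2 u) = u"
begin

lemma pair_eqI:
  assumes "u \<in> carrier M" "v \<in> carrier M" "p1 u = p1 v" "p2 u = p2 v"
  shows "u = v"
proof -
  have "u = pair (p1 u) (p2 u)" by (rule pair_p1_p2[OF assms(1), symmetric])
  also have "\<dots> = pair (p1 v) (p2 v)" by (simp only: assms(3,4))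
  also have "\<dots> = v" by (rule pair_p1_p2[OF assms(2)])
  finally show ?thesis .
qed

lemmas p1_simps [simp] = mod_hom_props[OF p1_hom]
lemmas p2_simps [simp] = mod_hom_props[OF p2_hom]

definition is_complex :: "(int \<Rightarrow> 'c set) \<Rightarrow> ('c \<Rightarrow> 'c) \<Rightarrow> bool"
  where "is_complex C D \<longleftrightarrow> D \<in> mod_hom R M M \<and> (\<forall>j. submodule (C j) R M) \<and>
    (\<forall>j. \<forall>x\<in>C j. D x \<in> C (j + 1) \<and> D (D x) = \<zero>\<^bsub>M\<^esub>)"

text \<open>The usual letters: cocycles \<open>Z\<close> and coboundaries \<open>B\<close> of the complex \<open>C\<close>.\<close>

definition Zc :: "(int \<Rightarrow> 'c set) \<Rightarrow> ('c \<Rightarrow> 'c) \<Rightarrow> int \<Rightarrow> 'c set"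
  where "Zc C D j = {x \<in> C j. D x = \<zero>\<^bsub>M\<^esub>}"

definition Bc :: "(int \<Rightarrow> 'c set) \<Rightarrow> ('c \<Rightarrow> 'c) \<Rightarrow> int \<Rightarrow> 'c set"
  where "Bc C D j = D ` C (j - 1)"

lemma complexD:
  assumes "is_complex C D"
  shows "D \<in> mod_hom R M M" "submodule (C j) R M" "x \<in> C j \<Longrightarrow> D x \<in> C (j + 1)"
    "x \<in> C j \<Longrightarrow> D (D x) = \<zero>\<^bsub>M\<^esub>" "x \<in> C j \<Longrightarrow> x \<in> carrier M"
proof -
  show "D \<in> mod_hom R M M" "submodule (C j) R M" "x \<in> C j \<Longrightarrow> D x \<in> C (j + 1)"
    "x \<in> C j \<Longrightarrow> D (D x) = \<zero>\<^bsub>M\<^esub>"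
    using assms unfolding is_complex_def by blast+
  thus "x \<in> C j \<Longrightarrow> x \<in> carrier M" using submodule_closed(2) by blast
qed

lemma complex_submodules:
  assumes C: "is_complex C D"
  shows "submodule (Zc C D j) R M" "submodule (Bc C D j) R M" "Bc C D j \<subseteq> Zc C D j"
proof -
  note D = mod_hom_props[OF complexD(1)[OF C]]
  note c = submodule_closed[OF complexD(2)[OF C, of j]]
  note c' = submodule_closed[OF complexD(2)[OF C, of "j - 1"]]
  show "submodule (Zc C D j) R M"
    by (rule submoduleI') (use c D in \<open>auto simp: Zc_def\<close>)
  show "submodule (Bc C D j) R M"
  proof (rule submoduleI')
    show "Bc C D j \<subseteq> carrier M" using c' D by (auto simp: Bc_def)
    show "\<zero>\<^bsub>M\<^esub> \<in> Bc C D j" unfolding Bc_def using c' D(4) by (intro image_eqI[of _ _ "\<zero>\<^bsub>M\<^esub>"]) auto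
    fix x y assume "x \<in> Bc C D j" "y \<in> Bc C D j"
    then obtain u v where "u \<in> C (j - 1)" "v \<in> C (j - 1)" "x = D u" "y = D v" by (auto simp: Bc_def)
    thus "x \<oplus>\<^bsub>M\<^esub> y \<in> Bc C D j" unfolding Bc_def using c' D(2)
      by (intro image_eqI[of _ _ "u \<oplus>\<^bsub>M\<^esub> v"]) auto
  next
    fix a x assume "a \<in> carrier R" "x \<in> Bc C D j"
    then obtain u where "u \<in> C (j - 1)" "x = D u" "a \<in> carrier R" by (auto simp: Bc_def)
    thus "a \<odot>\<^bsub>M\<^esub> x \<in> Bc C D j" unfolding Bc_def using c' D(3)
      by (intro image_eqI[of _ _ "a \<odot>\<^bsub>M\<^esub> u"]) auto
  qed
  show "Bc C D j \<subseteq> Zc C D j"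
    using complexD(3,4)[OF C, of _ "j - 1"] by (auto simp: Bc_def Zc_def)
qed

lemma BcI: "y \<in> C j \<Longrightarrow> D y \<in> Bc C D (j + 1)" "y \<in> C (j - 1) \<Longrightarrow> D y \<in> Bc C D j"
  by (auto simp: Bc_def)

lemma BcE:
  assumes "x \<in> Bc C D j"
  obtains y where "y \<in> C (j - 1)" "x = D y"
  using assms by (auto simp: Bc_def)

text \<open>The cone of multiplication by \<open>r\<close>, that is \<open>C\<close> tensored with the complex \<open>r : R \<rightarrow> R\<close> in degrees
  \<open>-1\<close> and \<open>0\<close>. With this shift its cohomology in the top degree of \<open>C\<close> is \<open>H/rH\<close>. It is a derived form of
  \<open>C/rC\<close>.\<close>

definition mapping_cone :: "(int \<Rightarrow> 'c set) \<Rightarrow> int \<Rightarrow> 'c set"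
  where "mapping_cone C j = {u \<in> carrier M. p1 u \<in> C j \<and> p2 u \<in> C (j + 1)}"

definition cone_diff :: "'a \<Rightarrow> ('c \<Rightarrow> 'c) \<Rightarrow> 'c \<Rightarrow> 'c"
  where "cone_diff r D u = pair (D (p1 u) \<oplus>\<^bsub>M\<^esub> r \<odot>\<^bsub>M\<^esub> p2 u) (\<ominus>\<^bsub>M\<^esub> D (p2 u))"

lemma cone_diff_props:
  assumes D: "D \<in> mod_hom R M M" and r: "r \<in> carrier R"
  shows "cone_diff r D \<in> mod_hom R M M"
    and "u \<in> carrier M \<Longrightarrow> p1 (cone_diff r D u) = D (p1 u) \<oplus>\<^bsub>M\<^esub> r \<odot>\<^bsub>M\<^esub> p2 u"
    and "u \<in> carrier M \<Longrightarrow> p2 (cone_diff r D u) = \<ominus>\<^bsub>M\<^esub> D (p2 u)"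
    and "x \<in> carrier M \<Longrightarrow> y \<in> carrier M \<Longrightarrow>
      cone_diff r D (pair x y) = pair (D x \<oplus>\<^bsub>M\<^esub> r \<odot>\<^bsub>M\<^esub> y) (\<ominus>\<^bsub>M\<^esub> D y)"
proof -
  note D' [simp] = mod_hom_props[OF D]
  have c: "cone_diff r D u \<in> carrier M" if "u \<in> carrier M" for u
    using that r by (simp add: cone_diff_def)
  show 1: "p1 (cone_diff r D u) = D (p1 u) \<oplus>\<^bsub>M\<^esub> r \<odot>\<^bsub>M\<^esub> p2 u"
    and 2: "p2 (cone_diff r D u) = \<ominus>\<^bsub>M\<^esub> D (p2 u)" if "u \<in> carrier M" for u
    using that r by (simp_all add: cone_diff_def)
  show "cone_diff r D (pair x y) = pair (D x \<oplus>\<^bsub>M\<^esub> r \<odot>\<^bsub>M\<^esub> y) (\<ominus>\<^bsub>M\<^esub> D y)"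
    if "x \<in> carrier M" "y \<in> carrier M"
    using that by (simp add: cone_diff_def)
  show "cone_diff r D \<in> mod_hom R M M"
    unfolding mod_hom_def
  proof (intro CollectI conjI ballI)
    show "cone_diff r D \<in> carrier M \<rightarrow> carrier M" using c by auto
    fix x y assume xy: "x \<in> carrier M" "y \<in> carrier M"
    show "cone_diff r D (x \<oplus>\<^bsub>M\<^esub> y) = cone_diff r D x \<oplus>\<^bsub>M\<^esub> cone_diff r D y"
    proof (rule pair_eqI)
      have cl: "D (p1 x) \<in> carrier M" "D (p1 y) \<in> carrier M" "D (p2 x) \<in> carrier M"
        "D (p2 y) \<in> carrier M" "p2 x \<in> carrier M" "p2 y \<in> carrier M" using xy by auto
      have "D (p1 x) \<oplus>\<^bsub>M\<^esub> D (p1 y) \<oplus>\<^bsub>M\<^esub> r \<odot>\<^bsub>M\<^esub> (p2 x \<oplus>\<^bsub>M\<^esub> p2 y) =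
        (D (p1 x) \<oplus>\<^bsub>M\<^esub> r \<odot>\<^bsub>M\<^esub> p2 x) \<oplus>\<^bsub>M\<^esub> (D (p1 y) \<oplus>\<^bsub>M\<^esub> r \<odot>\<^bsub>M\<^esub> p2 y)" using cl r by algebra
      thus "p1 (cone_diff r D (x \<oplus>\<^bsub>M\<^esub> y)) = p1 (cone_diff r D x \<oplus>\<^bsub>M\<^esub> cone_diff r D y)"
        using xy c by (simp add: 1)
      have "\<ominus>\<^bsub>M\<^esub> (D (p2 x) \<oplus>\<^bsub>M\<^esub> D (p2 y)) = \<ominus>\<^bsub>M\<^esub> D (p2 x) \<oplus>\<^bsub>M\<^esub> \<ominus>\<^bsub>M\<^esub> D (p2 y)" using cl by algebra
      thus "p2 (cone_diff r D (x \<oplus>\<^bsub>M\<^esub> y)) = p2 (cone_diff r D x \<oplus>\<^bsub>M\<^esub> cone_diff r D y)"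
        using xy c by (simp add: 2)
    qed (use xy c in auto)
  next
    fix a x assume x: "a \<in> carrier R" "x \<in> carrier M"
    show "cone_diff r D (a \<odot>\<^bsub>M\<^esub> x) = a \<odot>\<^bsub>M\<^esub> cone_diff r D x"
    proof (rule pair_eqI)
      have cl: "D (p1 x) \<in> carrier M" "D (p2 x) \<in> carrier M" "p2 x \<in> carrier M" using x by auto
      have "a \<odot>\<^bsub>M\<^esub> D (p1 x) \<oplus>\<^bsub>M\<^esub> r \<odot>\<^bsub>M\<^esub> (a \<odot>\<^bsub>M\<^esub> p2 x) = a \<odot>\<^bsub>M\<^esub> (D (p1 x) \<oplus>\<^bsub>M\<^esub> r \<odot>\<^bsub>M\<^esub> p2 x)"
        using cl x r by algebra
      thus "p1 (cone_diff r D (a \<odot>\<^bsub>M\<^esub> x)) = p1 (a \<odot>\<^bsub>M\<^esub> cone_diff r D x)" using x c by (simp add: 1)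
      show "p2 (cone_diff r D (a \<odot>\<^bsub>M\<^esub> x)) = p2 (a \<odot>\<^bsub>M\<^esub> cone_diff r D x)"
        using x c cl by (simp add: 2 smult_r_minus)
    qed (use x c in auto)
  qed
qed

lemma cone_complex:
  assumes C: "is_complex C D" and r: "r \<in> carrier R"
  shows "is_complex (mapping_cone C) (cone_diff r D)"
  unfolding is_complex_def
proof (intro conjI allI ballI)
  note D = mod_hom_props[OF complexD(1)[OF C]]
  note E = cone_diff_props[OF complexD(1)[OF C] r]
  show "cone_diff r D \<in> mod_hom R M M" by (rule E(1))
  fix j
  note c = submodule_closed[OF complexD(2)[OF C, of j]]
  note c1 = submodule_closed[OF complexD(2)[OF C, of "j + 1"]]
  note c2 = submodule_closed[OF complexD(2)[OF C, of "j + 1 + 1"]]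
  show "submodule (mapping_cone C j) R M"
    by (rule submoduleI') (use c c1 in \<open>auto simp: mapping_cone_def\<close>)
  fix u assume "u \<in> mapping_cone C j"
  hence u: "u \<in> carrier M" "p1 u \<in> C j" "p2 u \<in> C (j + 1)" by (auto simp: mapping_cone_def)
  have Eu: "cone_diff r D u \<in> carrier M" by (rule mod_hom_props(1)[OF E(1) u(1)])
  have d: "D (p1 u) \<in> C (j + 1)" "D (p2 u) \<in> C (j + 1 + 1)" "D (D (p1 u)) = \<zero>\<^bsub>M\<^esub>" "D (D (p2 u)) = \<zero>\<^bsub>M\<^esub>"
    using complexD(3,4)[OF C] u by blast+
  have dc: "D (p1 u) \<in> carrier M" "D (p2 u) \<in> carrier M" using D(1) u(1) by auto
  have a: "D (p1 u) \<oplus>\<^bsub>M\<^esub> r \<odot>\<^bsub>M\<^esub> p2 u \<in> C (j + 1)" by (intro c1(4) c1(7) d u r)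
  show "cone_diff r D u \<in> mapping_cone C (j + 1)"
    unfolding mapping_cone_def using Eu E(2,3)[OF u(1)] a c2(6)[OF d(2)] by auto
  show "cone_diff r D (cone_diff r D u) = \<zero>\<^bsub>M\<^esub>"
  proof (rule pair_eqI)
    have "D (D (p1 u) \<oplus>\<^bsub>M\<^esub> r \<odot>\<^bsub>M\<^esub> p2 u) \<oplus>\<^bsub>M\<^esub> r \<odot>\<^bsub>M\<^esub> (\<ominus>\<^bsub>M\<^esub> D (p2 u)) = \<zero>\<^bsub>M\<^esub>"
      using D(2,3) dc r u(1) d by (simp add: smult_r_minus M.r_neg)
    thus "p1 (cone_diff r D (cone_diff r D u)) = p1 \<zero>\<^bsub>M\<^esub>" using E(2,3) Eu u(1) by simp
    show "p2 (cone_diff r D (cone_diff r D u)) = p2 \<zero>\<^bsub>M\<^esub>"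
      using E(2,3) Eu u(1) d dc D(5) M_minus_zero by simp
  qed (use Eu mod_hom_props(1)[OF E(1)] in auto)
qed

lemma Zc_cone_iff:
  assumes C: "is_complex C D" and r: "r \<in> carrier R"
  shows "u \<in> Zc (mapping_cone C) (cone_diff r D) j \<longleftrightarrow> u \<in> carrier M \<and> p1 u \<in> C j \<and>
    p2 u \<in> Zc C D (j + 1) \<and> D (p1 u) \<oplus>\<^bsub>M\<^esub> r \<odot>\<^bsub>M\<^esub> p2 u = \<zero>\<^bsub>M\<^esub>"
proof -
  note D = mod_hom_props[OF complexD(1)[OF C]]
  note E = cone_diff_props[OF complexD(1)[OF C] r]
  have "cone_diff r D u = \<zero>\<^bsub>M\<^esub> \<longleftrightarrow> D (p1 u) \<oplus>\<^bsub>M\<^esub> r \<odot>\<^bsub>M\<^esub> p2 u = \<zero>\<^bsub>M\<^esub> \<and> D (p2 u) = \<zero>\<^bsub>M\<^esub>" if u: "u \<in> carrier M"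
  proof
    assume "cone_diff r D u = \<zero>\<^bsub>M\<^esub>"
    hence "p1 (cone_diff r D u) = \<zero>\<^bsub>M\<^esub>" "p2 (cone_diff r D u) = \<zero>\<^bsub>M\<^esub>" by simp_all
    hence 0: "D (p1 u) \<oplus>\<^bsub>M\<^esub> r \<odot>\<^bsub>M\<^esub> p2 u = \<zero>\<^bsub>M\<^esub>" "\<ominus>\<^bsub>M\<^esub> D (p2 u) = \<zero>\<^bsub>M\<^esub>"
      unfolding E(2)[OF u] E(3)[OF u] .
    have "D (p2 u) = \<ominus>\<^bsub>M\<^esub> (\<ominus>\<^bsub>M\<^esub> D (p2 u))" using D(1) u by simp
    also have "\<dots> = \<zero>\<^bsub>M\<^esub>" unfolding 0(2) by (rule M_minus_zero)
    finally show "D (p1 u) \<oplus>\<^bsub>M\<^esub> r \<odot>\<^bsub>M\<^esub> p2 u = \<zero>\<^bsub>M\<^esub> \<and> D (p2 u) = \<zero>\<^bsub>M\<^esub>" using 0(1) by blast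
  next
    assume "D (p1 u) \<oplus>\<^bsub>M\<^esub> r \<odot>\<^bsub>M\<^esub> p2 u = \<zero>\<^bsub>M\<^esub> \<and> D (p2 u) = \<zero>\<^bsub>M\<^esub>"
    hence 0: "D (p1 u) \<oplus>\<^bsub>M\<^esub> r \<odot>\<^bsub>M\<^esub> p2 u = \<zero>\<^bsub>M\<^esub>" "D (p2 u) = \<zero>\<^bsub>M\<^esub>" by blast+
    show "cone_diff r D u = \<zero>\<^bsub>M\<^esub>"
    proof (rule pair_eqI)
      show "cone_diff r D u \<in> carrier M" by (rule mod_hom_props(1)[OF E(1) u])
      show "p1 (cone_diff r D u) = p1 \<zero>\<^bsub>M\<^esub>" unfolding E(2)[OF u] 0(1) by simp
      show "p2 (cone_diff r D u) = p2 \<zero>\<^bsub>M\<^esub>" unfolding E(3)[OF u] 0(2) using M_minus_zero by simp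
    qed simp
  qed
  thus ?thesis by (auto simp: Zc_def mapping_cone_def)
qed

lemma Bc_coneI:
  assumes C: "is_complex C D" and r: "r \<in> carrier R" and u: "u \<in> carrier M"
    and x: "x \<in> C (j - 1)" and y: "y \<in> C j"
    and "p1 u = D x \<oplus>\<^bsub>M\<^esub> r \<odot>\<^bsub>M\<^esub> y" "p2 u = \<ominus>\<^bsub>M\<^esub> D y"
  shows "u \<in> Bc (mapping_cone C) (cone_diff r D) j"
proof -
  note D = mod_hom_props[OF complexD(1)[OF C]]
  note E = cone_diff_props[OF complexD(1)[OF C] r]
  have c: "x \<in> carrier M" "y \<in> carrier M" using complexD(5)[OF C] x y by auto
  have "pair x y \<in> mapping_cone C (j - 1)" using c x y by (simp add: mapping_cone_def)
  moreover have "u = cone_diff r D (pair x y)"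
  proof (rule pair_eqI[OF u])
    have cl: "D x \<oplus>\<^bsub>M\<^esub> r \<odot>\<^bsub>M\<^esub> y \<in> carrier M" "\<ominus>\<^bsub>M\<^esub> D y \<in> carrier M" using c D(1) r by auto
    show "cone_diff r D (pair x y) \<in> carrier M" unfolding E(4)[OF c] using cl by simp
    show "p1 u = p1 (cone_diff r D (pair x y))" unfolding E(4)[OF c] assms(6) using cl by simp
    show "p2 u = p2 (cone_diff r D (pair x y))" unfolding E(4)[OF c] assms(7) using cl by simp
  qed
  ultimately show ?thesis by (auto simp: Bc_def)
qed

lemma Bc_coneE:
  assumes C: "is_complex C D" and r: "r \<in> carrier R" and u: "u \<in> Bc (mapping_cone C) (cone_diff r D) j"
  obtains x y where "x \<in> C (j - 1)" "y \<in> C j" "p1 u = D x \<oplus>\<^bsub>M\<^esub> r \<odot>\<^bsub>M\<^esub> y" "p2 u = \<ominus>\<^bsub>M\<^esub> D y"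
proof -
  obtain w where w: "w \<in> mapping_cone C (j - 1)" "u = cone_diff r D w" using u by (rule BcE)
  thus thesis using that[of "p1 w" "p2 w"] cone_diff_props(2,3)[OF complexD(1)[OF C] r, of w]
    by (auto simp: mapping_cone_def)
qed

lemma pair_simps:
  "pair \<zero>\<^bsub>M\<^esub> \<zero>\<^bsub>M\<^esub> = \<zero>\<^bsub>M\<^esub>"
  "a \<in> carrier M \<Longrightarrow> b \<in> carrier M \<Longrightarrow> a' \<in> carrier M \<Longrightarrow> b' \<in> carrier M \<Longrightarrow>
    pair a b \<oplus>\<^bsub>M\<^esub> pair a' b' = pair (a \<oplus>\<^bsub>M\<^esub> a') (b \<oplus>\<^bsub>M\<^esub> b')"
  "r \<in> carrier R \<Longrightarrow> a \<in> carrier M \<Longrightarrow> b \<in> carrier M \<Longrightarrow> r \<odot>\<^bsub>M\<^esub> pair a b = pair (r \<odot>\<^bsub>M\<^esub> a) (r \<odot>\<^bsub>M\<^esub> b)"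
  by (rule pair_eqI; simp)+

lemma ZcD: "x \<in> Zc C D j \<Longrightarrow> x \<in> C j" "x \<in> Zc C D j \<Longrightarrow> D x = \<zero>\<^bsub>M\<^esub>"
  by (auto simp: Zc_def)

lemma cone_coboundary_of_second:
  assumes C: "is_complex C D" and r: "r \<in> carrier R" and y: "y \<in> C j"
  shows "pair (r \<odot>\<^bsub>M\<^esub> y) (\<ominus>\<^bsub>M\<^esub> D y) \<in> Bc (mapping_cone C) (cone_diff r D) j"
proof -
  note D = mod_hom_props[OF complexD(1)[OF C]]
  note c' = submodule_closed[OF complexD(2)[OF C, of "j - 1"]]
  have yc: "y \<in> carrier M" by (rule complexD(5)[OF C y])
  have cl: "r \<odot>\<^bsub>M\<^esub> y \<in> carrier M" "\<ominus>\<^bsub>M\<^esub> D y \<in> carrier M" using yc r D(1) by auto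
  show ?thesis
    by (rule Bc_coneI[OF C r _ c'(3) y]) (use cl D(4) in auto)
qed

lemma cone_coboundary_of_first:
  assumes C: "is_complex C D" and r: "r \<in> carrier R" and b: "b \<in> Bc C D j"
  shows "pair b \<zero>\<^bsub>M\<^esub> \<in> Bc (mapping_cone C) (cone_diff r D) j"
proof -
  note D = mod_hom_props[OF complexD(1)[OF C]]
  note c = submodule_closed[OF complexD(2)[OF C, of j]]
  obtain x where x: "x \<in> C (j - 1)" "b = D x" using b by (rule BcE)
  have "b \<in> carrier M" using x D(1) complexD(5)[OF C] by blast
  thus ?thesis
    by (intro Bc_coneI[OF C r _ x(1) c(3)]) (use x D(4) r in \<open>simp_all add: M_minus_zero\<close>)
qed

text \<open>Exactness of \<open>H\<^sup>j(C) \<rightarrow> H\<^sup>j(cone) \<rightarrow> H\<^sup>j\<^sup>+\<^sup>1(C)\<close> in the middle, on elements: a cocycle whose second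
  component bounds is moved into the first component.\<close>

lemma cone_cocycle_cases:
  assumes C: "is_complex C D" and r: "r \<in> carrier R"
    and u: "u \<in> Zc (mapping_cone C) (cone_diff r D) j" and y: "y \<in> C j" and p2: "p2 u = D y"
  shows "p1 u \<oplus>\<^bsub>M\<^esub> r \<odot>\<^bsub>M\<^esub> y \<in> Zc C D j"
    and "u \<oplus>\<^bsub>M\<^esub> pair (r \<odot>\<^bsub>M\<^esub> y) (\<ominus>\<^bsub>M\<^esub> D y) = pair (p1 u \<oplus>\<^bsub>M\<^esub> r \<odot>\<^bsub>M\<^esub> y) \<zero>\<^bsub>M\<^esub>"
proof -
  note D = mod_hom_props[OF complexD(1)[OF C]]
  note c = submodule_closed[OF complexD(2)[OF C, of j]]
  have u': "u \<in> carrier M" "p1 u \<in> C j" "D (p1 u) \<oplus>\<^bsub>M\<^esub> r \<odot>\<^bsub>M\<^esub> p2 u = \<zero>\<^bsub>M\<^esub>"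
    using u unfolding Zc_cone_iff[OF C r] by blast+
  have cl: "p1 u \<in> carrier M" "y \<in> carrier M" "D y \<in> carrier M" using u' y c(2) D(1) by auto
  have "D (p1 u \<oplus>\<^bsub>M\<^esub> r \<odot>\<^bsub>M\<^esub> y) = D (p1 u) \<oplus>\<^bsub>M\<^esub> r \<odot>\<^bsub>M\<^esub> p2 u" using D(2,3) cl r p2 by simp
  thus "p1 u \<oplus>\<^bsub>M\<^esub> r \<odot>\<^bsub>M\<^esub> y \<in> Zc C D j"
    using u'(2,3) c(4)[OF u'(2) c(7)[OF r y]] by (auto simp: Zc_def)
  have cl2: "r \<odot>\<^bsub>M\<^esub> y \<in> carrier M" "\<ominus>\<^bsub>M\<^esub> D y \<in> carrier M" using cl r by auto
  have n: "D y \<oplus>\<^bsub>M\<^esub> \<ominus>\<^bsub>M\<^esub> D y = \<zero>\<^bsub>M\<^esub>" using cl by (simp add: M.r_neg)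
  show "u \<oplus>\<^bsub>M\<^esub> pair (r \<odot>\<^bsub>M\<^esub> y) (\<ominus>\<^bsub>M\<^esub> D y) = pair (p1 u \<oplus>\<^bsub>M\<^esub> r \<odot>\<^bsub>M\<^esub> y) \<zero>\<^bsub>M\<^esub>"
    by (rule pair_eqI) (use u'(1) cl cl2 p2 n in auto)
qed

text \<open>By the exact sequence \<open>H\<^sup>j(C) \<rightarrow> H\<^sup>j(cone) \<rightarrow> H\<^sup>j\<^sup>+\<^sup>1(C)\<close>, whose first map kills \<open>rH\<^sup>j(C)\<close>.\<close>

lemma cone_acyclic:
  assumes C: "is_complex C D" and r: "r \<in> carrier R"
    and 1: "Zc C D (j + 1) \<subseteq> Bc C D (j + 1)"
    and 0: "Zc C D j \<subseteq> Bc C D j <+>\<^bsub>M\<^esub> (\<lambda>x. r \<odot>\<^bsub>M\<^esub> x) ` Zc C D j"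
  shows "Zc (mapping_cone C) (cone_diff r D) j \<subseteq> Bc (mapping_cone C) (cone_diff r D) j"
proof
  note D = mod_hom_props[OF complexD(1)[OF C]]
  note c = submodule_closed[OF complexD(2)[OF C, of j]]
  fix u assume u: "u \<in> Zc (mapping_cone C) (cone_diff r D) j"
  hence u': "u \<in> carrier M" "p1 u \<in> C j" "p2 u \<in> Zc C D (j + 1)" unfolding Zc_cone_iff[OF C r] by blast+
  then obtain y where y: "y \<in> C j" "p2 u = D y" using 1 by (auto elim!: BcE)
  have "p1 u \<oplus>\<^bsub>M\<^esub> r \<odot>\<^bsub>M\<^esub> y \<in> Zc C D j" by (rule cone_cocycle_cases(1)[OF C r u y])
  then obtain b z where bz: "b \<in> Bc C D j" "z \<in> Zc C D j" "p1 u \<oplus>\<^bsub>M\<^esub> r \<odot>\<^bsub>M\<^esub> y = b \<oplus>\<^bsub>M\<^esub> r \<odot>\<^bsub>M\<^esub> z"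
    using 0 by (blast elim: set_addE)
  obtain x where x: "x \<in> C (j - 1)" "b = D x" using bz(1) by (rule BcE)
  have z: "z \<in> C j" "D z = \<zero>\<^bsub>M\<^esub>" using bz by (auto simp: Zc_def)
  have cl: "p1 u \<in> carrier M" "y \<in> carrier M" "z \<in> carrier M" "b \<in> carrier M" "D y \<in> carrier M"
    using u' y z x c(2) D(1) complexD(5)[OF C] by auto
  have "p1 u = (p1 u \<oplus>\<^bsub>M\<^esub> r \<odot>\<^bsub>M\<^esub> y) \<ominus>\<^bsub>M\<^esub> r \<odot>\<^bsub>M\<^esub> y" using cl r by algebra
  also have "\<dots> = b \<oplus>\<^bsub>M\<^esub> r \<odot>\<^bsub>M\<^esub> (z \<ominus>\<^bsub>M\<^esub> y)" unfolding bz(3) using cl r by algebra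
  finally have 1: "p1 u = D x \<oplus>\<^bsub>M\<^esub> r \<odot>\<^bsub>M\<^esub> (z \<ominus>\<^bsub>M\<^esub> y)" using x by simp
  have "D (z \<ominus>\<^bsub>M\<^esub> y) = \<zero>\<^bsub>M\<^esub> \<ominus>\<^bsub>M\<^esub> D y" using D(6) cl z by simp
  hence 2: "p2 u = \<ominus>\<^bsub>M\<^esub> D (z \<ominus>\<^bsub>M\<^esub> y)" using y cl by (simp add: M.minus_eq)
  show "u \<in> Bc (mapping_cone C) (cone_diff r D) j"
    by (rule Bc_coneI[OF C r u'(1) x(1) c(5)[OF z(1) y(1)] 1 2])
qed

text \<open>The exact sequence again. The intermediate submodule \<open>L\<close> consists of the cocycles whose class
  comes from \<open>H\<^sup>j(C)\<close>.\<close>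

lemma cone_noetherian:
  assumes C: "is_complex C D" and r: "r \<in> carrier R"
    and n0: "noetherian_interval (Bc C D j) (Zc C D j)"
    and n1: "noetherian_interval (Bc C D (j + 1)) (Zc C D (j + 1))"
  shows "noetherian_interval (Bc (mapping_cone C) (cone_diff r D) j) (Zc (mapping_cone C) (cone_diff r D) j)"
proof -
  let ?E = "cone_diff r D" and ?K = "mapping_cone C"
  note D = mod_hom_props[OF complexD(1)[OF C]]
  note K = cone_complex[OF C r]
  note sK = complex_submodules[OF K, of j]
  note sC = complex_submodules[OF C]
  note cZ = submodule_closed[OF sC(1)] and cB = submodule_closed[OF sC(2)]
  define L where "L = {u \<in> Zc ?K ?E j. p2 u \<in> Bc C D (j + 1)}"
  have L: "submodule L R M"
    by (rule submoduleI')
      (use submodule_closed[OF sK(1)] cB in \<open>auto simp: L_def\<close>)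
  have BL: "Bc ?K ?E j \<subseteq> L"
  proof
    fix u assume u: "u \<in> Bc ?K ?E j"
    obtain x y where "y \<in> C j" "p2 u = \<ominus>\<^bsub>M\<^esub> D y" using Bc_coneE[OF C r u] .
    thus "u \<in> L" unfolding L_def using sK(3) u cB(6)[OF BcI(1)] by auto
  qed
  have LZ: "L \<subseteq> Zc ?K ?E j" by (auto simp: L_def)
  have z0: "\<zero>\<^bsub>M\<^esub> \<in> carrier M" by simp
  have "noetherian_interval (Bc ?K ?E j) L"
  proof (rule noetherian_transfer[OF n0, of _ "\<lambda>U. {a \<in> Zc C D j. pair a \<zero>\<^bsub>M\<^esub> \<in> U}"])
    fix U assume U: "U \<in> interval (Bc ?K ?E j) L"
    hence sU: "submodule U R M" "Bc ?K ?E j \<subseteq> U" by (auto simp: interval_def)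
    note cU = submodule_closed[OF sU(1)]
    have "submodule {a \<in> Zc C D j. pair a \<zero>\<^bsub>M\<^esub> \<in> U} R M"
    proof (rule submoduleI')
      show "\<zero>\<^bsub>M\<^esub> \<in> {a \<in> Zc C D j. pair a \<zero>\<^bsub>M\<^esub> \<in> U}" using cZ(3) cU(3) pair_simps(1) by simp
      fix a b assume ab: "a \<in> {a \<in> Zc C D j. pair a \<zero>\<^bsub>M\<^esub> \<in> U}" "b \<in> {a \<in> Zc C D j. pair a \<zero>\<^bsub>M\<^esub> \<in> U}"
      hence "pair a \<zero>\<^bsub>M\<^esub> \<oplus>\<^bsub>M\<^esub> pair b \<zero>\<^bsub>M\<^esub> \<in> U" by (intro cU(4)) blast+
      moreover have "a \<in> carrier M" "b \<in> carrier M" using ab cZ(2) by blast+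
      ultimately show "a \<oplus>\<^bsub>M\<^esub> b \<in> {a \<in> Zc C D j. pair a \<zero>\<^bsub>M\<^esub> \<in> U}"
        using ab cZ(4) pair_simps(2) by simp
    next
      fix s a assume s: "s \<in> carrier R" and a: "a \<in> {a \<in> Zc C D j. pair a \<zero>\<^bsub>M\<^esub> \<in> U}"
      hence "s \<odot>\<^bsub>M\<^esub> pair a \<zero>\<^bsub>M\<^esub> \<in> U" by (intro cU(7)) blast+
      moreover have "a \<in> carrier M" using a cZ(2) by blast
      ultimately show "s \<odot>\<^bsub>M\<^esub> a \<in> {a \<in> Zc C D j. pair a \<zero>\<^bsub>M\<^esub> \<in> U}"
        using a s cZ(7) pair_simps(3) by simp
    qed (use cZ(2) in blast)
    moreover have "Bc C D j \<subseteq> {a \<in> Zc C D j. pair a \<zero>\<^bsub>M\<^esub> \<in> U}"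
      using sC(3) cone_coboundary_of_first[OF C r] sU(2) by blast
    ultimately show "{a \<in> Zc C D j. pair a \<zero>\<^bsub>M\<^esub> \<in> U} \<in> interval (Bc C D j) (Zc C D j)"
      by (auto simp: interval_def)
  next
    have incl: "U \<subseteq> V" if U: "U \<in> interval (Bc ?K ?E j) L" and V: "V \<in> interval (Bc ?K ?E j) L"
      and sub: "{a \<in> Zc C D j. pair a \<zero>\<^bsub>M\<^esub> \<in> U} \<subseteq> {a \<in> Zc C D j. pair a \<zero>\<^bsub>M\<^esub> \<in> V}" for U V
    proof
      have sU: "submodule U R M" "Bc ?K ?E j \<subseteq> U" "U \<subseteq> L" using U by (auto simp: interval_def)
      have sV: "submodule V R M" "Bc ?K ?E j \<subseteq> V" using V by (auto simp: interval_def)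
      fix u assume u: "u \<in> U"
      hence uZ: "u \<in> Zc ?K ?E j" "p2 u \<in> Bc C D (j + 1)" using sU by (auto simp: L_def)
      then obtain y where y: "y \<in> C j" "p2 u = D y" by (auto elim: BcE)
      let ?w = "pair (r \<odot>\<^bsub>M\<^esub> y) (\<ominus>\<^bsub>M\<^esub> D y)"
      have w: "?w \<in> Bc ?K ?E j" by (rule cone_coboundary_of_second[OF C r y(1)])
      note cc = cone_cocycle_cases[OF C r uZ(1) y]
      have "u \<oplus>\<^bsub>M\<^esub> ?w \<in> U" using submodule_closed(4)[OF sU(1) u] w sU by blast
      hence "pair (p1 u \<oplus>\<^bsub>M\<^esub> r \<odot>\<^bsub>M\<^esub> y) \<zero>\<^bsub>M\<^esub> \<in> V" using cc sub by auto
      hence "?w \<oplus>\<^bsub>M\<^esub> u \<in> V"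
        using cc(2) u w submodule_closed(2)[OF sU(1)] submodule_closed(2)[OF sV(1)] sV(2)
        by (metis M.a_comm subsetD)
      thus "u \<in> V" using submodule_add_cancel[OF sV(1)] w sV(2) submodule_closed(2)[OF sU(1) u] by blast
    qed
    show "inj_on (\<lambda>U. {a \<in> Zc C D j. pair a \<zero>\<^bsub>M\<^esub> \<in> U}) (interval (Bc ?K ?E j) L)"
      by (rule inj_onI, rule equalityI; rule incl; simp)
  qed auto
  moreover have "noetherian_interval L (Zc ?K ?E j)"
  proof (rule noetherian_transfer[OF n1, of _ "\<lambda>U. p2 ` U"])
    fix U assume U: "U \<in> interval L (Zc ?K ?E j)"
    hence sU: "submodule U R M" "L \<subseteq> U" "U \<subseteq> Zc ?K ?E j" by (auto simp: interval_def)
    note cU = submodule_closed[OF sU(1)]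
    have "submodule (p2 ` U) R M"
    proof (rule submoduleI')
      show "p2 ` U \<subseteq> carrier M" using cU(2) by auto
      show "\<zero>\<^bsub>M\<^esub> \<in> p2 ` U" by (rule image_eqI[OF _ cU(3)]) simp
      fix x y assume "x \<in> p2 ` U" "y \<in> p2 ` U"
      then obtain u v where *: "u \<in> U" "v \<in> U" "x = p2 u" "y = p2 v" by blast
      show "x \<oplus>\<^bsub>M\<^esub> y \<in> p2 ` U" by (rule image_eqI[OF _ cU(4)[OF *(1,2)]]) (use * cU(2) in simp)
    next
      fix s x assume s: "s \<in> carrier R" and "x \<in> p2 ` U"
      then obtain u where *: "u \<in> U" "x = p2 u" by blast
      show "s \<odot>\<^bsub>M\<^esub> x \<in> p2 ` U" by (rule image_eqI[OF _ cU(7)[OF s *(1)]]) (use * s cU(2) in simp)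
    qed
    moreover have "Bc C D (j + 1) \<subseteq> p2 ` U"
    proof
      fix b assume "b \<in> Bc C D (j + 1)"
      then obtain y where y: "y \<in> C j" "b = D y" by (auto elim: BcE)
      have yc: "y \<in> carrier M" by (rule complexD(5)[OF C y(1)])
      have ny: "\<ominus>\<^bsub>M\<^esub> y \<in> C j" by (rule submodule_closed(6)[OF complexD(2)[OF C] y(1)])
      have cl: "r \<odot>\<^bsub>M\<^esub> (\<ominus>\<^bsub>M\<^esub> y) \<in> carrier M" "\<ominus>\<^bsub>M\<^esub> D (\<ominus>\<^bsub>M\<^esub> y) \<in> carrier M" using yc r D(1) by auto
      have "\<ominus>\<^bsub>M\<^esub> D (\<ominus>\<^bsub>M\<^esub> y) = b" using y(2) yc D(1,5) by simp
      hence "p2 (pair (r \<odot>\<^bsub>M\<^esub> (\<ominus>\<^bsub>M\<^esub> y)) (\<ominus>\<^bsub>M\<^esub> D (\<ominus>\<^bsub>M\<^esub> y))) = b" using cl by simp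
      thus "b \<in> p2 ` U" using cone_coboundary_of_second[OF C r ny] BL sU(2) by blast
    qed
    moreover have "p2 ` U \<subseteq> Zc C D (j + 1)" using sU(3) unfolding Zc_cone_iff[OF C r] subset_iff by blast
    ultimately show "p2 ` U \<in> interval (Bc C D (j + 1)) (Zc C D (j + 1))" by (auto simp: interval_def)
  next
    have incl: "U \<subseteq> V" if U: "U \<in> interval L (Zc ?K ?E j)" and V: "V \<in> interval L (Zc ?K ?E j)"
      and sub: "p2 ` U \<subseteq> p2 ` V" for U V
    proof
      have sU: "submodule U R M" "U \<subseteq> Zc ?K ?E j" using U by (auto simp: interval_def)
      have sV: "submodule V R M" "L \<subseteq> V" "V \<subseteq> Zc ?K ?E j" using V by (auto simp: interval_def)
      fix u assume u: "u \<in> U"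
      then obtain v where v: "v \<in> V" "p2 u = p2 v" using sub by blast
      have carr: "u \<in> carrier M" "v \<in> carrier M"
        using u v submodule_closed(2)[OF sU(1)] submodule_closed(2)[OF sV(1)] by blast+
      have "u \<ominus>\<^bsub>M\<^esub> v \<in> Zc ?K ?E j" using submodule_closed(5)[OF sK(1)] u v sU sV by blast
      moreover have "p2 (u \<ominus>\<^bsub>M\<^esub> v) = \<zero>\<^bsub>M\<^esub>" using carr v(2) M.r_neg[of "p2 v"] by (simp add: M.minus_eq)
      ultimately have "u \<ominus>\<^bsub>M\<^esub> v \<in> V" using sV(2) cB(3) by (auto simp: L_def)
      hence "(u \<ominus>\<^bsub>M\<^esub> v) \<oplus>\<^bsub>M\<^esub> v \<in> V" using submodule_closed(4)[OF sV(1)] v by blast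
      moreover have "(u \<ominus>\<^bsub>M\<^esub> v) \<oplus>\<^bsub>M\<^esub> v = u" using carr by algebra
      ultimately show "u \<in> V" by simp
    qed
    show "inj_on ((`) p2) (interval L (Zc ?K ?E j))"
      by (rule inj_onI, rule equalityI; rule incl; simp)
  qed auto
  ultimately show ?thesis
    by (intro interval_condition_extend[OF _ L BL LZ sK(1)]) simp_all
qed

text \<open>The second component maps \<open>H\<^sup>j(cone)\<close> onto the kernel of \<open>r\<close> on \<open>H\<^sup>j\<^sup>+\<^sup>1(C)\<close>.\<close>

lemma cone_artinian_kernel:
  assumes C: "is_complex C D" and r: "r \<in> carrier R"
    and art: "artinian_interval (Bc (mapping_cone C) (cone_diff r D) j) (Zc (mapping_cone C) (cone_diff r D) j)"
  shows "artinian_interval (Bc C D (j + 1)) {z \<in> Zc C D (j + 1). r \<odot>\<^bsub>M\<^esub> z \<in> Bc C D (j + 1)}"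
proof -
  let ?E = "cone_diff r D" and ?K = "mapping_cone C"
  let ?T = "{z \<in> Zc C D (j + 1). r \<odot>\<^bsub>M\<^esub> z \<in> Bc C D (j + 1)}"
  note D = mod_hom_props[OF complexD(1)[OF C]]
  note K = cone_complex[OF C r]
  note sK = complex_submodules[OF K, of j]
  note cK = submodule_closed[OF sK(1)]
  show ?thesis
  proof (rule artinian_transfer[OF art, of _ "\<lambda>U. {u \<in> Zc ?K ?E j. p2 u \<in> U}"])
    fix U assume "U \<in> interval (Bc C D (j + 1)) ?T"
    hence sU: "submodule U R M" "Bc C D (j + 1) \<subseteq> U" by (auto simp: interval_def)
    note cU = submodule_closed[OF sU(1)]
    have "submodule {u \<in> Zc ?K ?E j. p2 u \<in> U} R M"
      by (rule submoduleI') (use cK cU in auto)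
    moreover have "Bc ?K ?E j \<subseteq> {u \<in> Zc ?K ?E j. p2 u \<in> U}"
    proof
      fix u assume u: "u \<in> Bc ?K ?E j"
      obtain x y where y: "y \<in> C j" "p2 u = \<ominus>\<^bsub>M\<^esub> D y" using Bc_coneE[OF C r u] .
      have "D y \<in> U" using BcI(1)[of y C j D] y(1) sU(2) by blast
      thus "u \<in> {u \<in> Zc ?K ?E j. p2 u \<in> U}" using sK(3) u y(2) cU(6) by auto
    qed
    ultimately show "{u \<in> Zc ?K ?E j. p2 u \<in> U} \<in> interval (Bc ?K ?E j) (Zc ?K ?E j)"
      by (auto simp: interval_def)
  next
    have incl: "U \<subseteq> V" if U: "U \<in> interval (Bc C D (j + 1)) ?T"
      and sub: "{u \<in> Zc ?K ?E j. p2 u \<in> U} \<subseteq> {u \<in> Zc ?K ?E j. p2 u \<in> V}" for U V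
    proof
      have sU: "submodule U R M" "U \<subseteq> ?T" using U by (auto simp: interval_def)
      fix b assume b: "b \<in> U"
      hence bZ: "b \<in> Zc C D (j + 1)" "r \<odot>\<^bsub>M\<^esub> b \<in> Bc C D (j + 1)" using sU by auto
      obtain a where a: "a \<in> C j" "r \<odot>\<^bsub>M\<^esub> b = D a" using bZ(2) by (auto elim: BcE)
      have carr: "a \<in> carrier M" "b \<in> carrier M" "\<ominus>\<^bsub>M\<^esub> a \<in> carrier M" "D a \<in> carrier M"
        using complexD(5)[OF C] a ZcD(1)[OF bZ(1)] D(1) by auto
      have "\<ominus>\<^bsub>M\<^esub> a \<in> C j" by (rule submodule_closed(6)[OF complexD(2)[OF C] a(1)])
      moreover have "D (\<ominus>\<^bsub>M\<^esub> a) \<oplus>\<^bsub>M\<^esub> r \<odot>\<^bsub>M\<^esub> b = \<zero>\<^bsub>M\<^esub>" using D(5) carr a(2) by (simp add: M.l_neg)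
      ultimately have "pair (\<ominus>\<^bsub>M\<^esub> a) b \<in> Zc ?K ?E j"
        unfolding Zc_cone_iff[OF C r] using carr bZ(1) by simp
      hence "pair (\<ominus>\<^bsub>M\<^esub> a) b \<in> {u \<in> Zc ?K ?E j. p2 u \<in> V}" using b carr sub by auto
      thus "b \<in> V" using carr by simp
    qed
    show "inj_on (\<lambda>U. {u \<in> Zc ?K ?E j. p2 u \<in> U}) (interval (Bc C D (j + 1)) ?T)"
      by (rule inj_onI, rule equalityI; rule incl; simp)
  qed auto
qed

section \<open>Torsion subcomplexes\<close>

text \<open>Every \<open>u\<close> is divisible by \<open>s\<close> up to \<open>s\<close>-torsion. The condition on annihilators keeps the quotient
  \<open>v\<close> inside each torsion submodule that contains \<open>u\<close>, so that torsion submodules are soft again.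
  Injective modules are soft, and so are mapping cones of soft complexes. Softness is the reason why torsion subcomplexes compute local cohomology.\<close>

definition soft :: "'c set \<Rightarrow> bool"
  where "soft V \<longleftrightarrow> (\<forall>u\<in>V. \<forall>s\<in>carrier R. \<exists>v\<in>V. \<exists>t::nat.
    (\<forall>a\<in>carrier R. a \<odot>\<^bsub>M\<^esub> u = \<zero>\<^bsub>M\<^esub> \<longrightarrow> a \<odot>\<^bsub>M\<^esub> v = \<zero>\<^bsub>M\<^esub>) \<and> s [^] Suc t \<odot>\<^bsub>M\<^esub> v = s [^] t \<odot>\<^bsub>M\<^esub> u)"

definition torsion :: "'a set \<Rightarrow> (int \<Rightarrow> 'c set) \<Rightarrow> int \<Rightarrow> 'c set"
  where "torsion S C j = {x \<in> C j. \<forall>a\<in>S. \<exists>k::nat. a [^] k \<odot>\<^bsub>M\<^esub> x = \<zero>\<^bsub>M\<^esub>}"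

lemma zero_submodule: "submodule {\<zero>\<^bsub>M\<^esub>} R M"
  by (rule submoduleI') auto

lemma pow_closed: "s \<in> carrier R \<Longrightarrow> s [^] (k::nat) \<in> carrier R"
  by (rule R.nat_pow_closed)

lemma pow_kill_le:
  "s \<in> carrier R \<Longrightarrow> x \<in> carrier M \<Longrightarrow> s [^] (k::nat) \<odot>\<^bsub>M\<^esub> x = \<zero>\<^bsub>M\<^esub> \<Longrightarrow> k \<le> l \<Longrightarrow> s [^] l \<odot>\<^bsub>M\<^esub> x = \<zero>\<^bsub>M\<^esub>"
  using smult_pow_le[OF zero_submodule, of s x k l] by simp

lemma torsion_complex:
  assumes C: "is_complex C D" and S: "S \<subseteq> carrier R"
  shows "is_complex (torsion S C) D"
  unfolding is_complex_def
proof (intro conjI allI ballI)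
  note D = mod_hom_props[OF complexD(1)[OF C]]
  show "D \<in> mod_hom R M M" by (rule complexD(1)[OF C])
  fix j
  note c = submodule_closed[OF complexD(2)[OF C, of j]]
  show "submodule (torsion S C j) R M"
  proof (rule submoduleI')
    show "torsion S C j \<subseteq> carrier M" using c(2) by (auto simp: torsion_def)
    show "\<zero>\<^bsub>M\<^esub> \<in> torsion S C j" using c(3) S by (auto simp: torsion_def)
    fix x y assume xy: "x \<in> torsion S C j" "y \<in> torsion S C j"
    have "\<exists>k::nat. a [^] k \<odot>\<^bsub>M\<^esub> (x \<oplus>\<^bsub>M\<^esub> y) = \<zero>\<^bsub>M\<^esub>" if a: "a \<in> S" for a
    proof -
      have ac: "a \<in> carrier R" using a S by blast
      obtain k l :: nat where kl: "a [^] k \<odot>\<^bsub>M\<^esub> x = \<zero>\<^bsub>M\<^esub>" "a [^] l \<odot>\<^bsub>M\<^esub> y = \<zero>\<^bsub>M\<^esub>"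
        using xy a unfolding torsion_def by blast
      have carr: "x \<in> carrier M" "y \<in> carrier M" using xy c(2) by (auto simp: torsion_def)
      have "a [^] (max k l) \<odot>\<^bsub>M\<^esub> x = \<zero>\<^bsub>M\<^esub>" "a [^] (max k l) \<odot>\<^bsub>M\<^esub> y = \<zero>\<^bsub>M\<^esub>"
        by (rule pow_kill_le[OF ac carr(1) kl(1)], simp) (rule pow_kill_le[OF ac carr(2) kl(2)], simp)
      thus ?thesis using carr ac by (intro exI[of _ "max k l"]) (simp add: smult_r_distr)
    qed
    thus "x \<oplus>\<^bsub>M\<^esub> y \<in> torsion S C j" using xy c(4) by (auto simp: torsion_def)
  next
    fix r x assume r: "r \<in> carrier R" and x: "x \<in> torsion S C j"
    have xC: "x \<in> C j" "x \<in> carrier M" using x c(2) by (auto simp: torsion_def)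
    have "\<exists>k::nat. a [^] k \<odot>\<^bsub>M\<^esub> (r \<odot>\<^bsub>M\<^esub> x) = \<zero>\<^bsub>M\<^esub>" if a: "a \<in> S" for a
    proof -
      obtain k :: nat where k: "a [^] k \<odot>\<^bsub>M\<^esub> x = \<zero>\<^bsub>M\<^esub>" using x a unfolding torsion_def by blast
      have "a [^] k \<odot>\<^bsub>M\<^esub> (r \<odot>\<^bsub>M\<^esub> x) = r \<odot>\<^bsub>M\<^esub> (a [^] k \<odot>\<^bsub>M\<^esub> x)"
        using r xC a S by (intro smult_lcomm) auto
      thus ?thesis using k r by auto
    qed
    thus "r \<odot>\<^bsub>M\<^esub> x \<in> torsion S C j" using xC c(7)[OF r] by (auto simp: torsion_def)
  qed
  fix x assume x: "x \<in> torsion S C j"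
  hence xC: "x \<in> C j" "x \<in> carrier M" using c(2) by (auto simp: torsion_def)
  show "D (D x) = \<zero>\<^bsub>M\<^esub>" by (rule complexD(4)[OF C xC(1)])
  have "\<exists>k::nat. a [^] k \<odot>\<^bsub>M\<^esub> D x = \<zero>\<^bsub>M\<^esub>" if a: "a \<in> S" for a
  proof -
    obtain k :: nat where k: "a [^] k \<odot>\<^bsub>M\<^esub> x = \<zero>\<^bsub>M\<^esub>" using x a unfolding torsion_def by blast
    have "a [^] k \<odot>\<^bsub>M\<^esub> D x = D (a [^] k \<odot>\<^bsub>M\<^esub> x)" using D(3)[of "a [^] k" x] a S xC by auto
    thus ?thesis using k D(4) by auto
  qed
  thus "D x \<in> torsion S C (j + 1)" using complexD(3)[OF C xC(1)] by (auto simp: torsion_def)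
qed

lemma torsion_subset: "torsion S C j \<subseteq> C j"
  by (auto simp: torsion_def)

lemma Zc_torsion_subset: "Zc (torsion S C) D j \<subseteq> Zc C D j"
  using torsion_subset by (auto simp: Zc_def)

lemma Bc_torsion_subset: "Bc (torsion S C) D j \<subseteq> Bc C D j"
  unfolding Bc_def by (rule image_mono[OF torsion_subset])

lemma torsion_mapping_cone:
  assumes S: "S \<subseteq> carrier R"
  shows "torsion S (mapping_cone C) = mapping_cone (torsion S C)"
proof (rule ext)
  fix j
  have iff: "(\<exists>k::nat. a [^] k \<odot>\<^bsub>M\<^esub> u = \<zero>\<^bsub>M\<^esub>) \<longleftrightarrow>
      (\<exists>k::nat. a [^] k \<odot>\<^bsub>M\<^esub> p1 u = \<zero>\<^bsub>M\<^esub>) \<and> (\<exists>k::nat. a [^] k \<odot>\<^bsub>M\<^esub> p2 u = \<zero>\<^bsub>M\<^esub>)"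
    if a: "a \<in> carrier R" and u: "u \<in> carrier M" for a u
  proof
    assume "\<exists>k::nat. a [^] k \<odot>\<^bsub>M\<^esub> u = \<zero>\<^bsub>M\<^esub>"
    then obtain k :: nat where k: "a [^] k \<odot>\<^bsub>M\<^esub> u = \<zero>\<^bsub>M\<^esub>" by blast
    have "a [^] k \<odot>\<^bsub>M\<^esub> p1 u = p1 (a [^] k \<odot>\<^bsub>M\<^esub> u)" "a [^] k \<odot>\<^bsub>M\<^esub> p2 u = p2 (a [^] k \<odot>\<^bsub>M\<^esub> u)"
      using a u by simp_all
    thus "(\<exists>k::nat. a [^] k \<odot>\<^bsub>M\<^esub> p1 u = \<zero>\<^bsub>M\<^esub>) \<and> (\<exists>k::nat. a [^] k \<odot>\<^bsub>M\<^esub> p2 u = \<zero>\<^bsub>M\<^esub>)"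
      unfolding k by (metis p1_simps(4) p2_simps(4))
  next
    assume "(\<exists>k::nat. a [^] k \<odot>\<^bsub>M\<^esub> p1 u = \<zero>\<^bsub>M\<^esub>) \<and> (\<exists>k::nat. a [^] k \<odot>\<^bsub>M\<^esub> p2 u = \<zero>\<^bsub>M\<^esub>)"
    then obtain k l :: nat where kl: "a [^] k \<odot>\<^bsub>M\<^esub> p1 u = \<zero>\<^bsub>M\<^esub>" "a [^] l \<odot>\<^bsub>M\<^esub> p2 u = \<zero>\<^bsub>M\<^esub>" by blast
    have "a [^] (max k l) \<odot>\<^bsub>M\<^esub> p1 u = \<zero>\<^bsub>M\<^esub>" "a [^] (max k l) \<odot>\<^bsub>M\<^esub> p2 u = \<zero>\<^bsub>M\<^esub>"
      by (rule pow_kill_le[OF a _ kl(1)], use u in simp, simp)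
        (rule pow_kill_le[OF a _ kl(2)], use u in simp, simp)
    hence "a [^] (max k l) \<odot>\<^bsub>M\<^esub> u = \<zero>\<^bsub>M\<^esub>" using a u by - (rule pair_eqI, auto)
    thus "\<exists>k::nat. a [^] k \<odot>\<^bsub>M\<^esub> u = \<zero>\<^bsub>M\<^esub>" by blast
  qed
  show "torsion S (mapping_cone C) j = mapping_cone (torsion S C) j"
    unfolding torsion_def mapping_cone_def using iff S by blast
qed

lemma soft_mapping_cone:
  assumes C: "is_complex C D" and soft: "\<And>j. soft (C j)"
  shows "soft (mapping_cone C j)"
  unfolding soft_def
proof (intro ballI)
  fix u s assume u: "u \<in> mapping_cone C j" and s: "s \<in> carrier R"
  have uc: "u \<in> carrier M" "p1 u \<in> C j" "p2 u \<in> C (j + 1)" using u by (auto simp: mapping_cone_def)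
  obtain v t where v: "v \<in> C j" "\<And>a. a \<in> carrier R \<Longrightarrow> a \<odot>\<^bsub>M\<^esub> p1 u = \<zero>\<^bsub>M\<^esub> \<Longrightarrow> a \<odot>\<^bsub>M\<^esub> v = \<zero>\<^bsub>M\<^esub>"
    "s [^] Suc t \<odot>\<^bsub>M\<^esub> v = s [^] t \<odot>\<^bsub>M\<^esub> p1 u"
    using soft[of j] uc(2) s unfolding soft_def by blast
  obtain w t' where w: "w \<in> C (j + 1)" "\<And>a. a \<in> carrier R \<Longrightarrow> a \<odot>\<^bsub>M\<^esub> p2 u = \<zero>\<^bsub>M\<^esub> \<Longrightarrow> a \<odot>\<^bsub>M\<^esub> w = \<zero>\<^bsub>M\<^esub>"
    "s [^] Suc t' \<odot>\<^bsub>M\<^esub> w = s [^] t' \<odot>\<^bsub>M\<^esub> p2 u"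
    using soft[of "j + 1"] uc(3) s unfolding soft_def by blast
  have carr: "v \<in> carrier M" "w \<in> carrier M" using v w complexD(5)[OF C] by blast+
  have up: "s [^] Suc (l + k) \<odot>\<^bsub>M\<^esub> y = s [^] (l + k) \<odot>\<^bsub>M\<^esub> x"
    if "s [^] Suc k \<odot>\<^bsub>M\<^esub> y = s [^] k \<odot>\<^bsub>M\<^esub> x" "x \<in> carrier M" "y \<in> carrier M" for x y and k l :: nat
  proof -
    have "s [^] (l + Suc k) \<odot>\<^bsub>M\<^esub> y = s [^] l \<odot>\<^bsub>M\<^esub> (s [^] Suc k \<odot>\<^bsub>M\<^esub> y)" by (rule smult_pow_add[OF s that(3)])
    also have "\<dots> = s [^] l \<odot>\<^bsub>M\<^esub> (s [^] k \<odot>\<^bsub>M\<^esub> x)" unfolding that(1) ..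
    also have "\<dots> = s [^] (l + k) \<odot>\<^bsub>M\<^esub> x" by (rule smult_pow_add[OF s that(2), symmetric])
    finally show ?thesis by simp
  qed
  have 1: "s [^] Suc (t' + t) \<odot>\<^bsub>M\<^esub> v = s [^] (t' + t) \<odot>\<^bsub>M\<^esub> p1 u" using up[OF v(3)] uc carr by simp
  have 2: "s [^] Suc (t + t') \<odot>\<^bsub>M\<^esub> w = s [^] (t + t') \<odot>\<^bsub>M\<^esub> p2 u" using up[OF w(3)] uc carr by simp
  show "\<exists>v\<in>mapping_cone C j. \<exists>t::nat. (\<forall>a\<in>carrier R. a \<odot>\<^bsub>M\<^esub> u = \<zero>\<^bsub>M\<^esub> \<longrightarrow> a \<odot>\<^bsub>M\<^esub> v = \<zero>\<^bsub>M\<^esub>) \<and>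
    s [^] Suc t \<odot>\<^bsub>M\<^esub> v = s [^] t \<odot>\<^bsub>M\<^esub> u"
  proof (intro bexI[of _ "pair v w"] exI[of _ "t + t'"] conjI ballI impI)
    show "pair v w \<in> mapping_cone C j" using v(1) w(1) carr by (simp add: mapping_cone_def)
    fix a assume a: "a \<in> carrier R" "a \<odot>\<^bsub>M\<^esub> u = \<zero>\<^bsub>M\<^esub>"
    have "a \<odot>\<^bsub>M\<^esub> p1 u = p1 (a \<odot>\<^bsub>M\<^esub> u)" "a \<odot>\<^bsub>M\<^esub> p2 u = p2 (a \<odot>\<^bsub>M\<^esub> u)" using a(1) uc(1) by simp_all
    hence "a \<odot>\<^bsub>M\<^esub> v = \<zero>\<^bsub>M\<^esub>" "a \<odot>\<^bsub>M\<^esub> w = \<zero>\<^bsub>M\<^esub>" using v(2) w(2) a by simp_all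
    thus "a \<odot>\<^bsub>M\<^esub> pair v w = \<zero>\<^bsub>M\<^esub>" using pair_simps carr a by simp
  next
    have "p1 (s [^] Suc (t + t') \<odot>\<^bsub>M\<^esub> pair v w) = p1 (s [^] (t + t') \<odot>\<^bsub>M\<^esub> u)"
      using 1 carr uc(1) pow_closed[OF s] s by (simp add: add.commute)
    moreover have "p2 (s [^] Suc (t + t') \<odot>\<^bsub>M\<^esub> pair v w) = p2 (s [^] (t + t') \<odot>\<^bsub>M\<^esub> u)"
      using 2 carr uc(1) pow_closed[OF s] s by (simp)
    ultimately show "s [^] Suc (t + t') \<odot>\<^bsub>M\<^esub> pair v w = s [^] (t + t') \<odot>\<^bsub>M\<^esub> u"
      using carr uc(1) pow_closed[OF s] s by - (rule pair_eqI, simp_all)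
  qed
qed

lemma soft_torsion:
  assumes S: "S \<subseteq> carrier R" and soft: "soft (C j)"
  shows "soft (torsion S C j)"
  unfolding soft_def
proof (intro ballI)
  fix u s assume u: "u \<in> torsion S C j" and s: "s \<in> carrier R"
  hence "u \<in> C j" by (simp add: torsion_def)
  then obtain v t where v: "v \<in> C j" "\<forall>a\<in>carrier R. a \<odot>\<^bsub>M\<^esub> u = \<zero>\<^bsub>M\<^esub> \<longrightarrow> a \<odot>\<^bsub>M\<^esub> v = \<zero>\<^bsub>M\<^esub>"
    "s [^] Suc t \<odot>\<^bsub>M\<^esub> v = s [^] t \<odot>\<^bsub>M\<^esub> u"
    using soft s unfolding soft_def by blast
  have "\<exists>k::nat. a [^] k \<odot>\<^bsub>M\<^esub> v = \<zero>\<^bsub>M\<^esub>" if a: "a \<in> S" for a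
  proof -
    obtain k :: nat where "a [^] k \<odot>\<^bsub>M\<^esub> u = \<zero>\<^bsub>M\<^esub>" using u a unfolding torsion_def by blast
    moreover have "a [^] k \<in> carrier R" using a S by auto
    ultimately show ?thesis using v(2) by blast
  qed
  hence "v \<in> torsion S C j" using v(1) by (simp add: torsion_def)
  thus "\<exists>v\<in>torsion S C j. \<exists>t::nat. (\<forall>a\<in>carrier R. a \<odot>\<^bsub>M\<^esub> u = \<zero>\<^bsub>M\<^esub> \<longrightarrow> a \<odot>\<^bsub>M\<^esub> v = \<zero>\<^bsub>M\<^esub>) \<and>
    s [^] Suc t \<odot>\<^bsub>M\<^esub> v = s [^] t \<odot>\<^bsub>M\<^esub> u" using v(2,3) by blast
qed

lemma soft_divide:
  assumes V: "submodule V R M" and soft: "soft V" and u: "u \<in> V" and s: "s \<in> carrier R"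
  shows "\<exists>v\<in>V. \<exists>t::nat. s [^] (t + k) \<odot>\<^bsub>M\<^esub> v = s [^] t \<odot>\<^bsub>M\<^esub> u"
proof (induct k)
  case 0
  show ?case using u by (intro bexI[of _ u] exI[of _ 0]) auto
next
  case (Suc k)
  note c = submodule_closed[OF V]
  obtain v and t :: nat where v: "v \<in> V" "s [^] (t + k) \<odot>\<^bsub>M\<^esub> v = s [^] t \<odot>\<^bsub>M\<^esub> u" using Suc by blast
  obtain w and t' :: nat where w: "w \<in> V" "s [^] Suc t' \<odot>\<^bsub>M\<^esub> w = s [^] t' \<odot>\<^bsub>M\<^esub> v"
    using soft v(1) s unfolding soft_def by blast
  have carr: "v \<in> carrier M" "w \<in> carrier M" "u \<in> carrier M" using v w u c(2) by blast+
  have "s [^] ((t + k) + Suc t') \<odot>\<^bsub>M\<^esub> w = s [^] (t + k) \<odot>\<^bsub>M\<^esub> (s [^] Suc t' \<odot>\<^bsub>M\<^esub> w)"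
    by (rule smult_pow_add[OF s carr(2)])
  also have "\<dots> = s [^] (t + k) \<odot>\<^bsub>M\<^esub> (s [^] t' \<odot>\<^bsub>M\<^esub> v)" unfolding w(2) ..
  also have "\<dots> = s [^] t' \<odot>\<^bsub>M\<^esub> (s [^] (t + k) \<odot>\<^bsub>M\<^esub> v)"
    by (rule smult_lcomm[OF pow_closed[OF s] pow_closed[OF s] carr(1)])
  also have "\<dots> = s [^] t' \<odot>\<^bsub>M\<^esub> (s [^] t \<odot>\<^bsub>M\<^esub> u)" unfolding v(2) ..
  also have "\<dots> = s [^] (t' + t) \<odot>\<^bsub>M\<^esub> u" by (rule smult_pow_add[OF s carr(3), symmetric])
  finally have "s [^] ((t' + t) + Suc k) \<odot>\<^bsub>M\<^esub> w = s [^] (t' + t) \<odot>\<^bsub>M\<^esub> u" by (simp add: ac_simps)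
  thus ?case using w(1) by blast
qed

definition quasi_iso :: "(int \<Rightarrow> 'c set) \<Rightarrow> (int \<Rightarrow> 'c set) \<Rightarrow> ('c \<Rightarrow> 'c) \<Rightarrow> bool"
  where "quasi_iso C' C D \<longleftrightarrow> (\<forall>j. C' j \<subseteq> C j) \<and>
    (\<forall>j. Zc C D j \<subseteq> Zc C' D j <+>\<^bsub>M\<^esub> Bc C D j) \<and> (\<forall>j. Zc C' D j \<inter> Bc C D j \<subseteq> Bc C' D j)"

text \<open>By softness \<open>s\<close> acts bijectively on \<open>C\<close> modulo its \<open>s\<close>-torsion, hence on the cohomology of this
  quotient. That cohomology consists of \<open>s\<close>-torsion, so it vanishes. The proof carries this out on
  elements.\<close>

lemma quasi_iso_single_torsion:
  assumes C: "is_complex C D" and soft: "\<And>j. soft (C j)" and s: "s \<in> carrier R"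
    and tor: "\<And>j z. z \<in> Zc C D j \<Longrightarrow> \<exists>k::nat. s [^] k \<odot>\<^bsub>M\<^esub> z \<in> Bc C D j"
  shows "quasi_iso (torsion {s} C) C D"
  unfolding quasi_iso_def
proof (intro conjI allI subsetI)
  note D = mod_hom_props[OF complexD(1)[OF C]]
  note sc = pow_closed[OF s]
  fix j
  show "x \<in> torsion {s} C j \<Longrightarrow> x \<in> C j" for x using torsion_subset by blast
  show "z \<in> Zc (torsion {s} C) D j <+>\<^bsub>M\<^esub> Bc C D j" if z: "z \<in> Zc C D j" for z
  proof -
    obtain k :: nat where "s [^] k \<odot>\<^bsub>M\<^esub> z \<in> Bc C D j" using tor[OF z] by blast
    then obtain y where y: "y \<in> C (j - 1)" "s [^] k \<odot>\<^bsub>M\<^esub> z = D y" by (rule BcE)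
    obtain v and t :: nat where v: "v \<in> C (j - 1)" "s [^] (t + k) \<odot>\<^bsub>M\<^esub> v = s [^] t \<odot>\<^bsub>M\<^esub> y"
      using soft_divide[OF complexD(2)[OF C] soft y(1) s] by blast
    have zC: "z \<in> C j" "D z = \<zero>\<^bsub>M\<^esub>" using z by (auto simp: Zc_def)
    have Dv: "D v \<in> C j" using complexD(3)[OF C v(1)] by simp
    have carr: "z \<in> carrier M" "y \<in> carrier M" "v \<in> carrier M" "D v \<in> carrier M"
      using zC v y Dv complexD(5)[OF C] by blast+
    have "s [^] (t + k) \<odot>\<^bsub>M\<^esub> z = s [^] t \<odot>\<^bsub>M\<^esub> D y"
      using smult_pow_add[OF s carr(1), of t k] y(2) by simp
    also have "\<dots> = D (s [^] (t + k) \<odot>\<^bsub>M\<^esub> v)" using D(3)[OF sc carr(2)] v(2) by simp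
    also have "\<dots> = s [^] (t + k) \<odot>\<^bsub>M\<^esub> D v" by (rule D(3)[OF sc carr(3)])
    finally have eq: "s [^] (t + k) \<odot>\<^bsub>M\<^esub> z = s [^] (t + k) \<odot>\<^bsub>M\<^esub> D v" .
    have "s [^] (t + k) \<odot>\<^bsub>M\<^esub> (z \<ominus>\<^bsub>M\<^esub> D v) = s [^] (t + k) \<odot>\<^bsub>M\<^esub> z \<ominus>\<^bsub>M\<^esub> s [^] (t + k) \<odot>\<^bsub>M\<^esub> D v"
      using sc[of "t + k"] carr by algebra
    also have "\<dots> = \<zero>\<^bsub>M\<^esub>" unfolding eq using sc[of "t + k"] carr by algebra
    finally have "s [^] (t + k) \<odot>\<^bsub>M\<^esub> (z \<ominus>\<^bsub>M\<^esub> D v) = \<zero>\<^bsub>M\<^esub>" .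
    moreover have "z \<ominus>\<^bsub>M\<^esub> D v \<in> C j" by (rule submodule_closed(5)[OF complexD(2)[OF C] zC(1) Dv])
    moreover have "D (z \<ominus>\<^bsub>M\<^esub> D v) = \<zero>\<^bsub>M\<^esub>"
      using D(6)[OF carr(1,4)] zC(2) complexD(4)[OF C v(1)] M_minus_zero by (simp add: M.minus_eq)
    ultimately have "z \<ominus>\<^bsub>M\<^esub> D v \<in> Zc (torsion {s} C) D j" by (auto simp: Zc_def torsion_def)
    hence "(z \<ominus>\<^bsub>M\<^esub> D v) \<oplus>\<^bsub>M\<^esub> D v \<in> Zc (torsion {s} C) D j <+>\<^bsub>M\<^esub> Bc C D j"
      using v(1) by (intro set_addI) (auto simp: Bc_def)
    moreover have "(z \<ominus>\<^bsub>M\<^esub> D v) \<oplus>\<^bsub>M\<^esub> D v = z" using carr by algebra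
    ultimately show ?thesis by simp
  qed
  show "z \<in> Bc (torsion {s} C) D j" if z: "z \<in> Zc (torsion {s} C) D j \<inter> Bc C D j" for z
  proof -
    have zB: "z \<in> Bc C D j" using z by blast
    obtain k :: nat where k: "s [^] k \<odot>\<^bsub>M\<^esub> z = \<zero>\<^bsub>M\<^esub>" using z unfolding Zc_def torsion_def by blast
    obtain y where y: "y \<in> C (j - 1)" "z = D y" using zB by (rule BcE)
    have yc: "y \<in> carrier M" using complexD(5)[OF C] y by blast
    have "D (s [^] k \<odot>\<^bsub>M\<^esub> y) = \<zero>\<^bsub>M\<^esub>" using D(3)[OF sc yc] k y(2) by simp
    hence "s [^] k \<odot>\<^bsub>M\<^esub> y \<in> Zc C D (j - 1)"
      using submodule_closed(7)[OF complexD(2)[OF C] sc y(1)] by (auto simp: Zc_def)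
    then obtain l :: nat where "s [^] l \<odot>\<^bsub>M\<^esub> (s [^] k \<odot>\<^bsub>M\<^esub> y) \<in> Bc C D (j - 1)" using tor by blast
    then obtain w where w: "w \<in> C (j - 1 - 1)" "s [^] l \<odot>\<^bsub>M\<^esub> (s [^] k \<odot>\<^bsub>M\<^esub> y) = D w" by (rule BcE)
    obtain v and t :: nat where v: "v \<in> C (j - 1 - 1)" "s [^] (t + (l + k)) \<odot>\<^bsub>M\<^esub> v = s [^] t \<odot>\<^bsub>M\<^esub> w"
      using soft_divide[OF complexD(2)[OF C] soft w(1) s] by blast
    have Dv: "D v \<in> C (j - 1)" using complexD(3)[OF C v(1)] by simp
    have carr: "w \<in> carrier M" "v \<in> carrier M" "D v \<in> carrier M"
      using w v Dv complexD(5)[OF C] by blast+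
    let ?n = "t + (l + k)"
    have "s [^] ?n \<odot>\<^bsub>M\<^esub> y = s [^] t \<odot>\<^bsub>M\<^esub> D w"
      using smult_pow_add[OF s yc, of t "l + k"] smult_pow_add[OF s yc, of l k] w(2) by simp
    also have "\<dots> = D (s [^] ?n \<odot>\<^bsub>M\<^esub> v)" using D(3)[OF sc carr(1)] v(2) by simp
    also have "\<dots> = s [^] ?n \<odot>\<^bsub>M\<^esub> D v" by (rule D(3)[OF sc carr(2)])
    finally have eq: "s [^] ?n \<odot>\<^bsub>M\<^esub> y = s [^] ?n \<odot>\<^bsub>M\<^esub> D v" .
    have "s [^] ?n \<odot>\<^bsub>M\<^esub> (y \<ominus>\<^bsub>M\<^esub> D v) = s [^] ?n \<odot>\<^bsub>M\<^esub> y \<ominus>\<^bsub>M\<^esub> s [^] ?n \<odot>\<^bsub>M\<^esub> D v"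
      using sc[of ?n] carr yc by algebra
    also have "\<dots> = \<zero>\<^bsub>M\<^esub>" unfolding eq using sc[of ?n] carr by algebra
    finally have "s [^] ?n \<odot>\<^bsub>M\<^esub> (y \<ominus>\<^bsub>M\<^esub> D v) = \<zero>\<^bsub>M\<^esub>" .
    moreover have "y \<ominus>\<^bsub>M\<^esub> D v \<in> C (j - 1)" by (rule submodule_closed(5)[OF complexD(2)[OF C] y(1) Dv])
    ultimately have "y \<ominus>\<^bsub>M\<^esub> D v \<in> torsion {s} C (j - 1)" by (auto simp: torsion_def)
    moreover have "D (y \<ominus>\<^bsub>M\<^esub> D v) = z"
    proof -
      have "D y \<in> carrier M" using D(1) yc by blast
      thus ?thesis
        using D(6)[OF yc carr(3)] y(2) complexD(4)[OF C v(1)] M_minus_zero by (simp add: M.minus_eq)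
    qed
    ultimately show ?thesis by (auto simp: Bc_def)
  qed
qed

text \<open>The elements of \<open>S\<close> are treated one after the other, since torsion subcomplexes are soft again.\<close>

lemma quasi_iso_torsion_finite:
  assumes C: "is_complex C D" and soft: "\<And>j. soft (C j)" and fin: "finite S" and S: "S \<subseteq> carrier R"
    and tor: "\<And>s j z. s \<in> S \<Longrightarrow> z \<in> Zc C D j \<Longrightarrow> \<exists>k::nat. s [^] k \<odot>\<^bsub>M\<^esub> z \<in> Bc C D j"
  shows "quasi_iso (torsion S C) C D"
  using fin S tor
proof (induct S)
  case empty
  have "torsion {} C = C" by (rule ext) (auto simp: torsion_def)
  moreover have "quasi_iso C C D"
    unfolding quasi_iso_def using set_add_upper(1)[OF complex_submodules(1,2)[OF C]] by blast
  ultimately show ?case by simp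
next
  case (insert s S)
  let ?T = "torsion S C" and ?U = "torsion {s} (torsion S C)"
  have T: "is_complex ?T D" using insert by (intro torsion_complex[OF C]) auto
  have U: "is_complex ?U D" using insert by (intro torsion_complex[OF T]) auto
  have q: "quasi_iso ?T C D" using insert by auto
  have "\<exists>k::nat. s [^] k \<odot>\<^bsub>M\<^esub> z \<in> Bc ?T D j" if z: "z \<in> Zc ?T D j" for z j
  proof -
    have "z \<in> Zc C D j" using z Zc_torsion_subset by blast
    then obtain k :: nat where k: "s [^] k \<odot>\<^bsub>M\<^esub> z \<in> Bc C D j" using insert(5)[of s z] by blast
    have "s [^] k \<odot>\<^bsub>M\<^esub> z \<in> Zc ?T D j"
      using submodule_closed(7)[OF complex_submodules(1)[OF T] _ z] insert(4) by simp
    thus ?thesis using q k unfolding quasi_iso_def by blast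
  qed
  hence q': "quasi_iso ?U ?T D"
    using quasi_iso_single_torsion[OF T] soft_torsion[of S C] soft insert(4) by simp
  have eq: "torsion (insert s S) C = ?U" by (rule ext) (auto simp: torsion_def)
  have "quasi_iso ?U C D"
    unfolding quasi_iso_def
  proof (intro conjI allI)
    fix j
    show "?U j \<subseteq> C j" using torsion_subset by blast
    show "Zc ?U D j \<inter> Bc C D j \<subseteq> Bc ?U D j"
      using q q' Zc_torsion_subset[of "{s}" ?T D j] unfolding quasi_iso_def by blast
    have W: "submodule (Zc ?U D j <+>\<^bsub>M\<^esub> Bc C D j) R M"
      by (intro submodule_set_add complex_submodules U C)
    have "Zc ?T D j \<subseteq> Zc ?U D j <+>\<^bsub>M\<^esub> Bc ?T D j" using q' unfolding quasi_iso_def by blast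
    also have "\<dots> \<subseteq> Zc ?U D j <+>\<^bsub>M\<^esub> Bc C D j" by (intro set_add_mono Bc_torsion_subset subset_refl)
    finally have 1: "Zc ?T D j \<subseteq> Zc ?U D j <+>\<^bsub>M\<^esub> Bc C D j" .
    have "Zc ?T D j <+>\<^bsub>M\<^esub> Bc C D j \<subseteq> Zc ?U D j <+>\<^bsub>M\<^esub> Bc C D j"
      by (rule set_add_least[OF W 1 set_add_upper(2)]) (intro complex_submodules U C)+
    thus "Zc C D j \<subseteq> Zc ?U D j <+>\<^bsub>M\<^esub> Bc C D j" using q unfolding quasi_iso_def by blast
  qed
  thus ?case using eq by simp
qed

lemma finite_generators_m:
  obtains S where "finite S" "S \<subseteq> \<mm>" "\<And>C D. is_complex C D \<Longrightarrow> torsion \<mm> C = torsion S C"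
proof -
  obtain S where S: "finite S" "S \<subseteq> carrier R" "\<mm> = Idl S"
    using finetely_gen[OF ideal_m] by blast
  have Sm: "S \<subseteq> \<mm>" using S(3) R.genideal_self[OF S(2)] by simp
  have "torsion \<mm> C j = torsion S C j" if C: "is_complex C D" for C D and j
  proof
    show "torsion \<mm> C j \<subseteq> torsion S C j" using Sm by (auto simp: torsion_def)
    show "torsion S C j \<subseteq> torsion \<mm> C j"
    proof
      fix x assume x: "x \<in> torsion S C j"
      have xc: "x \<in> carrier M" "x \<in> C j" using x complexD(5)[OF C] by (auto simp: torsion_def)
      define I where "I = {a \<in> carrier R. \<exists>k::nat. a [^] k \<odot>\<^bsub>M\<^esub> x = \<zero>\<^bsub>M\<^esub>}"
      interpret nc: noetherian_cring R by unfold_locales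
      interpret N: noetherian_base_module R "regular_module R" by (rule nc.regular_noetherian_base_module)
      have "submodule I R (regular_module R)"
      proof (rule N.submoduleI')
        show "I \<subseteq> carrier (regular_module R)" by (auto simp: I_def)
        have "\<zero> [^] (1::nat) \<odot>\<^bsub>M\<^esub> x = \<zero>\<^bsub>M\<^esub>" using xc by simp
        thus "\<zero>\<^bsub>regular_module R\<^esub> \<in> I" unfolding I_def regular_module_simps by blast
        fix a b assume ab: "a \<in> I" "b \<in> I"
        then obtain k l :: nat where "a [^] k \<odot>\<^bsub>M\<^esub> x = \<zero>\<^bsub>M\<^esub>" "b [^] l \<odot>\<^bsub>M\<^esub> x = \<zero>\<^bsub>M\<^esub>" unfolding I_def by blast
        moreover have ab': "a \<in> carrier R" "b \<in> carrier R" using ab by (auto simp: I_def)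
        ultimately have "(a \<oplus> b) [^] (k + l) \<odot>\<^bsub>M\<^esub> x = \<zero>\<^bsub>M\<^esub>"
          using add_pow_smult_mem[OF zero_submodule ab' xc(1), of k l] by simp
        thus "a \<oplus>\<^bsub>regular_module R\<^esub> b \<in> I" unfolding I_def regular_module_simps using ab' by blast
      next
        fix r a assume r: "r \<in> carrier R" and a: "a \<in> I"
        then obtain k :: nat where k: "a \<in> carrier R" "a [^] k \<odot>\<^bsub>M\<^esub> x = \<zero>\<^bsub>M\<^esub>" unfolding I_def by blast
        have "(r \<otimes> a) [^] k \<odot>\<^bsub>M\<^esub> x = r [^] k \<odot>\<^bsub>M\<^esub> (a [^] k \<odot>\<^bsub>M\<^esub> x)"
          using r k(1) xc by (simp add: R.nat_pow_distrib smult_assoc1)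
        hence "(r \<otimes> a) [^] k \<odot>\<^bsub>M\<^esub> x = \<zero>\<^bsub>M\<^esub>" using k r by simp
        thus "r \<odot>\<^bsub>regular_module R\<^esub> a \<in> I" unfolding I_def regular_module_simps using r k(1) by blast
      qed
      hence "ideal I R" by (simp add: nc.submodule_regular_iff)
      moreover have "S \<subseteq> I" using S(2) x by (auto simp: I_def torsion_def)
      ultimately have "\<mm> \<subseteq> I" unfolding S(3) by (rule R.genideal_minimal)
      thus "x \<in> torsion \<mm> C j" using xc by (auto simp: I_def torsion_def)
    qed
  qed
  hence "torsion \<mm> C = torsion S C" if "is_complex C D" for C D
    by (intro ext) (use that in blast)
  thus thesis using that S(1) Sm by blast
qed

section \<open>Koszul complexes\<close>

text \<open>The Koszul complex on \<open>rs\<close> with coefficients in \<open>C\<close>, as an iterated cone.\<close>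

primrec koszul :: "'a list \<Rightarrow> (int \<Rightarrow> 'c set) \<Rightarrow> int \<Rightarrow> 'c set"
  where "koszul [] C = C" | "koszul (r # rs) C = koszul rs (mapping_cone C)"

primrec koszul_diff :: "'a list \<Rightarrow> ('c \<Rightarrow> 'c) \<Rightarrow> 'c \<Rightarrow> 'c"
  where "koszul_diff [] D = D" | "koszul_diff (r # rs) D = koszul_diff rs (cone_diff r D)"

lemma koszul_complex:
  "is_complex C D \<Longrightarrow> set rs \<subseteq> carrier R \<Longrightarrow> is_complex (koszul rs C) (koszul_diff rs D)"
  by (induct rs arbitrary: C D) (auto intro: cone_complex)

lemma torsion_koszul: "S \<subseteq> carrier R \<Longrightarrow> torsion S (koszul rs C) = koszul rs (torsion S C)"
  by (induct rs arbitrary: C) (simp_all add: torsion_mapping_cone)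

lemma cone_cohomology_torsion:
  assumes C: "is_complex C D" and r: "r \<in> carrier R" and s: "s \<in> carrier R"
    and tor: "\<And>j z. z \<in> Zc C D j \<Longrightarrow> \<exists>k::nat. s [^] k \<odot>\<^bsub>M\<^esub> z \<in> Bc C D j"
    and u: "u \<in> Zc (mapping_cone C) (cone_diff r D) j"
  shows "\<exists>k::nat. s [^] k \<odot>\<^bsub>M\<^esub> u \<in> Bc (mapping_cone C) (cone_diff r D) j"
proof -
  let ?E = "cone_diff r D" and ?K = "mapping_cone C"
  note D = mod_hom_props[OF complexD(1)[OF C]]
  note sK = complex_submodules[OF cone_complex[OF C r], of j]
  note cB = submodule_closed[OF sK(2)] and cZ = submodule_closed[OF sK(1)]
  have u': "u \<in> carrier M" "p2 u \<in> Zc C D (j + 1)" using u unfolding Zc_cone_iff[OF C r] by blast+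
  obtain k :: nat where "s [^] k \<odot>\<^bsub>M\<^esub> p2 u \<in> Bc C D (j + 1)" using tor[OF u'(2)] by blast
  then obtain y where y: "y \<in> C j" "s [^] k \<odot>\<^bsub>M\<^esub> p2 u = D y" by (auto elim: BcE)
  let ?u = "s [^] k \<odot>\<^bsub>M\<^esub> u" and ?w = "pair (r \<odot>\<^bsub>M\<^esub> y) (\<ominus>\<^bsub>M\<^esub> D y)"
  have uZ: "?u \<in> Zc ?K ?E j" by (rule cZ(7)[OF pow_closed[OF s] u])
  have p2: "p2 ?u = D y" using y(2) u'(1) s by simp
  note cc = cone_cocycle_cases[OF C r uZ y(1) p2]
  have w: "?w \<in> Bc ?K ?E j" by (rule cone_coboundary_of_second[OF C r y(1)])
  let ?z = "p1 ?u \<oplus>\<^bsub>M\<^esub> r \<odot>\<^bsub>M\<^esub> y"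
  have zc: "?z \<in> carrier M" using complexD(5)[OF C ZcD(1)[OF cc(1)]] .
  obtain l :: nat where l: "s [^] l \<odot>\<^bsub>M\<^esub> ?z \<in> Bc C D j" using tor[OF cc(1)] by blast
  have "s [^] l \<odot>\<^bsub>M\<^esub> (?u \<oplus>\<^bsub>M\<^esub> ?w) = pair (s [^] l \<odot>\<^bsub>M\<^esub> ?z) \<zero>\<^bsub>M\<^esub>"
    unfolding cc(2) using pair_simps(3)[of "s [^] l" ?z "\<zero>\<^bsub>M\<^esub>"] zc s by simp
  hence 1: "s [^] l \<odot>\<^bsub>M\<^esub> (?u \<oplus>\<^bsub>M\<^esub> ?w) \<in> Bc ?K ?E j" using cone_coboundary_of_first[OF C r l] by simp
  have wl: "s [^] l \<odot>\<^bsub>M\<^esub> ?w \<in> Bc ?K ?E j" by (rule cB(7)[OF pow_closed[OF s] w])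
  have carr: "?u \<in> carrier M" "?w \<in> carrier M" using cZ(2)[OF uZ] cB(2)[OF w] by blast+
  have "s [^] l \<odot>\<^bsub>M\<^esub> ?w \<oplus>\<^bsub>M\<^esub> s [^] l \<odot>\<^bsub>M\<^esub> ?u = s [^] l \<odot>\<^bsub>M\<^esub> (?u \<oplus>\<^bsub>M\<^esub> ?w)"
    using carr pow_closed[OF s, of l] by (simp add: smult_r_distr M.a_comm)
  hence "s [^] l \<odot>\<^bsub>M\<^esub> ?w \<oplus>\<^bsub>M\<^esub> s [^] l \<odot>\<^bsub>M\<^esub> ?u \<in> Bc ?K ?E j" using 1 by simp
  hence "s [^] l \<odot>\<^bsub>M\<^esub> ?u \<in> Bc ?K ?E j"
    using submodule_add_cancel[OF sK(2) wl] carr(1) pow_closed[OF s] by blast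
  moreover have "s [^] l \<odot>\<^bsub>M\<^esub> ?u = s [^] (l + k) \<odot>\<^bsub>M\<^esub> u" by (rule smult_pow_add[OF s u'(1), symmetric])
  ultimately have "s [^] (l + k) \<odot>\<^bsub>M\<^esub> u \<in> Bc ?K ?E j" by simp
  thus ?thesis by blast
qed

lemma cone_cohomology_killed:
  assumes C: "is_complex C D" and r: "r \<in> carrier R"
    and u: "u \<in> Zc (mapping_cone C) (cone_diff r D) j"
  shows "r \<odot>\<^bsub>M\<^esub> u \<in> Bc (mapping_cone C) (cone_diff r D) j"
proof -
  note D = mod_hom_props[OF complexD(1)[OF C]]
  have u': "u \<in> carrier M" "p1 u \<in> C j" "p2 u \<in> C (j + 1)" "D (p1 u) \<oplus>\<^bsub>M\<^esub> r \<odot>\<^bsub>M\<^esub> p2 u = \<zero>\<^bsub>M\<^esub>"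
    using u ZcD(1) unfolding Zc_cone_iff[OF C r] by blast+
  have carr: "D (p1 u) \<in> carrier M" "r \<odot>\<^bsub>M\<^esub> p2 u \<in> carrier M" using u' r D(1) by auto
  have "r \<odot>\<^bsub>M\<^esub> p2 u = (D (p1 u) \<oplus>\<^bsub>M\<^esub> r \<odot>\<^bsub>M\<^esub> p2 u) \<ominus>\<^bsub>M\<^esub> D (p1 u)" using carr by algebra
  also have "\<dots> = \<ominus>\<^bsub>M\<^esub> D (p1 u)" unfolding u'(4) using carr by algebra
  finally have 2: "r \<odot>\<^bsub>M\<^esub> p2 u = \<ominus>\<^bsub>M\<^esub> D (p1 u)" .
  show ?thesis
    by (rule Bc_coneI[OF C r _ submodule_closed(3)[OF complexD(2)[OF C]] u'(2)])
      (use u' r 2 D(4) in auto)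
qed

text \<open>Multiplication by \<open>r\<close> is homotopic to zero on the cone of \<open>r\<close>, and further cones preserve torsion
  cohomology.\<close>

lemma koszul_cohomology_torsion:
  assumes "is_complex C D" "set rs \<subseteq> carrier R" "s \<in> carrier R"
    and "s \<in> set rs \<or> (\<forall>j. \<forall>z\<in>Zc C D j. \<exists>k::nat. s [^] k \<odot>\<^bsub>M\<^esub> z \<in> Bc C D j)"
    and "u \<in> Zc (koszul rs C) (koszul_diff rs D) j"
  shows "\<exists>k::nat. s [^] k \<odot>\<^bsub>M\<^esub> u \<in> Bc (koszul rs C) (koszul_diff rs D) j"
  using assms
proof (induct rs arbitrary: C D)
  case Nil thus ?case by auto
next
  case (Cons r rs)
  have r: "r \<in> carrier R" using Cons(3) by simp
  let ?E = "cone_diff r D" and ?K = "mapping_cone C"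
  have K: "is_complex ?K ?E" by (rule cone_complex[OF Cons(2) r])
  have "s \<in> set rs \<or> (\<forall>j. \<forall>z\<in>Zc ?K ?E j. \<exists>k::nat. s [^] k \<odot>\<^bsub>M\<^esub> z \<in> Bc ?K ?E j)"
  proof (cases "s = r")
    case True
    have "s [^] (1::nat) \<odot>\<^bsub>M\<^esub> z \<in> Bc ?K ?E j" if z: "z \<in> Zc ?K ?E j" for z j
      using cone_cohomology_killed[OF Cons(2) r z] True r by simp
    thus ?thesis by blast
  next
    case False
    thus ?thesis using Cons(5) cone_cohomology_torsion[OF Cons(2) r Cons(4)] by auto
  qed
  thus ?case using Cons(1)[OF K _ Cons(4)] Cons(3,6) by simp
qed

text \<open>Melkersson's criterion, applied for each member of \<open>rs\<close>: the kernel of \<open>r\<close> on the cohomology of \<open>C\<close>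
  is a quotient of the cohomology of the cone.\<close>

lemma koszul_artinian_descent:
  assumes "is_complex C D" "set rs \<subseteq> carrier R"
    and "\<And>r j x. r \<in> set rs \<Longrightarrow> x \<in> C j \<Longrightarrow> \<exists>k::nat. r [^] k \<odot>\<^bsub>M\<^esub> x = \<zero>\<^bsub>M\<^esub>"
    and "\<And>j. artinian_interval (Bc (koszul rs C) (koszul_diff rs D) j) (Zc (koszul rs C) (koszul_diff rs D) j)"
  shows "artinian_interval (Bc C D j) (Zc C D j)"
  using assms
proof (induct rs arbitrary: C D j)
  case Nil thus ?case by simp
next
  case (Cons r rs)
  have r: "r \<in> carrier R" using Cons(3) by simp
  let ?E = "cone_diff r D" and ?K = "mapping_cone C"
  have K: "is_complex ?K ?E" by (rule cone_complex[OF Cons(2) r])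
  have "torsion (set rs) ?K = ?K"
  proof -
    have "torsion (set rs) C = C" using Cons(4) by (intro ext) (auto simp: torsion_def)
    thus ?thesis using torsion_mapping_cone[of "set rs" C] Cons(3) by simp
  qed
  hence tor: "\<exists>k::nat. a [^] k \<odot>\<^bsub>M\<^esub> x = \<zero>\<^bsub>M\<^esub>" if "a \<in> set rs" "x \<in> ?K j" for a x j
    using that unfolding torsion_def fun_eq_iff by blast
  have "artinian_interval (Bc ?K ?E (j - 1)) (Zc ?K ?E (j - 1))"
    by (rule Cons(1)[OF K]) (use Cons(3,5) tor in auto)
  hence art: "artinian_interval (Bc C D j) {z \<in> Zc C D j. r \<odot>\<^bsub>M\<^esub> z \<in> Bc C D j}"
    using cone_artinian_kernel[OF Cons(2) r, of "j - 1"] by simp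
  note s = complex_submodules[OF Cons(2), of j]
  show ?case
  proof (rule artinian_of_torsion_kernel[OF s(2,1,3) r _ art])
    fix z assume "z \<in> Zc C D j"
    then obtain k :: nat where "r [^] k \<odot>\<^bsub>M\<^esub> z = \<zero>\<^bsub>M\<^esub>" using Cons(4)[of r z j] ZcD(1) by auto
    thus "\<exists>k::nat. r [^] k \<odot>\<^bsub>M\<^esub> z \<in> Bc C D j" using submodule_closed(3)[OF s(2)] by metis
  qed
qed

text \<open>In the top degree the cohomology of the cone is \<open>H/rH\<close>. So if the subcomplex \<open>C'\<close> accounts for the
  top cohomology of \<open>C\<close> up to \<open>\<mm>\<close> times it after taking the cone, then it already does so before.\<close>

lemma cone_top_degree:
  assumes C: "is_complex C D" and C': "is_complex C' D" and r: "r \<in> \<mm>"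
    and sub: "C' j \<subseteq> C j"
    and v: "Zc C D (j + 1) \<subseteq> Bc C D (j + 1)" and v': "Zc C' D (j + 1) \<subseteq> Bc C' D (j + 1)"
    and gen: "Zc (mapping_cone C) (cone_diff r D) j \<subseteq>
      (Zc (mapping_cone C') (cone_diff r D) j <+>\<^bsub>M\<^esub> Bc (mapping_cone C) (cone_diff r D) j) <+>\<^bsub>M\<^esub>
        ideal_multiples M \<mm> (Zc (mapping_cone C) (cone_diff r D) j)"
  shows "Zc C D j \<subseteq> (Zc C' D j <+>\<^bsub>M\<^esub> Bc C D j) <+>\<^bsub>M\<^esub> ideal_multiples M \<mm> (Zc C D j)"
proof
  let ?E = "cone_diff r D" and ?K = "mapping_cone C" and ?K' = "mapping_cone C'"
  have rc: "r \<in> carrier R" using r m_subset by blast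
  note D = mod_hom_props[OF complexD(1)[OF C]]
  note cC = submodule_closed[OF complexD(2)[OF C, of j]]
  note cC' = submodule_closed[OF complexD(2)[OF C', of j]]
  have I: "submodule (ideal_multiples M \<mm> (Zc C D j)) R M"
    by (intro submodule_ideal_multiples ideal_m complex_submodules C)
  note cI = submodule_closed[OF I] and cZ = submodule_closed[OF complex_submodules(1)[OF C, of j]]
  have K: "is_complex ?K ?E" by (rule cone_complex[OF C rc])
  have key: "\<exists>c. c \<in> C j \<and> p2 w = D c \<and> p1 w \<oplus>\<^bsub>M\<^esub> r \<odot>\<^bsub>M\<^esub> c \<in> ideal_multiples M \<mm> (Zc C D j)"
    if "w \<in> ideal_multiples M \<mm> (Zc ?K ?E j)" for w
    using that
  proof induct
    case (prod a u)
    have ac: "a \<in> carrier R" using prod m_subset by blast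
    have u: "u \<in> carrier M" "p2 u \<in> Zc C D (j + 1)" using prod(2) unfolding Zc_cone_iff[OF C rc] by blast+
    obtain c where c: "c \<in> C j" "p2 u = D c" using u(2) v by (auto elim!: BcE)
    have cc: "c \<in> carrier M" using c cC by blast
    have "p1 u \<oplus>\<^bsub>M\<^esub> r \<odot>\<^bsub>M\<^esub> c \<in> Zc C D j" by (rule cone_cocycle_cases(1)[OF C rc prod(2) c])
    hence "a \<odot>\<^bsub>M\<^esub> (p1 u \<oplus>\<^bsub>M\<^esub> r \<odot>\<^bsub>M\<^esub> c) \<in> ideal_multiples M \<mm> (Zc C D j)"
      by (rule ideal_multiples.prod[OF prod(1)])
    moreover have "a \<odot>\<^bsub>M\<^esub> (p1 u \<oplus>\<^bsub>M\<^esub> r \<odot>\<^bsub>M\<^esub> c) = p1 (a \<odot>\<^bsub>M\<^esub> u) \<oplus>\<^bsub>M\<^esub> r \<odot>\<^bsub>M\<^esub> (a \<odot>\<^bsub>M\<^esub> c)"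
      using ac u(1) cc rc by (simp add: smult_r_distr smult_lcomm[of a r])
    moreover have "p2 (a \<odot>\<^bsub>M\<^esub> u) = D (a \<odot>\<^bsub>M\<^esub> c)" using ac u(1) c(2) D(3)[OF ac cc] by simp
    ultimately show ?case using cC(7)[OF ac c(1)] by auto
  next
    case (sum x y)
    then obtain c d where *: "c \<in> C j" "p2 x = D c" "p1 x \<oplus>\<^bsub>M\<^esub> r \<odot>\<^bsub>M\<^esub> c \<in> ideal_multiples M \<mm> (Zc C D j)"
      "d \<in> C j" "p2 y = D d" "p1 y \<oplus>\<^bsub>M\<^esub> r \<odot>\<^bsub>M\<^esub> d \<in> ideal_multiples M \<mm> (Zc C D j)" by blast
    have carr: "x \<in> carrier M" "y \<in> carrier M" "c \<in> carrier M" "d \<in> carrier M"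
      using sum(1,3) submodule_closed(2)[OF submodule_ideal_multiples[OF ideal_m complex_submodules(1)[OF K]]] * cC
      by blast+
    have pc: "p1 x \<in> carrier M" "p1 y \<in> carrier M" using carr by auto
    have "(p1 x \<oplus>\<^bsub>M\<^esub> r \<odot>\<^bsub>M\<^esub> c) \<oplus>\<^bsub>M\<^esub> (p1 y \<oplus>\<^bsub>M\<^esub> r \<odot>\<^bsub>M\<^esub> d) = (p1 x \<oplus>\<^bsub>M\<^esub> p1 y) \<oplus>\<^bsub>M\<^esub> r \<odot>\<^bsub>M\<^esub> (c \<oplus>\<^bsub>M\<^esub> d)"
      using pc carr rc by algebra
    hence "p1 (x \<oplus>\<^bsub>M\<^esub> y) \<oplus>\<^bsub>M\<^esub> r \<odot>\<^bsub>M\<^esub> (c \<oplus>\<^bsub>M\<^esub> d) \<in> ideal_multiples M \<mm> (Zc C D j)"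
      using cI(4)[OF *(3,6)] carr by simp
    moreover have "p2 (x \<oplus>\<^bsub>M\<^esub> y) = D (c \<oplus>\<^bsub>M\<^esub> d)" using carr * D(2) by simp
    ultimately show ?case using cC(4)[OF *(1,4)] by blast
  qed
  fix z assume z: "z \<in> Zc C D j"
  have zc: "z \<in> C j" "z \<in> carrier M" "D z = \<zero>\<^bsub>M\<^esub>" using z cC(2) by (auto simp: Zc_def)
  have "pair z \<zero>\<^bsub>M\<^esub> \<in> Zc ?K ?E j"
    unfolding Zc_cone_iff[OF C rc]
    using zc rc submodule_closed(3)[OF complex_submodules(1)[OF C, of "j + 1"]] by simp
  then obtain q w where qw: "q \<in> Zc ?K' ?E j <+>\<^bsub>M\<^esub> Bc ?K ?E j" "w \<in> ideal_multiples M \<mm> (Zc ?K ?E j)"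
    "pair z \<zero>\<^bsub>M\<^esub> = q \<oplus>\<^bsub>M\<^esub> w" using gen by (blast elim: set_addE)
  obtain g b where gb: "g \<in> Zc ?K' ?E j" "b \<in> Bc ?K ?E j" "q = g \<oplus>\<^bsub>M\<^esub> b" using qw(1) by (rule set_addE)
  have g: "g \<in> carrier M" "p1 g \<in> C' j" "p2 g \<in> Zc C' D (j + 1)"
    using gb(1) unfolding Zc_cone_iff[OF C' rc] by blast+
  obtain y where y: "y \<in> C' j" "p2 g = D y" using g(3) v' by (auto elim!: BcE)
  have g1: "p1 g \<oplus>\<^bsub>M\<^esub> r \<odot>\<^bsub>M\<^esub> y \<in> Zc C' D j" by (rule cone_cocycle_cases(1)[OF C' rc gb(1) y])
  obtain x e where b: "x \<in> C (j - 1)" "e \<in> C j" "p1 b = D x \<oplus>\<^bsub>M\<^esub> r \<odot>\<^bsub>M\<^esub> e" "p2 b = \<ominus>\<^bsub>M\<^esub> D e"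
    using Bc_coneE[OF C rc gb(2)] .
  obtain c where c: "c \<in> C j" "p2 w = D c" "p1 w \<oplus>\<^bsub>M\<^esub> r \<odot>\<^bsub>M\<^esub> c \<in> ideal_multiples M \<mm> (Zc C D j)"
    using key[OF qw(2)] by blast
  have bw: "b \<in> carrier M" "w \<in> carrier M"
    using gb(2) qw(2) submodule_closed(2)[OF complex_submodules(2)[OF K]]
      submodule_closed(2)[OF submodule_ideal_multiples[OF ideal_m complex_submodules(1)[OF K]]] by blast+
  have carr: "p1 g \<in> carrier M" "p1 w \<in> carrier M" "y \<in> carrier M" "c \<in> carrier M" "e \<in> carrier M"
    "D x \<in> carrier M" "D y \<in> carrier M" "D c \<in> carrier M" "D e \<in> carrier M"
    using g bw y c b cC' cC D(1) complexD(5)[OF C] by auto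
  have "p1 (pair z \<zero>\<^bsub>M\<^esub>) = (p1 g \<oplus>\<^bsub>M\<^esub> p1 b) \<oplus>\<^bsub>M\<^esub> p1 w" unfolding qw(3) gb(3) using g bw by simp
  hence "z = (p1 g \<oplus>\<^bsub>M\<^esub> (D x \<oplus>\<^bsub>M\<^esub> r \<odot>\<^bsub>M\<^esub> e)) \<oplus>\<^bsub>M\<^esub> p1 w" using zc b(3) by simp
  also have "\<dots> = ((p1 g \<oplus>\<^bsub>M\<^esub> r \<odot>\<^bsub>M\<^esub> y) \<oplus>\<^bsub>M\<^esub> D x) \<oplus>\<^bsub>M\<^esub> ((p1 w \<oplus>\<^bsub>M\<^esub> r \<odot>\<^bsub>M\<^esub> c) \<oplus>\<^bsub>M\<^esub> r \<odot>\<^bsub>M\<^esub> ((e \<ominus>\<^bsub>M\<^esub> y) \<ominus>\<^bsub>M\<^esub> c))"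
    using carr rc by algebra
  finally have zeq: "z = ((p1 g \<oplus>\<^bsub>M\<^esub> r \<odot>\<^bsub>M\<^esub> y) \<oplus>\<^bsub>M\<^esub> D x) \<oplus>\<^bsub>M\<^esub> ((p1 w \<oplus>\<^bsub>M\<^esub> r \<odot>\<^bsub>M\<^esub> c) \<oplus>\<^bsub>M\<^esub> r \<odot>\<^bsub>M\<^esub> ((e \<ominus>\<^bsub>M\<^esub> y) \<ominus>\<^bsub>M\<^esub> c))" .
  have "p2 (pair z \<zero>\<^bsub>M\<^esub>) = (p2 g \<oplus>\<^bsub>M\<^esub> p2 b) \<oplus>\<^bsub>M\<^esub> p2 w" unfolding qw(3) gb(3) using g bw by simp
  hence 0: "\<zero>\<^bsub>M\<^esub> = (D y \<oplus>\<^bsub>M\<^esub> \<ominus>\<^bsub>M\<^esub> D e) \<oplus>\<^bsub>M\<^esub> D c" using zc y b(4) c by simp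
  let ?t = "(e \<ominus>\<^bsub>M\<^esub> y) \<ominus>\<^bsub>M\<^esub> c"
  have "D ?t = (D e \<ominus>\<^bsub>M\<^esub> D y) \<ominus>\<^bsub>M\<^esub> D c" using carr D(6) by simp
  also have "\<dots> = \<ominus>\<^bsub>M\<^esub> ((D y \<oplus>\<^bsub>M\<^esub> \<ominus>\<^bsub>M\<^esub> D e) \<oplus>\<^bsub>M\<^esub> D c)" using carr by algebra
  also have "\<dots> = \<zero>\<^bsub>M\<^esub>" unfolding 0[symmetric] by (rule M_minus_zero)
  finally have "D ?t = \<zero>\<^bsub>M\<^esub>" .
  have yC: "y \<in> C j" using y(1) sub by blast
  have tZ: "?t \<in> Zc C D j"
    using \<open>D ?t = \<zero>\<^bsub>M\<^esub>\<close> cC(5)[OF cC(5)[OF b(2) yC] c(1)] by (auto simp: Zc_def)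
  have "r \<odot>\<^bsub>M\<^esub> ?t \<in> ideal_multiples M \<mm> (Zc C D j)" by (rule ideal_multiples.prod[OF r tZ])
  hence "(p1 w \<oplus>\<^bsub>M\<^esub> r \<odot>\<^bsub>M\<^esub> c) \<oplus>\<^bsub>M\<^esub> r \<odot>\<^bsub>M\<^esub> ?t \<in> ideal_multiples M \<mm> (Zc C D j)" by (rule cI(4)[OF c(3)])
  moreover have "(p1 g \<oplus>\<^bsub>M\<^esub> r \<odot>\<^bsub>M\<^esub> y) \<oplus>\<^bsub>M\<^esub> D x \<in> Zc C' D j <+>\<^bsub>M\<^esub> Bc C D j"
    by (rule set_addI[OF g1]) (use b(1) in \<open>auto simp: Bc_def\<close>)
  ultimately show "z \<in> (Zc C' D j <+>\<^bsub>M\<^esub> Bc C D j) <+>\<^bsub>M\<^esub> ideal_multiples M \<mm> (Zc C D j)"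
    by (subst zeq) (rule set_addI)
qed

lemma cone_acyclic_above:
  assumes C: "is_complex C D" and r: "r \<in> carrier R" and v: "\<And>i. k \<le> i \<Longrightarrow> Zc C D i \<subseteq> Bc C D i" and i: "k \<le> i"
  shows "Zc (mapping_cone C) (cone_diff r D) i \<subseteq> Bc (mapping_cone C) (cone_diff r D) i"
proof (rule cone_acyclic[OF C r])
  show "Zc C D (i + 1) \<subseteq> Bc C D (i + 1)" using v i by auto
  have "Bc C D i \<subseteq> Bc C D i <+>\<^bsub>M\<^esub> (\<lambda>x. r \<odot>\<^bsub>M\<^esub> x) ` Zc C D i"
    by (intro set_add_upper submodule_smult_image complex_submodules C r)
  thus "Zc C D i \<subseteq> Bc C D i <+>\<^bsub>M\<^esub> (\<lambda>x. r \<odot>\<^bsub>M\<^esub> x) ` Zc C D i" using v[OF i] by blast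
qed

lemma koszul_top_degree:
  assumes "is_complex C D" "is_complex C' D" "set rs \<subseteq> \<mm>" "\<And>i. C' i \<subseteq> C i"
    and "\<And>i. j + 1 \<le> i \<Longrightarrow> Zc C D i \<subseteq> Bc C D i" "\<And>i. j + 1 \<le> i \<Longrightarrow> Zc C' D i \<subseteq> Bc C' D i"
    and "Zc (koszul rs C) (koszul_diff rs D) j \<subseteq>
      Zc (koszul rs C') (koszul_diff rs D) j <+>\<^bsub>M\<^esub> Bc (koszul rs C) (koszul_diff rs D) j"
  shows "Zc C D j \<subseteq> (Zc C' D j <+>\<^bsub>M\<^esub> Bc C D j) <+>\<^bsub>M\<^esub> ideal_multiples M \<mm> (Zc C D j)"
  using assms
proof (induct rs arbitrary: C C' D)
  case Nil
  have "Zc C' D j <+>\<^bsub>M\<^esub> Bc C D j \<subseteq> (Zc C' D j <+>\<^bsub>M\<^esub> Bc C D j) <+>\<^bsub>M\<^esub> ideal_multiples M \<mm> (Zc C D j)"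
    using Nil by (intro set_add_upper submodule_set_add submodule_ideal_multiples ideal_m complex_submodules)
  thus ?case using Nil(7) by auto
next
  case (Cons r rs)
  have r: "r \<in> \<mm>" "r \<in> carrier R" using Cons(4) m_subset by auto
  have sub: "mapping_cone C' i \<subseteq> mapping_cone C i" for i
    using Cons(5) by (auto simp: mapping_cone_def)
  show ?case
  proof (rule cone_top_degree[OF Cons(2,3) r(1) Cons(5)])
    show "Zc C D (j + 1) \<subseteq> Bc C D (j + 1)" "Zc C' D (j + 1) \<subseteq> Bc C' D (j + 1)"
      using Cons(6,7) by simp_all
    show "Zc (mapping_cone C) (cone_diff r D) j \<subseteq>
      (Zc (mapping_cone C') (cone_diff r D) j <+>\<^bsub>M\<^esub> Bc (mapping_cone C) (cone_diff r D) j) <+>\<^bsub>M\<^esub>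
        ideal_multiples M \<mm> (Zc (mapping_cone C) (cone_diff r D) j)"
    proof (rule Cons(1)[OF _ _ _ sub])
      show "is_complex (mapping_cone C) (cone_diff r D)" "is_complex (mapping_cone C') (cone_diff r D)"
        using cone_complex Cons(2,3) r by blast+
      show "set rs \<subseteq> \<mm>" using Cons(4) by simp
      show "Zc (mapping_cone C) (cone_diff r D) i \<subseteq> Bc (mapping_cone C) (cone_diff r D) i" if "j + 1 \<le> i" for i
        by (rule cone_acyclic_above[OF Cons(2) r(2) Cons(6) that])
      show "Zc (mapping_cone C') (cone_diff r D) i \<subseteq> Bc (mapping_cone C') (cone_diff r D) i" if "j + 1 \<le> i" for i
        by (rule cone_acyclic_above[OF Cons(3) r(2) Cons(7) that])
    qed (use Cons(8) in simp)
  qed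
qed

section \<open>Grothendieck's non-vanishing theorem\<close>

text \<open>What is used of an injective resolution of a finitely generated module, in a form that mapping
  cones inherit.\<close>

definition resolution_like :: "(int \<Rightarrow> 'c set) \<Rightarrow> ('c \<Rightarrow> 'c) \<Rightarrow> bool"
  where "resolution_like C D \<longleftrightarrow> is_complex C D \<and> (\<forall>j. soft (C j)) \<and>
    (\<forall>j. noetherian_interval (Bc C D j) (Zc C D j)) \<and> (\<forall>j\<ge>1. Zc C D j \<subseteq> Bc C D j)"

lemma resolution_like_cone:
  assumes C: "resolution_like C D" and r: "r \<in> carrier R"
  shows "resolution_like (mapping_cone C) (cone_diff r D)"
proof -
  have C': "is_complex C D" "\<And>j. soft (C j)" "\<And>j. noetherian_interval (Bc C D j) (Zc C D j)"
    "\<And>j. 1 \<le> j \<Longrightarrow> Zc C D j \<subseteq> Bc C D j" using C unfolding resolution_like_def by blast+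
  show ?thesis
    unfolding resolution_like_def
    using cone_complex[OF C'(1) r] soft_mapping_cone[OF C'(1,2)] cone_noetherian[OF C'(1) r C'(3,3)]
      cone_acyclic_above[OF C'(1) r C'(4)] by blast
qed

lemma resolution_like_koszul:
  "resolution_like C D \<Longrightarrow> set rs \<subseteq> carrier R \<Longrightarrow> resolution_like (koszul rs C) (koszul_diff rs D)"
  by (induct rs arbitrary: C D) (auto intro: resolution_like_cone)

text \<open>The cohomology is noetherian because the torsion subcomplex is quasi-isomorphic to \<open>C\<close>, and it is
  \<open>\<mm>\<close>-torsion.\<close>

lemma torsion_artinian:
  assumes C: "is_complex C D" and q: "quasi_iso (torsion \<mm> C) C D"
    and noeth: "noetherian_interval (Bc C D j) (Zc C D j)"
  shows "artinian_interval (Bc (torsion \<mm> C) D j) (Zc (torsion \<mm> C) D j)"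
proof -
  let ?T = "torsion \<mm> C"
  have T: "is_complex ?T D" by (rule torsion_complex[OF C m_subset])
  note sT = complex_submodules[OF T, of j] and sC = complex_submodules[OF C, of j]
  have ZB: "Zc ?T D j \<subseteq> Zc C D j" "Bc ?T D j \<subseteq> Bc C D j" by (rule Zc_torsion_subset Bc_torsion_subset)+
  have inter: "Zc ?T D j \<inter> Bc C D j \<subseteq> Bc ?T D j" using q unfolding quasi_iso_def by blast
  have "noetherian_interval (Bc ?T D j) (Zc ?T D j)"
  proof (rule noetherian_transfer[OF noeth, of _ "\<lambda>U. U <+>\<^bsub>M\<^esub> Bc C D j"])
    fix U assume "U \<in> interval (Bc ?T D j) (Zc ?T D j)"
    hence U: "submodule U R M" "U \<subseteq> Zc ?T D j" by (auto simp: interval_def)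
    have "U \<subseteq> Zc C D j" using U ZB by blast
    thus "U <+>\<^bsub>M\<^esub> Bc C D j \<in> interval (Bc C D j) (Zc C D j)"
      unfolding interval_def using submodule_set_add[OF U(1) sC(2)] set_add_upper(2)[OF U(1) sC(2)]
        set_add_least[OF sC(1) _ sC(3)] by blast
  next
    fix U V :: "'c set" assume "U \<subseteq> V"
    thus "U <+>\<^bsub>M\<^esub> Bc C D j \<subseteq> V <+>\<^bsub>M\<^esub> Bc C D j" by (intro set_add_mono) auto
  next
    have incl: "U \<subseteq> V" if U: "U \<in> interval (Bc ?T D j) (Zc ?T D j)" and V: "V \<in> interval (Bc ?T D j) (Zc ?T D j)"
      and sub: "U <+>\<^bsub>M\<^esub> Bc C D j \<subseteq> V <+>\<^bsub>M\<^esub> Bc C D j" for U V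
    proof
      have U': "submodule U R M" "U \<subseteq> Zc ?T D j" using U by (auto simp: interval_def)
      have V': "submodule V R M" "Bc ?T D j \<subseteq> V" "V \<subseteq> Zc ?T D j" using V by (auto simp: interval_def)
      fix u assume u: "u \<in> U"
      hence "u \<in> V <+>\<^bsub>M\<^esub> Bc C D j" using sub set_add_upper(1)[OF U'(1) sC(2)] by blast
      then obtain v b where vb: "v \<in> V" "b \<in> Bc C D j" "u = v \<oplus>\<^bsub>M\<^esub> b" by (rule set_addE)
      have bc: "b \<in> carrier M" using submodule_closed(2)[OF sC(2) vb(2)] .
      have "b \<in> Zc ?T D j"
        using submodule_add_cancel[OF sT(1) _ bc, of v] vb(1,3) u U'(2) V'(3) by blast
      hence "b \<in> V" using inter vb(2) V'(2) by blast
      thus "u \<in> V" unfolding vb(3) using submodule_closed(4)[OF V'(1) vb(1)] by blast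
    qed
    show "inj_on (\<lambda>U. U <+>\<^bsub>M\<^esub> Bc C D j) (interval (Bc ?T D j) (Zc ?T D j))"
      by (rule inj_onI, rule equalityI; rule incl; simp)
  qed
  thus ?thesis
  proof (rule artinian_of_noetherian_torsion[OF sT(2,1,3)])
    fix z a assume "z \<in> Zc ?T D j" "a \<in> \<mm>"
    then obtain k :: nat where "a [^] k \<odot>\<^bsub>M\<^esub> z = \<zero>\<^bsub>M\<^esub>" using ZcD(1) unfolding torsion_def by blast
    thus "\<exists>k::nat. a [^] k \<odot>\<^bsub>M\<^esub> z \<in> Bc ?T D j" using submodule_closed(3)[OF sT(2)] by metis
  qed
qed

text \<open>If \<open>N\<close> has \<open>q\<close> in its support and \<open>r \<in> q\<close>, then Nakayama's lemma at \<open>q\<close> shows that \<open>q\<close> is in the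
  support of \<open>N/rN\<close>.\<close>

lemma support_cone:
  assumes C: "is_complex C D" and noeth: "noetherian_interval (Bc C D j) (Zc C D j)"
    and q: "primeideal q R" and r: "r \<in> q"
    and z: "z \<in> Zc C D j" "\<And>s. s \<in> carrier R - q \<Longrightarrow> s \<odot>\<^bsub>M\<^esub> z \<notin> Bc C D j"
  shows "\<exists>u\<in>Zc (mapping_cone C) (cone_diff r D) j. \<forall>s\<in>carrier R - q.
    s \<odot>\<^bsub>M\<^esub> u \<notin> Bc (mapping_cone C) (cone_diff r D) j"
proof (rule ccontr)
  assume no: "\<not> ?thesis"
  interpret q: primeideal q R by fact
  let ?E = "cone_diff r D" and ?K = "mapping_cone C"
  note D = mod_hom_props[OF complexD(1)[OF C]]
  note sC = complex_submodules[OF C, of j]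
  have rc: "r \<in> carrier R" using r by simp
  have "\<exists>s\<in>carrier R - q. s \<odot>\<^bsub>M\<^esub> x \<in> Bc C D j <+>\<^bsub>M\<^esub> ideal_multiples M q (Zc C D j)"
    if x: "x \<in> Zc C D j" for x
  proof -
    have xc: "x \<in> carrier M" "x \<in> C j" "D x = \<zero>\<^bsub>M\<^esub>" using x submodule_closed(2)[OF sC(1)] by (auto simp: Zc_def)
    have "pair x \<zero>\<^bsub>M\<^esub> \<in> Zc ?K ?E j"
      unfolding Zc_cone_iff[OF C rc]
      using xc rc submodule_closed(3)[OF complex_submodules(1)[OF C, of "j + 1"]] by simp
    then obtain s where s: "s \<in> carrier R - q" "s \<odot>\<^bsub>M\<^esub> pair x \<zero>\<^bsub>M\<^esub> \<in> Bc ?K ?E j" using no by blast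
    have sc: "s \<in> carrier R" using s by blast
    obtain a b where ab: "a \<in> C (j - 1)" "b \<in> C j" "p1 (s \<odot>\<^bsub>M\<^esub> pair x \<zero>\<^bsub>M\<^esub>) = D a \<oplus>\<^bsub>M\<^esub> r \<odot>\<^bsub>M\<^esub> b"
      "p2 (s \<odot>\<^bsub>M\<^esub> pair x \<zero>\<^bsub>M\<^esub>) = \<ominus>\<^bsub>M\<^esub> D b" using Bc_coneE[OF C rc s(2)] .
    have bc: "b \<in> carrier M" "D b \<in> carrier M" using complexD(5)[OF C ab(2)] D(1) by auto
    have "\<ominus>\<^bsub>M\<^esub> D b = \<zero>\<^bsub>M\<^esub>" using ab(4) xc sc by simp
    hence "D b = \<ominus>\<^bsub>M\<^esub> \<zero>\<^bsub>M\<^esub>" using M.minus_minus[OF bc(2)] by simp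
    hence "b \<in> Zc C D j" using ab(2) M_minus_zero by (simp add: Zc_def)
    hence "r \<odot>\<^bsub>M\<^esub> b \<in> ideal_multiples M q (Zc C D j)" by (rule ideal_multiples.prod[OF r])
    hence "D a \<oplus>\<^bsub>M\<^esub> r \<odot>\<^bsub>M\<^esub> b \<in> Bc C D j <+>\<^bsub>M\<^esub> ideal_multiples M q (Zc C D j)"
      using ab(1) by (intro set_addI) (auto simp: Bc_def)
    moreover have "s \<odot>\<^bsub>M\<^esub> x = D a \<oplus>\<^bsub>M\<^esub> r \<odot>\<^bsub>M\<^esub> b" using ab(3) xc sc by simp
    ultimately show ?thesis using s(1) by (intro bexI[of _ s]) simp_all
  qed
  from local_nakayama[OF q sC(2,1,3) noeth this z(1)] show False using z(2) by blast
qed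

text \<open>Grothendieck's non-vanishing theorem for the module \<open>N = H\<^sup>0(C)\<close>, whose local cohomology is that of the
  torsion subcomplex. The chain of primes starts in the support of \<open>N\<close>. Suppose that the local
  cohomology vanishes from degree \<open>n \<ge> 2\<close> on. Then \<open>H = H\<^sup>n\<^sup>-\<^sup>1\<close> is artinian and \<open>H = \<mm>H\<close>, because it is the top
  degree and the Koszul complex on generators of \<open>\<mm>\<close> has vanishing cohomology in positive degrees.
  Therefore \<open>H = rH\<close> for some \<open>r \<in> \<mm>\<close>. On the cone of \<open>r\<close>, a derived form of \<open>N/rN\<close>, local cohomology
  vanishes already from degree \<open>n - 1\<close> on, but its support still has a chain of length \<open>n - 1\<close>.\<close>

theorem torsion_cohomology_nonvanishing:
  assumes "resolution_like C D"
    and "\<And>i. i \<le> n \<Longrightarrow> primeideal (p i) R" "\<And>i. i < n \<Longrightarrow> p i \<subset> p (Suc i)" "p n = \<mm>"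
    and "z \<in> Zc C D 0" "\<And>s. s \<in> carrier R - p 0 \<Longrightarrow> s \<odot>\<^bsub>M\<^esub> z \<notin> Bc C D 0"
  shows "\<exists>j\<ge>int n. \<not> Zc (torsion \<mm> C) D j \<subseteq> Bc (torsion \<mm> C) D j"
  using assms
proof (induct n arbitrary: C D p z rule: less_induct)
  case (less n)
  note C = less(2) and p = less(3) and chain = less(4) and pn = less(5) and z = less(6,7)
  let ?T = "torsion \<mm> C"
  show ?case
  proof (rule ccontr)
    assume "\<not> ?thesis"
    hence van: "Zc ?T D j \<subseteq> Bc ?T D j" if "int n \<le> j" for j using that by blast
    have C': "is_complex C D" "\<And>j. noetherian_interval (Bc C D j) (Zc C D j)"
      "\<And>j. 1 \<le> j \<Longrightarrow> Zc C D j \<subseteq> Bc C D j" using C unfolding resolution_like_def by blast+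
    have T: "is_complex ?T D" by (rule torsion_complex[OF C'(1) m_subset])
    note sC = complex_submodules[OF C'(1), of 0] and sT = complex_submodules[OF T]
    obtain S where S: "finite S" "S \<subseteq> \<mm>" "\<And>C D. is_complex C D \<Longrightarrow> torsion \<mm> C = torsion S C"
      using finite_generators_m by blast
    obtain rs where rs: "set rs = S" using finite_list[OF S(1)] by blast
    have rsm: "set rs \<subseteq> \<mm>" and rsR: "set rs \<subseteq> carrier R" using rs S(2) m_subset by auto
    let ?K = "koszul rs C" and ?E = "koszul_diff rs D"
    have K: "resolution_like ?K ?E" by (rule resolution_like_koszul[OF C rsR])
    hence K': "is_complex ?K ?E" "\<And>j. soft (?K j)" "\<And>j. noetherian_interval (Bc ?K ?E j) (Zc ?K ?E j)"
      "\<And>j. 1 \<le> j \<Longrightarrow> Zc ?K ?E j \<subseteq> Bc ?K ?E j" unfolding resolution_like_def by blast+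
    have TK: "torsion \<mm> ?K = koszul rs ?T" by (rule torsion_koszul[OF m_subset])
    have "quasi_iso (torsion S ?K) ?K ?E"
    proof (rule quasi_iso_torsion_finite[OF K'(1,2) S(1)])
      show "S \<subseteq> carrier R" using rs rsR by simp
      fix s j x assume "s \<in> S" "x \<in> Zc ?K ?E j"
      thus "\<exists>k::nat. s [^] k \<odot>\<^bsub>M\<^esub> x \<in> Bc ?K ?E j"
        using koszul_cohomology_torsion[OF C'(1) rsR, of s x j] rs rsR by auto
    qed
    hence q: "quasi_iso (torsion \<mm> ?K) ?K ?E" using S(3)[OF K'(1)] by simp
    have TKc: "is_complex (torsion \<mm> ?K) ?E" by (rule torsion_complex[OF K'(1) m_subset])
    consider "n \<le> 1" | "2 \<le> n" by linarith
    thus False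
    proof cases
      case 1
      \<comment> \<open>The torsion cocycles account for the cohomology in degree zero, by Nakayama's lemma.\<close>
      let ?W = "Zc ?T D 0 <+>\<^bsub>M\<^esub> Bc C D 0"
      have "Zc C D 0 \<subseteq> ?W <+>\<^bsub>M\<^esub> ideal_multiples M \<mm> (Zc C D 0)"
      proof (rule koszul_top_degree[OF C'(1) T rsm torsion_subset])
        show "Zc C D i \<subseteq> Bc C D i" if "0 + 1 \<le> i" for i using C'(3) that by simp
        show "Zc ?T D i \<subseteq> Bc ?T D i" if "0 + 1 \<le> i" for i using van 1 that by simp
        show "Zc ?K ?E 0 \<subseteq> Zc (koszul rs ?T) ?E 0 <+>\<^bsub>M\<^esub> Bc ?K ?E 0"
          using q unfolding quasi_iso_def TK by blast
      qed
      moreover have W: "submodule ?W R M" "?W \<subseteq> Zc C D 0" "Bc C D 0 \<subseteq> ?W"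
        using submodule_set_add[OF sT(1) sC(2)] set_add_least[OF sC(1) Zc_torsion_subset sC(3)]
          set_add_upper(2)[OF sT(1) sC(2)] by blast+
      moreover have "noetherian_interval ?W (Zc C D 0)"
        by (rule interval_condition_mono[OF C'(2) W(3)]) simp
      ultimately have "Zc C D 0 = ?W" by (intro nakayama[OF _ sC(1)])
      then obtain g b where gb: "g \<in> Zc ?T D 0" "b \<in> Bc C D 0" "z = g \<oplus>\<^bsub>M\<^esub> b"
        using z(1) by (auto elim: set_addE)
      have carr: "g \<in> carrier M" "b \<in> carrier M"
        using submodule_closed(2)[OF sT(1) gb(1)] submodule_closed(2)[OF sC(2) gb(2)] by blast+
      have "\<exists>s\<in>carrier R - p 0. s \<odot>\<^bsub>M\<^esub> g \<in> Bc C D 0"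
      proof (cases "n = 0")
        case True
        hence "g \<in> Bc ?T D 0" using van[of 0] gb(1) by auto
        hence "g \<in> Bc C D 0" by (rule subsetD[OF Bc_torsion_subset])
        thus ?thesis using R.primeideal_one_compl[OF p[of 0]] carr
          by (intro bexI[of _ \<one>]) auto
      next
        case False
        hence "n = 1" using 1 by simp
        hence "p 0 \<subset> \<mm>" using chain[of 0] pn by simp
        then obtain a where a: "a \<in> \<mm>" "a \<notin> p 0" by blast
        obtain k :: nat where k: "a [^] k \<odot>\<^bsub>M\<^esub> g = \<zero>\<^bsub>M\<^esub>"
          using a(1) ZcD(1)[OF gb(1)] unfolding torsion_def by blast
        have ac: "a \<in> carrier R" using a m_subset by blast
        have "a [^] k \<notin> p 0" using R.primeideal_pow_mem[OF p[of 0] ac] a by blast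
        thus ?thesis using k pow_closed[OF ac] submodule_closed(3)[OF sC(2)]
          by (intro bexI[of _ "a [^] k"]) auto
      qed
      then obtain s where s: "s \<in> carrier R - p 0" "s \<odot>\<^bsub>M\<^esub> g \<in> Bc C D 0" by blast
      have sc: "s \<in> carrier R" using s by blast
      have "s \<odot>\<^bsub>M\<^esub> z = s \<odot>\<^bsub>M\<^esub> g \<oplus>\<^bsub>M\<^esub> s \<odot>\<^bsub>M\<^esub> b" unfolding gb(3) by (rule smult_r_distr[OF sc carr])
      hence "s \<odot>\<^bsub>M\<^esub> z \<in> Bc C D 0"
        using submodule_closed(4)[OF sC(2) s(2) submodule_closed(7)[OF sC(2) sc gb(2)]] by simp
      thus False using z(2)[OF s(1)] by blast
    next
      case 2
      then obtain m where m: "n = Suc m" "1 \<le> m" by (cases n) auto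
      let ?j = "int m"
      \<comment> \<open>The zero complex as subcomplex: this says that the top cohomology is \<open>\<mm>\<close> times itself.\<close>
      have Z0: "is_complex (\<lambda>_. {\<zero>\<^bsub>M\<^esub>}) D"
        using complexD(1)[OF C'(1)] mod_hom_props(4)[OF complexD(1)[OF C'(1)]] zero_submodule
        by (auto simp: is_complex_def)
      have Z0Z: "Zc (\<lambda>_. {\<zero>\<^bsub>M\<^esub>}) D i = {\<zero>\<^bsub>M\<^esub>}" "Bc (\<lambda>_. {\<zero>\<^bsub>M\<^esub>}) D i = {\<zero>\<^bsub>M\<^esub>}" for i
        using mod_hom_props(4)[OF complexD(1)[OF C'(1)]] by (auto simp: Zc_def Bc_def)
      have "Zc ?T D ?j \<subseteq> (Zc (\<lambda>_. {\<zero>\<^bsub>M\<^esub>}) D ?j <+>\<^bsub>M\<^esub> Bc ?T D ?j) <+>\<^bsub>M\<^esub> ideal_multiples M \<mm> (Zc ?T D ?j)"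
      proof (rule koszul_top_degree[OF T Z0 rsm])
        show "{\<zero>\<^bsub>M\<^esub>} \<subseteq> ?T i" for i using submodule_closed(3)[OF complexD(2)[OF T]] by simp
        show "Zc ?T D i \<subseteq> Bc ?T D i" if "?j + 1 \<le> i" for i using van that m(1) by simp
        show "Zc (\<lambda>_. {\<zero>\<^bsub>M\<^esub>}) D i \<subseteq> Bc (\<lambda>_. {\<zero>\<^bsub>M\<^esub>}) D i" for i using Z0Z by simp
        have "Zc (torsion \<mm> ?K) ?E ?j \<subseteq> Bc ?K ?E ?j" 
          by (rule subset_trans[OF Zc_torsion_subset K'(4)]) (use m(2) in simp)
        hence "Zc (koszul rs ?T) ?E ?j \<subseteq> Bc (koszul rs ?T) ?E ?j"
          using q Zc_torsion_subset unfolding quasi_iso_def TK by blast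
        also have "\<dots> \<subseteq> Zc (koszul rs (\<lambda>_. {\<zero>\<^bsub>M\<^esub>})) ?E ?j <+>\<^bsub>M\<^esub> Bc (koszul rs ?T) ?E ?j"
          by (rule set_add_upper(2)) (intro complex_submodules koszul_complex T Z0 rsR)+
        finally show "Zc (koszul rs ?T) ?E ?j \<subseteq> \<dots>" .
      qed
      moreover have "{\<zero>\<^bsub>M\<^esub>} <+>\<^bsub>M\<^esub> Bc ?T D ?j = Bc ?T D ?j"
      proof
        show "{\<zero>\<^bsub>M\<^esub>} <+>\<^bsub>M\<^esub> Bc ?T D ?j \<subseteq> Bc ?T D ?j"
          by (rule set_add_least[OF sT(2)]) (use submodule_closed(3)[OF sT(2)] in auto)
      qed (rule set_add_upper(2)[OF zero_submodule sT(2)])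
      ultimately have div: "Zc ?T D ?j \<subseteq> Bc ?T D ?j <+>\<^bsub>M\<^esub> ideal_multiples M \<mm> (Zc ?T D ?j)"
        unfolding Z0Z by simp
      have "artinian_interval (Bc ?T D ?j) (Zc ?T D ?j)"
      proof (rule koszul_artinian_descent[OF T rsR])
        show "\<exists>k::nat. r [^] k \<odot>\<^bsub>M\<^esub> x = \<zero>\<^bsub>M\<^esub>" if "r \<in> set rs" "x \<in> ?T i" for r i x
          using that rsm unfolding torsion_def by blast
        show "artinian_interval (Bc (koszul rs ?T) ?E i) (Zc (koszul rs ?T) ?E i)" for i
          using torsion_artinian[OF K'(1) q K'(3)] unfolding TK .
      qed
      from artinian_divisible[OF sT(2,1,3) this div]
      obtain r where r: "r \<in> \<mm>" "Zc ?T D ?j \<subseteq> Bc ?T D ?j <+>\<^bsub>M\<^esub> (\<lambda>x. r \<odot>\<^bsub>M\<^esub> x) ` Zc ?T D ?j" by blast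
      have rc: "r \<in> carrier R" using r m_subset by blast
      let ?L = "mapping_cone C" and ?F = "cone_diff r D"
      have TL: "torsion \<mm> ?L = mapping_cone ?T" by (rule torsion_mapping_cone[OF m_subset])
      have vanL: "Zc (torsion \<mm> ?L) ?F i \<subseteq> Bc (torsion \<mm> ?L) ?F i" if i: "?j \<le> i" for i
        unfolding TL
      proof (cases "i = ?j")
        case True
        have "Zc ?T D (?j + 1) \<subseteq> Bc ?T D (?j + 1)" using van m(1) by simp
        thus "Zc (mapping_cone ?T) ?F i \<subseteq> Bc (mapping_cone ?T) ?F i"
          using cone_acyclic[OF T rc _ r(2)] True by simp
      next
        case False
        show "Zc (mapping_cone ?T) ?F i \<subseteq> Bc (mapping_cone ?T) ?F i"
          by (rule cone_acyclic_above[OF T rc, where k = "int n"]) (use van False i m(1) in auto)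
      qed
      interpret nc: noetherian_cring R by unfold_locales
      have "\<exists>q. (\<forall>i\<le>m. primeideal (q i) R) \<and> (\<forall>i<m. q i \<subset> q (Suc i)) \<and> p 0 \<subseteq> q 0 \<and> r \<in> q 0 \<and> q m = p (Suc m)"
        by (rule nc.prime_chain_containing) (use p chain pn m(1) r in auto)
      then obtain q where q: "\<And>i. i \<le> m \<Longrightarrow> primeideal (q i) R" "\<And>i. i < m \<Longrightarrow> q i \<subset> q (Suc i)"
        "p 0 \<subseteq> q 0" "r \<in> q 0" "q m = \<mm>" using pn m(1) by blast
      obtain u where u: "u \<in> Zc ?L ?F 0" "\<And>s. s \<in> carrier R - q 0 \<Longrightarrow> s \<odot>\<^bsub>M\<^esub> u \<notin> Bc ?L ?F 0"
        using support_cone[OF C'(1) C'(2) q(1)[of 0] q(4) z(1)] z(2) q(3) by blast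
      have "\<exists>j\<ge>int m. \<not> Zc (torsion \<mm> ?L) ?F j \<subseteq> Bc (torsion \<mm> ?L) ?F j"
        by (rule less(1)[OF _ resolution_like_cone[OF C rc] q(1,2,5) u]) (use m(1) in simp)
      thus False using vanL by blast
    qed
  qed
qed

end

section \<open>Finitely generated modules, injective modules and dimension\<close>

context noetherian_base_module
begin

lemma adjoin_element_noetherian:
  assumes N: "submodule N R M" and s: "s \<in> carrier M"
  shows "noetherian_interval N (N <+>\<^bsub>M\<^esub> (\<lambda>a. a \<odot>\<^bsub>M\<^esub> s) ` carrier R)"
proof -
  note cN = submodule_closed[OF N]
  let ?V = "N <+>\<^bsub>M\<^esub> (\<lambda>a. a \<odot>\<^bsub>M\<^esub> s) ` carrier R"
  show ?thesis
  proof (rule noetherian_transfer[OF ideals_noetherian, of _ "\<lambda>U. {a \<in> carrier R. a \<odot>\<^bsub>M\<^esub> s \<in> U}"])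
    fix U assume "U \<in> interval N ?V"
    thus "{a \<in> carrier R. a \<odot>\<^bsub>M\<^esub> s \<in> U} \<in> {I. ideal I R}"
      using conductor_ideal[OF _ s] by (simp add: interval_def)
  next
    have incl: "U \<subseteq> V" if U: "U \<in> interval N ?V" and V: "V \<in> interval N ?V"
      and sub: "{a \<in> carrier R. a \<odot>\<^bsub>M\<^esub> s \<in> U} \<subseteq> {a \<in> carrier R. a \<odot>\<^bsub>M\<^esub> s \<in> V}" for U V
    proof
      have U': "submodule U R M" "N \<subseteq> U" "U \<subseteq> ?V" using U by (auto simp: interval_def)
      have V': "submodule V R M" "N \<subseteq> V" using V by (auto simp: interval_def)
      fix u assume u: "u \<in> U"
      then obtain x a where xa: "x \<in> N" "a \<in> carrier R" "u = x \<oplus>\<^bsub>M\<^esub> a \<odot>\<^bsub>M\<^esub> s"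
        using U'(3) by (blast elim: set_addE)
      have "a \<odot>\<^bsub>M\<^esub> s \<in> U" using submodule_add_cancel[OF U'(1), of x] xa u U'(2) s by blast
      hence "a \<odot>\<^bsub>M\<^esub> s \<in> V" using xa(2) sub by blast
      thus "u \<in> V" unfolding xa(3) using submodule_closed(4)[OF V'(1)] xa(1) V'(2) by blast
    qed
    show "inj_on (\<lambda>U. {a \<in> carrier R. a \<odot>\<^bsub>M\<^esub> s \<in> U}) (interval N ?V)"
      by (rule inj_onI, rule equalityI; rule incl; simp)
  qed auto
qed

lemma finite_set_noetherian:
  assumes "finite S" "S \<subseteq> carrier M"
  shows "\<exists>N. submodule N R M \<and> S \<subseteq> N \<and> noetherian_interval {\<zero>\<^bsub>M\<^esub>} N"
  using assms
proof (induct S)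
  case empty
  have "submodule {\<zero>\<^bsub>M\<^esub>} R M" by (rule submoduleI') auto
  thus ?case using interval_condition_trivial by blast
next
  case (insert s S)
  then obtain N where N: "submodule N R M" "S \<subseteq> N" "noetherian_interval {\<zero>\<^bsub>M\<^esub>} N" by blast
  have s: "s \<in> carrier M" using insert by blast
  note C = submodule_cyclic[OF s]
  let ?V = "N <+>\<^bsub>M\<^esub> (\<lambda>a. a \<odot>\<^bsub>M\<^esub> s) ` carrier R"
  note V = submodule_set_add[OF N(1) C] set_add_upper[OF N(1) C]
  have "noetherian_interval {\<zero>\<^bsub>M\<^esub>} ?V"
    by (rule interval_condition_extend[OF _ N(1) _ V(2,1) N(3) adjoin_element_noetherian[OF N(1) s]])
      (use submodule_closed(3)[OF N(1)] in auto)
  moreover have "insert s S \<subseteq> ?V" using N(2) V mem_cyclic[OF s] by blast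
  ultimately show ?case using V(1) by blast
qed

lemma finsum_mem_submodule:
  assumes N: "submodule N R M" and "finite S" "f \<in> S \<rightarrow> N"
  shows "(\<Oplus>\<^bsub>M\<^esub>s\<in>S. f s) \<in> N"
  using assms(2,3)
proof (induct S)
  case empty thus ?case using submodule_closed(3)[OF N] by simp
next
  case (insert s S)
  have "f \<in> S \<rightarrow> carrier M" "f s \<in> carrier M" using insert(4) submodule_closed(2)[OF N] by blast+
  hence "(\<Oplus>\<^bsub>M\<^esub>s\<in>insert s S. f s) = f s \<oplus>\<^bsub>M\<^esub> (\<Oplus>\<^bsub>M\<^esub>s\<in>S. f s)"
    using insert(1,2) by (intro M.finsum_insert) auto
  thus ?case using insert submodule_closed(4)[OF N] by auto
qed

lemma finitely_generated_submodule_eq: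
  assumes gen: "carrier M = {(\<Oplus>\<^bsub>M\<^esub>s\<in>S. a s \<odot>\<^bsub>M\<^esub> s) | a. a \<in> S \<rightarrow> carrier R}"
    and S: "finite S" and N: "submodule N R M" "S \<subseteq> N"
  shows "N = carrier M"
proof
  show "carrier M \<subseteq> N"
  proof
    fix x assume "x \<in> carrier M"
    then obtain a where a: "a \<in> S \<rightarrow> carrier R" "x = (\<Oplus>\<^bsub>M\<^esub>s\<in>S. a s \<odot>\<^bsub>M\<^esub> s)" unfolding gen by blast
    show "x \<in> N" unfolding a(2)
      by (rule finsum_mem_submodule[OF N(1) S]) (use a(1) N submodule_closed(7)[OF N(1)] in blast)
  qed
qed (rule submodule_closed(1)[OF N(1)])

lemma finitely_generated_noetherian:
  assumes "finitely_generated_module R M"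
  shows "noetherian_interval {\<zero>\<^bsub>M\<^esub>} (carrier M)"
proof -
  obtain S where S: "finite S" "S \<subseteq> carrier M"
    "carrier M = {(\<Oplus>\<^bsub>M\<^esub>s\<in>S. a s \<odot>\<^bsub>M\<^esub> s) | a. a \<in> S \<rightarrow> carrier R}"
    using assms unfolding finitely_generated_module_def by blast
  obtain N where N: "submodule N R M" "S \<subseteq> N" "noetherian_interval {\<zero>\<^bsub>M\<^esub>} N"
    using finite_set_noetherian[OF S(1,2)] by blast
  show ?thesis using finitely_generated_submodule_eq[OF S(3,1) N(1,2)] N(3) by simp
qed

text \<open>Otherwise every generator is killed by an element outside \<open>P\<close>, and the product of these elements is
  an annihilator outside \<open>P\<close>.\<close>

lemma finitely_generated_support:
  assumes fg: "finitely_generated_module R M" and P: "primeideal P R" and ann: "annihilator R M \<subseteq> P"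
  shows "\<exists>x\<in>carrier M. \<forall>s\<in>carrier R - P. s \<odot>\<^bsub>M\<^esub> x \<noteq> \<zero>\<^bsub>M\<^esub>"
proof (rule ccontr)
  assume no: "\<not> ?thesis"
  obtain S where S: "finite S" "S \<subseteq> carrier M"
    "carrier M = {(\<Oplus>\<^bsub>M\<^esub>s\<in>S. a s \<odot>\<^bsub>M\<^esub> s) | a. a \<in> S \<rightarrow> carrier R}"
    using fg unfolding finitely_generated_module_def by blast
  have "\<exists>t\<in>carrier R - P. \<forall>x\<in>T. t \<odot>\<^bsub>M\<^esub> x = \<zero>\<^bsub>M\<^esub>" if "finite T" "T \<subseteq> carrier M" for T
    using that
  proof (induct T)
    case empty thus ?case using R.primeideal_one_compl[OF P] by blast
  next
    case (insert x T)
    obtain t where t: "t \<in> carrier R - P" "\<forall>x\<in>T. t \<odot>\<^bsub>M\<^esub> x = \<zero>\<^bsub>M\<^esub>" using insert by blast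
    obtain s where s: "s \<in> carrier R - P" "s \<odot>\<^bsub>M\<^esub> x = \<zero>\<^bsub>M\<^esub>" using no insert(4) by blast
    have c: "s \<in> carrier R" "t \<in> carrier R" using s t by blast+
    have "(t \<otimes> s) \<odot>\<^bsub>M\<^esub> y = \<zero>\<^bsub>M\<^esub>" if y: "y \<in> insert x T" for y
    proof -
      have yc: "y \<in> carrier M" using y insert(4) by blast
      have "(t \<otimes> s) \<odot>\<^bsub>M\<^esub> y = t \<odot>\<^bsub>M\<^esub> (s \<odot>\<^bsub>M\<^esub> y)" by (rule smult_assoc1[OF c(2,1) yc])
      also have "\<dots> = \<zero>\<^bsub>M\<^esub>"
      proof (cases "y = x")
        case True thus ?thesis using s(2) c by simp
      next
        case False
        hence "t \<odot>\<^bsub>M\<^esub> y = \<zero>\<^bsub>M\<^esub>" using t(2) y by blast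
        thus ?thesis using smult_lcomm[OF c(2,1) yc] c by simp
      qed
      finally show ?thesis .
    qed
    thus ?case using R.primeideal_compl_mult[OF P t(1) s(1)] by blast
  qed
  from this[OF S(1,2)] obtain t where t: "t \<in> carrier R - P" "\<forall>x\<in>S. t \<odot>\<^bsub>M\<^esub> x = \<zero>\<^bsub>M\<^esub>" by blast
  have tc: "t \<in> carrier R" using t by blast
  let ?N = "{x \<in> carrier M. t \<odot>\<^bsub>M\<^esub> x \<in> {\<zero>\<^bsub>M\<^esub>}}"
  have "submodule {\<zero>\<^bsub>M\<^esub>} R M" by (rule submoduleI') auto
  hence "submodule ?N R M" by (rule submodule_preimage_smult[OF _ carrier_is_submodule tc])
  hence "?N = carrier M" 
    by (rule finitely_generated_submodule_eq[OF S(3,1)]) (use S(2) t(2) in blast)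
  hence "t \<in> annihilator R M" using tc by (auto simp: annihilator_def)
  thus False using ann t(1) by blast
qed

text \<open>If the ideals \<open>(Ann u : s\<^sup>t)\<close> are stationary from \<open>t\<close> on, then \<open>b + c s\<^sup>t\<^sup>+\<^sup>1 \<mapsto> c s\<^sup>t u\<close> is a well-defined map on
  the ideal \<open>Ann u + (s\<^sup>t\<^sup>+\<^sup>1)\<close>, and \<open>v\<close> is the image of \<open>1\<close> under an extension to \<open>R\<close>.\<close>

lemma injective_soft:
  assumes E: "injective_module R M" and u: "u \<in> carrier M" and s: "s \<in> carrier R"
  shows "\<exists>v\<in>carrier M. \<exists>t::nat. (\<forall>a\<in>carrier R. a \<odot>\<^bsub>M\<^esub> u = \<zero>\<^bsub>M\<^esub> \<longrightarrow> a \<odot>\<^bsub>M\<^esub> v = \<zero>\<^bsub>M\<^esub>) \<and>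
    s [^] Suc t \<odot>\<^bsub>M\<^esub> v = s [^] t \<odot>\<^bsub>M\<^esub> u"
proof -
  have sc: "s [^] (k::nat) \<in> carrier R" for k using s by simp
  have z: "submodule {\<zero>\<^bsub>M\<^esub>} R M" by (rule submoduleI') auto
  define K where "K t = {a \<in> carrier R. a \<odot>\<^bsub>M\<^esub> (s [^] t \<odot>\<^bsub>M\<^esub> u) \<in> {\<zero>\<^bsub>M\<^esub>}}" for t :: nat
  have K: "ideal (K t) R" for t unfolding K_def using conductor_ideal[OF z] u sc by simp
  have Kmono: "K t \<subseteq> K (Suc t)" for t
  proof
    fix a assume "a \<in> K t"
    hence a: "a \<in> carrier R" "a \<odot>\<^bsub>M\<^esub> (s [^] t \<odot>\<^bsub>M\<^esub> u) = \<zero>\<^bsub>M\<^esub>" by (auto simp: K_def)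
    have "a \<odot>\<^bsub>M\<^esub> (s [^] Suc t \<odot>\<^bsub>M\<^esub> u) = s \<odot>\<^bsub>M\<^esub> (a \<odot>\<^bsub>M\<^esub> (s [^] t \<odot>\<^bsub>M\<^esub> u))"
      using a(1) s u sc[of t] by (simp add: smult_assoc1 smult_lcomm)
    thus "a \<in> K (Suc t)" using a s by (simp add: K_def)
  qed
  have "range K \<subseteq> {I. ideal I R}" "K 0 \<in> range K" using K by auto
  hence "\<exists>U\<in>range K. \<forall>V\<in>range K. U \<subseteq> V \<longrightarrow> V = U" by (rule extremal_conditionD[OF ideals_noetherian])
  then obtain U where U: "U \<in> range K" "\<forall>V\<in>range K. U \<subseteq> V \<longrightarrow> V = U" by (rule bexE)
  then obtain t where "U = K t" by blast
  hence Kt: "K (Suc t) = K t" using U(2) Kmono by simp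
  define e where "e = s [^] Suc t"
  have e: "e \<in> carrier R" unfolding e_def by (rule sc)
  let ?N = "regular_module R"
  interpret nc: noetherian_cring R by unfold_locales
  interpret N: noetherian_base_module R ?N by (rule nc.regular_noetherian_base_module)
  let ?C = "(\<lambda>c. c \<otimes> e) ` carrier R"
  define J where "J = K 0 <+>\<^bsub>R\<^esub> ?C"
  have C: "ideal ?C R" using N.submodule_cyclic[of e] e by (simp add: nc.submodule_regular_iff)
  have J: "ideal J R" "K 0 \<subseteq> J" "?C \<subseteq> J" unfolding J_def using nc.submodule_add_ideals[OF K C] by blast+
  have K0: "b \<in> carrier R" "b \<odot>\<^bsub>M\<^esub> u = \<zero>\<^bsub>M\<^esub>" if "b \<in> K 0" for b
    using that u by (auto simp: K_def)
  define rel where "rel x y \<longleftrightarrow> (\<exists>b\<in>K 0. \<exists>c\<in>carrier R. x = b \<oplus> c \<otimes> e \<and> y = c \<odot>\<^bsub>M\<^esub> (s [^] t \<odot>\<^bsub>M\<^esub> u))" for x y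
  have relI: "rel (b \<oplus> c \<otimes> e) (c \<odot>\<^bsub>M\<^esub> (s [^] t \<odot>\<^bsub>M\<^esub> u))" if "b \<in> K 0" "c \<in> carrier R" for b c
    using that unfolding rel_def by blast
  have unique: "y = y'" if xy: "rel x y" "rel x y'" for x y y'
  proof -
    obtain b c where bc: "b \<in> K 0" "c \<in> carrier R" "x = b \<oplus> c \<otimes> e" "y = c \<odot>\<^bsub>M\<^esub> (s [^] t \<odot>\<^bsub>M\<^esub> u)"
      using xy(1) unfolding rel_def by blast
    obtain b' c' where bc': "b' \<in> K 0" "c' \<in> carrier R" "x = b' \<oplus> c' \<otimes> e" "y' = c' \<odot>\<^bsub>M\<^esub> (s [^] t \<odot>\<^bsub>M\<^esub> u)"
      using xy(2) unfolding rel_def by blast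
    have carr: "b \<in> carrier R" "b' \<in> carrier R" using K0 bc bc' by blast+
    have "(c \<ominus> c') \<otimes> e = (b \<oplus> c \<otimes> e) \<ominus> (b' \<oplus> c' \<otimes> e) \<oplus> (b' \<ominus> b)"
      using carr bc(2) bc'(2) e by algebra
    also have "\<dots> = b' \<ominus> b" unfolding bc(3)[symmetric] bc'(3)[symmetric]
    proof -
      have "x \<in> carrier R" using bc(2,3) carr e by simp
      thus "x \<ominus> x \<oplus> (b' \<ominus> b) = b' \<ominus> b" using carr by algebra
    qed
    finally have eq: "(c \<ominus> c') \<otimes> e = b' \<ominus> b" .
    have "(c \<ominus> c') \<odot>\<^bsub>M\<^esub> (e \<odot>\<^bsub>M\<^esub> u) = ((c \<ominus> c') \<otimes> e) \<odot>\<^bsub>M\<^esub> u"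
      using bc(2) bc'(2) e u by (intro smult_assoc1[symmetric]) auto
    also have "\<dots> = b' \<odot>\<^bsub>M\<^esub> u \<ominus>\<^bsub>M\<^esub> b \<odot>\<^bsub>M\<^esub> u" unfolding eq using carr u by algebra
    also have "\<dots> = \<zero>\<^bsub>M\<^esub>" using K0 bc(1) bc'(1) M_minus_zero by (simp add: M.minus_eq)
    finally have "c \<ominus> c' \<in> K (Suc t)" using bc(2) bc'(2) by (simp add: K_def e_def)
    hence "c \<ominus> c' \<in> K t" using Kt by simp
    hence 0: "(c \<ominus> c') \<odot>\<^bsub>M\<^esub> (s [^] t \<odot>\<^bsub>M\<^esub> u) = \<zero>\<^bsub>M\<^esub>" by (simp add: K_def)
    have w: "s [^] t \<odot>\<^bsub>M\<^esub> u \<in> carrier M" using sc u by blast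
    have "y = (c \<ominus> c') \<odot>\<^bsub>M\<^esub> (s [^] t \<odot>\<^bsub>M\<^esub> u) \<oplus>\<^bsub>M\<^esub> c' \<odot>\<^bsub>M\<^esub> (s [^] t \<odot>\<^bsub>M\<^esub> u)"
      unfolding bc(4) using bc(2) bc'(2) w by algebra
    also have "\<dots> = y'" unfolding 0 bc'(4) using bc'(2) w by simp
    finally show ?thesis .
  qed
  define g where "g x = (THE y. rel x y)" for x
  have g: "g x = y" if "rel x y" for x y
    unfolding g_def by (rule the_equality) (use unique that in blast)+
  have Jrel: "\<exists>y. rel x y" if x: "x \<in> J" for x
    using x relI unfolding J_def set_add_def' by blast
  have w: "s [^] t \<odot>\<^bsub>M\<^esub> u \<in> carrier M" using sc u by blast
  have subJ: "submodule J R ?N" using J by (simp add: nc.submodule_regular_iff)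
  let ?A = "?N\<lparr>carrier := J\<rparr>"
  have modA: "module R ?A" by (rule submodule.submodule_is_module[OF subJ N.module_axioms])
  have "g \<in> mod_hom R ?A M"
    unfolding mod_hom_def
  proof (intro CollectI conjI ballI)
    show "g \<in> carrier ?A \<rightarrow> carrier M"
    proof
      fix x assume "x \<in> carrier ?A"
      then obtain y where y: "rel x y" using Jrel by auto
      hence "y \<in> carrier M" unfolding rel_def using w by auto
      thus "g x \<in> carrier M" using g[OF y] by simp
    qed
  next
    fix x y assume "x \<in> carrier ?A" "y \<in> carrier ?A"
    hence "x \<in> J" "y \<in> J" by simp_all
    then obtain x' y' where xy: "rel x x'" "rel y y'" using Jrel by blast
    obtain b c where bc: "b \<in> K 0" "c \<in> carrier R" "x = b \<oplus> c \<otimes> e" "x' = c \<odot>\<^bsub>M\<^esub> (s [^] t \<odot>\<^bsub>M\<^esub> u)"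
      using xy(1) unfolding rel_def by blast
    obtain b' c' where bc': "b' \<in> K 0" "c' \<in> carrier R" "y = b' \<oplus> c' \<otimes> e" "y' = c' \<odot>\<^bsub>M\<^esub> (s [^] t \<odot>\<^bsub>M\<^esub> u)"
      using xy(2) unfolding rel_def by blast
    have carr: "b \<in> carrier R" "b' \<in> carrier R" using K0 bc bc' by blast+
    have "b \<oplus> b' \<in> K 0" using ideal.axioms(1)[OF K] bc(1) bc'(1) additive_subgroup.a_closed by metis
    hence "rel ((b \<oplus> b') \<oplus> (c \<oplus> c') \<otimes> e) ((c \<oplus> c') \<odot>\<^bsub>M\<^esub> (s [^] t \<odot>\<^bsub>M\<^esub> u))"
      using bc(2) bc'(2) by (intro relI) auto
    moreover have "(b \<oplus> b') \<oplus> (c \<oplus> c') \<otimes> e = x \<oplus> y"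
      unfolding bc(3) bc'(3) using carr bc(2) bc'(2) e by algebra
    moreover have "(c \<oplus> c') \<odot>\<^bsub>M\<^esub> (s [^] t \<odot>\<^bsub>M\<^esub> u) = x' \<oplus>\<^bsub>M\<^esub> y'"
      unfolding bc(4) bc'(4) using bc(2) bc'(2) w by (simp add: smult_l_distr)
    ultimately have "rel (x \<oplus> y) (x' \<oplus>\<^bsub>M\<^esub> y')" by simp
    thus "g (x \<oplus>\<^bsub>?A\<^esub> y) = g x \<oplus>\<^bsub>M\<^esub> g y" using g xy by simp
  next
    fix r x assume r: "r \<in> carrier R" and "x \<in> carrier ?A"
    then obtain x' where xy: "rel x x'" using Jrel by auto
    obtain b c where bc: "b \<in> K 0" "c \<in> carrier R" "x = b \<oplus> c \<otimes> e" "x' = c \<odot>\<^bsub>M\<^esub> (s [^] t \<odot>\<^bsub>M\<^esub> u)"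
      using xy unfolding rel_def by blast
    have carr: "b \<in> carrier R" using K0 bc by blast
    have "r \<otimes> b \<in> K 0" using ideal.I_l_closed[OF K bc(1) r] .
    hence "rel (r \<otimes> b \<oplus> (r \<otimes> c) \<otimes> e) ((r \<otimes> c) \<odot>\<^bsub>M\<^esub> (s [^] t \<odot>\<^bsub>M\<^esub> u))"
      using bc(2) r by (intro relI) auto
    moreover have "r \<otimes> b \<oplus> (r \<otimes> c) \<otimes> e = r \<otimes> x"
      unfolding bc(3) using carr bc(2) r e by algebra
    moreover have "(r \<otimes> c) \<odot>\<^bsub>M\<^esub> (s [^] t \<odot>\<^bsub>M\<^esub> u) = r \<odot>\<^bsub>M\<^esub> x'"
      unfolding bc(4) using bc(2) r w by (simp add: smult_assoc1)
    ultimately have "rel (r \<otimes> x) (r \<odot>\<^bsub>M\<^esub> x')" by simp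
    thus "g (r \<odot>\<^bsub>?A\<^esub> x) = r \<odot>\<^bsub>M\<^esub> g x" using g xy by simp
  qed
  moreover have "(\<lambda>x. x) \<in> mod_hom R ?A ?N"
    using N.submodule_closed(1)[OF subJ] by (auto simp: mod_hom_def)
  ultimately have "\<exists>h\<in>mod_hom R ?N M. \<forall>x\<in>carrier ?A. h ((\<lambda>x. x) x) = g x"
    using E[unfolded injective_module_def, THEN conjunct2, rule_format, OF modA N.module_axioms, of "\<lambda>x. x" g]
    by simp
  then obtain h where h: "h \<in> mod_hom R ?N M" "\<And>x. x \<in> J \<Longrightarrow> h x = g x" by auto
  define v where "v = h \<one>"
  have v: "v \<in> carrier M" unfolding v_def using mod_homD(1)[OF h(1)] by simp
  have hv: "h r = r \<odot>\<^bsub>M\<^esub> v" if "r \<in> carrier R" for r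
    unfolding v_def using mod_homD(3)[OF h(1) that, of \<one>] that by simp
  have "a \<odot>\<^bsub>M\<^esub> v = \<zero>\<^bsub>M\<^esub>" if a: "a \<in> carrier R" "a \<odot>\<^bsub>M\<^esub> u = \<zero>\<^bsub>M\<^esub>" for a
  proof -
    have aK: "a \<in> K 0" using a u by (simp add: K_def)
    have "rel (a \<oplus> \<zero> \<otimes> e) (\<zero> \<odot>\<^bsub>M\<^esub> (s [^] t \<odot>\<^bsub>M\<^esub> u))" by (rule relI[OF aK R.zero_closed])
    hence "rel a \<zero>\<^bsub>M\<^esub>" using a w e by simp
    hence "h a = \<zero>\<^bsub>M\<^esub>" using h(2) J(2) aK g by auto
    thus ?thesis using hv a by simp
  qed
  moreover have "e \<odot>\<^bsub>M\<^esub> v = s [^] t \<odot>\<^bsub>M\<^esub> u"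
  proof -
    have 0: "\<zero> \<in> K 0" using u by (simp add: K_def)
    have "rel (\<zero> \<oplus> \<one> \<otimes> e) (\<one> \<odot>\<^bsub>M\<^esub> (s [^] t \<odot>\<^bsub>M\<^esub> u))" by (rule relI[OF 0 R.one_closed])
    moreover have "\<zero> \<oplus> \<one> \<otimes> e = e" using e R.l_one R.l_zero by metis
    ultimately have "rel e (s [^] t \<odot>\<^bsub>M\<^esub> u)" using w by simp
    moreover have "e \<in> J" using J(3) N.mem_cyclic[of e] e by auto
    ultimately have "h e = s [^] t \<odot>\<^bsub>M\<^esub> u" using h(2) g by simp
    thus ?thesis using hv[OF e] by simp
  qed
  ultimately show ?thesis using v unfolding e_def by blast
qed

end

lemma mem_carrier_FactRing:
  "X' \<in> carrier (R Quot I) \<Longrightarrow> \<exists>a\<in>carrier R. X' = I +>\<^bsub>R\<^esub> a"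
  by (auto simp: FactRing_def A_RCOSETS_def')

lemma zero_FactRing: "\<zero>\<^bsub>R Quot I\<^esub> = I"
  by (simp add: FactRing_def)

context noetherian_local_ring
begin

text \<open>The primes are pulled back, and the last one is replaced by \<open>\<mm>\<close>, which contains all primes.\<close>

lemma prime_chain_of_quotient:
  assumes I: "ideal I R"
    and p: "\<And>i. i \<le> n \<Longrightarrow> primeideal (p i) (R Quot I)" "\<And>i. i < n \<Longrightarrow> p i \<subset> p (Suc i)"
  obtains q where "\<And>i. i \<le> n \<Longrightarrow> primeideal (q i) R" "\<And>i. i < n \<Longrightarrow> q i \<subset> q (Suc i)" "q n = \<mm>" "I \<subseteq> q 0"
proof -
  interpret I: ideal I R by (rule I)
  interpret h: ring_hom_ring R "R Quot I" "(+>\<^bsub>R\<^esub>) I" by (rule I.rcos_ring_hom_ring)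
  define v where "v i = {r \<in> carrier R. I +>\<^bsub>R\<^esub> r \<in> p i}" for i
  have v: "primeideal (v i) R" if "i \<le> n" for i
    unfolding v_def using h.primeideal_vimage[OF is_cring p(1)[OF that]] by simp
  have Iv: "I \<subseteq> v i" if "i \<le> n" for i
  proof
    fix a assume a: "a \<in> I"
    interpret P: primeideal "p i" "R Quot I" by (rule p(1)[OF that])
    have "I +>\<^bsub>R\<^esub> a = I" by (rule I.a_rcos_const[OF a])
    moreover have "I \<in> p i"
      using additive_subgroup.zero_closed[OF P.is_additive_subgroup] unfolding zero_FactRing .
    ultimately show "a \<in> v i" unfolding v_def using I.Icarr[OF a] by simp
  qed
  have vs: "v i \<subset> v (Suc i)" if i: "i < n" for i
  proof -
    obtain X' where X': "X' \<in> p (Suc i)" "X' \<notin> p i" using p(2)[OF i] by blast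
    have "X' \<in> carrier (R Quot I)" using ideal.Icarr[OF primeideal.axioms(1)[OF p(1)[of "Suc i"]] X'(1)] i by simp
    then obtain r where "r \<in> carrier R" "X' = I +>\<^bsub>R\<^esub> r" using mem_carrier_FactRing by blast
    hence "r \<in> v (Suc i)" "r \<notin> v i" using X' by (auto simp: v_def)
    moreover have "v i \<subseteq> v (Suc i)" using p(2)[OF i] by (auto simp: v_def)
    ultimately show ?thesis by blast
  qed
  define q where "q i = (if i = n then \<mm> else v i)" for i
  show thesis
  proof (rule that[of q])
    show "primeideal (q i) R" if "i \<le> n" for i using v[OF that] primeideal_m by (simp add: q_def)
    show "q i \<subset> q (Suc i)" if "i < n" for i
      using vs[OF that] primeideal_subset[OF v[of "Suc i"]] that by (auto simp: q_def)
    show "q n = \<mm>" by (simp add: q_def)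
    show "I \<subseteq> q 0" using Iv[of 0] primeideal_subset[OF v[of 0]] by (auto simp: q_def)
  qed
qed

text \<open>The image of \<open>\<mm>\<close> is a prime of the quotient.\<close>

lemma krull_dim_quotient_nonneg:
  assumes I: "ideal I R" "\<one> \<notin> I"
  shows "krull_dim (R Quot I) \<ge> 0"
proof -
  interpret I: ideal I R by (rule I)
  interpret m: primeideal \<mm> R by (rule primeideal_m)
  interpret h: ring_hom_cring R "R Quot I" "(+>\<^bsub>R\<^esub>) I" by (rule I.rcos_ring_hom_cring[OF is_cring])
  have Im: "I \<subseteq> \<mm>" by (rule proper_ideal_subset[OF I])
  let ?P = "(+>\<^bsub>R\<^esub>) I ` \<mm>"
  have mem: "a \<in> \<mm>" if a: "a \<in> carrier R" "I +>\<^bsub>R\<^esub> a \<in> ?P" for a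
  proof -
    obtain b where b: "b \<in> \<mm>" "I +>\<^bsub>R\<^esub> a = I +>\<^bsub>R\<^esub> b" using a(2) by blast
    have "a \<in> I +>\<^bsub>R\<^esub> b" using I.a_rcos_self[OF a(1)] b(2) by simp
    then obtain c where "c \<in> I" "a = c \<oplus> b" by (auto simp: a_r_coset_def')
    thus ?thesis using Im b(1) m.a_closed by blast
  qed
  have elem: "\<exists>a\<in>carrier R. X' = I +>\<^bsub>R\<^esub> a" if "X' \<in> carrier (R Quot I)" for X'
    by (rule mem_carrier_FactRing[OF that])
  have "primeideal ?P (R Quot I)"
  proof (rule primeidealI)
    show "cring (R Quot I)" by (rule h.S.is_cring)
    show "ideal ?P (R Quot I)"
    proof (rule idealI)
      show "ring (R Quot I)" by (rule h.S.ring_axioms)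
      show "subgroup ?P (add_monoid (R Quot I))"
      proof (rule h.S.add.subgroupI)
        show "?P \<subseteq> carrier (R Quot I)" using h.hom_closed m.Icarr by auto
        show "?P \<noteq> {}" using m.zero_closed by blast
        fix X' assume "X' \<in> ?P"
        then obtain a where a: "a \<in> \<mm>" "X' = I +>\<^bsub>R\<^esub> a" by blast
        have "\<ominus>\<^bsub>R Quot I\<^esub> X' = I +>\<^bsub>R\<^esub> (\<ominus> a)"
          using h.hom_a_inv[of a] a m.Icarr by simp
        thus "\<ominus>\<^bsub>R Quot I\<^esub> X' \<in> ?P" using a m.a_inv_closed by blast
        fix Y' assume "Y' \<in> ?P"
        then obtain b where b: "b \<in> \<mm>" "Y' = I +>\<^bsub>R\<^esub> b" by blast
        have "X' \<oplus>\<^bsub>R Quot I\<^esub> Y' = I +>\<^bsub>R\<^esub> (a \<oplus> b)" using h.hom_add[of a b] a b m.Icarr by simp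
        thus "X' \<oplus>\<^bsub>R Quot I\<^esub> Y' \<in> ?P" using a b m.a_closed by blast
      qed
      fix X' Y' assume X': "X' \<in> ?P" and "Y' \<in> carrier (R Quot I)"
      obtain a where a: "a \<in> \<mm>" "X' = I +>\<^bsub>R\<^esub> a" using X' by blast
      obtain b where b: "b \<in> carrier R" "Y' = I +>\<^bsub>R\<^esub> b" using elem \<open>Y' \<in> _\<close> by blast
      have "Y' \<otimes>\<^bsub>R Quot I\<^esub> X' = I +>\<^bsub>R\<^esub> (b \<otimes> a)" "X' \<otimes>\<^bsub>R Quot I\<^esub> Y' = I +>\<^bsub>R\<^esub> (a \<otimes> b)"
        using h.hom_mult[of a b] h.hom_mult[of b a] a b m.Icarr by simp_all
      thus "Y' \<otimes>\<^bsub>R Quot I\<^esub> X' \<in> ?P" "X' \<otimes>\<^bsub>R Quot I\<^esub> Y' \<in> ?P"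
        using a b m.I_l_closed m.I_r_closed by blast+
    qed
    show "carrier (R Quot I) \<noteq> ?P"
    proof
      assume "carrier (R Quot I) = ?P"
      hence "I +>\<^bsub>R\<^esub> \<one> \<in> ?P" using h.hom_closed[OF one_closed] by simp
      hence "\<one> \<in> \<mm>" by (rule mem[OF one_closed])
      thus False using primeideal_one_compl[OF primeideal_m] by blast
    qed
    fix X' Y' assume XY: "X' \<in> carrier (R Quot I)" "Y' \<in> carrier (R Quot I)" "X' \<otimes>\<^bsub>R Quot I\<^esub> Y' \<in> ?P"
    obtain a where a: "a \<in> carrier R" "X' = I +>\<^bsub>R\<^esub> a" using elem[OF XY(1)] by (rule bexE)
    obtain b where b: "b \<in> carrier R" "Y' = I +>\<^bsub>R\<^esub> b" using elem[OF XY(2)] by (rule bexE)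
    have "I +>\<^bsub>R\<^esub> (a \<otimes> b) \<in> ?P" using XY(3) unfolding a(2) b(2) h.hom_mult[OF a(1) b(1)] .
    hence "a \<otimes> b \<in> \<mm>" by (rule mem[OF m_closed[OF a(1) b(1)]])
    hence "a \<in> \<mm> \<or> b \<in> \<mm>" by (rule m.I_prime[OF a(1) b(1)])
    thus "X' \<in> ?P \<or> Y' \<in> ?P" unfolding a(2) b(2) by (elim disjE) (rule disjI1 disjI2, erule imageI)+
  qed
  hence "0 \<in> {ereal (real n) | n. \<exists>p. (\<forall>i\<le>n. primeideal (p i) (R Quot I)) \<and> (\<forall>i<n. p i \<subset> p (Suc i))}"
    by (auto intro!: exI[of _ 0] exI[of _ "\<lambda>_. ?P"] simp: zero_ereal_def)
  thus ?thesis unfolding krull_dim_def by (rule Sup_upper)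
qed

end

section \<open>The minimal injective resolution inside one module\<close>

text \<open>The product of countably many copies of all \<open>I n\<close>. Interleaving the copies makes it isomorphic to its
  own square.\<close>

definition ambient_module :: "(int \<Rightarrow> ('a, 'b) module) \<Rightarrow> ('a, nat \<Rightarrow> int \<Rightarrow> 'b) module"
  where "ambient_module I =
    \<lparr>carrier = {x. \<forall>k n. x k n \<in> carrier (I n)}, monoid.mult = undefined, one = undefined,
      ring.zero = (\<lambda>k n. \<zero>\<^bsub>I n\<^esub>), ring.add = (\<lambda>x y k n. x k n \<oplus>\<^bsub>I n\<^esub> y k n),
      smult = (\<lambda>r x k n. r \<odot>\<^bsub>I n\<^esub> x k n)\<rparr>"

definition interleave :: "(nat \<Rightarrow> 'e) \<Rightarrow> (nat \<Rightarrow> 'e) \<Rightarrow> nat \<Rightarrow> 'e"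
  where "interleave x y k = (if even k then x (k div 2) else y (k div 2))"

definition even_part :: "(nat \<Rightarrow> 'e) \<Rightarrow> nat \<Rightarrow> 'e" where "even_part x k = x (2 * k)"

definition odd_part :: "(nat \<Rightarrow> 'e) \<Rightarrow> nat \<Rightarrow> 'e" where "odd_part x k = x (Suc (2 * k))"

definition ambient_diff :: "(int \<Rightarrow> 'b \<Rightarrow> 'b) \<Rightarrow> (nat \<Rightarrow> int \<Rightarrow> 'b) \<Rightarrow> nat \<Rightarrow> int \<Rightarrow> 'b"
  where "ambient_diff d x k n = d (n - 1) (x k (n - 1))"

definition single :: "(int \<Rightarrow> ('a, 'b) module) \<Rightarrow> int \<Rightarrow> 'b \<Rightarrow> nat \<Rightarrow> int \<Rightarrow> 'b"
  where "single I j a k n = (if k = 0 \<and> n = j then a else \<zero>\<^bsub>I n\<^esub>)"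

text \<open>The module \<open>I j\<close> as part of the copy number \<open>0\<close>; the levels form the complex \<open>I\<close> inside the ambient
  module.\<close>

definition level :: "(int \<Rightarrow> ('a, 'b) module) \<Rightarrow> int \<Rightarrow> (nat \<Rightarrow> int \<Rightarrow> 'b) set"
  where "level I j = single I j ` carrier (I j)"

lemma ambient_module_simps [simp]:
  "x \<in> carrier (ambient_module I) \<longleftrightarrow> (\<forall>k n. x k n \<in> carrier (I n))"
  "\<zero>\<^bsub>ambient_module I\<^esub> = (\<lambda>k n. \<zero>\<^bsub>I n\<^esub>)"
  "x \<oplus>\<^bsub>ambient_module I\<^esub> y = (\<lambda>k n. x k n \<oplus>\<^bsub>I n\<^esub> y k n)"
  "r \<odot>\<^bsub>ambient_module I\<^esub> x = (\<lambda>k n. r \<odot>\<^bsub>I n\<^esub> x k n)"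
  by (simp_all add: ambient_module_def)

locale minimal_resolution_setup = noetherian_local_ring R \<mm>
  for R :: "('a, 'r) ring_scheme" (structure) and \<mm> +
  fixes M :: "('a, 'm, 'k) module_scheme" and I :: "int \<Rightarrow> ('a, 'b) module"
    and d :: "int \<Rightarrow> 'b \<Rightarrow> 'b" and \<epsilon> :: "'m \<Rightarrow> 'b"
  assumes M: "module R M" and fg: "finitely_generated_module R M"
    and res: "minimal_injective_resolution R M I d \<epsilon>"
begin

lemma I_module: "module R (I n)"
  and d_hom: "d n \<in> mod_hom R (I n) (I (n + 1))"
  and d_d: "x \<in> carrier (I n) \<Longrightarrow> d (n + 1) (d n x) = \<zero>\<^bsub>I (n + 1 + 1)\<^esub>"
  using res unfolding minimal_injective_resolution_def injective_resolution_def cochain_complex_def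
  by blast+

lemma I_base: "noetherian_local_module R (I n) \<mm>"
  by (intro noetherian_local_module.intro noetherian_base_module.intro I_module
      noetherian_ring_axioms noetherian_local_ring_axioms)

lemma M_base: "noetherian_base_module R M"
  by (intro noetherian_base_module.intro M noetherian_ring_axioms)

lemma I_zero: "\<zero>\<^bsub>I n\<^esub> \<in> carrier (I n)"
  using abelian_monoid.zero_closed[OF abelian_group.axioms(1)[OF module.axioms(2)[OF I_module]]] .

lemma d_closed: "x \<in> carrier (I n) \<Longrightarrow> d n x \<in> carrier (I (n + 1))"
  and d_add: "x \<in> carrier (I n) \<Longrightarrow> y \<in> carrier (I n) \<Longrightarrow> d n (x \<oplus>\<^bsub>I n\<^esub> y) = d n x \<oplus>\<^bsub>I (n + 1)\<^esub> d n y"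
  and d_smult: "r \<in> carrier R \<Longrightarrow> x \<in> carrier (I n) \<Longrightarrow> d n (r \<odot>\<^bsub>I n\<^esub> x) = r \<odot>\<^bsub>I (n + 1)\<^esub> d n x"
  using mod_homD[OF d_hom] by blast+

lemma d_zero: "d n \<zero>\<^bsub>I n\<^esub> = \<zero>\<^bsub>I (n + 1)\<^esub>"
proof -
  interpret A: module R "I n" by (rule I_module)
  interpret B: module R "I (n + 1)" by (rule I_module)
  show ?thesis using d_smult[OF zero_closed I_zero, of n] d_closed[OF I_zero, of n] by simp
qed

lemma module_ambient: "module R (ambient_module I)"
proof (intro moduleI abelian_groupI is_cring)
  fix x y z assume c: "x \<in> carrier (ambient_module I)" "y \<in> carrier (ambient_module I)"
    "z \<in> carrier (ambient_module I)"
  show "x \<oplus>\<^bsub>ambient_module I\<^esub> y \<oplus>\<^bsub>ambient_module I\<^esub> z = x \<oplus>\<^bsub>ambient_module I\<^esub> (y \<oplus>\<^bsub>ambient_module I\<^esub> z)"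
    using c abelian_monoid.a_assoc[OF abelian_group.axioms(1)[OF module.axioms(2)[OF I_module]]] by simp
next
  fix x y assume c: "x \<in> carrier (ambient_module I)" "y \<in> carrier (ambient_module I)"
  show "x \<oplus>\<^bsub>ambient_module I\<^esub> y \<in> carrier (ambient_module I)"
    using c abelian_monoid.a_closed[OF abelian_group.axioms(1)[OF module.axioms(2)[OF I_module]]] by simp
  show "x \<oplus>\<^bsub>ambient_module I\<^esub> y = y \<oplus>\<^bsub>ambient_module I\<^esub> x"
    using c abelian_monoid.a_comm[OF abelian_group.axioms(1)[OF module.axioms(2)[OF I_module]]] by simp
next
  show "\<zero>\<^bsub>ambient_module I\<^esub> \<in> carrier (ambient_module I)" using I_zero by simp
  fix x assume c: "x \<in> carrier (ambient_module I)"
  show "\<zero>\<^bsub>ambient_module I\<^esub> \<oplus>\<^bsub>ambient_module I\<^esub> x = x"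
    using c abelian_monoid.l_zero[OF abelian_group.axioms(1)[OF module.axioms(2)[OF I_module]]] by simp
  have neg: "\<ominus>\<^bsub>I n\<^esub> a \<in> carrier (I n)" "\<ominus>\<^bsub>I n\<^esub> a \<oplus>\<^bsub>I n\<^esub> a = \<zero>\<^bsub>I n\<^esub>" if "a \<in> carrier (I n)" for n a
    using abelian_group.a_inv_closed[OF module.axioms(2)[OF I_module] that]
      abelian_group.l_neg[OF module.axioms(2)[OF I_module] that] by blast+
  show "\<exists>y\<in>carrier (ambient_module I). y \<oplus>\<^bsub>ambient_module I\<^esub> x = \<zero>\<^bsub>ambient_module I\<^esub>"
    by (rule bexI[of _ "\<lambda>k n. \<ominus>\<^bsub>I n\<^esub> x k n"]) (use c neg in simp_all)
next
  fix a x assume c: "a \<in> carrier R" "x \<in> carrier (ambient_module I)"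
  show "a \<odot>\<^bsub>ambient_module I\<^esub> x \<in> carrier (ambient_module I)"
    using c module.smult_closed[OF I_module] by simp
next
  fix a b x assume c: "a \<in> carrier R" "b \<in> carrier R" "x \<in> carrier (ambient_module I)"
  show "(a \<oplus> b) \<odot>\<^bsub>ambient_module I\<^esub> x = a \<odot>\<^bsub>ambient_module I\<^esub> x \<oplus>\<^bsub>ambient_module I\<^esub> b \<odot>\<^bsub>ambient_module I\<^esub> x"
    using c module.smult_l_distr[OF I_module] by simp
  show "(a \<otimes> b) \<odot>\<^bsub>ambient_module I\<^esub> x = a \<odot>\<^bsub>ambient_module I\<^esub> (b \<odot>\<^bsub>ambient_module I\<^esub> x)"
    using c module.smult_assoc1[OF I_module] by simp
next
  fix a x y assume c: "a \<in> carrier R" "x \<in> carrier (ambient_module I)" "y \<in> carrier (ambient_module I)"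
  show "a \<odot>\<^bsub>ambient_module I\<^esub> (x \<oplus>\<^bsub>ambient_module I\<^esub> y) =
      a \<odot>\<^bsub>ambient_module I\<^esub> x \<oplus>\<^bsub>ambient_module I\<^esub> a \<odot>\<^bsub>ambient_module I\<^esub> y"
    using c module.smult_r_distr[OF I_module] by simp
next
  fix x assume c: "x \<in> carrier (ambient_module I)"
  show "\<one> \<odot>\<^bsub>ambient_module I\<^esub> x = x"
    using c module.smult_one[OF I_module] by simp
qed

lemma paired_ambient:
  "paired_local_module R (ambient_module I) \<mm> interleave even_part odd_part"
proof (intro paired_local_module.intro noetherian_local_module.intro noetherian_base_module.intro
    module_ambient noetherian_ring_axioms noetherian_local_ring_axioms paired_local_module_axioms.intro)
  show "even_part \<in> mod_hom R (ambient_module I) (ambient_module I)"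
    "odd_part \<in> mod_hom R (ambient_module I) (ambient_module I)"
    by (auto simp: mod_hom_def even_part_def odd_part_def)
  fix x y assume "x \<in> carrier (ambient_module I)" "y \<in> carrier (ambient_module I)"
  thus "interleave x y \<in> carrier (ambient_module I)" by (auto simp: interleave_def)
  show "even_part (interleave x y) = x" "odd_part (interleave x y) = y"
    by (auto simp: interleave_def even_part_def odd_part_def)
next
  fix u show "interleave (even_part u) (odd_part u) = u"
    by (rule ext) (auto simp: interleave_def even_part_def odd_part_def elim!: evenE oddE)
qed

end

sublocale minimal_resolution_setup \<subseteq> U: paired_local_module R "ambient_module I" \<mm> interleave even_part odd_part
  by (rule paired_ambient)

context minimal_resolution_setup
begin

lemma single_closed: "a \<in> carrier (I j) \<Longrightarrow> single I j a \<in> carrier (ambient_module I)"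
  using I_zero by (simp add: single_def)

lemma single_zero: "single I j \<zero>\<^bsub>I j\<^esub> = \<zero>\<^bsub>ambient_module I\<^esub>"
  by (auto simp: single_def fun_eq_iff)

lemma single_inject: "single I j a = single I j b \<longleftrightarrow> a = b"
  by (auto simp: single_def fun_eq_iff)

lemma single_add:
  "single I j a \<oplus>\<^bsub>ambient_module I\<^esub> single I j b = single I j (a \<oplus>\<^bsub>I j\<^esub> b)"
proof -
  have "\<zero>\<^bsub>I n\<^esub> \<oplus>\<^bsub>I n\<^esub> \<zero>\<^bsub>I n\<^esub> = \<zero>\<^bsub>I n\<^esub>" for n
    using abelian_monoid.l_zero[OF abelian_group.axioms(1)[OF module.axioms(2)[OF I_module]] I_zero] .
  thus ?thesis by (auto simp: single_def fun_eq_iff)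
qed

lemma single_smult:
  "r \<in> carrier R \<Longrightarrow> r \<odot>\<^bsub>ambient_module I\<^esub> single I j a = single I j (r \<odot>\<^bsub>I j\<^esub> a)"
  using module.smult_r_null[OF I_module] by (auto simp: single_def fun_eq_iff)

lemma single_diff: "ambient_diff d (single I j a) = single I (j + 1) (d j a)"
proof (intro ext)
  fix k n
  have "d (n - 1) \<zero>\<^bsub>I (n - 1)\<^esub> = \<zero>\<^bsub>I n\<^esub>" using d_zero[of "n - 1"] by simp
  thus "ambient_diff d (single I j a) k n = single I (j + 1) (d j a) k n"
    by (auto simp: ambient_diff_def single_def)
qed

lemma ambient_diff_hom: "ambient_diff d \<in> mod_hom R (ambient_module I) (ambient_module I)"
proof -
  have c: "d (n - 1) x \<in> carrier (I n)" if "x \<in> carrier (I (n - 1))" for n x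
    using d_closed[OF that] by simp
  have a: "d (n - 1) (x \<oplus>\<^bsub>I (n - 1)\<^esub> y) = d (n - 1) x \<oplus>\<^bsub>I n\<^esub> d (n - 1) y"
    if "x \<in> carrier (I (n - 1))" "y \<in> carrier (I (n - 1))" for n x y
    using d_add[OF that] by simp
  have s: "d (n - 1) (r \<odot>\<^bsub>I (n - 1)\<^esub> x) = r \<odot>\<^bsub>I n\<^esub> d (n - 1) x"
    if "r \<in> carrier R" "x \<in> carrier (I (n - 1))" for n r x
    using d_smult[OF that] by simp
  show ?thesis using c a s by (auto simp: mod_hom_def ambient_diff_def fun_eq_iff)
qed

lemma submodule_level: "submodule (level I j) R (ambient_module I)"
proof (rule U.submoduleI')
  interpret A: module R "I j" by (rule I_module)
  show "level I j \<subseteq> carrier (ambient_module I)"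
    unfolding level_def using single_closed by blast
  show "\<zero>\<^bsub>ambient_module I\<^esub> \<in> level I j"
    unfolding level_def single_zero[symmetric, of j] using I_zero by blast
  fix x y assume "x \<in> level I j" "y \<in> level I j"
  then obtain a b where "a \<in> carrier (I j)" "b \<in> carrier (I j)" "x = single I j a" "y = single I j b"
    unfolding level_def by blast
  thus "x \<oplus>\<^bsub>ambient_module I\<^esub> y \<in> level I j"
    unfolding level_def using single_add A.a_closed by (metis imageI)
next
  interpret A: module R "I j" by (rule I_module)
  fix r x assume r: "r \<in> carrier R" and "x \<in> level I j"
  then obtain a where "a \<in> carrier (I j)" "x = single I j a" unfolding level_def by blast
  thus "r \<odot>\<^bsub>ambient_module I\<^esub> x \<in> level I j"
    unfolding level_def using single_smult[OF r] A.smult_closed[OF r] by (metis imageI)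
qed

lemma level_complex: "U.is_complex (level I) (ambient_diff d)"
  unfolding U.is_complex_def
proof (intro conjI allI ballI ambient_diff_hom submodule_level)
  fix j x assume "x \<in> level I j"
  then obtain a where a: "a \<in> carrier (I j)" "x = single I j a" unfolding level_def by blast
  show "ambient_diff d x \<in> level I (j + 1)"
    unfolding a(2) single_diff level_def using d_closed[OF a(1)] by (rule imageI)
  show "ambient_diff d (ambient_diff d x) = \<zero>\<^bsub>ambient_module I\<^esub>"
    unfolding a(2) single_diff d_d[OF a(1)] by (rule single_zero)
qed

lemma single_mem_level: "single I j a \<in> level I j \<longleftrightarrow> a \<in> carrier (I j)"
  unfolding level_def by (auto simp: single_inject)

lemma single_mem_Zc:
  "single I j a \<in> U.Zc (level I) (ambient_diff d) j \<longleftrightarrow> a \<in> carrier (I j) \<and> d j a = \<zero>\<^bsub>I (j + 1)\<^esub>"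
  unfolding U.Zc_def mem_Collect_eq single_mem_level single_diff single_zero[symmetric, of "j + 1"]
    single_inject ..

lemma single_mem_Bc:
  "single I j a \<in> U.Bc (level I) (ambient_diff d) j \<longleftrightarrow> (\<exists>y\<in>carrier (I (j - 1)). d (j - 1) y = a)"
proof -
  have "ambient_diff d (single I (j - 1) y) = single I j (d (j - 1) y)" for y
    using single_diff[of "j - 1" y] by simp
  thus ?thesis unfolding U.Bc_def level_def image_image by (auto simp: single_inject)
qed

lemma Zc_level: "U.Zc (level I) (ambient_diff d) j \<subseteq> level I j"
  by (auto simp: U.Zc_def)

lemma single_mem_torsion:
  "single I j a \<in> U.torsion \<mm> (level I) j \<longleftrightarrow>
    a \<in> carrier (I j) \<and> (\<forall>b\<in>\<mm>. \<exists>k::nat. b [^] k \<odot>\<^bsub>I j\<^esub> a = \<zero>\<^bsub>I j\<^esub>)"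
proof -
  have "b [^] (k::nat) \<odot>\<^bsub>ambient_module I\<^esub> single I j a = \<zero>\<^bsub>ambient_module I\<^esub> \<longleftrightarrow>
      b [^] k \<odot>\<^bsub>I j\<^esub> a = \<zero>\<^bsub>I j\<^esub>" if "b \<in> \<mm>" for b k
  proof -
    have "b [^] k \<in> carrier R" using that m_subset by auto
    thus ?thesis using single_smult single_zero[of j] single_inject by metis
  qed
  thus ?thesis unfolding U.torsion_def mem_Collect_eq single_mem_level by simp
qed

lemma soft_level: "U.soft (level I j)"
  unfolding U.soft_def
proof (intro ballI)
  interpret A: noetherian_base_module R "I j"
    using I_base by (rule noetherian_local_module.axioms(1))
  fix u s assume "u \<in> level I j" and s: "s \<in> carrier R"
  then obtain a where a: "a \<in> carrier (I j)" "u = single I j a" unfolding level_def by blast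
  have inj: "injective_module R (I j)"
    using res unfolding minimal_injective_resolution_def injective_resolution_def by blast
  obtain v and t :: nat where v: "v \<in> carrier (I j)"
    "\<And>b. b \<in> carrier R \<Longrightarrow> b \<odot>\<^bsub>I j\<^esub> a = \<zero>\<^bsub>I j\<^esub> \<Longrightarrow> b \<odot>\<^bsub>I j\<^esub> v = \<zero>\<^bsub>I j\<^esub>"
    "s [^] Suc t \<odot>\<^bsub>I j\<^esub> v = s [^] t \<odot>\<^bsub>I j\<^esub> a"
    using A.injective_soft[OF inj a(1) s] by blast
  have st: "s [^] (k::nat) \<in> carrier R" for k using s by simp
  show "\<exists>v\<in>level I j. \<exists>t::nat. (\<forall>a\<in>carrier R. a \<odot>\<^bsub>ambient_module I\<^esub> u = \<zero>\<^bsub>ambient_module I\<^esub> \<longrightarrow>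
      a \<odot>\<^bsub>ambient_module I\<^esub> v = \<zero>\<^bsub>ambient_module I\<^esub>) \<and>
      s [^] Suc t \<odot>\<^bsub>ambient_module I\<^esub> v = s [^] t \<odot>\<^bsub>ambient_module I\<^esub> u"
  proof (intro bexI[of _ "single I j v"] exI[of _ t] conjI ballI impI)
    show "single I j v \<in> level I j" using v(1) by (simp add: single_mem_level)
    fix b assume b: "b \<in> carrier R" "b \<odot>\<^bsub>ambient_module I\<^esub> u = \<zero>\<^bsub>ambient_module I\<^esub>"
    have "b \<odot>\<^bsub>I j\<^esub> a = \<zero>\<^bsub>I j\<^esub>"
      using b(2) unfolding a(2) single_smult[OF b(1)] single_zero[symmetric, of j] single_inject .
    hence "b \<odot>\<^bsub>I j\<^esub> v = \<zero>\<^bsub>I j\<^esub>" by (rule v(2)[OF b(1)])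
    thus "b \<odot>\<^bsub>ambient_module I\<^esub> single I j v = \<zero>\<^bsub>ambient_module I\<^esub>"
      unfolding single_smult[OF b(1)] single_zero[symmetric, of j] by (rule arg_cong)
  next
    show "s [^] Suc t \<odot>\<^bsub>ambient_module I\<^esub> single I j v = s [^] t \<odot>\<^bsub>ambient_module I\<^esub> u"
      unfolding a(2) single_smult[OF st] v(3) ..
  qed
qed

lemma resolution_facts:
  shows "\<epsilon> \<in> mod_hom R M (I 0)" "inj_on \<epsilon> (carrier M)"
    "\<And>a. a \<in> carrier (I 0) \<Longrightarrow> d 0 a = \<zero>\<^bsub>I 1\<^esub> \<longleftrightarrow> a \<in> \<epsilon> ` carrier M"
    "\<And>j. j < 0 \<Longrightarrow> carrier (I j) = {\<zero>\<^bsub>I j\<^esub>}"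
    "\<And>j a. 0 < j \<Longrightarrow> a \<in> carrier (I j) \<Longrightarrow> d j a = \<zero>\<^bsub>I (j + 1)\<^esub> \<Longrightarrow> \<exists>y\<in>carrier (I (j - 1)). d (j - 1) y = a"
proof -
  have r: "\<epsilon> \<in> mod_hom R M (I 0)" "inj_on \<epsilon> (carrier M)" "\<epsilon> ` carrier M = cocycles I d 0"
    "\<forall>n<0. carrier (I n) = {\<zero>\<^bsub>I n\<^esub>}" "\<forall>n>0. cocycles I d n = coboundaries I d n"
    using res unfolding minimal_injective_resolution_def injective_resolution_def by blast+
  have Z: "a \<in> cocycles I d j \<longleftrightarrow> a \<in> carrier (I j) \<and> d j a = \<zero>\<^bsub>I (j + 1)\<^esub>" for a j
    by (simp add: cocycles_def a_kernel_def')
  show "\<epsilon> \<in> mod_hom R M (I 0)" "inj_on \<epsilon> (carrier M)" "\<And>j. j < 0 \<Longrightarrow> carrier (I j) = {\<zero>\<^bsub>I j\<^esub>}"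
    using r by blast+
  show "d 0 a = \<zero>\<^bsub>I 1\<^esub> \<longleftrightarrow> a \<in> \<epsilon> ` carrier M" if "a \<in> carrier (I 0)" for a
    unfolding r(3) Z using that by simp
  show "\<exists>y\<in>carrier (I (j - 1)). d (j - 1) y = a"
    if "0 < j" "a \<in> carrier (I j)" "d j a = \<zero>\<^bsub>I (j + 1)\<^esub>" for j a
  proof -
    have "a \<in> coboundaries I d j" using that r(5) Z[of a j] by blast
    thus ?thesis unfolding coboundaries_def by (auto simp: image_iff)
  qed
qed

lemma level_acyclic:
  assumes j: "j \<noteq> 0"
  shows "U.Zc (level I) (ambient_diff d) j \<subseteq> U.Bc (level I) (ambient_diff d) j"
proof
  fix x assume x: "x \<in> U.Zc (level I) (ambient_diff d) j"
  then obtain a where a: "x = single I j a" using Zc_level unfolding level_def by blast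
  have a': "a \<in> carrier (I j)" "d j a = \<zero>\<^bsub>I (j + 1)\<^esub>" using x unfolding a single_mem_Zc by blast+
  show "x \<in> U.Bc (level I) (ambient_diff d) j"
  proof (cases "0 < j")
    case True
    thus ?thesis unfolding a single_mem_Bc using resolution_facts(5) a' by blast
  next
    case False
    hence "a = \<zero>\<^bsub>I j\<^esub>" using resolution_facts(4)[of j] a' j by auto
    thus ?thesis unfolding a using single_zero[of j]
        U.submodule_closed(3)[OF U.complex_submodules(2)[OF level_complex, of j]] by simp
  qed
qed

text \<open>The only cohomology is \<open>M\<close> in degree \<open>0\<close>, where submodules of \<open>M\<close> are compared along \<open>\<epsilon>\<close>.\<close>

lemma level_noetherian:
  "U.noetherian_interval (U.Bc (level I) (ambient_diff d) j) (U.Zc (level I) (ambient_diff d) j)"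
proof (cases "j = 0")
  case False
  show ?thesis
    by (rule U.interval_condition_mono[OF U.interval_condition_trivial order_refl level_acyclic[OF False]])
next
  case True
  interpret N: noetherian_base_module R M by (rule M_base)
  let ?Z = "U.Zc (level I) (ambient_diff d) 0" and ?B = "U.Bc (level I) (ambient_diff d) 0"
  note eps = mod_homD[OF resolution_facts(1)]
  let ?e = "\<lambda>m. single I 0 (\<epsilon> m)"
  have e0: "?e \<zero>\<^bsub>M\<^esub> = \<zero>\<^bsub>ambient_module I\<^esub>"
  proof -
    interpret A: module R "I 0" by (rule I_module)
    have "\<epsilon> (\<zero> \<odot>\<^bsub>M\<^esub> \<zero>\<^bsub>M\<^esub>) = \<zero> \<odot>\<^bsub>I 0\<^esub> \<epsilon> \<zero>\<^bsub>M\<^esub>" by (rule eps(3)) auto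
    hence "\<epsilon> \<zero>\<^bsub>M\<^esub> = \<zero>\<^bsub>I 0\<^esub>" using eps(1)[of "\<zero>\<^bsub>M\<^esub>"] by simp
    thus ?thesis using single_zero[of 0] by simp
  qed
  have surj: "\<exists>m\<in>carrier M. x = ?e m" if x: "x \<in> ?Z" for x
  proof -
    obtain a where a: "x = single I 0 a" using x Zc_level unfolding level_def by blast
    have "a \<in> carrier (I 0)" "d 0 a = \<zero>\<^bsub>I 1\<^esub>" using x unfolding a single_mem_Zc by simp_all
    hence "a \<in> \<epsilon> ` carrier M" using resolution_facts(3) by blast
    thus ?thesis using a by blast
  qed
  have "U.noetherian_interval ?B ?Z"
  proof (rule noetherian_transfer[OF N.finitely_generated_noetherian[OF fg], of _ "\<lambda>V. {m \<in> carrier M. ?e m \<in> V}"])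
    fix V assume "V \<in> U.interval ?B ?Z"
    hence V: "submodule V R (ambient_module I)" by (simp add: U.interval_def)
    note cV = U.submodule_closed[OF V]
    have "submodule {m \<in> carrier M. ?e m \<in> V} R M"
    proof (rule N.submoduleI')
      show "\<zero>\<^bsub>M\<^esub> \<in> {m \<in> carrier M. ?e m \<in> V}" using e0 cV(3) by simp
      fix x y assume xy: "x \<in> {m \<in> carrier M. ?e m \<in> V}" "y \<in> {m \<in> carrier M. ?e m \<in> V}"
      have "?e x \<oplus>\<^bsub>ambient_module I\<^esub> ?e y \<in> V" using xy by (intro cV(4)) blast+
      thus "x \<oplus>\<^bsub>M\<^esub> y \<in> {m \<in> carrier M. ?e m \<in> V}" unfolding single_add using xy eps(2) by simp
    next
      fix r x assume r: "r \<in> carrier R" and x: "x \<in> {m \<in> carrier M. ?e m \<in> V}"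
      have "r \<odot>\<^bsub>ambient_module I\<^esub> ?e x \<in> V" using x r by (intro cV(7)) blast+
      thus "r \<odot>\<^bsub>M\<^esub> x \<in> {m \<in> carrier M. ?e m \<in> V}" unfolding single_smult[OF r] using x r eps(3) by simp
    qed blast
    thus "{m \<in> carrier M. ?e m \<in> V} \<in> N.interval {\<zero>\<^bsub>M\<^esub>} (carrier M)"
      using N.submodule_closed(3) by (auto simp: N.interval_def)
  next
    have incl: "V \<subseteq> W" if V: "V \<in> U.interval ?B ?Z"
      and sub: "{m \<in> carrier M. ?e m \<in> V} \<subseteq> {m \<in> carrier M. ?e m \<in> W}" for V W
    proof
      fix x assume x: "x \<in> V"
      hence "x \<in> ?Z" using V by (auto simp: U.interval_def)
      then obtain m where "m \<in> carrier M" "x = ?e m" using surj by blast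
      thus "x \<in> W" using x sub by blast
    qed
    show "inj_on (\<lambda>V. {m \<in> carrier M. ?e m \<in> V}) (U.interval ?B ?Z)"
      by (rule inj_onI, rule equalityI; rule incl; simp)
  qed auto
  thus ?thesis using True by simp
qed

lemma level_resolution_like: "U.resolution_like (level I) (ambient_diff d)"
  unfolding U.resolution_like_def using level_complex soft_level level_noetherian level_acyclic by auto

definition m_torsion :: "int \<Rightarrow> 'b \<Rightarrow> bool"
  where "m_torsion j a \<longleftrightarrow> a \<in> carrier (I j) \<and> (\<forall>b\<in>\<mm>. \<exists>k::nat. b [^] k \<odot>\<^bsub>I j\<^esub> a = \<zero>\<^bsub>I j\<^esub>)"

lemma nonzero_torsion_cocycle:
  assumes q: "\<And>i. i \<le> n \<Longrightarrow> primeideal (q i) R" "\<And>i. i < n \<Longrightarrow> q i \<subset> q (Suc i)" "q n = \<mm>"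
    and ann: "annihilator R M \<subseteq> q 0"
  obtains j z where "int n \<le> j" "m_torsion j z" "d j z = \<zero>\<^bsub>I (j + 1)\<^esub>"
    "\<And>y. m_torsion (j - 1) y \<Longrightarrow> d (j - 1) y \<noteq> z"
proof -
  interpret N: noetherian_base_module R M by (rule M_base)
  let ?D = "ambient_diff d"
  obtain m where m: "m \<in> carrier M" "\<And>s. s \<in> carrier R - q 0 \<Longrightarrow> s \<odot>\<^bsub>M\<^esub> m \<noteq> \<zero>\<^bsub>M\<^esub>"
    using N.finitely_generated_support[OF fg q(1)[of 0] ann] by blast
  note eps = mod_homD[OF resolution_facts(1)]
  let ?z = "single I 0 (\<epsilon> m)"
  have em: "\<epsilon> m \<in> carrier (I 0)" by (rule eps(1)[OF m(1)])
  hence "d 0 (\<epsilon> m) = \<zero>\<^bsub>I 1\<^esub>" using resolution_facts(3) m(1) by blast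
  hence zZ: "?z \<in> U.Zc (level I) ?D 0" unfolding single_mem_Zc using em by simp
  have zB: "s \<odot>\<^bsub>ambient_module I\<^esub> ?z \<notin> U.Bc (level I) ?D 0" if s: "s \<in> carrier R - q 0" for s
  proof
    have sc: "s \<in> carrier R" using s by blast
    interpret A: module R "I 0" by (rule I_module)
    assume "s \<odot>\<^bsub>ambient_module I\<^esub> ?z \<in> U.Bc (level I) ?D 0"
    hence "\<exists>y\<in>carrier (I (0 - 1)). d (0 - 1) y = s \<odot>\<^bsub>I 0\<^esub> \<epsilon> m"
      unfolding single_smult[OF sc] single_mem_Bc .
    then obtain y where y: "y \<in> carrier (I (- 1))" "d (- 1) y = s \<odot>\<^bsub>I 0\<^esub> \<epsilon> m" by auto
    hence "y = \<zero>\<^bsub>I (- 1)\<^esub>" using resolution_facts(4)[of "- 1"] by simp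
    hence "s \<odot>\<^bsub>I 0\<^esub> \<epsilon> m = \<zero>\<^bsub>I 0\<^esub>" using y(2) d_zero[of "- 1"] by simp
    moreover have "\<epsilon> (\<zero> \<odot>\<^bsub>M\<^esub> \<zero>\<^bsub>M\<^esub>) = \<zero> \<odot>\<^bsub>I 0\<^esub> \<epsilon> \<zero>\<^bsub>M\<^esub>" by (rule eps(3)) auto
    hence "\<epsilon> \<zero>\<^bsub>M\<^esub> = \<zero>\<^bsub>I 0\<^esub>" using eps(1)[of "\<zero>\<^bsub>M\<^esub>"] by simp
    ultimately have "\<epsilon> (s \<odot>\<^bsub>M\<^esub> m) = \<epsilon> \<zero>\<^bsub>M\<^esub>" using eps(3)[OF sc m(1)] by simp
    hence "s \<odot>\<^bsub>M\<^esub> m = \<zero>\<^bsub>M\<^esub>" using resolution_facts(2) m(1) sc unfolding inj_on_def by auto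
    thus False using m(2)[OF s] by blast
  qed
  have "\<exists>j\<ge>int n. \<not> U.Zc (U.torsion \<mm> (level I)) ?D j \<subseteq> U.Bc (U.torsion \<mm> (level I)) ?D j"
    by (rule U.torsion_cohomology_nonvanishing[OF level_resolution_like q zZ zB])
  then obtain j x where j: "int n \<le> j" and x: "x \<in> U.Zc (U.torsion \<mm> (level I)) ?D j"
    "x \<notin> U.Bc (U.torsion \<mm> (level I)) ?D j" by blast
  have xT: "x \<in> U.torsion \<mm> (level I) j" "?D x = \<zero>\<^bsub>ambient_module I\<^esub>" using U.ZcD[OF x(1)] by blast+
  then obtain z where z: "x = single I j z" using U.torsion_subset unfolding level_def by blast
  show thesis
  proof (rule that[OF j])
    show "m_torsion j z" using xT(1) unfolding z single_mem_torsion m_torsion_def .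
    show "d j z = \<zero>\<^bsub>I (j + 1)\<^esub>"
      using xT(2) unfolding z single_diff single_zero[symmetric, of "j + 1"] single_inject .
    fix y assume "m_torsion (j - 1) y"
    hence y: "single I (j - 1) y \<in> U.torsion \<mm> (level I) (j - 1)"
      unfolding single_mem_torsion m_torsion_def .
    show "d (j - 1) y \<noteq> z"
    proof
      assume "d (j - 1) y = z"
      hence "?D (single I (j - 1) y) = x" unfolding single_diff z by simp
      thus False using x(2) U.BcI(2)[of _ "U.torsion \<mm> (level I)", OF y, of ?D] by simp
    qed
  qed
qed

end

section \<open>Cohomology of the injective linear part\<close>

lemma (in cring) ideal_power_Suc:
  assumes "ideal \<aa> R"
  shows "\<aa> [^]\<^bsub>ideals_set R\<^esub> Suc n = (\<aa> [^]\<^bsub>ideals_set R\<^esub> n) \<cdot>\<^bsub>R\<^esub> \<aa>"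
    and "\<aa> [^]\<^bsub>ideals_set R\<^esub> (0::nat) = carrier R"
proof -
  show "\<aa> [^]\<^bsub>ideals_set R\<^esub> Suc n = (\<aa> [^]\<^bsub>ideals_set R\<^esub> n) \<cdot>\<^bsub>R\<^esub> \<aa>"
    by (simp add: ideals_set_def)
  show "\<aa> [^]\<^bsub>ideals_set R\<^esub> (0::nat) = carrier R"
    by (simp add: ideals_set_def)
qed

lemma (in cring) ideal_power_subset: "ideal \<aa> R \<Longrightarrow> \<aa> [^]\<^bsub>ideals_set R\<^esub> (n::nat) \<subseteq> carrier R"
proof (induct n)
  case 0
  show ?case unfolding ideal_power_Suc(2)[OF 0] ..
next
  case (Suc n)
  show ?case
  proof
    fix x assume "x \<in> \<aa> [^]\<^bsub>ideals_set R\<^esub> Suc n"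
    hence "x \<in> (\<aa> [^]\<^bsub>ideals_set R\<^esub> n) \<cdot>\<^bsub>R\<^esub> \<aa>" unfolding ideal_power_Suc(1)[OF Suc(2)] .
    thus "x \<in> carrier R"
      by induct (use Suc ideal.Icarr[OF Suc(2)] in auto)
  qed
qed

lemma (in module) annihilated_by_power:
  assumes a: "ideal \<aa> R"
  shows "annihilated_by M (\<aa> [^]\<^bsub>ideals_set R\<^esub> n) = colon_power \<aa> {\<zero>\<^bsub>M\<^esub>} n"
proof (induct n)
  case 0
  have "x = \<zero>\<^bsub>M\<^esub>" if "x \<in> carrier M" "\<forall>a\<in>carrier R. a \<odot>\<^bsub>M\<^esub> x = \<zero>\<^bsub>M\<^esub>" for x
    using that smult_one[of x] by (metis R.one_closed)
  thus ?case unfolding R.ideal_power_Suc(2)[OF a] by (auto simp: annihilated_by_def)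
next
  case (Suc n)
  have ac: "\<aa> \<subseteq> carrier R" using ideal.Icarr[OF a] by blast
  note pc = R.ideal_power_subset[OF a, of n]
  show ?case
  proof (intro equalityI subsetI)
    fix x assume x: "x \<in> annihilated_by M (\<aa> [^]\<^bsub>ideals_set R\<^esub> Suc n)"
    hence xc: "x \<in> carrier M" by (simp add: annihilated_by_def)
    have "b \<odot>\<^bsub>M\<^esub> x \<in> annihilated_by M (\<aa> [^]\<^bsub>ideals_set R\<^esub> n)" if b: "b \<in> \<aa>" for b
      unfolding annihilated_by_def
    proof (intro CollectI conjI ballI)
      show "b \<odot>\<^bsub>M\<^esub> x \<in> carrier M" using b ac xc by blast
      fix c assume c: "c \<in> \<aa> [^]\<^bsub>ideals_set R\<^esub> n"
      have "c \<otimes> b \<in> \<aa> [^]\<^bsub>ideals_set R\<^esub> Suc n"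
        unfolding R.ideal_power_Suc(1)[OF a] by (rule ideal_prod.prod[OF c b])
      hence "(c \<otimes> b) \<odot>\<^bsub>M\<^esub> x = \<zero>\<^bsub>M\<^esub>" using x by (simp add: annihilated_by_def)
      moreover have "c \<in> carrier R" "b \<in> carrier R" using c b pc ac by blast+
      ultimately show "c \<odot>\<^bsub>M\<^esub> (b \<odot>\<^bsub>M\<^esub> x) = \<zero>\<^bsub>M\<^esub>" using smult_assoc1 xc by simp
    qed
    thus "x \<in> colon_power \<aa> {\<zero>\<^bsub>M\<^esub>} (Suc n)" using xc Suc by simp
  next
    fix x assume x: "x \<in> colon_power \<aa> {\<zero>\<^bsub>M\<^esub>} (Suc n)"
    hence xc: "x \<in> carrier M" and xa: "\<And>b. b \<in> \<aa> \<Longrightarrow> b \<odot>\<^bsub>M\<^esub> x \<in> annihilated_by M (\<aa> [^]\<^bsub>ideals_set R\<^esub> n)"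
      using Suc by simp_all
    have "c \<in> carrier R \<and> c \<odot>\<^bsub>M\<^esub> x = \<zero>\<^bsub>M\<^esub>" if "c \<in> (\<aa> [^]\<^bsub>ideals_set R\<^esub> n) \<cdot>\<^bsub>R\<^esub> \<aa>" for c
      using that
    proof induct
      case (prod i j)
      have "i \<odot>\<^bsub>M\<^esub> (j \<odot>\<^bsub>M\<^esub> x) = \<zero>\<^bsub>M\<^esub>" using xa[OF prod(2)] prod(1) by (simp add: annihilated_by_def)
      moreover have "i \<in> carrier R" "j \<in> carrier R" using prod pc ac by blast+
      ultimately show ?case using smult_assoc1 xc by simp
    next
      case (sum s t)
      thus ?case using xc by (simp add: smult_l_distr)
    qed
    thus "x \<in> annihilated_by M (\<aa> [^]\<^bsub>ideals_set R\<^esub> Suc n)"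
      unfolding R.ideal_power_Suc(1)[OF a] annihilated_by_def using xc by blast
  qed
qed

lemma (in module) colon_power_nilpotent:
  assumes "\<aa> \<subseteq> carrier R" "b \<in> \<aa>" "x \<in> colon_power \<aa> {\<zero>\<^bsub>M\<^esub>} n"
  shows "b [^] n \<odot>\<^bsub>M\<^esub> x = \<zero>\<^bsub>M\<^esub>"
  using assms(3)
proof (induct n arbitrary: x)
  case 0 thus ?case using assms by auto
next
  case (Suc n)
  hence "x \<in> carrier M" "b \<odot>\<^bsub>M\<^esub> x \<in> colon_power \<aa> {\<zero>\<^bsub>M\<^esub>} n" using assms(2) by auto
  thus ?case using Suc(1) smult_pow_Suc[of b x n] assms(1,2) by auto
qed

context minimal_resolution_setup
begin

abbreviation G :: "int \<Rightarrow> int \<Rightarrow> 'b set"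
  where "G j n \<equiv> inj_filtration R \<mm> I j n"

lemma G_eq: "G j n = module.colon_power (I n) \<mm> {\<zero>\<^bsub>I n\<^esub>} (nat (j - n))"
  unfolding inj_filtration_def by (rule module.annihilated_by_power[OF I_module ideal_m])

lemma submodule_zero_I: "submodule {\<zero>\<^bsub>I n\<^esub>} R (I n)"
proof -
  interpret A: module R "I n" by (rule I_module)
  show ?thesis by (rule A.submoduleI') auto
qed

lemma submodule_G: "submodule (G j n) R (I n)"
proof -
  interpret A: module R "I n" by (rule I_module)
  show ?thesis unfolding G_eq by (rule A.submodule_colon_power[OF submodule_zero_I m_subset])
qed

lemma G_low: "j \<le> n \<Longrightarrow> G j n = {\<zero>\<^bsub>I n\<^esub>}"
proof -
  interpret A: module R "I n" by (rule I_module)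
  show "j \<le> n \<Longrightarrow> G j n = {\<zero>\<^bsub>I n\<^esub>}" unfolding G_eq by simp
qed

lemma G_torsion: "x \<in> G j n \<Longrightarrow> m_torsion n x"
proof -
  interpret A: module R "I n" by (rule I_module)
  assume x: "x \<in> G j n"
  have "b [^] nat (j - n) \<odot>\<^bsub>I n\<^esub> x = \<zero>\<^bsub>I n\<^esub>" if "b \<in> \<mm>" for b
    using A.colon_power_nilpotent[OF m_subset that] x unfolding G_eq by blast
  thus ?thesis unfolding m_torsion_def using A.submodule_closed(2)[OF submodule_G x] by blast
qed

lemma torsion_in_G: "m_torsion n x \<Longrightarrow> \<exists>j. x \<in> G j n"
proof -
  interpret A: noetherian_local_module R "I n" \<mm> by (rule I_base)
  assume x: "m_torsion n x"
  have "\<exists>k. {x} \<subseteq> A.colon_power \<mm> {\<zero>\<^bsub>I n\<^esub>} k"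
    by (rule A.nilpotent_uniform[OF submodule_zero_I ideal_m]) (use x in \<open>auto simp: m_torsion_def\<close>)
  then obtain k where "x \<in> A.colon_power \<mm> {\<zero>\<^bsub>I n\<^esub>} k" by blast
  hence "x \<in> G (n + int k) n" unfolding G_eq by simp
  thus ?thesis by blast
qed

text \<open>Minimality enters here: an essential submodule meets, and hence contains, every simple submodule.
  So the socle consists of cocycles.\<close>

lemma d_socle:
  assumes x: "x \<in> carrier (I n)" and soc: "\<And>a. a \<in> \<mm> \<Longrightarrow> a \<odot>\<^bsub>I n\<^esub> x = \<zero>\<^bsub>I n\<^esub>"
  shows "d n x = \<zero>\<^bsub>I (n + 1)\<^esub>"
proof (cases "x = \<zero>\<^bsub>I n\<^esub>")
  case True thus ?thesis by (simp add: d_zero)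
next
  case False
  interpret A: noetherian_local_module R "I n" \<mm> by (rule I_base)
  have "injective_envelope R (cocycles I d n) (I n)"
    using res unfolding minimal_injective_resolution_def minimal_injective_complex_def by blast
  hence Z: "submodule (cocycles I d n) R (I n)"
    and ess: "\<And>L. submodule L R (I n) \<Longrightarrow> L \<noteq> {\<zero>\<^bsub>I n\<^esub>} \<Longrightarrow> L \<inter> cocycles I d n \<noteq> {\<zero>\<^bsub>I n\<^esub>}"
    unfolding injective_envelope_def by blast+
  let ?C = "(\<lambda>b. b \<odot>\<^bsub>I n\<^esub> x) ` carrier R"
  have C: "submodule ?C R (I n)" by (rule A.submodule_cyclic[OF x])
  have "?C \<noteq> {\<zero>\<^bsub>I n\<^esub>}" using A.mem_cyclic[OF x] False by blast
  hence "?C \<inter> cocycles I d n \<noteq> {\<zero>\<^bsub>I n\<^esub>}" by (rule ess[OF C])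
  moreover have "\<zero>\<^bsub>I n\<^esub> \<in> ?C \<inter> cocycles I d n" using A.submodule_closed(3)[OF C] A.submodule_closed(3)[OF Z] by blast
  ultimately obtain b where b: "b \<in> carrier R" "b \<odot>\<^bsub>I n\<^esub> x \<in> cocycles I d n" "b \<odot>\<^bsub>I n\<^esub> x \<noteq> \<zero>\<^bsub>I n\<^esub>" by blast
  hence "b \<notin> \<mm>" using soc by blast
  hence "x \<in> cocycles I d n" by (rule A.smult_unit_mem[OF Z b(1) _ x b(2)])
  thus ?thesis by (simp add: cocycles_def a_kernel_def')
qed

text \<open>If \<open>\<mm>\<^sup>k\<^sup>+\<^sup>1x = 0\<close>, then \<open>\<mm>\<^sup>kx\<close> lies in the socle, so that the differential lowers the exponent by one.\<close>

lemma d_G: "x \<in> G j n \<Longrightarrow> d n x \<in> G j (n + 1)"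
proof -
  interpret A: noetherian_local_module R "I n" \<mm> by (rule I_base)
  interpret B: noetherian_local_module R "I (n + 1)" \<mm> by (rule I_base)
  have key: "d n x \<in> B.colon_power \<mm> {\<zero>\<^bsub>I (n + 1)\<^esub>} k"
    if "x \<in> A.colon_power \<mm> {\<zero>\<^bsub>I n\<^esub>} (Suc k)" for k x
    using that
  proof (induct k arbitrary: x)
    case 0
    hence "d n x = \<zero>\<^bsub>I (n + 1)\<^esub>" by (intro d_socle) auto
    thus ?case by simp
  next
    case (Suc k)
    have x: "x \<in> carrier (I n)" "\<And>a. a \<in> \<mm> \<Longrightarrow> a \<odot>\<^bsub>I n\<^esub> x \<in> A.colon_power \<mm> {\<zero>\<^bsub>I n\<^esub>} (Suc k)"
      using Suc(2) unfolding A.colon_power.simps(2)[of _ _ "Suc k"] by blast+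
    have "a \<odot>\<^bsub>I (n + 1)\<^esub> d n x \<in> B.colon_power \<mm> {\<zero>\<^bsub>I (n + 1)\<^esub>} k" if a: "a \<in> \<mm>" for a
      using Suc(1)[OF x(2)[OF a]] d_smult[of a x n] a x(1) m_subset by auto
    thus ?case using d_closed[OF x(1)] by simp
  qed
  assume x: "x \<in> G j n"
  show ?thesis
  proof (cases "j \<le> n")
    case True
    thus ?thesis using x G_low[of j n] G_low[of j "n + 1"] d_zero by simp
  next
    case False
    hence "nat (j - n) = Suc (nat (j - (n + 1)))" by simp
    thus ?thesis using key x unfolding G_eq by metis
  qed
qed

abbreviation Lin :: "int \<Rightarrow> ('a, int \<Rightarrow> 'b set) module"
  where "Lin n \<equiv> inj_lin R \<mm> I n"

abbreviation dlin :: "int \<Rightarrow> (int \<Rightarrow> 'b set) \<Rightarrow> int \<Rightarrow> 'b set"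
  where "dlin \<equiv> inj_lin_diff R \<mm> I d"

lemma coset_def': "V +>\<^bsub>I n\<^esub> a = {v \<oplus>\<^bsub>I n\<^esub> a | v. v \<in> V}"
  by (auto simp: a_r_coset_def')

lemma coset_eq_iff:
  assumes V: "submodule V R (I n)" and x: "x \<in> carrier (I n)" and y: "y \<in> carrier (I n)"
  shows "x \<in> V +>\<^bsub>I n\<^esub> y \<longleftrightarrow> V +>\<^bsub>I n\<^esub> x = V +>\<^bsub>I n\<^esub> y"
proof
  interpret A: module R "I n" by (rule I_module)
  note c = A.submodule_closed[OF V]
  have self: "z \<in> V +>\<^bsub>I n\<^esub> z" if "z \<in> carrier (I n)" for z
  proof -
    have "\<zero>\<^bsub>I n\<^esub> \<oplus>\<^bsub>I n\<^esub> z \<in> V +>\<^bsub>I n\<^esub> z" unfolding coset_def' using c(3) by blast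
    thus ?thesis using that by simp
  qed
  show "V +>\<^bsub>I n\<^esub> x = V +>\<^bsub>I n\<^esub> y \<Longrightarrow> x \<in> V +>\<^bsub>I n\<^esub> y" using self[OF x] by simp
  assume "x \<in> V +>\<^bsub>I n\<^esub> y"
  then obtain v where v: "v \<in> V" "x = v \<oplus>\<^bsub>I n\<^esub> y" unfolding coset_def' by blast
  have vc: "v \<in> carrier (I n)" using v c by blast
  show "V +>\<^bsub>I n\<^esub> x = V +>\<^bsub>I n\<^esub> y"
  proof (intro equalityI subsetI)
    fix w assume "w \<in> V +>\<^bsub>I n\<^esub> x"
    then obtain u where u: "u \<in> V" "w = u \<oplus>\<^bsub>I n\<^esub> x" unfolding coset_def' by blast
    have "u \<in> carrier (I n)" using u c by blast
    hence "w = (u \<oplus>\<^bsub>I n\<^esub> v) \<oplus>\<^bsub>I n\<^esub> y" unfolding u(2) v(2) using vc y by algebra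
    thus "w \<in> V +>\<^bsub>I n\<^esub> y" unfolding coset_def' using c(4)[OF u(1) v(1)] by blast
  next
    fix w assume "w \<in> V +>\<^bsub>I n\<^esub> y"
    then obtain u where u: "u \<in> V" "w = u \<oplus>\<^bsub>I n\<^esub> y" unfolding coset_def' by blast
    have "u \<in> carrier (I n)" using u c by blast
    hence "w = (u \<ominus>\<^bsub>I n\<^esub> v) \<oplus>\<^bsub>I n\<^esub> x" unfolding u(2) v(2) using vc y by algebra
    thus "w \<in> V +>\<^bsub>I n\<^esub> x" unfolding coset_def' using c(5)[OF u(1) v(1)] by blast
  qed
qed

lemma coset_zero: "submodule V R (I n) \<Longrightarrow> V +>\<^bsub>I n\<^esub> \<zero>\<^bsub>I n\<^esub> = V"
proof -
  interpret A: module R "I n" by (rule I_module)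
  assume "submodule V R (I n)"
  note c = A.submodule_closed[OF this]
  have "v \<oplus>\<^bsub>I n\<^esub> \<zero>\<^bsub>I n\<^esub> = v" if "v \<in> V" for v using c(2)[OF that] by simp
  thus ?thesis unfolding coset_def' by (auto intro: sym)
qed

lemma coset_self: "submodule V R (I n) \<Longrightarrow> x \<in> carrier (I n) \<Longrightarrow> x \<in> V +>\<^bsub>I n\<^esub> x"
  using coset_eq_iff by blast

lemma Lin_carrier: "x \<in> carrier (Lin n) \<longleftrightarrow>
    (\<forall>j. \<exists>a\<in>G (j + 1) n. x j = G j n +>\<^bsub>I n\<^esub> a) \<and> finite {j. x j \<noteq> G j n}"
  by (auto simp: inj_lin_def direct_sum_module_def quotient_module_def A_RCOSETS_def' a_r_coset_def')

lemma Lin_zero: "\<zero>\<^bsub>Lin n\<^esub> = (\<lambda>j. G j n)"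
  by (simp add: inj_lin_def direct_sum_module_def quotient_module_def)

lemma Lin_add: "x \<oplus>\<^bsub>Lin n\<^esub> y = (\<lambda>j. x j <+>\<^bsub>I n\<^esub> y j)"
  by (simp add: inj_lin_def direct_sum_module_def quotient_module_def set_add_def')

lemma Lin_zero_add: "x \<in> carrier (Lin n) \<Longrightarrow> \<zero>\<^bsub>Lin n\<^esub> \<oplus>\<^bsub>Lin n\<^esub> x = x"
proof -
  interpret A: module R "I n" by (rule I_module)
  assume x: "x \<in> carrier (Lin n)"
  have "G j n <+>\<^bsub>I n\<^esub> x j = x j" for j
  proof -
    obtain a where a: "a \<in> G (j + 1) n" "x j = G j n +>\<^bsub>I n\<^esub> a" using x unfolding Lin_carrier by blast
    have ac: "a \<in> carrier (I n)" using A.submodule_closed(2)[OF submodule_G a(1)] .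
    show ?thesis unfolding a(2)
    proof (intro equalityI subsetI)
      fix w assume "w \<in> G j n <+>\<^bsub>I n\<^esub> (G j n +>\<^bsub>I n\<^esub> a)"
      then obtain u v where uv: "u \<in> G j n" "v \<in> G j n" "w = u \<oplus>\<^bsub>I n\<^esub> (v \<oplus>\<^bsub>I n\<^esub> a)"
        unfolding coset_def' by (blast elim: A.set_addE)
      have "u \<in> carrier (I n)" "v \<in> carrier (I n)"
        using A.submodule_closed(2)[OF submodule_G] uv by blast+
      hence "w = (u \<oplus>\<^bsub>I n\<^esub> v) \<oplus>\<^bsub>I n\<^esub> a" unfolding uv(3) using ac by algebra
      thus "w \<in> G j n +>\<^bsub>I n\<^esub> a"
        unfolding coset_def' using A.submodule_closed(4)[OF submodule_G uv(1,2)] by blast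
    next
      fix w assume w: "w \<in> G j n +>\<^bsub>I n\<^esub> a"
      hence "w \<in> carrier (I n)" unfolding coset_def' using A.submodule_closed(2)[OF submodule_G] ac by auto
      hence "w = \<zero>\<^bsub>I n\<^esub> \<oplus>\<^bsub>I n\<^esub> w" by simp
      thus "w \<in> G j n <+>\<^bsub>I n\<^esub> (G j n +>\<^bsub>I n\<^esub> a)"
        using A.set_addI[OF A.submodule_closed(3)[OF submodule_G] w] by simp
    qed
  qed
  thus ?thesis unfolding Lin_add Lin_zero by simp
qed

lemma dlin_coset:
  assumes a: "a \<in> carrier (I n)" and x: "x j = G j n +>\<^bsub>I n\<^esub> a"
  shows "dlin n x j = G j (n + 1) +>\<^bsub>I (n + 1)\<^esub> d n a"
proof -
  interpret A: module R "I n" by (rule I_module)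
  interpret B: module R "I (n + 1)" by (rule I_module)
  have "G j (n + 1) +>\<^bsub>I (n + 1)\<^esub> d n u = G j (n + 1) +>\<^bsub>I (n + 1)\<^esub> d n a"
    if u: "u \<in> G j n +>\<^bsub>I n\<^esub> a" for u
  proof -
    obtain v where v: "v \<in> G j n" "u = v \<oplus>\<^bsub>I n\<^esub> a" using u unfolding coset_def' by blast
    have vc: "v \<in> carrier (I n)" using A.submodule_closed(2)[OF submodule_G v(1)] .
    have "d n u = d n v \<oplus>\<^bsub>I (n + 1)\<^esub> d n a" unfolding v(2) by (rule d_add[OF vc a])
    hence "d n u \<in> G j (n + 1) +>\<^bsub>I (n + 1)\<^esub> d n a" unfolding coset_def' using d_G[OF v(1)] by blast
    moreover have "u \<in> carrier (I n)" using v vc a by simp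
    ultimately show ?thesis using coset_eq_iff[OF submodule_G d_closed d_closed[OF a]] by blast
  qed
  thus ?thesis unfolding inj_lin_diff_def x using coset_self[OF submodule_G a, of j] by blast
qed

lemma dlin_zero: "dlin n \<zero>\<^bsub>Lin n\<^esub> = \<zero>\<^bsub>Lin (n + 1)\<^esub>"
proof
  fix j
  have "\<zero>\<^bsub>Lin n\<^esub> j = G j n +>\<^bsub>I n\<^esub> \<zero>\<^bsub>I n\<^esub>" unfolding Lin_zero coset_zero[OF submodule_G] ..
  from dlin_coset[of _ n "\<zero>\<^bsub>Lin n\<^esub>" j, OF I_zero this] show "dlin n \<zero>\<^bsub>Lin n\<^esub> j = \<zero>\<^bsub>Lin (n + 1)\<^esub> j"
    unfolding d_zero Lin_zero coset_zero[OF submodule_G] .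
qed

lemma Lin_zero_closed: "\<zero>\<^bsub>Lin n\<^esub> \<in> carrier (Lin n)"
proof -
  interpret A: module R "I n" by (rule I_module)
  have "\<exists>a\<in>G (j + 1) n. G j n = G j n +>\<^bsub>I n\<^esub> a" for j
    using coset_zero[OF submodule_G, of n j] A.submodule_closed(3)[OF submodule_G] by metis
  thus ?thesis unfolding Lin_carrier Lin_zero by simp
qed

text \<open>The coset of \<open>x\<close> is a point of the cohomology module, so it is the zero coset.\<close>

lemma zero_cohomologyD:
  assumes H: "carrier (cohomology Lin dlin n) = {\<zero>\<^bsub>cohomology Lin dlin n\<^esub>}"
    and x: "x \<in> carrier (Lin n)" "dlin n x = \<zero>\<^bsub>Lin (n + 1)\<^esub>"
  shows "\<exists>y\<in>carrier (Lin (n - 1)). dlin (n - 1) y = x"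
proof -
  let ?B = "coboundaries Lin dlin n" and ?Z = "cocycles Lin dlin n"
  have xZ: "x \<in> ?Z" using x by (simp add: cocycles_def a_kernel_def')
  have "?B +>\<^bsub>Lin n\<^esub> x \<in> carrier (cohomology Lin dlin n)"
    using xZ by (auto simp: cohomology_def quotient_module_def A_RCOSETS_def' a_r_coset_def')
  hence eq: "?B +>\<^bsub>Lin n\<^esub> x = ?B" using H by (simp add: cohomology_def quotient_module_def)
  have "\<zero>\<^bsub>Lin n\<^esub> = dlin (n - 1) \<zero>\<^bsub>Lin (n - 1)\<^esub>" using dlin_zero[of "n - 1"] by simp
  hence "\<zero>\<^bsub>Lin n\<^esub> \<in> ?B" unfolding coboundaries_def using Lin_zero_closed by blast
  hence "\<zero>\<^bsub>Lin n\<^esub> \<oplus>\<^bsub>Lin n\<^esub> x \<in> ?B +>\<^bsub>Lin n\<^esub> x" by (auto simp: a_r_coset_def')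
  hence "x \<in> ?B" unfolding eq Lin_zero_add[OF x(1)] .
  thus ?thesis unfolding coboundaries_def by blast
qed

text \<open>Descent along the filtration: vanishing cohomology of the graded pieces in degree \<open>n\<close> allows
  subtracting coboundaries from a cocycle until it lies in \<open>G n n\<close>, which is zero.\<close>

lemma torsion_cocycle_bounds:
  assumes H: "carrier (cohomology Lin dlin n) = {\<zero>\<^bsub>cohomology Lin dlin n\<^esub>}"
    and z: "m_torsion n z" "d n z = \<zero>\<^bsub>I (n + 1)\<^esub>"
  shows "\<exists>y. m_torsion (n - 1) y \<and> d (n - 1) y = z"
proof -
  interpret A: module R "I n" by (rule I_module)
  interpret P: module R "I (n - 1)" by (rule I_module)
  have dc: "d (n - 1) y \<in> carrier (I n)" if "y \<in> carrier (I (n - 1))" for y using d_closed[OF that] by simp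
  have "\<exists>y. m_torsion (n - 1) y \<and> d (n - 1) y = z"
    if "z \<in> G (n + int k) n" "d n z = \<zero>\<^bsub>I (n + 1)\<^esub>" for k z
    using that
  proof (induct k arbitrary: z)
    case 0
    hence "z = \<zero>\<^bsub>I n\<^esub>" using G_low[of n n] by simp
    moreover have "m_torsion (n - 1) \<zero>\<^bsub>I (n - 1)\<^esub>"
      by (rule G_torsion[of _ 0]) (rule P.submodule_closed(3)[OF submodule_G])
    ultimately show ?case using d_zero[of "n - 1"] by (intro exI[of _ "\<zero>\<^bsub>I (n - 1)\<^esub>"]) simp
  next
    case (Suc k)
    let ?j = "n + int k"
    have zG: "z \<in> G (?j + 1) n" using Suc(2) by (simp add: ac_simps)
    have zc: "z \<in> carrier (I n)" by (rule A.submodule_closed(2)[OF submodule_G zG])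
    \<comment> \<open>The class of \<open>z\<close>, placed in the summand \<open>?j\<close>, is a cocycle of the linear part.\<close>
    define x where "x i = (if i = ?j then G ?j n +>\<^bsub>I n\<^esub> z else G i n)" for i
    have xi: "x i = G i n +>\<^bsub>I n\<^esub> (if i = ?j then z else \<zero>\<^bsub>I n\<^esub>)" for i
      unfolding x_def using coset_zero[OF submodule_G] by simp
    have "x \<in> carrier (Lin n)"
      unfolding Lin_carrier
    proof (intro conjI allI)
      show "\<exists>a\<in>G (i + 1) n. x i = G i n +>\<^bsub>I n\<^esub> a" for i
        unfolding xi using zG A.submodule_closed(3)[OF submodule_G] by auto
      have "{i. x i \<noteq> G i n} \<subseteq> {?j}" by (auto simp: x_def)
      thus "finite {i. x i \<noteq> G i n}" using finite_subset by blast
    qed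
    moreover have "dlin n x = \<zero>\<^bsub>Lin (n + 1)\<^esub>"
    proof
      fix i
      have "d n (if i = ?j then z else \<zero>\<^bsub>I n\<^esub>) = \<zero>\<^bsub>I (n + 1)\<^esub>" using Suc(3) d_zero by simp
      thus "dlin n x i = \<zero>\<^bsub>Lin (n + 1)\<^esub> i"
        using dlin_coset[of _ n x i, OF _ xi[of i]] zc I_zero coset_zero[OF submodule_G] unfolding Lin_zero by simp
    qed
    ultimately obtain w where w: "w \<in> carrier (Lin (n - 1))" "dlin (n - 1) w = x"
      using zero_cohomologyD[OF H] by blast
    obtain y where y: "y \<in> G (?j + 1) (n - 1)" "w ?j = G ?j (n - 1) +>\<^bsub>I (n - 1)\<^esub> y"
      using w(1) unfolding Lin_carrier by blast
    have yc: "y \<in> carrier (I (n - 1))" by (rule P.submodule_closed(2)[OF submodule_G y(1)])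
    have "G ?j n +>\<^bsub>I n\<^esub> d (n - 1) y = x ?j" using dlin_coset[of y "n - 1" w ?j, OF yc y(2)] w(2) by simp
    also have "x ?j = G ?j n +>\<^bsub>I n\<^esub> z" by (simp add: x_def)
    finally have "z \<in> G ?j n +>\<^bsub>I n\<^esub> d (n - 1) y"
      unfolding coset_eq_iff[OF submodule_G zc dc[OF yc]] by (rule sym)
    then obtain v where v: "v \<in> G ?j n" "z = v \<oplus>\<^bsub>I n\<^esub> d (n - 1) y" unfolding coset_def' by blast
    have vc: "v \<in> carrier (I n)" by (rule A.submodule_closed(2)[OF submodule_G v(1)])
    have "d n z = d n v \<oplus>\<^bsub>I (n + 1)\<^esub> d n (d (n - 1) y)" unfolding v(2) by (rule d_add[OF vc dc[OF yc]])
    moreover have "d n (d (n - 1) y) = \<zero>\<^bsub>I (n + 1)\<^esub>" using d_d[OF yc] by simp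
    ultimately have "d n v = \<zero>\<^bsub>I (n + 1)\<^esub>"
      using Suc(3) abelian_monoid.r_zero[OF abelian_group.axioms(1)[OF module.axioms(2)[OF I_module]] d_closed[OF vc]] by simp
    then obtain y' where y': "m_torsion (n - 1) y'" "d (n - 1) y' = v" using Suc(1)[OF v(1)] by blast
    have y'c: "y' \<in> carrier (I (n - 1))" using y'(1) by (simp add: m_torsion_def)
    have "d (n - 1) (y' \<oplus>\<^bsub>I (n - 1)\<^esub> y) = z" using d_add[OF y'c yc] y'(2) v(2) by simp
    moreover have "m_torsion (n - 1) (y' \<oplus>\<^bsub>I (n - 1)\<^esub> y)"
    proof -
      have "y' \<in> carrier (I (n - 1)) \<and> m_torsion (n - 1) y" using y'c G_torsion[OF y(1)] by blast
      hence "single I (n - 1) y' \<in> U.torsion \<mm> (level I) (n - 1)"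
        "single I (n - 1) y \<in> U.torsion \<mm> (level I) (n - 1)"
        using y'(1) unfolding single_mem_torsion m_torsion_def by blast+
      hence "single I (n - 1) y' \<oplus>\<^bsub>ambient_module I\<^esub> single I (n - 1) y \<in> U.torsion \<mm> (level I) (n - 1)"
        by (rule U.submodule_closed(4)[OF U.complexD(2)[OF U.torsion_complex[OF level_complex m_subset]]])
      thus ?thesis unfolding single_add single_mem_torsion m_torsion_def .
    qed
    ultimately show ?case by blast
  qed
  moreover obtain j where "z \<in> G j n" using torsion_in_G[OF z(1)] by blast
  hence "z \<in> G (n + int (nat (j - n))) n" unfolding G_eq by (simp del: int_nat_eq)
  ultimately show ?thesis using z(2) by blast
qed

text \<open>For \<open>M = 0\<close> the whole resolution vanishes and the defect is \<open>-\<infinity>\<close>. So an injectively Koszul module is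
  not zero, which gives \<open>dim M \<ge> 0\<close>.\<close>

lemma zero_module_cohomology:
  assumes z: "\<And>n. carrier (I n) = {\<zero>\<^bsub>I n\<^esub>}"
  shows "carrier (cohomology Lin dlin n) = {\<zero>\<^bsub>cohomology Lin dlin n\<^esub>}"
proof -
  have one: "carrier (Lin n) = {\<zero>\<^bsub>Lin n\<^esub>}" for n
  proof
    show "{\<zero>\<^bsub>Lin n\<^esub>} \<subseteq> carrier (Lin n)" using Lin_zero_closed by blast
    show "carrier (Lin n) \<subseteq> {\<zero>\<^bsub>Lin n\<^esub>}"
    proof
      fix x assume x: "x \<in> carrier (Lin n)"
      have "x j = G j n" for j
      proof -
        interpret A: module R "I n" by (rule I_module)
        obtain a where a: "a \<in> G (j + 1) n" "x j = G j n +>\<^bsub>I n\<^esub> a" using x unfolding Lin_carrier by blast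
        have "a = \<zero>\<^bsub>I n\<^esub>" using A.submodule_closed(2)[OF submodule_G a(1)] z by blast
        thus ?thesis unfolding a(2) using coset_zero[OF submodule_G] by simp
      qed
      thus "x \<in> {\<zero>\<^bsub>Lin n\<^esub>}" unfolding Lin_zero by auto
    qed
  qed
  have B: "coboundaries Lin dlin n = {\<zero>\<^bsub>Lin n\<^esub>}"
    unfolding coboundaries_def one using dlin_zero[of "n - 1"] by simp
  have Z: "cocycles Lin dlin n = {\<zero>\<^bsub>Lin n\<^esub>}"
    using dlin_zero[of n] one[of n] by (auto simp: cocycles_def a_kernel_def')
  have "{\<zero>\<^bsub>Lin n\<^esub>} +>\<^bsub>Lin n\<^esub> \<zero>\<^bsub>Lin n\<^esub> = {\<zero>\<^bsub>Lin n\<^esub>}"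
    using Lin_zero_add[OF Lin_zero_closed] by (simp add: a_r_coset_def')
  thus ?thesis unfolding cohomology_def B Z
    by (simp add: quotient_module_def A_RCOSETS_def' a_r_coset_def')
qed

lemma zero_module_resolution:
  assumes M0: "carrier M = {\<zero>\<^bsub>M\<^esub>}"
  shows "carrier (I n) = {\<zero>\<^bsub>I n\<^esub>}"
proof -
  have "injective_envelope R (cocycles I d n) (I n)" for n
    using res unfolding minimal_injective_resolution_def minimal_injective_complex_def by blast
  hence env: "carrier (I n) = {\<zero>\<^bsub>I n\<^esub>}" if "cocycles I d n = {\<zero>\<^bsub>I n\<^esub>}" for n
    using that module.carrier_is_submodule[OF I_module] I_zero unfolding injective_envelope_def by blast
  have r: "\<epsilon> ` carrier M = cocycles I d 0" "\<forall>n>0. cocycles I d n = coboundaries I d n"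
    using res unfolding minimal_injective_resolution_def injective_resolution_def by blast+
  have nonneg: "carrier (I (int k)) = {\<zero>\<^bsub>I (int k)\<^esub>}" for k
  proof (induct k)
    case 0
    have "\<zero>\<^bsub>I 0\<^esub> \<in> cocycles I d 0" using I_zero d_zero by (simp add: cocycles_def a_kernel_def')
    moreover have "cocycles I d 0 = {\<epsilon> \<zero>\<^bsub>M\<^esub>}" using r(1) M0 by simp
    ultimately have "cocycles I d 0 = {\<zero>\<^bsub>I 0\<^esub>}" by simp
    thus ?case using env[of 0] by simp
  next
    case (Suc k)
    have "cocycles I d (int (Suc k)) = d (int k) ` carrier (I (int k))"
      using r(2) by (simp add: coboundaries_def)
    hence "cocycles I d (int k + 1) = {\<zero>\<^bsub>I (int k + 1)\<^esub>}" unfolding Suc using d_zero[of "int k"]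
      by (simp add: add.commute)
    thus ?case using env[of "int k + 1"] by (simp add: add.commute)
  qed
  show ?thesis
  proof (cases "n < 0")
    case True thus ?thesis by (rule resolution_facts(4))
  next
    case False thus ?thesis using nonneg[of "nat n"] by simp
  qed
qed

lemma annihilator_ideal: "ideal (annihilator R M) R"
proof -
  interpret N: module R M by (rule M)
  interpret nc: noetherian_cring R by unfold_locales
  interpret S: noetherian_base_module R "regular_module R" by (rule nc.regular_noetherian_base_module)
  have "submodule (annihilator R M) R (regular_module R)"
    by (rule S.submoduleI')
      (auto simp: annihilator_def N.smult_l_distr N.smult_assoc1)
  thus ?thesis by (simp add: nc.submodule_regular_iff)
qed

lemma module_dim_le_inj_ld: "module_dim R M \<le> inj_ld R \<mm> I d"
  unfolding module_dim_def krull_dim_def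
proof (rule Sup_least)
  let ?Q = "R Quot annihilator R M"
  fix x assume "x \<in> {ereal (real n) | n. \<exists>p. (\<forall>i\<le>n. primeideal (p i) ?Q) \<and> (\<forall>i<n. p i \<subset> p (Suc i))}"
  then obtain n p where n: "x = ereal (real n)" "\<forall>i\<le>n. primeideal (p i) ?Q" "\<forall>i<n. p i \<subset> p (Suc i)" by blast
  obtain q where q: "\<And>i. i \<le> n \<Longrightarrow> primeideal (q i) R" "\<And>i. i < n \<Longrightarrow> q i \<subset> q (Suc i)" "q n = \<mm>"
    "annihilator R M \<subseteq> q 0"
    using prime_chain_of_quotient[OF annihilator_ideal, of n p] n(2,3) by blast
  obtain j z where j: "int n \<le> j" "m_torsion j z" "d j z = \<zero>\<^bsub>I (j + 1)\<^esub>"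
    "\<And>y. m_torsion (j - 1) y \<Longrightarrow> d (j - 1) y \<noteq> z"
    using nonzero_torsion_cocycle[OF q] by blast
  have "carrier (cohomology Lin dlin j) \<noteq> {\<zero>\<^bsub>cohomology Lin dlin j\<^esub>}"
    using torsion_cocycle_bounds[OF _ j(2,3)] j(4) by blast
  hence "ereal (real_of_int j) \<le> inj_ld R \<mm> I d"
    unfolding inj_ld_def by (intro Sup_upper) blast
  moreover have "x \<le> ereal (real_of_int j)" unfolding n(1) using j(1) by simp
  ultimately show "x \<le> inj_ld R \<mm> I d" by (rule order_trans[rotated])
qed

lemma module_dim_injectively_koszul:
  assumes K: "injectively_koszul R \<mm> I d"
  shows "module_dim R M = 0"
proof (rule antisym)
  show "module_dim R M \<le> 0" using module_dim_le_inj_ld K unfolding injectively_koszul_def by simp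
  have "\<one> \<notin> annihilator R M"
  proof
    interpret N: module R M by (rule M)
    assume "\<one> \<in> annihilator R M"
    hence "x = \<zero>\<^bsub>M\<^esub>" if "x \<in> carrier M" for x
      using that N.smult_one[OF that] by (simp add: annihilator_def)
    hence "carrier M = {\<zero>\<^bsub>M\<^esub>}" by auto
    hence "carrier (cohomology Lin dlin n) = {\<zero>\<^bsub>cohomology Lin dlin n\<^esub>}" for n
      using zero_module_cohomology zero_module_resolution by blast
    hence "inj_ld R \<mm> I d = Sup {}" unfolding inj_ld_def by simp
    thus False using K unfolding injectively_koszul_def by (simp add: bot_ereal_def)
  qed
  thus "0 \<le> module_dim R M" unfolding module_dim_def by (rule krull_dim_quotient_nonneg[OF annihilator_ideal])
qed

end

theorem corollary4p13:
  fixes R :: "('a, 'r) ring_scheme" and \<mm> :: "'a set"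
    and M :: "('a, 'm, 'k) module_scheme"
    and I :: "int \<Rightarrow> ('a, 'b) module" and d :: "int \<Rightarrow> 'b \<Rightarrow> 'b" and \<epsilon> :: "'m \<Rightarrow> 'b"
  assumes "noetherian_local_ring R \<mm>"
    and "module R M" and "finitely_generated_module R M"
    and "minimal_injective_resolution R M I d \<epsilon>"
  shows "inj_ld R \<mm> I d \<ge> module_dim R M \<and>
    (injectively_koszul R \<mm> I d \<longrightarrow> module_dim R M = 0)"
proof -
  interpret minimal_resolution_setup R \<mm> M I d \<epsilon>
    by (intro minimal_resolution_setup.intro minimal_resolution_setup_axioms.intro assms)
  show ?thesis using module_dim_le_inj_ld module_dim_injectively_koszul by blast
qed

end
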